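(* Let $\mathcal{C}$ be a skeletally small triangulated category with suspension $[1]$ and let $\mathcal{N}\subseteq\mathcal{C}$ be a full additive subcategory closed under direct summands, isomorphisms and extensions. Let $(Q,\mu)\colon(\mathcal{C},\mathbb{E}_{\mathcal{N}},\mathfrak{s}_{\mathcal{N}})\to(\widetilde{\mathcal{C}}_{\mathcal{N}},\widetilde{\mathbb{E}}_{\mathcal{N}},\widetilde{\mathfrak{s}}_{\mathcal{N}})$ be the extriangulated localization with respect to $\mathcal{N}$. Consider the conditions: (i) The extriangulated category $(\widetilde{\mathcal{C}}_{\mathcal{N}},\widetilde{\mathbb{E}}_{\mathcal{N}},\widetilde{\mathfrak{s}}_{\mathcal{N}})$ corresponds to an exact category. (ii) $\mathsf{Cone}(\mathcal{N},\mathcal{N})=\mathcal{C}$ in the triangulated category $\mathcal{C}$. (iii) $\mathcal{N}$ is a Serre subcategory of the extriangulated category $(\mathcal{C},\mathbb{E}_{\mathcal{N}},\mathfrak{s}_{\mathcal{N}})$. Then (ii) always implies (i) and (iii). If moreover $\mathcal{N}$ is functorially finite in $\mathcal{C}$, then all three conditions are equivalent.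
   Context: All categories and functors are additive; subcategories are full, additive and closed under isomorphisms. **Extriangulated categories (Nakaoka–Palu).** An extriangulated category is a triple $(\mathcal{C},\mathbb{E},\mathfrak{s})$ with $\mathcal{C}$ additive, $\mathbb{E}\colon\mathcal{C}^{\mathrm{op}}\times\mathcal{C}\to\mathsf{Ab}$ biadditive, and $\mathfrak{s}$ assigning to each $\delta\in\mathbb{E}(C,A)$ an equivalence class $[A\xrightarrow{x}B\xrightarrow{y}C]$ (equivalence: isomorphism of middle terms compatible with identities on the ends); write $a_*\delta=\mathbb{E}(C,a)(\delta)$, $c^*\delta=\mathbb{E}(c,A)(\delta)$. A pair consisting of $\delta$ and a representative of $\mathfrak{s}(\delta)$ is an $\mathfrak{s}$-triangle $A\xrightarrow{x}B\xrightarrow{y}C\overset{\delta}{\dashrightarrow}$; the sequence is an $\mathfrak{s}$-conflation, $x$ an $\mathfrak{s}$-inflation with cone $C$, $y$ an $\mathfrak{s}$-deflation with cocone $A$. Axioms: (realization) for $\mathfrak{s}$-triangles with $\delta,\delta'$ and $a,c$ with $a_*\delta=c^*\delta'$ there is $b$ with $bx=x'a$, $y'b=cy$; (additivity) $\mathfrak{s}(0)$ is split and $\mathfrak{s}(\delta\oplus\delta')=\mathfrak{s}(\delta)\oplus\mathfrak{s}(\delta')$; (ET3) if $bx=x'a$ there is $c$ with $cy=y'b$ and $a_*\delta=c^*\delta'$, and dually; (ET4) for $\mathfrak{s}$-triangles $A\xrightarrow{f}B\xrightarrow{f'}D\overset{\delta}{\dashrightarrow}$ and $B\xrightarrow{g}C\xrightarrow{g'}F\overset{\delta'}{\dashrightarrow}$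 there are an $\mathfrak{s}$-triangle $A\xrightarrow{gf}C\xrightarrow{h'}E\overset{\delta''}{\dashrightarrow}$ and an $\mathfrak{s}$-triangle $D\xrightarrow{d}E\xrightarrow{e}F\overset{f'_*\delta'}{\dashrightarrow}$ with $df'=h'g$, $eh'=g'$, $d^*\delta''=\delta$, $f_*\delta''=e^*\delta'$; and dually. The triangulated category $\mathcal{C}$ is extriangulated with $\mathbb{E}(C,A)=\mathcal{C}(C,A[1])$ and $\mathfrak{s}$-triangles the usual triangles. An exact category is extriangulated with $\mathbb{E}=\mathrm{Ext}^1$ (Yoneda) and its conflations; an extriangulated category *corresponds to* an exact category if it arises in this way (up to natural isomorphism of $\mathbb{E}$) from some exact structure on the underlying category. **Exact functors.** An exact functor $(F,\phi)\colon(\mathcal{C},\mathbb{E},\mathfrak{s})\to(\mathcal{C}',\mathbb{E}',\mathfrak{s}')$ is an additive functor $F$ with a natural transformation $\phi\colon\mathbb{E}\to\mathbb{E}'\circ(F^{\mathrm{op}}\times F)$ such that $\mathfrak{s}'(\phi_{C,A}(\delta))=[FA\xrightarrow{Fx}FB\xrightarrow{Fy}FC]$ for each $\mathfrak{s}$-triangle. Composition: $(F',\phi')\circ(F,\phi)=(F'F,(\phi'\cdot(F^{\mathrm{op}}\times F))\circ\phi)$. A natural transformation of exact functors $(F,\phi)\to(G,\psi)$ is a natural transformation $\eta\colon F\to G$ with $(\eta_A)_*\phi_{C,A}(\delta)=(\eta_C)^*\psi_{C,A}(\delta)$. **Relative structure.** $\mathbb{E}_{\mathcal{N}}(C,A)=\mathbb{E}^L_{\mathcal{N}}(C,A)\cap\mathbb{E}^R_{\mathcal{N}}(C,A)$,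 where $h\colon C\to A[1]$ lies in $\mathbb{E}^L_{\mathcal{N}}(C,A)$ iff for every $x\colon N\to C$ with $N\in\mathcal{N}$, $h\circ x$ factors through an object of $\mathcal{N}[1]$; and in $\mathbb{E}^R_{\mathcal{N}}(C,A)$ iff for every $y\colon A\to N$ with $N\in\mathcal{N}$, $y\circ h[-1]$ factors through an object of $\mathcal{N}[-1]$. $\mathfrak{s}_{\mathcal{N}}$ is the restriction of $\mathfrak{s}$; $(\mathcal{C},\mathbb{E}_{\mathcal{N}},\mathfrak{s}_{\mathcal{N}})$ is an extriangulated category. **Subcategories.** A subcategory $\mathcal{N}$ of an extriangulated category is *thick* if it is closed under direct summands and isomorphisms and, for any conflation $A\to B\to C$, if two of $A,B,C$ are in $\mathcal{N}$ so is the third; a thick subcategory is *Serre* if for each conflation $A\to B\to C$ with $B\in\mathcal{N}$ one has $A,C\in\mathcal{N}$. $\mathsf{Cone}(\mathcal{N},\mathcal{N})$ is the class of objects $X$ fitting in a triangle $N'\to N\to X\to N'[1]$ with $N,N'\in\mathcal{N}$. **Localization.** Let $\mathcal{L}$ be the class of $\mathfrak{s}_{\mathcal{N}}$-inflations with cone in $\mathcal{N}$, $\mathcal{R}$ the class of $\mathfrak{s}_{\mathcal{N}}$-deflations with cocone in $\mathcal{N}$, and $\mathscr{S}_{\mathcal{N}}$ the smallest class of morphisms closed under composition and containing $\mathcal{L}\cup\mathcal{R}$. Let $Q\colon\mathcal{C}\to\widetilde{\mathcal{C}}_{\mathcal{N}}:=\mathcal{C}[\mathscr{S}_{\mathcal{N}}^{-1}]$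 be the Gabriel–Zisman localization. The *extriangulated localization* with respect to $\mathcal{N}$ (which exists) is an extriangulated structure on $\widetilde{\mathcal{C}}_{\mathcal{N}}$ with an exact functor $(Q,\mu)\colon(\mathcal{C},\mathbb{E}_{\mathcal{N}},\mathfrak{s}_{\mathcal{N}})\to(\widetilde{\mathcal{C}}_{\mathcal{N}},\widetilde{\mathbb{E}}_{\mathcal{N}},\widetilde{\mathfrak{s}}_{\mathcal{N}})$ such that: (i) any exact functor $(F,\phi)$ from $(\mathcal{C},\mathbb{E}_{\mathcal{N}},\mathfrak{s}_{\mathcal{N}})$ inverting $\mathscr{S}_{\mathcal{N}}$ factors as $(\widetilde F,\widetilde\phi)\circ(Q,\mu)$ for a unique exact functor $(\widetilde F,\widetilde\phi)$; (ii) any natural transformation of exact functors between two such functors is induced by a unique natural transformation of the induced exact functors. It is unique up to unique exact isomorphism; moreover, a morphism of $\widetilde{\mathcal{C}}_{\mathcal{N}}$ is an $\widetilde{\mathfrak{s}}_{\mathcal{N}}$-inflation (resp. deflation) iff it equals $\beta\circ Q(f)\circ\gamma$ with $f$ an $\mathfrak{s}_{\mathcal{N}}$-inflation (resp. deflation) and $\beta,\gamma$ isomorphisms. *)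

theory Defs
  imports "HOL-Algebra.Group"
begin

section \<open>Categories and functors\<close>

text \<open>A category carries its objects and arrows as sets; every arrow knows its domain and its
  codomain. Since the carriers are sets, every category in this sense is small.\<close>

record ('o, 'm) cat =
  Ob :: "'o set"
  Ar :: "'m set"
  Dom :: "'m \<Rightarrow> 'o"
  Cod :: "'m \<Rightarrow> 'o"
  Idn :: "'o \<Rightarrow> 'm"
  Comp :: "'m \<Rightarrow> 'm \<Rightarrow> 'm"  (infixr "\<cdot>\<index>" 70)

definition Mor :: "('o, 'm, 'z) cat_scheme \<Rightarrow> 'o \<Rightarrow> 'o \<Rightarrow> 'm set" where
  "Mor C A B = {f \<in> Ar C. Dom C f = A \<and> Cod C f = B}"

locale category =
  fixes C :: "('o, 'm, 'z) cat_scheme" (structure)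
  assumes dom_Ob: "f \<in> Ar C \<Longrightarrow> Dom C f \<in> Ob C"
    and cod_Ob: "f \<in> Ar C \<Longrightarrow> Cod C f \<in> Ob C"
    and id_Mor: "A \<in> Ob C \<Longrightarrow> Idn C A \<in> Mor C A A"
    and comp_Mor: "\<lbrakk>f \<in> Mor C A B; g \<in> Mor C B D\<rbrakk> \<Longrightarrow> g \<cdot> f \<in> Mor C A D"
    and id_left: "f \<in> Mor C A B \<Longrightarrow> Idn C B \<cdot> f = f"
    and id_right: "f \<in> Mor C A B \<Longrightarrow> f \<cdot> Idn C A = f"
    and comp_assoc: "\<lbrakk>f \<in> Mor C A B; g \<in> Mor C B D; h \<in> Mor C D E\<rbrakk>
      \<Longrightarrow> h \<cdot> (g \<cdot> f) = (h \<cdot> g) \<cdot> f"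

definition is_iso :: "('o, 'm, 'z) cat_scheme \<Rightarrow> 'm \<Rightarrow> 'o \<Rightarrow> 'o \<Rightarrow> bool" where
  "is_iso C f A B \<longleftrightarrow> f \<in> Mor C A B \<and>
     (\<exists>g \<in> Mor C B A. g \<cdot>\<^bsub>C\<^esub> f = Idn C A \<and> f \<cdot>\<^bsub>C\<^esub> g = Idn C B)"

definition is_functor ::
  "('o, 'm, 'z) cat_scheme \<Rightarrow> ('p, 'n, 'w) cat_scheme \<Rightarrow> ('o \<Rightarrow> 'p) \<Rightarrow> ('m \<Rightarrow> 'n) \<Rightarrow> bool" where
  "is_functor C D Fo Fa \<longleftrightarrow>
     (\<forall>A \<in> Ob C. Fo A \<in> Ob D \<and> Fa (Idn C A) = Idn D (Fo A)) \<and>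
     (\<forall>A B. \<forall>f \<in> Mor C A B. Fa f \<in> Mor D (Fo A) (Fo B)) \<and>
     (\<forall>A B E. \<forall>f \<in> Mor C A B. \<forall>g \<in> Mor C B E. Fa (g \<cdot>\<^bsub>C\<^esub> f) = Fa g \<cdot>\<^bsub>D\<^esub> Fa f)"

definition zero_object :: "('o, 'm, 'z) cat_scheme \<Rightarrow> 'o \<Rightarrow> bool" where
  "zero_object C Z \<longleftrightarrow> Z \<in> Ob C \<and>
     (\<forall>A \<in> Ob C. (\<exists>!f. f \<in> Mor C A Z) \<and> (\<exists>!f. f \<in> Mor C Z A))"

section \<open>Additive categories\<close>

record ('o, 'm) addcat = "('o, 'm) cat" +
  Add :: "'m \<Rightarrow> 'm \<Rightarrow> 'm"  (infixl "\<boxplus>\<index>" 65)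
  Zero :: "'o \<Rightarrow> 'o \<Rightarrow> 'm"

text \<open>Abelian groups are the commutative groups of \<^theory>\<open>HOL-Algebra.Group\<close>; the (additive) group
  operation is therefore called \<^const>\<open>mult\<close> and its neutral element \<^const>\<open>one\<close>.\<close>

definition Homg :: "('o, 'm, 'z) addcat_scheme \<Rightarrow> 'o \<Rightarrow> 'o \<Rightarrow> 'm monoid" where
  "Homg C A B = \<lparr>carrier = Mor C A B, mult = Add C, one = Zero C A B\<rparr>"

definition Neg :: "('o, 'm, 'z) addcat_scheme \<Rightarrow> 'm \<Rightarrow> 'm" where
  "Neg C f = inv\<^bsub>Homg C (Dom C f) (Cod C f)\<^esub> f"

text \<open>\<open>biproduct C A B S i j p q\<close>: the object \<open>S\<close> with injections \<open>i, j\<close> and projections \<open>p, q\<close>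
  is a biproduct of \<open>A\<close> and \<open>B\<close>.\<close>

definition biproduct ::
  "('o, 'm, 'z) addcat_scheme \<Rightarrow> 'o \<Rightarrow> 'o \<Rightarrow> 'o \<Rightarrow> 'm \<Rightarrow> 'm \<Rightarrow> 'm \<Rightarrow> 'm \<Rightarrow> bool" where
  "biproduct C A B S i j p q \<longleftrightarrow>
     A \<in> Ob C \<and> B \<in> Ob C \<and> S \<in> Ob C \<and>
     i \<in> Mor C A S \<and> j \<in> Mor C B S \<and> p \<in> Mor C S A \<and> q \<in> Mor C S B \<and>
     p \<cdot>\<^bsub>C\<^esub> i = Idn C A \<and> q \<cdot>\<^bsub>C\<^esub> j = Idn C B \<and>
     q \<cdot>\<^bsub>C\<^esub> i = Zero C A B \<and> p \<cdot>\<^bsub>C\<^esub> j = Zero C B A \<and>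
     (i \<cdot>\<^bsub>C\<^esub> p) \<boxplus>\<^bsub>C\<^esub> (j \<cdot>\<^bsub>C\<^esub> q) = Idn C S"

text \<open>\<open>f \<oplus> g\<close>, for the projections \<open>p, q\<close> of the source biproduct and the injections
  \<open>i, j\<close> of the target biproduct.\<close>

definition dsum ::
  "('o, 'm, 'z) addcat_scheme \<Rightarrow> 'm \<Rightarrow> 'm \<Rightarrow> 'm \<Rightarrow> 'm \<Rightarrow> 'm \<Rightarrow> 'm \<Rightarrow> 'm" where
  "dsum C i j p q f g = (i \<cdot>\<^bsub>C\<^esub> f \<cdot>\<^bsub>C\<^esub> p) \<boxplus>\<^bsub>C\<^esub> (j \<cdot>\<^bsub>C\<^esub> g \<cdot>\<^bsub>C\<^esub> q)"

locale additive_category = category C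
  for C :: "('o, 'm, 'z) addcat_scheme" (structure) +
  assumes hom_group: "\<lbrakk>A \<in> Ob C; B \<in> Ob C\<rbrakk> \<Longrightarrow> comm_group (Homg C A B)"
    and comp_add_left: "\<lbrakk>f \<in> Mor C A B; g \<in> Mor C B D; g' \<in> Mor C B D\<rbrakk>
      \<Longrightarrow> (g \<boxplus> g') \<cdot> f = (g \<cdot> f) \<boxplus> (g' \<cdot> f)"
    and comp_add_right: "\<lbrakk>f \<in> Mor C A B; f' \<in> Mor C A B; g \<in> Mor C B D\<rbrakk>
      \<Longrightarrow> g \<cdot> (f \<boxplus> f') = (g \<cdot> f) \<boxplus> (g \<cdot> f')"
    and zero_object_exists: "\<exists>Z. zero_object C Z"
    and biproduct_exists: "\<lbrakk>A \<in> Ob C; B \<in> Ob C\<rbrakk> \<Longrightarrow> \<exists>S i j p q. biproduct C A B S i j p q"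

definition additive_functor ::
  "('o, 'm, 'z) addcat_scheme \<Rightarrow> ('p, 'n, 'w) addcat_scheme \<Rightarrow> ('o \<Rightarrow> 'p) \<Rightarrow> ('m \<Rightarrow> 'n) \<Rightarrow> bool"
  where
  "additive_functor C D Fo Fa \<longleftrightarrow> is_functor C D Fo Fa \<and>
     (\<forall>A \<in> Ob C. \<forall>B \<in> Ob C. Fa \<in> hom (Homg C A B) (Homg D (Fo A) (Fo B)))"

text \<open>A full subcategory is given by its set of objects.\<close>

definition additive_subcategory :: "('o, 'm, 'z) addcat_scheme \<Rightarrow> 'o set \<Rightarrow> bool" where
  "additive_subcategory C N \<longleftrightarrow> N \<subseteq> Ob C \<and>
     (\<forall>A B f. A \<in> N \<and> is_iso C f A B \<longrightarrow> B \<in> N) \<and>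
     (\<forall>Z. zero_object C Z \<longrightarrow> Z \<in> N) \<and>
     (\<forall>A B S i j p q. A \<in> N \<and> B \<in> N \<and> biproduct C A B S i j p q \<longrightarrow> S \<in> N)"

definition summand_closed :: "('o, 'm, 'z) addcat_scheme \<Rightarrow> 'o set \<Rightarrow> bool" where
  "summand_closed C N \<longleftrightarrow>
     (\<forall>A B S i j p q. S \<in> N \<and> biproduct C A B S i j p q \<longrightarrow> A \<in> N \<and> B \<in> N)"

definition factors_through :: "('o, 'm, 'z) cat_scheme \<Rightarrow> 'm \<Rightarrow> 'o \<Rightarrow> bool" where
  "factors_through C f M \<longleftrightarrow>
     (\<exists>u \<in> Mor C (Dom C f) M. \<exists>v \<in> Mor C M (Cod C f). v \<cdot>\<^bsub>C\<^esub> u = f)"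

definition contravariantly_finite :: "('o, 'm, 'z) cat_scheme \<Rightarrow> 'o set \<Rightarrow> bool" where
  "contravariantly_finite C N \<longleftrightarrow>
     (\<forall>X \<in> Ob C. \<exists>M \<in> N. \<exists>f \<in> Mor C M X.
        \<forall>M' \<in> N. \<forall>g \<in> Mor C M' X. \<exists>h \<in> Mor C M' M. f \<cdot>\<^bsub>C\<^esub> h = g)"

definition covariantly_finite :: "('o, 'm, 'z) cat_scheme \<Rightarrow> 'o set \<Rightarrow> bool" where
  "covariantly_finite C N \<longleftrightarrow>
     (\<forall>X \<in> Ob C. \<exists>M \<in> N. \<exists>f \<in> Mor C X M.
        \<forall>M' \<in> N. \<forall>g \<in> Mor C X M'. \<exists>h \<in> Mor C M M'. h \<cdot>\<^bsub>C\<^esub> f = g)"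

definition functorially_finite :: "('o, 'm, 'z) cat_scheme \<Rightarrow> 'o set \<Rightarrow> bool" where
  "functorially_finite C N \<longleftrightarrow> contravariantly_finite C N \<and> covariantly_finite C N"

section \<open>Triangulated categories\<close>

text \<open>The suspension \<open>[1]\<close> is an automorphism: \<open>ShO, ShA\<close> is its action on objects and arrows,
  \<open>UnO, UnA\<close> that of its inverse \<open>[-1]\<close>. An element \<open>(f, g, h)\<close> of \<open>Tri\<close> is a distinguished
  triangle \<open>A \<rightarrow> B \<rightarrow> D \<rightarrow> A[1]\<close>.\<close>

record ('o, 'm) tricat = "('o, 'm) addcat" +
  ShO :: "'o \<Rightarrow> 'o"
  ShA :: "'m \<Rightarrow> 'm"
  UnO :: "'o \<Rightarrow> 'o"
  UnA :: "'m \<Rightarrow> 'm"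
  Tri :: "('m \<times> 'm \<times> 'm) set"

definition triangle :: "('o, 'm, 'z) tricat_scheme \<Rightarrow> 'o \<Rightarrow> 'o \<Rightarrow> 'o \<Rightarrow> 'm \<Rightarrow> 'm \<Rightarrow> 'm \<Rightarrow> bool" where
  "triangle T A B D f g h \<longleftrightarrow>
     f \<in> Mor T A B \<and> g \<in> Mor T B D \<and> h \<in> Mor T D (ShO T A) \<and> (f, g, h) \<in> Tri T"

locale triangulated_category = additive_category T
  for T :: "('o, 'm, 'z) tricat_scheme" (structure) +
  assumes shift_functor: "additive_functor T T (ShO T) (ShA T)"
    and unshift_functor: "additive_functor T T (UnO T) (UnA T)"
    and shift_inverse_Ob: "A \<in> Ob T \<Longrightarrow> UnO T (ShO T A) = A \<and> ShO T (UnO T A) = A"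
    and shift_inverse_Ar: "f \<in> Ar T \<Longrightarrow> UnA T (ShA T f) = f \<and> ShA T (UnA T f) = f"
    and triangle_type: "(f, g, h) \<in> Tri T \<Longrightarrow> \<exists>A B D. triangle T A B D f g h"
    and TR1_iso: "\<lbrakk>triangle T A B D f g h; is_iso T a A A'; is_iso T b B B'; is_iso T d D D';
       f' \<in> Mor T A' B'; g' \<in> Mor T B' D'; h' \<in> Mor T D' (ShO T A');
       b \<cdot> f = f' \<cdot> a; d \<cdot> g = g' \<cdot> b; ShA T a \<cdot> h = h' \<cdot> d\<rbrakk> \<Longrightarrow> triangle T A' B' D' f' g' h'"
    and TR1_id: "\<lbrakk>A \<in> Ob T; zero_object T Z\<rbrakk>
      \<Longrightarrow> triangle T A A Z (Idn T A) (Zero T A Z) (Zero T Z (ShO T A))"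
    and TR1_cone: "f \<in> Mor T A B \<Longrightarrow> \<exists>D g h. triangle T A B D f g h"
    and TR2: "\<lbrakk>f \<in> Mor T A B; g \<in> Mor T B D; h \<in> Mor T D (ShO T A)\<rbrakk>
      \<Longrightarrow> triangle T A B D f g h \<longleftrightarrow> triangle T B D (ShO T A) g h (Neg T (ShA T f))"
    and TR3: "\<lbrakk>triangle T A B D f g h; triangle T A' B' D' f' g' h';
       a \<in> Mor T A A'; b \<in> Mor T B B'; b \<cdot> f = f' \<cdot> a\<rbrakk>
      \<Longrightarrow> \<exists>d \<in> Mor T D D'. d \<cdot> g = g' \<cdot> b \<and> ShA T a \<cdot> h = h' \<cdot> d"
    and TR4: "\<lbrakk>triangle T A B D f f' f''; triangle T B C F g g' g''; triangle T A C E (g \<cdot> f) h' h''\<rbrakk>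
      \<Longrightarrow> \<exists>d e. triangle T D E F d e (ShA T f' \<cdot> g'') \<and>
            d \<cdot> f' = h' \<cdot> g \<and> e \<cdot> h' = g' \<and> h'' \<cdot> d = f'' \<and> g'' \<cdot> e = ShA T f \<cdot> h''"

definition tri_extension_closed :: "('o, 'm, 'z) tricat_scheme \<Rightarrow> 'o set \<Rightarrow> bool" where
  "tri_extension_closed T N \<longleftrightarrow>
     (\<forall>A B D f g h. triangle T A B D f g h \<and> A \<in> N \<and> D \<in> N \<longrightarrow> B \<in> N)"

definition Cone :: "('o, 'm, 'z) tricat_scheme \<Rightarrow> 'o set \<Rightarrow> 'o set \<Rightarrow> 'o set" where
  "Cone T N' N = {X. \<exists>A \<in> N'. \<exists>B \<in> N. \<exists>f g h. triangle T A B X f g h}"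

section \<open>Extriangulated categories\<close>

text \<open>\<open>Ext X D A\<close> is the abelian group \<open>E(D,A)\<close>, \<open>Emap X d a\<close> is the map
  \<open>E(d,a) : E(Cod d, Dom a) \<rightarrow> E(Dom d, Cod a)\<close>, and \<open>Real X D A \<delta>\<close> is the equivalence class
  \<open>s(\<delta>)\<close> of sequences \<open>A \<rightarrow> B \<rightarrow> D\<close>, as a set of pairs of arrows.\<close>

record ('o, 'm, 'e) extri = "('o, 'm) addcat" +
  Ext :: "'o \<Rightarrow> 'o \<Rightarrow> 'e monoid"
  Emap :: "'m \<Rightarrow> 'm \<Rightarrow> 'e \<Rightarrow> 'e"
  Real :: "'o \<Rightarrow> 'o \<Rightarrow> 'e \<Rightarrow> ('m \<times> 'm) set"

definition push :: "('o, 'm, 'e, 'z) extri_scheme \<Rightarrow> 'o \<Rightarrow> 'm \<Rightarrow> 'e \<Rightarrow> 'e" where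
  "push X D a \<delta> = Emap X (Idn X D) a \<delta>"

definition pull :: "('o, 'm, 'e, 'z) extri_scheme \<Rightarrow> 'o \<Rightarrow> 'm \<Rightarrow> 'e \<Rightarrow> 'e" where
  "pull X A d \<delta> = Emap X d (Idn X A) \<delta>"

definition seqs :: "('o, 'm, 'z) cat_scheme \<Rightarrow> 'o \<Rightarrow> 'o \<Rightarrow> ('m \<times> 'm) set" where
  "seqs C A D = {(x, y). \<exists>B. x \<in> Mor C A B \<and> y \<in> Mor C B D}"

definition seq_class :: "('o, 'm, 'z) cat_scheme \<Rightarrow> 'o \<Rightarrow> 'o \<Rightarrow> 'm \<Rightarrow> 'm \<Rightarrow> ('m \<times> 'm) set" where
  "seq_class C A D x y = {(x', y') \<in> seqs C A D.
     \<exists>b. is_iso C b (Cod C x) (Cod C x') \<and> b \<cdot>\<^bsub>C\<^esub> x = x' \<and> y' \<cdot>\<^bsub>C\<^esub> b = y}"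

definition s_triangle ::
  "('o, 'm, 'e, 'z) extri_scheme \<Rightarrow> 'o \<Rightarrow> 'o \<Rightarrow> 'o \<Rightarrow> 'm \<Rightarrow> 'm \<Rightarrow> 'e \<Rightarrow> bool" where
  "s_triangle X A B D x y \<delta> \<longleftrightarrow> A \<in> Ob X \<and> B \<in> Ob X \<and> D \<in> Ob X \<and>
     x \<in> Mor X A B \<and> y \<in> Mor X B D \<and> \<delta> \<in> carrier (Ext X D A) \<and> (x, y) \<in> Real X D A \<delta>"

definition conflation :: "('o, 'm, 'e, 'z) extri_scheme \<Rightarrow> 'o \<Rightarrow> 'o \<Rightarrow> 'o \<Rightarrow> 'm \<Rightarrow> 'm \<Rightarrow> bool" where
  "conflation X A B D x y \<longleftrightarrow> (\<exists>\<delta>. s_triangle X A B D x y \<delta>)"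

text \<open>In \<open>s_additive\<close> the element \<open>\<delta> \<oplus> \<delta>'\<close> of \<open>E(D \<oplus> D', A \<oplus> A')\<close> is the one with
  components \<open>\<delta>, 0, 0, \<delta>'\<close>, that is, \<open>E(q, i)(\<delta>) + E(q', i')(\<delta>')\<close> for the projections
  \<open>q, q'\<close> of \<open>D \<oplus> D'\<close> and the injections \<open>i, i'\<close> of \<open>A \<oplus> A'\<close>.\<close>

locale extriangulated_category = additive_category X
  for X :: "('o, 'm, 'e, 'z) extri_scheme" (structure) +
  assumes Ext_group: "\<lbrakk>D \<in> Ob X; A \<in> Ob X\<rbrakk> \<Longrightarrow> comm_group (Ext X D A)"
    and Emap_hom: "\<lbrakk>d \<in> Mor X D' D; a \<in> Mor X A A'\<rbrakk>
      \<Longrightarrow> Emap X d a \<in> hom (Ext X D A) (Ext X D' A')"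
    and Emap_id: "\<lbrakk>D \<in> Ob X; A \<in> Ob X; \<delta> \<in> carrier (Ext X D A)\<rbrakk>
      \<Longrightarrow> Emap X (Idn X D) (Idn X A) \<delta> = \<delta>"
    and Emap_comp: "\<lbrakk>d \<in> Mor X D' D; d' \<in> Mor X D'' D'; a \<in> Mor X A A'; a' \<in> Mor X A' A'';
       \<delta> \<in> carrier (Ext X D A)\<rbrakk>
      \<Longrightarrow> Emap X (d \<cdot> d') (a' \<cdot> a) \<delta> = Emap X d' a' (Emap X d a \<delta>)"
    and Emap_add_left: "\<lbrakk>d \<in> Mor X D' D; d' \<in> Mor X D' D; a \<in> Mor X A A'; \<delta> \<in> carrier (Ext X D A)\<rbrakk>
      \<Longrightarrow> Emap X (d \<boxplus> d') a \<delta> = Emap X d a \<delta> \<otimes>\<^bsub>Ext X D' A'\<^esub> Emap X d' a \<delta>"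
    and Emap_add_right: "\<lbrakk>d \<in> Mor X D' D; a \<in> Mor X A A'; a' \<in> Mor X A A'; \<delta> \<in> carrier (Ext X D A)\<rbrakk>
      \<Longrightarrow> Emap X d (a \<boxplus> a') \<delta> = Emap X d a \<delta> \<otimes>\<^bsub>Ext X D' A'\<^esub> Emap X d a' \<delta>"
    and Real_class: "\<lbrakk>D \<in> Ob X; A \<in> Ob X; \<delta> \<in> carrier (Ext X D A)\<rbrakk>
      \<Longrightarrow> \<exists>(x, y) \<in> seqs X A D. Real X D A \<delta> = seq_class X A D x y"
    and realization: "\<lbrakk>s_triangle X A B D x y \<delta>; s_triangle X A' B' D' x' y' \<delta>';
       a \<in> Mor X A A'; d \<in> Mor X D D'; push X D a \<delta> = pull X A' d \<delta>'\<rbrakk>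
      \<Longrightarrow> \<exists>b \<in> Mor X B B'. b \<cdot> x = x' \<cdot> a \<and> y' \<cdot> b = d \<cdot> y"
    and s_zero: "biproduct X A D S i j p q \<Longrightarrow> s_triangle X A S D i q \<one>\<^bsub>Ext X D A\<^esub>"
    and s_additive: "\<lbrakk>s_triangle X A B D x y \<delta>; s_triangle X A' B' D' x' y' \<delta>';
       biproduct X A A' SA i i' p p'; biproduct X B B' SB j j' r r';
       biproduct X D D' SD k k' q q'\<rbrakk>
      \<Longrightarrow> s_triangle X SA SB SD (dsum X j j' p p' x x') (dsum X k k' r r' y y')
            (Emap X q i \<delta> \<otimes>\<^bsub>Ext X SD SA\<^esub> Emap X q' i' \<delta>')"
    and ET3: "\<lbrakk>s_triangle X A B D x y \<delta>; s_triangle X A' B' D' x' y' \<delta>';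
       a \<in> Mor X A A'; b \<in> Mor X B B'; b \<cdot> x = x' \<cdot> a\<rbrakk>
      \<Longrightarrow> \<exists>d \<in> Mor X D D'. d \<cdot> y = y' \<cdot> b \<and> push X D a \<delta> = pull X A' d \<delta>'"
    and ET3op: "\<lbrakk>s_triangle X A B D x y \<delta>; s_triangle X A' B' D' x' y' \<delta>';
       b \<in> Mor X B B'; d \<in> Mor X D D'; d \<cdot> y = y' \<cdot> b\<rbrakk>
      \<Longrightarrow> \<exists>a \<in> Mor X A A'. b \<cdot> x = x' \<cdot> a \<and> push X D a \<delta> = pull X A' d \<delta>'"
    and ET4: "\<lbrakk>s_triangle X A B D f f' \<delta>; s_triangle X B C F g g' \<delta>'\<rbrakk>
      \<Longrightarrow> \<exists>E h' d e \<delta>''. s_triangle X A C E (g \<cdot> f) h' \<delta>'' \<and>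
            s_triangle X D E F d e (push X F f' \<delta>') \<and>
            d \<cdot> f' = h' \<cdot> g \<and> e \<cdot> h' = g' \<and>
            pull X A d \<delta>'' = \<delta> \<and> push X E f \<delta>'' = pull X B e \<delta>'"
    and ET4op: "\<lbrakk>s_triangle X D B A f' f \<delta>; s_triangle X F C B g' g \<delta>'\<rbrakk>
      \<Longrightarrow> \<exists>E h' d e \<delta>''. s_triangle X E C A h' (f \<cdot> g) \<delta>'' \<and>
            s_triangle X F E D e d (pull X F f' \<delta>') \<and>
            f' \<cdot> d = g \<cdot> h' \<and> h' \<cdot> e = g' \<and>
            push X A d \<delta>'' = \<delta> \<and> pull X E f \<delta>'' = push X B e \<delta>'"

definition thick_subcategory :: "('o, 'm, 'e, 'z) extri_scheme \<Rightarrow> 'o set \<Rightarrow> bool" where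
  "thick_subcategory X N \<longleftrightarrow> additive_subcategory X N \<and> summand_closed X N \<and>
     (\<forall>A B D x y. conflation X A B D x y \<longrightarrow>
        (A \<in> N \<and> B \<in> N \<longrightarrow> D \<in> N) \<and> (B \<in> N \<and> D \<in> N \<longrightarrow> A \<in> N) \<and> (A \<in> N \<and> D \<in> N \<longrightarrow> B \<in> N))"

definition serre_subcategory :: "('o, 'm, 'e, 'z) extri_scheme \<Rightarrow> 'o set \<Rightarrow> bool" where
  "serre_subcategory X N \<longleftrightarrow> thick_subcategory X N \<and>
     (\<forall>A B D x y. conflation X A B D x y \<and> B \<in> N \<longrightarrow> A \<in> N \<and> D \<in> N)"

section \<open>Exact categories as extriangulated categories\<close>

definition is_kernel :: "('o, 'm, 'z) addcat_scheme \<Rightarrow> 'm \<Rightarrow> 'm \<Rightarrow> bool" where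
  "is_kernel C i p \<longleftrightarrow> (\<exists>A B D. i \<in> Mor C A B \<and> p \<in> Mor C B D \<and> p \<cdot>\<^bsub>C\<^esub> i = Zero C A D \<and>
     (\<forall>T. \<forall>f \<in> Mor C T B. p \<cdot>\<^bsub>C\<^esub> f = Zero C T D \<longrightarrow> (\<exists>!g. g \<in> Mor C T A \<and> i \<cdot>\<^bsub>C\<^esub> g = f)))"

definition is_cokernel :: "('o, 'm, 'z) addcat_scheme \<Rightarrow> 'm \<Rightarrow> 'm \<Rightarrow> bool" where
  "is_cokernel C p i \<longleftrightarrow> (\<exists>A B D. i \<in> Mor C A B \<and> p \<in> Mor C B D \<and> p \<cdot>\<^bsub>C\<^esub> i = Zero C A D \<and>
     (\<forall>T. \<forall>f \<in> Mor C B T. f \<cdot>\<^bsub>C\<^esub> i = Zero C A T \<longrightarrow> (\<exists>!g. g \<in> Mor C D T \<and> g \<cdot>\<^bsub>C\<^esub> p = f)))"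

definition is_pushout :: "('o, 'm, 'z) cat_scheme \<Rightarrow> 'm \<Rightarrow> 'm \<Rightarrow> 'm \<Rightarrow> 'm \<Rightarrow> bool" where
  "is_pushout C i f i' f' \<longleftrightarrow> (\<exists>A B A' B'. i \<in> Mor C A B \<and> f \<in> Mor C A A' \<and>
     i' \<in> Mor C A' B' \<and> f' \<in> Mor C B B' \<and> f' \<cdot>\<^bsub>C\<^esub> i = i' \<cdot>\<^bsub>C\<^esub> f \<and>
     (\<forall>T. \<forall>u \<in> Mor C B T. \<forall>v \<in> Mor C A' T. u \<cdot>\<^bsub>C\<^esub> i = v \<cdot>\<^bsub>C\<^esub> f \<longrightarrow>
        (\<exists>!w. w \<in> Mor C B' T \<and> w \<cdot>\<^bsub>C\<^esub> f' = u \<and> w \<cdot>\<^bsub>C\<^esub> i' = v)))"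

definition is_pullback :: "('o, 'm, 'z) cat_scheme \<Rightarrow> 'm \<Rightarrow> 'm \<Rightarrow> 'm \<Rightarrow> 'm \<Rightarrow> bool" where
  "is_pullback C p f p' f' \<longleftrightarrow> (\<exists>B D B' D'. p \<in> Mor C B D \<and> f \<in> Mor C D' D \<and>
     p' \<in> Mor C B' D' \<and> f' \<in> Mor C B' B \<and> p \<cdot>\<^bsub>C\<^esub> f' = f \<cdot>\<^bsub>C\<^esub> p' \<and>
     (\<forall>T. \<forall>u \<in> Mor C T B. \<forall>v \<in> Mor C T D'. p \<cdot>\<^bsub>C\<^esub> u = f \<cdot>\<^bsub>C\<^esub> v \<longrightarrow>
        (\<exists>!w. w \<in> Mor C T B' \<and> f' \<cdot>\<^bsub>C\<^esub> w = u \<and> p' \<cdot>\<^bsub>C\<^esub> w = v)))"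

text \<open>Quillen's axioms in the form of Buehler's survey; \<open>EE\<close> is the class of conflations.\<close>

locale exact_structure = additive_category C
  for C :: "('o, 'm, 'z) addcat_scheme" (structure) +
  fixes EE :: "('m \<times> 'm) set"
  assumes kernel_cokernel: "(i, p) \<in> EE \<Longrightarrow> is_kernel C i p \<and> is_cokernel C p i"
    and iso_closed: "\<lbrakk>(i, p) \<in> EE; i \<in> Mor C A B; p \<in> Mor C B D; i' \<in> Mor C A' B'; p' \<in> Mor C B' D';
       is_iso C a A A'; is_iso C b B B'; is_iso C d D D'; b \<cdot> i = i' \<cdot> a; d \<cdot> p = p' \<cdot> b\<rbrakk>
      \<Longrightarrow> (i', p') \<in> EE"
    and E0: "A \<in> Ob C \<Longrightarrow> \<exists>p. (Idn C A, p) \<in> EE"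
    and E0op: "A \<in> Ob C \<Longrightarrow> \<exists>i. (i, Idn C A) \<in> EE"
    and E1: "\<lbrakk>(i, p) \<in> EE; (i', p') \<in> EE; Cod C i = Dom C i'\<rbrakk> \<Longrightarrow> \<exists>q. (i' \<cdot> i, q) \<in> EE"
    and E1op: "\<lbrakk>(i, p) \<in> EE; (i', p') \<in> EE; Cod C p = Dom C p'\<rbrakk> \<Longrightarrow> \<exists>k. (k, p' \<cdot> p) \<in> EE"
    and E2: "\<lbrakk>(i, p) \<in> EE; f \<in> Ar C; Dom C f = Dom C i\<rbrakk>
      \<Longrightarrow> \<exists>i' f' p'. is_pushout C i f i' f' \<and> (i', p') \<in> EE"
    and E2op: "\<lbrakk>(i, p) \<in> EE; f \<in> Ar C; Cod C f = Cod C p\<rbrakk>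
      \<Longrightarrow> \<exists>p' f' i'. is_pullback C p f p' f' \<and> (i', p') \<in> EE"

text \<open>The action \<open>Ext\<^sup>1(d,a)\<close> on a Yoneda class \<open>\<xi>\<close>: push a representative \<open>(x,y)\<close> out along
  \<open>a\<close>, giving \<open>(x'',y'')\<close>, and pull the result back along \<open>d\<close>, giving \<open>(x',y')\<close>. Pushed-out and
  pulled-back extensions are recognised, up to equivalence, by a morphism of conflations that is
  the identity at the other end.\<close>

definition yoneda_map ::
  "('o, 'm, 'z) addcat_scheme \<Rightarrow> ('m \<times> 'm) set \<Rightarrow> 'm \<Rightarrow> 'm \<Rightarrow> ('m \<times> 'm) set \<Rightarrow> ('m \<times> 'm) set" where
  "yoneda_map C EE d a \<xi> =
     {(x', y'). (x', y') \<in> EE \<inter> seqs C (Cod C a) (Dom C d) \<and>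
        (\<exists>x y x'' y''. (x, y) \<in> \<xi> \<and> (x, y) \<in> EE \<inter> seqs C (Dom C a) (Cod C d) \<and>
           (x'', y'') \<in> EE \<inter> seqs C (Cod C a) (Cod C d) \<and>
           (\<exists>b \<in> Mor C (Cod C x) (Cod C x''). b \<cdot>\<^bsub>C\<^esub> x = x'' \<cdot>\<^bsub>C\<^esub> a \<and> y'' \<cdot>\<^bsub>C\<^esub> b = y) \<and>
           (\<exists>b \<in> Mor C (Cod C x') (Cod C x''). b \<cdot>\<^bsub>C\<^esub> x' = x'' \<and> y'' \<cdot>\<^bsub>C\<^esub> b = d \<cdot>\<^bsub>C\<^esub> y'))}"

text \<open>Baer sum: \<open>\<xi> + \<xi>' = Ext\<^sup>1(\<Delta>, \<nabla>)(\<xi> \<oplus> \<xi>')\<close> with the diagonal \<open>\<Delta> = k + k'\<close> of \<open>D\<close> and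
  the codiagonal \<open>\<nabla> = p + p'\<close> of \<open>A\<close>.\<close>

definition baer_sum ::
  "('o, 'm, 'z) addcat_scheme \<Rightarrow> ('m \<times> 'm) set \<Rightarrow> 'o \<Rightarrow> 'o \<Rightarrow>
    ('m \<times> 'm) set \<Rightarrow> ('m \<times> 'm) set \<Rightarrow> ('m \<times> 'm) set" where
  "baer_sum C EE D A \<xi> \<xi>' =
     {s. \<exists>x y x' y' SA i i' p p' SB j j' r r' SD k k' q q'.
        (x, y) \<in> \<xi> \<and> (x', y') \<in> \<xi>' \<and>
        biproduct C A A SA i i' p p' \<and> biproduct C (Cod C x) (Cod C x') SB j j' r r' \<and>
        biproduct C D D SD k k' q q' \<and>
        s \<in> yoneda_map C EE (k \<boxplus>\<^bsub>C\<^esub> k') (p \<boxplus>\<^bsub>C\<^esub> p')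
               {(dsum C j j' p p' x x', dsum C k k' r r' y y')}}"

definition yoneda_ext ::
  "('o, 'm, 'z) addcat_scheme \<Rightarrow> ('m \<times> 'm) set \<Rightarrow> 'o \<Rightarrow> 'o \<Rightarrow> ('m \<times> 'm) set monoid" where
  "yoneda_ext C EE D A =
     \<lparr>carrier = {seq_class C A D x y | x y. (x, y) \<in> EE \<inter> seqs C A D},
      mult = baer_sum C EE D A,
      one = {(i, q). \<exists>S j p. biproduct C A D S i j p q}\<rparr>"

definition exact_extri ::
  "('o, 'm, 'z) addcat_scheme \<Rightarrow> ('m \<times> 'm) set \<Rightarrow> ('o, 'm, ('m \<times> 'm) set) extri" where
  "exact_extri C EE =
     \<lparr>Ob = Ob C, Ar = Ar C, Dom = Dom C, Cod = Cod C, Idn = Idn C, Comp = Comp C,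
      Add = Add C, Zero = Zero C,
      Ext = yoneda_ext C EE, Emap = yoneda_map C EE, Real = (\<lambda>D A \<xi>. \<xi>)\<rparr>"

definition corresponds_to_exact :: "('o, 'm, 'e, 'z) extri_scheme \<Rightarrow> bool" where
  "corresponds_to_exact X \<longleftrightarrow>
     (\<exists>EE \<theta>. exact_structure X EE \<and> (let Y = exact_extri X EE in
        (\<forall>D \<in> Ob X. \<forall>A \<in> Ob X. \<theta> D A \<in> iso (Ext X D A) (Ext Y D A)) \<and>
        (\<forall>D D' A A'. \<forall>d \<in> Mor X D' D. \<forall>a \<in> Mor X A A'. \<forall>\<delta> \<in> carrier (Ext X D A).
           \<theta> D' A' (Emap X d a \<delta>) = Emap Y d a (\<theta> D A \<delta>)) \<and>
        (\<forall>D \<in> Ob X. \<forall>A \<in> Ob X. \<forall>\<delta> \<in> carrier (Ext X D A). Real X D A \<delta> = Real Y D A (\<theta> D A \<delta>))))"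

section \<open>Exact functors\<close>

record ('o, 'm, 'e, 'p, 'n, 'f) exfun =
  FOb :: "'o \<Rightarrow> 'p"
  FAr :: "'m \<Rightarrow> 'n"
  FExt :: "'o \<Rightarrow> 'o \<Rightarrow> 'e \<Rightarrow> 'f"

definition exact_functor ::
  "('o, 'm, 'e, 'z) extri_scheme \<Rightarrow> ('p, 'n, 'f, 'w) extri_scheme \<Rightarrow>
    ('o, 'm, 'e, 'p, 'n, 'f) exfun \<Rightarrow> bool" where
  "exact_functor X Y F \<longleftrightarrow> additive_functor X Y (FOb F) (FAr F) \<and>
     (\<forall>D \<in> Ob X. \<forall>A \<in> Ob X. FExt F D A \<in> hom (Ext X D A) (Ext Y (FOb F D) (FOb F A))) \<and>
     (\<forall>D D' A A'. \<forall>d \<in> Mor X D' D. \<forall>a \<in> Mor X A A'. \<forall>\<delta> \<in> carrier (Ext X D A).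
        FExt F D' A' (Emap X d a \<delta>) = Emap Y (FAr F d) (FAr F a) (FExt F D A \<delta>)) \<and>
     (\<forall>A B D x y \<delta>. s_triangle X A B D x y \<delta> \<longrightarrow>
        s_triangle Y (FOb F A) (FOb F B) (FOb F D) (FAr F x) (FAr F y) (FExt F D A \<delta>))"

definition exfun_comp ::
  "('p, 'n, 'f, 'q, 'k, 'g) exfun \<Rightarrow> ('o, 'm, 'e, 'p, 'n, 'f) exfun \<Rightarrow> ('o, 'm, 'e, 'q, 'k, 'g) exfun"
  where
  "exfun_comp G F = \<lparr>FOb = (\<lambda>A. FOb G (FOb F A)), FAr = (\<lambda>f. FAr G (FAr F f)),
     FExt = (\<lambda>D A \<delta>. FExt G (FOb F D) (FOb F A) (FExt F D A \<delta>))\<rparr>"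

text \<open>Equality of exact functors out of \<open>X\<close>: the values outside the carriers are immaterial.\<close>

definition exfun_eq ::
  "('o, 'm, 'e, 'z) extri_scheme \<Rightarrow> ('o, 'm, 'e, 'p, 'n, 'f) exfun \<Rightarrow>
    ('o, 'm, 'e, 'p, 'n, 'f) exfun \<Rightarrow> bool" where
  "exfun_eq X F G \<longleftrightarrow> (\<forall>A \<in> Ob X. FOb F A = FOb G A) \<and> (\<forall>f \<in> Ar X. FAr F f = FAr G f) \<and>
     (\<forall>D \<in> Ob X. \<forall>A \<in> Ob X. \<forall>\<delta> \<in> carrier (Ext X D A). FExt F D A \<delta> = FExt G D A \<delta>)"

definition exact_nat_trans ::
  "('o, 'm, 'e, 'z) extri_scheme \<Rightarrow> ('p, 'n, 'f, 'w) extri_scheme \<Rightarrow>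
    ('o, 'm, 'e, 'p, 'n, 'f) exfun \<Rightarrow> ('o, 'm, 'e, 'p, 'n, 'f) exfun \<Rightarrow> ('o \<Rightarrow> 'n) \<Rightarrow> bool" where
  "exact_nat_trans X Y F G \<eta> \<longleftrightarrow>
     (\<forall>A \<in> Ob X. \<eta> A \<in> Mor Y (FOb F A) (FOb G A)) \<and>
     (\<forall>A B. \<forall>f \<in> Mor X A B. \<eta> B \<cdot>\<^bsub>Y\<^esub> FAr F f = FAr G f \<cdot>\<^bsub>Y\<^esub> \<eta> A) \<and>
     (\<forall>D \<in> Ob X. \<forall>A \<in> Ob X. \<forall>\<delta> \<in> carrier (Ext X D A).
        push Y (FOb F D) (\<eta> A) (FExt F D A \<delta>) = pull Y (FOb G A) (\<eta> D) (FExt G D A \<delta>))"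

definition inverts ::
  "('p, 'n, 'w) cat_scheme \<Rightarrow> ('o, 'm, 'e, 'p, 'n, 'f) exfun \<Rightarrow> 'm set \<Rightarrow> bool" where
  "inverts Y F S \<longleftrightarrow> (\<forall>s \<in> S. is_iso Y (FAr F s) (Dom Y (FAr F s)) (Cod Y (FAr F s)))"

section \<open>Gabriel--Zisman localization\<close>

text \<open>A zigzag is a list of steps in the order in which they are traversed; \<open>Inl f\<close> is an arrow
  \<open>f\<close>, \<open>Inr s\<close> is the formal inverse of an arrow \<open>s\<close> in \<open>S\<close>. The arrows of \<open>C[S\<^sup>-\<^sup>1]\<close> are the
  zigzags modulo the smallest congruence which makes \<open>f \<mapsto> [Inl f]\<close> a functor and \<open>[Inr s]\<close>
  inverse to \<open>[Inl s]\<close>; such an arrow is stored with its domain and codomain.\<close>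

type_synonym 'm zigzag = "('m + 'm) list"
type_synonym ('o, 'm) gzarrow = "'o \<times> 'o \<times> 'm zigzag set"

inductive zz_path :: "('o, 'm, 'z) cat_scheme \<Rightarrow> 'm set \<Rightarrow> 'o \<Rightarrow> 'm zigzag \<Rightarrow> 'o \<Rightarrow> bool"
  for C :: "('o, 'm, 'z) cat_scheme" and S :: "'m set" where
  zz_nil: "A \<in> Ob C \<Longrightarrow> zz_path C S A [] A"
| zz_fwd: "\<lbrakk>f \<in> Mor C A B; zz_path C S B p D\<rbrakk> \<Longrightarrow> zz_path C S A (Inl f # p) D"
| zz_bwd: "\<lbrakk>s \<in> S; s \<in> Mor C B A; zz_path C S B p D\<rbrakk> \<Longrightarrow> zz_path C S A (Inr s # p) D"

inductive zz_eq :: "('o, 'm, 'z) cat_scheme \<Rightarrow> 'm set \<Rightarrow> 'o \<Rightarrow> 'o \<Rightarrow> 'm zigzag \<Rightarrow> 'm zigzag \<Rightarrow> bool"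
  for C :: "('o, 'm, 'z) cat_scheme" and S :: "'m set" where
  zz_refl: "zz_path C S A p B \<Longrightarrow> zz_eq C S A B p p"
| zz_sym: "zz_eq C S A B p q \<Longrightarrow> zz_eq C S A B q p"
| zz_trans: "\<lbrakk>zz_eq C S A B p q; zz_eq C S A B q r\<rbrakk> \<Longrightarrow> zz_eq C S A B p r"
| zz_cong: "\<lbrakk>zz_eq C S A B p p'; zz_eq C S B D q q'\<rbrakk> \<Longrightarrow> zz_eq C S A D (p @ q) (p' @ q')"
| zz_id: "A \<in> Ob C \<Longrightarrow> zz_eq C S A A [Inl (Idn C A)] []"
| zz_comp: "\<lbrakk>f \<in> Mor C A B; g \<in> Mor C B D\<rbrakk> \<Longrightarrow> zz_eq C S A D [Inl f, Inl g] [Inl (g \<cdot>\<^bsub>C\<^esub> f)]"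
| zz_inv_left: "\<lbrakk>s \<in> S; s \<in> Mor C A B\<rbrakk> \<Longrightarrow> zz_eq C S A A [Inl s, Inr s] []"
| zz_inv_right: "\<lbrakk>s \<in> S; s \<in> Mor C A B\<rbrakk> \<Longrightarrow> zz_eq C S B B [Inr s, Inl s] []"

definition gz_class ::
  "('o, 'm, 'z) cat_scheme \<Rightarrow> 'm set \<Rightarrow> 'o \<Rightarrow> 'o \<Rightarrow> 'm zigzag \<Rightarrow> ('o, 'm) gzarrow" where
  "gz_class C S A B p = (A, B, {q. zz_eq C S A B p q})"

definition gz_localization ::
  "('o, 'm, 'z) cat_scheme \<Rightarrow> 'm set \<Rightarrow> ('o, ('o, 'm) gzarrow) cat" where
  "gz_localization C S =
     \<lparr>Ob = Ob C,
      Ar = {gz_class C S A B p | A B p. zz_path C S A p B},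
      Dom = (\<lambda>(A, B, P). A),
      Cod = (\<lambda>(A, B, P). B),
      Idn = (\<lambda>A. gz_class C S A A []),
      Comp = (\<lambda>(B', D, Q) (A, B, P). (A, D, {r. \<exists>p \<in> P. \<exists>q \<in> Q. zz_eq C S A D (p @ q) r}))\<rparr>"

definition gz_functor :: "('o, 'm, 'z) cat_scheme \<Rightarrow> 'm set \<Rightarrow> 'm \<Rightarrow> ('o, 'm) gzarrow" where
  "gz_functor C S f = gz_class C S (Dom C f) (Cod C f) [Inl f]"

section \<open>Extriangulated localization\<close>

text \<open>The smallest class of arrows closed under composition and containing the inflations with
  cone in \<open>N\<close> and the deflations with cocone in \<open>N\<close>.\<close>

inductive_set loc_arrows :: "('o, 'm, 'e, 'z) extri_scheme \<Rightarrow> 'o set \<Rightarrow> 'm set"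
  for X :: "('o, 'm, 'e, 'z) extri_scheme" and N :: "'o set" where
  infl: "\<lbrakk>conflation X A B D x y; D \<in> N\<rbrakk> \<Longrightarrow> x \<in> loc_arrows X N"
| defl: "\<lbrakk>conflation X A B D x y; A \<in> N\<rbrakk> \<Longrightarrow> y \<in> loc_arrows X N"
| comp: "\<lbrakk>f \<in> loc_arrows X N; g \<in> loc_arrows X N; Cod X f = Dom X g\<rbrakk> \<Longrightarrow> g \<cdot>\<^bsub>X\<^esub> f \<in> loc_arrows X N"

text \<open>\<open>Y\<close> is an extriangulated structure on \<open>X[S\<^sup>-\<^sup>1]\<close>, \<open>Q\<close> is an exact functor on the canonical
  functor \<open>X \<rightarrow> X[S\<^sup>-\<^sup>1]\<close>, and \<open>Q\<close> is 2-universal among the exact functors inverting \<open>S\<close>.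
  HOL cannot quantify over types, so the test categories \<open>Z\<close> are all the extriangulated categories
  over the types of \<open>Y\<close>. This asks no more of \<open>(Y, Q)\<close> than the universal property against
  arbitrary extriangulated categories.\<close>

definition extri_localization ::
  "('o, 'm, 'e, 'z) extri_scheme \<Rightarrow> 'm set \<Rightarrow> ('o, ('o, 'm) gzarrow, 'f) extri \<Rightarrow>
    ('o, 'm, 'e, 'o, ('o, 'm) gzarrow, 'f) exfun \<Rightarrow> bool" where
  "extri_localization X S Y Q \<longleftrightarrow>
     extriangulated_category Y \<and> cat.truncate Y = gz_localization X S \<and>
     exact_functor X Y Q \<and>
     (\<forall>A \<in> Ob X. FOb Q A = A) \<and> (\<forall>f \<in> Ar X. FAr Q f = gz_functor X S f) \<and>
     (\<forall>(Z :: ('o, ('o, 'm) gzarrow, 'f) extri) F.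
        extriangulated_category Z \<and> exact_functor X Z F \<and> inverts Z F S \<longrightarrow>
        (\<exists>F'. exact_functor Y Z F' \<and> exfun_eq X (exfun_comp F' Q) F \<and>
           (\<forall>G. exact_functor Y Z G \<and> exfun_eq X (exfun_comp G Q) F \<longrightarrow> exfun_eq Y G F'))) \<and>
     (\<forall>(Z :: ('o, ('o, 'm) gzarrow, 'f) extri) F G F' G' \<eta>.
        extriangulated_category Z \<and>
        exact_functor X Z F \<and> inverts Z F S \<and> exact_functor X Z G \<and> inverts Z G S \<and>
        exact_functor Y Z F' \<and> exfun_eq X (exfun_comp F' Q) F \<and>
        exact_functor Y Z G' \<and> exfun_eq X (exfun_comp G' Q) G \<and>
        exact_nat_trans X Z F G \<eta> \<longrightarrow>
        (\<exists>\<eta>'. exact_nat_trans Y Z F' G' \<eta>' \<and> (\<forall>A \<in> Ob X. \<eta>' (FOb Q A) = \<eta> A) \<and>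
           (\<forall>\<zeta>. exact_nat_trans Y Z F' G' \<zeta> \<and> (\<forall>A \<in> Ob X. \<zeta> (FOb Q A) = \<eta> A) \<longrightarrow>
              (\<forall>B \<in> Ob Y. \<zeta> B = \<eta>' B))))"

section \<open>The relative structure of a triangulated category\<close>

definition E_left :: "('o, 'm, 'z) tricat_scheme \<Rightarrow> 'o set \<Rightarrow> 'o \<Rightarrow> 'o \<Rightarrow> 'm set" where
  "E_left T N D A = {h \<in> Mor T D (ShO T A).
     \<forall>M \<in> N. \<forall>x \<in> Mor T M D. \<exists>M' \<in> N. factors_through T (h \<cdot>\<^bsub>T\<^esub> x) (ShO T M')}"

definition E_right :: "('o, 'm, 'z) tricat_scheme \<Rightarrow> 'o set \<Rightarrow> 'o \<Rightarrow> 'o \<Rightarrow> 'm set" where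
  "E_right T N D A = {h \<in> Mor T D (ShO T A).
     \<forall>M \<in> N. \<forall>y \<in> Mor T A M. \<exists>M' \<in> N. factors_through T (y \<cdot>\<^bsub>T\<^esub> UnA T h) (UnO T M')}"

definition tri_extri :: "('o, 'm, 'z) tricat_scheme \<Rightarrow> ('o, 'm, 'm) extri" where
  "tri_extri T =
     \<lparr>Ob = Ob T, Ar = Ar T, Dom = Dom T, Cod = Cod T, Idn = Idn T, Comp = Comp T,
      Add = Add T, Zero = Zero T,
      Ext = (\<lambda>D A. Homg T D (ShO T A)),
      Emap = (\<lambda>d a h. ShA T a \<cdot>\<^bsub>T\<^esub> h \<cdot>\<^bsub>T\<^esub> d),
      Real = (\<lambda>D A h. {(x, y). \<exists>B. triangle T A B D x y h})\<rparr>"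

definition rel_extri :: "('o, 'm, 'z) tricat_scheme \<Rightarrow> 'o set \<Rightarrow> ('o, 'm, 'm) extri" where
  "rel_extri T N = (tri_extri T)
     \<lparr>Ext := (\<lambda>D A. (Homg T D (ShO T A))\<lparr>carrier := E_left T N D A \<inter> E_right T N D A\<rparr>)\<rparr>"

end

theory Submission
  imports Defs
begin

text \<open>
  Every arrow inverted by the localization is regular (monic and epic) modulo the ideal of arrows
  which factor through \<open>N\<close>, and the Ore conditions hold modulo this ideal. Hence \<open>Q f = 0\<close> if and only
  if \<open>f\<close> factors through \<open>N\<close>, and every arrow of the localization is a left and a right fraction.

  Suppose \<open>Cone(N,N) = C\<close>, let \<open>A \<rightarrow> B \<rightarrow> D\<close> be a relative conflation and \<open>N1 \<rightarrow> N0 \<rightarrow> D\<close> a triangle with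
  \<open>N1, N0 \<in> N\<close>. The homotopy pullback \<open>P\<close> of \<open>B\<close> and \<open>N0\<close> over \<open>D\<close> factors the inflation as
  \<open>A \<rightarrow> P \<rightarrow> B\<close>; the first map has cone \<open>N0\<close>, the second has cocone \<open>N1\<close>, and both are monic modulo \<open>N\<close>.
  So \<open>Q\<close> sends relative inflations to monomorphisms and dually relative deflations to epimorphisms.
  The conflations of an extriangulated category which consist of a monomorphism and an epimorphism
  form an exact substructure, and by the universal property this substructure of the localization is
  everything. If moreover \<open>B \<in> N\<close>, then \<open>P \<in> N\<close>, and the triangle \<open>M \<rightarrow> F \<oplus> A \<rightarrow> P\<close> with \<open>M, F \<in> N\<close> obtained
  from a factorization \<open>N0 \<rightarrow> M[1] \<rightarrow> A[1]\<close> gives \<open>A \<in> N\<close>.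

  Conversely, if \<open>N\<close> is functorially finite, complete a right approximation \<open>M0 \<rightarrow> D\<close> to a triangle
  \<open>K \<rightarrow> M0 \<rightarrow> D\<close> and choose a left approximation \<open>K \<rightarrow> M1\<close>. Then \<open>K \<rightarrow> M0 \<oplus> M1\<close> is a relative inflation into
  an object of \<open>N\<close>; either of (i) and (iii) forces \<open>K \<in> N\<close>, so \<open>D \<in> Cone(N,N)\<close>.
\<close>

section \<open>Calculus in additive categories\<close>

text \<open>The data on \<open>Y\<close> are only zigzag classes and a universal property, so
  vanishing of \<open>Q f\<close> is read off from zigzags themselves: they act, modulo the ideal,
  on arrows into their source, and evaluation at an identity separates arrows. That null arrows die
  comes instead from additivity of \<open>Q\<close>, because \<open>0 \<rightarrow> M\<close> is
  inverted for \<open>M\<close> in \<open>N\<close>. Both facts together turn Ore squares, which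
  commute only modulo the ideal, into genuine fractions.

  One device recurs. For an inflation with cone \<open>D\<close> in \<open>N\<close>, the relative
  condition says that its class is pushed out from some \<open>E(D,M)\<close> with \<open>M\<close>
  in \<open>N\<close>; the homotopy pushout then trades the inflation for a deflation with cocone
  \<open>M\<close>. Regularity, the Ore conditions and the Serre property all use this trade.

  All constructions take place in the full structure \<open>tri_extri T\<close>; relative triangles
  are its triangles with a condition on the class. The condition is phrased by pushing and pulling
  classes, so that \<open>opp\<close> exchanges its halves and each dual statement is an instance of
  its mirror image.

  The largest exact substructure lives over the same types as \<open>Y\<close>, hence it is a
  legitimate test category for the universal property.\<close>

context category
begin

lemma Mor_Ar: "f \<in> Ar C \<Longrightarrow> f \<in> Mor C (Dom C f) (Cod C f)"
  by (simp add: Mor_def)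

lemma Mor_Ob: "f \<in> Mor C A B \<Longrightarrow> A \<in> Ob C \<and> B \<in> Ob C"
  using dom_Ob cod_Ob by (auto simp: Mor_def)

declare dom_Ob [simp] cod_Ob [simp]

lemma comp_Ar [simp]:
  assumes "f \<in> Ar C" "g \<in> Ar C" "Cod C f = Dom C g"
  shows "g \<cdot> f \<in> Ar C" "Dom C (g \<cdot> f) = Dom C f" "Cod C (g \<cdot> f) = Cod C g"
  using comp_Mor[of f "Dom C f" "Cod C f" g "Cod C g"] assms by (auto simp: Mor_def)

lemma id_Ar [simp]:
  assumes "A \<in> Ob C"
  shows "Idn C A \<in> Ar C" "Dom C (Idn C A) = A" "Cod C (Idn C A) = A"
  using id_Mor[OF assms] by (auto simp: Mor_def)

lemma id_comp [simp]: "f \<in> Ar C \<Longrightarrow> Cod C f = B \<Longrightarrow> Idn C B \<cdot> f = f"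
  using id_left by (auto simp: Mor_def)

lemma comp_id [simp]: "f \<in> Ar C \<Longrightarrow> Dom C f = A \<Longrightarrow> f \<cdot> Idn C A = f"
  using id_right by (auto simp: Mor_def)

lemma assoc [simp]:
  "f \<in> Ar C \<Longrightarrow> g \<in> Ar C \<Longrightarrow> h \<in> Ar C \<Longrightarrow> Cod C f = Dom C g \<Longrightarrow> Cod C g = Dom C h
    \<Longrightarrow> (h \<cdot> g) \<cdot> f = h \<cdot> (g \<cdot> f)"
  using comp_assoc[of f "Dom C f" "Cod C f" g "Cod C g" h "Cod C h"] by (auto simp: Mor_def)

lemma reassoc:
  "g \<cdot> f = k \<Longrightarrow> f \<in> Ar C \<Longrightarrow> g \<in> Ar C \<Longrightarrow> Cod C f = Dom C g
    \<Longrightarrow> t \<in> Ar C \<Longrightarrow> Cod C t = Dom C f \<Longrightarrow> g \<cdot> (f \<cdot> t) = k \<cdot> t"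
  using assoc[of t f g] by auto

lemma reassoc2:
  "g \<cdot> f = k \<cdot> l \<Longrightarrow> f \<in> Ar C \<Longrightarrow> g \<in> Ar C \<Longrightarrow> Cod C f = Dom C g
    \<Longrightarrow> l \<in> Ar C \<Longrightarrow> k \<in> Ar C \<Longrightarrow> Cod C l = Dom C k
    \<Longrightarrow> t \<in> Ar C \<Longrightarrow> Cod C t = Dom C f \<Longrightarrow> Dom C l = Dom C f \<Longrightarrow> g \<cdot> (f \<cdot> t) = k \<cdot> (l \<cdot> t)"
  using assoc[of t f g] by auto

lemma is_isoE:
  assumes "is_iso C f A B"
  obtains g where "f \<in> Mor C A B" "g \<in> Mor C B A" "g \<cdot> f = Idn C A" "f \<cdot> g = Idn C B"
    "is_iso C g B A"
proof -
  obtain g where "f \<in> Mor C A B" "g \<in> Mor C B A" "g \<cdot> f = Idn C A" "f \<cdot> g = Idn C B"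
    using assms unfolding is_iso_def by auto
  moreover from this have "is_iso C g B A" unfolding is_iso_def by auto
  ultimately show thesis by (rule that)
qed

lemma is_isoI:
  assumes "f \<in> Mor C A B" "g \<in> Mor C B A" "g \<cdot> f = Idn C A" "f \<cdot> g = Idn C B"
  shows "is_iso C f A B"
  using assms unfolding is_iso_def by auto

lemma is_iso_id [simp]: "A \<in> Ob C \<Longrightarrow> is_iso C (Idn C A) A A"
  by (rule is_isoI[of _ _ _ "Idn C A"]) (auto simp: Mor_def)

lemma is_iso_comp:
  assumes "is_iso C f A B" "is_iso C g B D"
  shows "is_iso C (g \<cdot> f) A D"
proof -
  obtain f' where f: "f \<in> Mor C A B" "f' \<in> Mor C B A" "f' \<cdot> f = Idn C A" "f \<cdot> f' = Idn C B"
    by (rule is_isoE[OF assms(1)])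
  obtain g' where g: "g \<in> Mor C B D" "g' \<in> Mor C D B" "g' \<cdot> g = Idn C B" "g \<cdot> g' = Idn C D"
    by (rule is_isoE[OF assms(2)])
  note * = f g
  have t: "f \<in> Ar C" "Dom C f = A" "Cod C f = B" "f' \<in> Ar C" "Dom C f' = B" "Cod C f' = A"
    "g \<in> Ar C" "Dom C g = B" "Cod C g = D" "g' \<in> Ar C" "Dom C g' = D" "Cod C g' = B"
    using * by (auto simp: Mor_def)
  show ?thesis
    using * t reassoc[OF *(7)] reassoc[OF *(4)]
    by (intro is_isoI[of _ _ _ "f' \<cdot> g'"]) (auto simp: Mor_def)
qed

lemma iso_if_two_sided:
  assumes "f \<in> Mor C A B" "g \<in> Mor C B A" "h \<in> Mor C B A" "g \<cdot> f = Idn C A" "f \<cdot> h = Idn C B"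
  shows "is_iso C f A B"
proof -
  have "h = (g \<cdot> f) \<cdot> h" using assms by (simp add: Mor_def)
  also have "\<dots> = g \<cdot> (f \<cdot> h)" using assms by (intro assoc) (auto simp: Mor_def)
  also have "\<dots> = g" using assms by (simp add: Mor_def)
  finally show ?thesis using assms by (intro is_isoI) auto
qed

end

definition mono_arr :: "('o, 'm, 'z) cat_scheme \<Rightarrow> 'm \<Rightarrow> bool" where
  "mono_arr C x \<longleftrightarrow> (\<forall>W. \<forall>f \<in> Mor C W (Dom C x). \<forall>g \<in> Mor C W (Dom C x).
     x \<cdot>\<^bsub>C\<^esub> f = x \<cdot>\<^bsub>C\<^esub> g \<longrightarrow> f = g)"

definition epi_arr :: "('o, 'm, 'z) cat_scheme \<Rightarrow> 'm \<Rightarrow> bool" where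
  "epi_arr C x \<longleftrightarrow> (\<forall>W. \<forall>f \<in> Mor C (Cod C x) W. \<forall>g \<in> Mor C (Cod C x) W.
     f \<cdot>\<^bsub>C\<^esub> x = g \<cdot>\<^bsub>C\<^esub> x \<longrightarrow> f = g)"

context additive_category
begin

lemma Homg_simps [simp]:
  "carrier (Homg C A B) = Mor C A B" "mult (Homg C A B) = Add C" "one (Homg C A B) = Zero C A B"
  by (simp_all add: Homg_def)

lemma zero_Ar [simp]:
  assumes "A \<in> Ob C" "B \<in> Ob C"
  shows "Zero C A B \<in> Ar C" "Dom C (Zero C A B) = A" "Cod C (Zero C A B) = B"
proof -
  interpret G: comm_group "Homg C A B" by (rule hom_group[OF assms])
  have "Zero C A B \<in> Mor C A B" using G.one_closed by simp
  then show "Zero C A B \<in> Ar C" "Dom C (Zero C A B) = A" "Cod C (Zero C A B) = B"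
    by (auto simp: Mor_def)
qed

lemma add_Ar [simp]:
  assumes "f \<in> Ar C" "g \<in> Ar C" "Dom C f = Dom C g" "Cod C f = Cod C g"
  shows "f \<boxplus> g \<in> Ar C" "Dom C (f \<boxplus> g) = Dom C g" "Cod C (f \<boxplus> g) = Cod C g"
proof -
  interpret G: comm_group "Homg C (Dom C g) (Cod C g)" by (rule hom_group) (use assms in auto)
  have "f \<boxplus> g \<in> Mor C (Dom C g) (Cod C g)" using G.m_closed[of f g] assms by (simp add: Mor_def)
  then show "f \<boxplus> g \<in> Ar C" "Dom C (f \<boxplus> g) = Dom C g" "Cod C (f \<boxplus> g) = Cod C g"
    by (auto simp: Mor_def)
qed

lemma neg_Ar [simp]:
  assumes "f \<in> Ar C"
  shows "Neg C f \<in> Ar C" "Dom C (Neg C f) = Dom C f" "Cod C (Neg C f) = Cod C f"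
proof -
  interpret G: comm_group "Homg C (Dom C f) (Cod C f)" by (rule hom_group) (use assms in auto)
  have "Neg C f \<in> Mor C (Dom C f) (Cod C f)" using G.inv_closed[of f] assms
    by (simp add: Mor_def Neg_def)
  then show "Neg C f \<in> Ar C" "Dom C (Neg C f) = Dom C f" "Cod C (Neg C f) = Cod C f"
    by (auto simp: Mor_def)
qed

lemma add_comm:
  assumes "f \<in> Ar C" "g \<in> Ar C" "Dom C f = Dom C g" "Cod C f = Cod C g"
  shows "f \<boxplus> g = g \<boxplus> f"
proof -
  interpret G: comm_group "Homg C (Dom C g) (Cod C g)" by (rule hom_group) (use assms in auto)
  show ?thesis using G.m_comm[of f g] assms by (simp add: Mor_def)
qed

lemma add_assoc:
  assumes "f \<in> Ar C" "g \<in> Ar C" "h \<in> Ar C" "Dom C f = Dom C g" "Cod C f = Cod C g"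
    "Dom C g = Dom C h" "Cod C g = Cod C h"
  shows "(f \<boxplus> g) \<boxplus> h = f \<boxplus> (g \<boxplus> h)"
proof -
  interpret G: comm_group "Homg C (Dom C g) (Cod C g)" by (rule hom_group) (use assms in auto)
  show ?thesis using G.m_assoc[of f g h] assms by (simp add: Mor_def)
qed

lemma add_left_comm:
  assumes "f \<in> Ar C" "g \<in> Ar C" "h \<in> Ar C" "Dom C f = Dom C g" "Cod C f = Cod C g"
    "Dom C g = Dom C h" "Cod C g = Cod C h"
  shows "f \<boxplus> (g \<boxplus> h) = g \<boxplus> (f \<boxplus> h)"
proof -
  have "f \<boxplus> (g \<boxplus> h) = (f \<boxplus> g) \<boxplus> h" using assms by (intro add_assoc[symmetric]) auto
  also have "\<dots> = (g \<boxplus> f) \<boxplus> h" using assms add_comm[of f g] by simp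
  also have "\<dots> = g \<boxplus> (f \<boxplus> h)" using assms by (intro add_assoc) auto
  finally show ?thesis .
qed

lemmas add_ac = add_assoc add_comm add_left_comm

lemma add_zero [simp]:
  assumes "f \<in> Ar C" "Dom C f = A" "Cod C f = B"
  shows "f \<boxplus> Zero C A B = f" "Zero C A B \<boxplus> f = f"
proof -
  interpret G: comm_group "Homg C A B" by (rule hom_group) (use assms in auto)
  show "f \<boxplus> Zero C A B = f" "Zero C A B \<boxplus> f = f" using G.r_one[of f] G.l_one[of f] assms
    by (simp_all add: Mor_def)
qed

lemma add_neg [simp]:
  assumes "f \<in> Ar C"
  shows "f \<boxplus> Neg C f = Zero C (Dom C f) (Cod C f)" "Neg C f \<boxplus> f = Zero C (Dom C f) (Cod C f)"
proof -
  interpret G: comm_group "Homg C (Dom C f) (Cod C f)" by (rule hom_group) (use assms in auto)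
  show "f \<boxplus> Neg C f = Zero C (Dom C f) (Cod C f)" "Neg C f \<boxplus> f = Zero C (Dom C f) (Cod C f)"
    using G.r_inv[of f] G.l_inv[of f] assms
    by (simp_all add: Mor_def Neg_def)
qed

lemma add_neg_left [simp]:
  assumes "f \<in> Ar C" "g \<in> Ar C" "Dom C f = Dom C g" "Cod C f = Cod C g"
  shows "f \<boxplus> (Neg C f \<boxplus> g) = g" "Neg C f \<boxplus> (f \<boxplus> g) = g"
proof -
  have "f \<boxplus> (Neg C f \<boxplus> g) = (f \<boxplus> Neg C f) \<boxplus> g"
    using assms by (intro add_assoc[symmetric]) auto
  then show "f \<boxplus> (Neg C f \<boxplus> g) = g" using assms by simp
  have "Neg C f \<boxplus> (f \<boxplus> g) = (Neg C f \<boxplus> f) \<boxplus> g"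
    using assms by (intro add_assoc[symmetric]) auto
  then show "Neg C f \<boxplus> (f \<boxplus> g) = g" using assms by simp
qed

lemma add_cancel:
  assumes "f \<in> Ar C" "g \<in> Ar C" "h \<in> Ar C" "Dom C f = Dom C g" "Cod C f = Cod C g"
    "Dom C g = Dom C h" "Cod C g = Cod C h" "f \<boxplus> g = f \<boxplus> h"
  shows "g = h"
proof -
  have "g = Neg C f \<boxplus> (f \<boxplus> g)" using assms by (intro add_neg_left(2)[symmetric]) auto
  also have "\<dots> = Neg C f \<boxplus> (f \<boxplus> h)" using assms(8) by (rule arg_cong)
  also have "\<dots> = h" using assms by (intro add_neg_left(2)) auto
  finally show ?thesis .
qed

lemma neg_unique:
  assumes "f \<in> Mor C A B" "g \<in> Mor C A B" "f \<boxplus> g = Zero C A B"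
  shows "Neg C f = g"
  by (rule add_cancel[of f]) (use assms in \<open>auto simp: Mor_def\<close>)

lemma neg_neg [simp]: "f \<in> Ar C \<Longrightarrow> Neg C (Neg C f) = f"
  by (rule neg_unique[of _ "Dom C f" "Cod C f"]) (auto simp: Mor_def)

lemma neg_zero [simp]: "A \<in> Ob C \<Longrightarrow> B \<in> Ob C \<Longrightarrow> Neg C (Zero C A B) = Zero C A B"
  by (rule neg_unique[of _ A B]) (auto simp: Mor_def)

lemma neg_add:
  assumes "f \<in> Ar C" "g \<in> Ar C" "Dom C f = Dom C g" "Cod C f = Cod C g"
  shows "Neg C (f \<boxplus> g) = Neg C f \<boxplus> Neg C g"
  by (rule neg_unique[of _ "Dom C f" "Cod C f"]) (use assms in \<open>auto simp: Mor_def add_ac\<close>)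

lemma distrib_right [simp]:
  "f \<in> Ar C \<Longrightarrow> g \<in> Ar C \<Longrightarrow> g' \<in> Ar C \<Longrightarrow> Dom C g = Cod C f \<Longrightarrow> Dom C g' = Cod C f
    \<Longrightarrow> Cod C g = Cod C g' \<Longrightarrow> (g \<boxplus> g') \<cdot> f = (g \<cdot> f) \<boxplus> (g' \<cdot> f)"
  using comp_add_left[of f "Dom C f" "Cod C f" g "Cod C g" g'] by (auto simp: Mor_def)

lemma distrib_left [simp]:
  "f \<in> Ar C \<Longrightarrow> f' \<in> Ar C \<Longrightarrow> g \<in> Ar C \<Longrightarrow> Dom C g = Cod C f \<Longrightarrow> Cod C f' = Cod C f
    \<Longrightarrow> Dom C f = Dom C f' \<Longrightarrow> g \<cdot> (f \<boxplus> f') = (g \<cdot> f) \<boxplus> (g \<cdot> f')"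
  using comp_add_right[of f "Dom C f" "Cod C f" f' g "Cod C g"] by (auto simp: Mor_def)

text \<open>Cancellation in the Hom group. From \<open>0 + 0 = 0\<close> it yields that composites
  with zero arrows are zero, and later that additive functors preserve zero arrows.\<close>

lemma idem_zero:
  assumes "f \<in> Mor C A B" "f \<boxplus> f = f" shows "f = Zero C A B"
proof -
  have AB: "A \<in> Ob C" "B \<in> Ob C" using Mor_Ob[OF assms(1)] by auto
  then have "f \<boxplus> f = f \<boxplus> Zero C A B" using assms by (auto simp: Mor_def)
  then show ?thesis using assms(1) AB by (intro add_cancel[of f f "Zero C A B"]) (auto simp: Mor_def)
qed

lemma comp_zero [simp]:
  assumes "f \<in> Ar C" "Cod C f = B" "D \<in> Ob C"
  shows "Zero C B D \<cdot> f = Zero C (Dom C f) D"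
proof (rule idem_zero)
  have B: "B \<in> Ob C" using assms by auto
  then have z: "Zero C B D \<in> Ar C" "Dom C (Zero C B D) = B" "Cod C (Zero C B D) = D"
    using assms by auto
  show "Zero C B D \<cdot> f \<in> Mor C (Dom C f) D" using assms z by (simp add: Mor_def)
  have "(Zero C B D \<boxplus> Zero C B D) \<cdot> f = (Zero C B D \<cdot> f) \<boxplus> (Zero C B D \<cdot> f)"
    by (rule distrib_right) (use assms z in auto)
  then show "(Zero C B D \<cdot> f) \<boxplus> (Zero C B D \<cdot> f) = Zero C B D \<cdot> f" using z by simp
qed

lemma zero_comp [simp]:
  assumes "f \<in> Ar C" "Dom C f = B" "A \<in> Ob C"
  shows "f \<cdot> Zero C A B = Zero C A (Cod C f)"
proof (rule idem_zero)
  have B: "B \<in> Ob C" using assms by auto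
  then have z: "Zero C A B \<in> Ar C" "Dom C (Zero C A B) = A" "Cod C (Zero C A B) = B"
    using assms by auto
  show "f \<cdot> Zero C A B \<in> Mor C A (Cod C f)" using assms z by (simp add: Mor_def)
  have "f \<cdot> (Zero C A B \<boxplus> Zero C A B) = (f \<cdot> Zero C A B) \<boxplus> (f \<cdot> Zero C A B)"
    by (rule distrib_left) (use assms z in auto)
  then show "(f \<cdot> Zero C A B) \<boxplus> (f \<cdot> Zero C A B) = f \<cdot> Zero C A B" using z by simp
qed

lemma neg_comp [simp]:
  assumes "f \<in> Ar C" "g \<in> Ar C" "Cod C f = Dom C g"
  shows "Neg C g \<cdot> f = Neg C (g \<cdot> f)"
proof (rule neg_unique[symmetric])
  show "(g \<cdot> f) \<boxplus> (Neg C g \<cdot> f) = Zero C (Dom C f) (Cod C g)"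
    using assms distrib_right[of f g "Neg C g"] by simp
qed (use assms in \<open>auto simp: Mor_def\<close>)

lemma comp_neg [simp]:
  assumes "f \<in> Ar C" "g \<in> Ar C" "Cod C f = Dom C g"
  shows "g \<cdot> Neg C f = Neg C (g \<cdot> f)"
proof (rule neg_unique[symmetric])
  show "(g \<cdot> f) \<boxplus> (g \<cdot> Neg C f) = Zero C (Dom C f) (Cod C g)"
    using assms distrib_left[of f "Neg C f" g] by simp
qed (use assms in \<open>auto simp: Mor_def\<close>)

lemma eq_iff_diff_zero:
  assumes "f \<in> Mor C A B" "g \<in> Mor C A B"
  shows "f = g \<longleftrightarrow> f \<boxplus> Neg C g = Zero C A B"
proof
  assume "f \<boxplus> Neg C g = Zero C A B"
  then have "Neg C f = Neg C g"
    by (intro neg_unique[of _ A B]) (use assms in \<open>auto simp: Mor_def\<close>)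
  then have "Neg C (Neg C f) = Neg C (Neg C g)" by simp
  then show "f = g" using assms by (simp add: Mor_def)
qed (use assms in \<open>auto simp: Mor_def\<close>)

lemma mono_arrI:
  assumes "x \<in> Mor C A B"
    and "\<And>W f. f \<in> Mor C W A \<Longrightarrow> x \<cdot> f = Zero C W B \<Longrightarrow> f = Zero C W A"
  shows "mono_arr C x"
  unfolding mono_arr_def
proof (intro allI ballI impI)
  fix W f g assume f: "f \<in> Mor C W (Dom C x)" and g: "g \<in> Mor C W (Dom C x)" and e: "x \<cdot> f = x \<cdot> g"
  have "x \<cdot> (f \<boxplus> Neg C g) = Zero C W B" using f g assms(1) e by (simp add: Mor_def)
  then have "f \<boxplus> Neg C g = Zero C W A" using f g assms(1) by (intro assms(2)) (auto simp: Mor_def)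
  then show "f = g" using eq_iff_diff_zero[of f W A g] f g assms(1) by (auto simp: Mor_def)
qed

lemma epi_arrI:
  assumes "x \<in> Mor C A B"
    and "\<And>W f. f \<in> Mor C B W \<Longrightarrow> f \<cdot> x = Zero C A W \<Longrightarrow> f = Zero C B W"
  shows "epi_arr C x"
  unfolding epi_arr_def
proof (intro allI ballI impI)
  fix W f g assume f: "f \<in> Mor C (Cod C x) W" and g: "g \<in> Mor C (Cod C x) W" and e: "f \<cdot> x = g \<cdot> x"
  have "(f \<boxplus> Neg C g) \<cdot> x = Zero C A W" using f g assms(1) e by (simp add: Mor_def)
  then have "f \<boxplus> Neg C g = Zero C B W" using f g assms(1) by (intro assms(2)) (auto simp: Mor_def)
  then show "f = g" using eq_iff_diff_zero[of f B W g] f g assms(1) by (auto simp: Mor_def)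
qed

lemma monoD:
  assumes "mono_arr C x" "x \<in> Mor C A B" "f \<in> Mor C W A" "x \<cdot> f = Zero C W B"
  shows "f = Zero C W A"
proof -
  have O: "W \<in> Ob C" "A \<in> Ob C" "B \<in> Ob C" using Mor_Ob[OF assms(2)] Mor_Ob[OF assms(3)] by auto
  have "x \<cdot> f = x \<cdot> Zero C W A" using assms O by (simp add: Mor_def)
  then show ?thesis
    by (rule assms(1)[unfolded mono_arr_def, rule_format, of _ W, rotated 2])
      (use assms(2,3) O in \<open>simp_all add: Mor_def\<close>)
qed

lemma epiD:
  assumes "epi_arr C x" "x \<in> Mor C A B" "f \<in> Mor C B W" "f \<cdot> x = Zero C A W"
  shows "f = Zero C B W"
proof -
  have O: "W \<in> Ob C" "A \<in> Ob C" "B \<in> Ob C" using Mor_Ob[OF assms(2)] Mor_Ob[OF assms(3)] by auto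
  have "f \<cdot> x = Zero C B W \<cdot> x" using assms O by (simp add: Mor_def)
  then show ?thesis
    by (rule assms(1)[unfolded epi_arr_def, rule_format, of _ W, rotated 2])
      (use assms(2,3) O in \<open>simp_all add: Mor_def\<close>)
qed

text \<open>The inverse is \<open>1 - n\<close>, since
  \<open>(1 + n)(1 - n) = 1 - n n\<close>.\<close>

lemma unipotent_iso:
  assumes "n \<in> Mor C A A" "n \<cdot> n = Zero C A A"
  shows "is_iso C (Idn C A \<boxplus> n) A A"
proof -
  have A: "A \<in> Ob C" using Mor_Ob[OF assms(1)] by auto
  show ?thesis
    using assms A
    by (intro is_isoI[of _ _ _ "Idn C A \<boxplus> Neg C n"]) (auto simp: Mor_def add_ac)
qed

text \<open>Replaces the five lemma below: a comparison map of two triangles with a comparison map back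
  composes to \<open>1 + n\<close> with \<open>n\<^sup>2 = 0\<close>, so no exact sequence has to be continued beyond the middle term.\<close>

lemma iso_of_unipotent:
  assumes f: "f \<in> Mor C A B" and g: "g \<in> Mor C B A"
    and "((g \<cdot> f) \<boxplus> Neg C (Idn C A)) \<cdot> ((g \<cdot> f) \<boxplus> Neg C (Idn C A)) = Zero C A A" (is "?n \<cdot> ?n = _")
    and "((f \<cdot> g) \<boxplus> Neg C (Idn C B)) \<cdot> ((f \<cdot> g) \<boxplus> Neg C (Idn C B)) = Zero C B B" (is "?m \<cdot> ?m = _")
  shows "is_iso C f A B"
proof -
  have O: "A \<in> Ob C" "B \<in> Ob C" using Mor_Ob[OF f] by auto
  have n: "?n \<in> Mor C A A" "?m \<in> Mor C B B" using f g O by (auto simp: Mor_def)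
  have e1: "Idn C A \<boxplus> ?n = g \<cdot> f" using f g O by (auto simp: Mor_def add_ac)
  have e2: "Idn C B \<boxplus> ?m = f \<cdot> g" using f g O by (auto simp: Mor_def add_ac)
  have i1: "is_iso C (g \<cdot> f) A A" using unipotent_iso[OF n(1) assms(3)] e1 by simp
  have i2: "is_iso C (f \<cdot> g) B B" using unipotent_iso[OF n(2) assms(4)] e2 by simp
  obtain u where u: "u \<in> Mor C A A" "u \<cdot> (g \<cdot> f) = Idn C A" using i1 by (auto elim: is_isoE)
  obtain v where v: "v \<in> Mor C B B" "(f \<cdot> g) \<cdot> v = Idn C B" using i2 by (auto elim: is_isoE)
  \<comment> \<open>\<open>u \<cdot> g\<close> inverts \<open>f\<close> on the left and
    \<open>g \<cdot> v\<close> inverts it on the right; the two need not be compared, because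
    one-sided inverses on both sides coincide.\<close>
  show ?thesis
    by (rule iso_if_two_sided[of _ _ _ "u \<cdot> g" "g \<cdot> v"]) (use f g u v in \<open>auto simp: Mor_def\<close>)
qed

lemma biproductD:
  assumes "biproduct C A B S i j p q"
  shows "A \<in> Ob C" "B \<in> Ob C" "S \<in> Ob C" "i \<in> Ar C" "Dom C i = A" "Cod C i = S"
     "j \<in> Ar C" "Dom C j = B" "Cod C j = S" "p \<in> Ar C" "Dom C p = S" "Cod C p = A"
     "q \<in> Ar C" "Dom C q = S" "Cod C q = B"
     "p \<cdot> i = Idn C A" "q \<cdot> j = Idn C B"
     "q \<cdot> i = Zero C A B" "p \<cdot> j = Zero C B A"
     "(i \<cdot> p) \<boxplus> (j \<cdot> q) = Idn C S"
  using assms unfolding biproduct_def by (auto simp: Mor_def)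

lemma biproduct_reassoc:
  assumes "biproduct C A B S i j p q" "t \<in> Ar C"
  shows "Cod C t = A \<Longrightarrow> p \<cdot> i \<cdot> t = t" "Cod C t = B \<Longrightarrow> q \<cdot> j \<cdot> t = t"
    "Cod C t = A \<Longrightarrow> q \<cdot> i \<cdot> t = Zero C (Dom C t) B" "Cod C t = B \<Longrightarrow> p \<cdot> j \<cdot> t = Zero C (Dom C t) A"
  using biproductD[OF assms(1)] assms(2)
   reassoc[of p i _ t] reassoc[of q j _ t] reassoc[of q i _ t] reassoc[of p j _ t] by auto

lemma biproduct_ext_right:
  assumes "biproduct C A B S i j p q" "f \<in> Mor C W S" "g \<in> Mor C W S" "p \<cdot> f = p \<cdot> g" "q \<cdot> f = q \<cdot> g"
  shows "f = g"
proof -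
  note b = biproductD[OF assms(1)]
  have "f = ((i \<cdot> p) \<boxplus> (j \<cdot> q)) \<cdot> f" using b(20) assms by (simp add: Mor_def)
  also have "\<dots> = ((i \<cdot> p) \<boxplus> (j \<cdot> q)) \<cdot> g" using b(1-19) assms by (simp add: Mor_def)
  also have "\<dots> = g" using b(20) assms by (simp add: Mor_def)
  finally show ?thesis .
qed

lemma biproduct_ext_left:
  assumes "biproduct C A B S i j p q" "f \<in> Mor C S W" "g \<in> Mor C S W" "f \<cdot> i = g \<cdot> i" "f \<cdot> j = g \<cdot> j"
  shows "f = g"
proof -
  note b = biproductD[OF assms(1)]
  have "f = f \<cdot> ((i \<cdot> p) \<boxplus> (j \<cdot> q))" using b(20) assms by (simp add: Mor_def)
  also have "\<dots> = (f \<cdot> i) \<cdot> p \<boxplus> (f \<cdot> j) \<cdot> q" using b(1-19) assms(2,3) by (simp add: Mor_def)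
  also have "\<dots> = (g \<cdot> i) \<cdot> p \<boxplus> (g \<cdot> j) \<cdot> q" using assms(4,5) by simp
  also have "\<dots> = g \<cdot> ((i \<cdot> p) \<boxplus> (j \<cdot> q))" using b(1-19) assms(2,3) by (simp add: Mor_def)
  also have "\<dots> = g" using b(20) assms by (simp add: Mor_def)
  finally show ?thesis .
qed

lemma zero_objectD:
  assumes "zero_object C Z" "f \<in> Mor C A B" "A = Z \<or> B = Z"
  shows "f = Zero C A B"
proof -
  have O: "A \<in> Ob C" "B \<in> Ob C" using Mor_Ob[OF assms(2)] by auto
  then have "Zero C A B \<in> Mor C A B" by (simp add: Mor_def)
  then show ?thesis using assms O unfolding zero_object_def by metis
qed

lemma zero_object_id: "zero_object C Z \<Longrightarrow> Z \<in> Ob C \<and> Idn C Z = Zero C Z Z"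
  using zero_objectD[of Z "Idn C Z" Z Z] by (auto simp: zero_object_def Mor_def)

lemma biproduct_zero_right:
  assumes "A \<in> Ob C" "zero_object C Z"
  shows "biproduct C A Z A (Idn C A) (Zero C Z A) (Idn C A) (Zero C A Z)"
  using assms zero_object_id[OF assms(2)] unfolding biproduct_def by (auto simp: Mor_def)

lemma biproduct_zero_left:
  assumes "A \<in> Ob C" "zero_object C Z"
  shows "biproduct C Z A A (Zero C Z A) (Idn C A) (Zero C A Z) (Idn C A)"
  using assms zero_object_id[OF assms(2)] unfolding biproduct_def by (auto simp: Mor_def)

text \<open>The automorphism \<open>1 + j a p\<close> of the biproduct moves the first injection
  onto the graph of \<open>a\<close>; its inverse changes the second projection accordingly. So the
  graph of any arrow is a split inflation.\<close>

lemma biproduct_graph: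
  assumes "biproduct C A B S i j p q" "a \<in> Mor C A B"
  shows "biproduct C A B S (i \<boxplus> (j \<cdot> a)) j p (q \<boxplus> Neg C (a \<cdot> p))"
proof -
  note b = biproductD[OF assms(1)] biproduct_reassoc[OF assms(1)]
  have a: "a \<in> Ar C" "Dom C a = A" "Cod C a = B" using assms(2) by (auto simp: Mor_def)
  have "((i \<boxplus> (j \<cdot> a)) \<cdot> p) \<boxplus> (j \<cdot> (q \<boxplus> Neg C (a \<cdot> p))) = (i \<cdot> p) \<boxplus> (j \<cdot> q)"
    using a b(1-15) by (simp add: add_ac)
  then show ?thesis using a b unfolding biproduct_def by (auto simp: Mor_def)
qed

lemma biproduct_swap:
  assumes "biproduct C A B S i j p q"
  shows "biproduct C B A S j i q p"
  using biproductD[OF assms] unfolding biproduct_def by (auto simp: Mor_def add_ac)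

end

section \<open>Opposite extriangulated categories\<close>

text \<open>Formed as a full record, so that the locale of extriangulated categories can be
  interpreted at it. The arguments of \<open>Ext\<close> and \<open>Emap\<close> and the two arrows
  of a realising sequence change places.\<close>

definition opp :: "('o, 'm, 'e, 'z) extri_scheme \<Rightarrow> ('o, 'm, 'e) extri" where
  "opp X = \<lparr>Ob = Ob X, Ar = Ar X, Dom = Cod X, Cod = Dom X, Idn = Idn X,
     Comp = (\<lambda>g f. f \<cdot>\<^bsub>X\<^esub> g), Add = Add X, Zero = (\<lambda>A B. Zero X B A),
     Ext = (\<lambda>D A. Ext X A D), Emap = (\<lambda>d a. Emap X a d),
     Real = (\<lambda>D A \<delta>. {(x, y). (y, x) \<in> Real X A D \<delta>})\<rparr>"

lemma opp_simps [simp]: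
  "Ob (opp X) = Ob X" "Ar (opp X) = Ar X" "Dom (opp X) = Cod X" "Cod (opp X) = Dom X"
  "Idn (opp X) = Idn X" "g \<cdot>\<^bsub>opp X\<^esub> f = f \<cdot>\<^bsub>X\<^esub> g" "f \<boxplus>\<^bsub>opp X\<^esub> g = f \<boxplus>\<^bsub>X\<^esub> g" "Zero (opp X) A B = Zero X B A"
  "Ext (opp X) D A = Ext X A D" "Emap (opp X) d a \<delta> = Emap X a d \<delta>"
  "Mor (opp X) A B = Mor X B A" "Homg (opp X) A B = Homg X B A"
  "(x, y) \<in> Real (opp X) D A \<delta> \<longleftrightarrow> (y, x) \<in> Real X A D \<delta>"
  "Neg (opp X) f = Neg X f"
  by (auto simp: opp_def Mor_def Homg_def Neg_def conj_commute)

lemma opp_derived [simp]: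
  "s_triangle (opp X) A B D x y \<delta> \<longleftrightarrow> s_triangle X D B A y x \<delta>"
  "push (opp X) D a \<delta> = pull X D a \<delta>" "pull (opp X) A d \<delta> = push X A d \<delta>"
  "is_iso (opp X) f A B \<longleftrightarrow> is_iso X f B A"
  "zero_object (opp X) Z \<longleftrightarrow> zero_object X Z"
  "mono_arr (opp X) f \<longleftrightarrow> epi_arr X f" "epi_arr (opp X) f \<longleftrightarrow> mono_arr X f"
  "(x, y) \<in> seqs (opp X) A D \<longleftrightarrow> (y, x) \<in> seqs X D A"
  by (auto simp: s_triangle_def push_def pull_def is_iso_def zero_object_def mono_arr_def
      epi_arr_def seqs_def)

context additive_category
begin

lemma seq_class_sym:
  assumes "(x', y') \<in> seq_class C A D x y" "(x, y) \<in> seqs C A D"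
  shows "(x, y) \<in> seq_class C A D x' y'"
proof -
  obtain b where b: "is_iso C b (Cod C x) (Cod C x')" "b \<cdot> x = x'" "y' \<cdot> b = y"
    and s: "(x', y') \<in> seqs C A D" using assms(1) by (auto simp: seq_class_def)
  obtain c where c: "b \<in> Mor C (Cod C x) (Cod C x')" "c \<in> Mor C (Cod C x') (Cod C x)"
    "c \<cdot> b = Idn C (Cod C x)" "b \<cdot> c = Idn C (Cod C x')" "is_iso C c (Cod C x') (Cod C x)"
    using b(1) by (rule is_isoE)
  have t: "x \<in> Ar C" "Dom C x = A" "y \<in> Ar C" "Dom C y = Cod C x" "Cod C y = D"
     "x' \<in> Ar C" "Dom C x' = A" "y' \<in> Ar C" "Dom C y' = Cod C x'" "Cod C y' = D"
    using s assms(2) by (auto simp: seqs_def Mor_def)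
  have "c \<cdot> x' = (c \<cdot> b) \<cdot> x" using b(2) c(1,2) t by (subst assoc) (auto simp: Mor_def)
  then have 1: "c \<cdot> x' = x" using c t by simp
  have "y \<cdot> c = y' \<cdot> (b \<cdot> c)" using b(3)[symmetric] c(1,2) t by (simp add: Mor_def)
  then have 2: "y \<cdot> c = y'" using c t by simp
  show ?thesis using 1 2 c(5) assms(2) by (auto simp: seq_class_def)
qed

lemma seq_class_refl:
  assumes "(x, y) \<in> seqs C A D" shows "(x, y) \<in> seq_class C A D x y"
proof -
  obtain B where "x \<in> Mor C A B" "y \<in> Mor C B D" using assms by (auto simp: seqs_def)
  then have "is_iso C (Idn C B) (Cod C x) (Cod C x) \<and> Idn C B \<cdot> x = x \<and> y \<cdot> Idn C B = y"
    using Mor_Ob[of x A B] by (auto simp: Mor_def)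
  then show ?thesis using assms by (auto simp: seq_class_def)
qed

end

context extriangulated_category
begin

lemma biproduct_opp [simp]:
  "biproduct (opp X) A B S i j p q \<longleftrightarrow> biproduct X A B S p q i j"
  by (auto simp: biproduct_def)

text \<open>The isomorphism of middle terms points the other way in \<open>opp X\<close>; the
  classes agree because the relation is symmetric.\<close>

lemma seq_class_opp:
  assumes "(x, y) \<in> seqs X A D"
  shows "seq_class (opp X) D A y x = {(y', x'). (x', y') \<in> seq_class X A D x y}"
proof -
  have 1: "(y', x') \<in> seq_class (opp X) D A y x \<longleftrightarrow> (x, y) \<in> seq_class X A D x' y'"
    if "(x', y') \<in> seqs X A D" for x' y'
    using that assms unfolding seq_class_def by (auto simp: seqs_def Mor_def)
  show ?thesis
  proof safe
    fix y' x' assume *: "(y', x') \<in> seq_class (opp X) D A y x"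
    then have s: "(x', y') \<in> seqs X A D" by (auto simp: seq_class_def)
    show "(x', y') \<in> seq_class X A D x y" using 1[OF s] * seq_class_sym[OF _ s] by blast
  next
    fix y' x' assume *: "(x', y') \<in> seq_class X A D x y"
    then have s: "(x', y') \<in> seqs X A D" by (auto simp: seq_class_def)
    show "(y', x') \<in> seq_class (opp X) D A y x" using 1[OF s] * seq_class_sym[OF _ assms] by blast
  qed
qed

lemma additive_opp: "additive_category (opp X)"
proof (rule additive_category.intro)
  show "category (opp X)"
    by unfold_locales (auto simp: Mor_def)
  show "additive_category_axioms (opp X)"
  proof (rule additive_category_axioms.intro, goal_cases)
    case (5 A B) then show ?case using biproduct_exists[of A B] by (simp, metis)
  qed (auto simp: Mor_def hom_group zero_object_exists)
qed

text \<open>The axioms come in dual pairs, such as ET3 and ET4 with their duals and the two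
  additivity laws of \<open>Emap\<close>, or are self-dual up to swapping the factors of a
  biproduct.\<close>

lemma opp: "extriangulated_category (opp X)"
proof -
  have "extriangulated_category_axioms (opp X)"
  proof (rule extriangulated_category_axioms.intro, goal_cases)
    case (1 D A) then show ?case by (simp add: Ext_group)
  next
    case (2 d D' D a A A') then show ?case by (simp add: opp_def Mor_def Emap_hom)
  next
    case (3 D A \<delta>) then show ?case by (simp add: Emap_id)
  next
    case (4 d D' D d' D'' a A A' a' A'' \<delta>) then show ?case by (simp add: Emap_comp)
  next
    case (5 d D' D d' a A A' \<delta>) then show ?case by (simp add: Emap_add_right)
  next
    case (6 d D' D a A A' a' \<delta>) then show ?case by (simp add: Emap_add_left)
  next
    case (7 D A \<delta>)
    then obtain x y where xy: "(x, y) \<in> seqs X D A" "Real X A D \<delta> = seq_class X D A x y"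
      using Real_class[of A D \<delta>] by auto
    have "Real (opp X) D A \<delta> = seq_class (opp X) A D y x"
      unfolding seq_class_opp[OF xy(1)] using xy(2) by (auto simp: opp_def)
    then show ?case using xy(1) by (intro bexI[of _ "(y, x)"]) auto
  next
    case (8 A B D x y \<delta> A' B' D' x' y' \<delta>' a d)
    then obtain b where "b \<in> Mor X B' B" "b \<cdot> y' = y \<cdot> d" "x \<cdot> b = a \<cdot> x'"
      using realization[of D' B' A' y' x' \<delta>' D B A y x \<delta> d a] by auto
    then show ?case by auto
  next
    case (9 A D S i j p q) then show ?case using s_zero[of D A S q p j i] by (auto dest: biproduct_swap)
  next
    case (10 A B D x y \<delta> A' B' D' x' y' \<delta>' SA i i' p p' SB j j' r r' SD k k' q q')
    have t: "x \<in> Ar X" "Cod X x = A" "Dom X x = B" "y \<in> Ar X" "Cod X y = B" "Dom X y = D"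
      "x' \<in> Ar X" "Cod X x' = A'" "Dom X x' = B'" "y' \<in> Ar X" "Cod X y' = B'" "Dom X y' = D'"
      using 10(1,2) by (auto simp: s_triangle_def Mor_def)
    note b = biproductD[OF 10(3)[simplified]] biproductD[OF 10(4)[simplified]] biproductD[OF 10(5)[simplified]]
    have 1: "dsum (opp X) j j' p p' x x' = dsum X p p' j j' x x'"
      "dsum (opp X) k k' r r' y y' = dsum X r r' k k' y y'"
      using t b(1-15) b(21-35) b(41-55) by (simp_all add: dsum_def)
    show ?case using 10 unfolding 1 by (auto intro: s_additive)
  next
    case (11 A B D x y \<delta> A' B' D' x' y' \<delta>' a b)
    then show ?case using ET3op[of D' B' A' y' x' \<delta>' D B A y x \<delta> b a] by force
  next
    case (12 A B D x y \<delta> A' B' D' x' y' \<delta>' b d)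
    then show ?case using ET3[of D' B' A' y' x' \<delta>' D B A y x \<delta> d b] by force
  next
    case (13 A B D f f' \<delta> C F g g' \<delta>')
    then show ?case using ET4op[of D B A f' f \<delta> F C g' g \<delta>'] by simp
  next
    case (14 D B A f' f \<delta> F C g' g \<delta>')
    then show ?case using ET4[of A B D f f' \<delta> C F g g' \<delta>'] by simp
  qed
  then show ?thesis by (intro extriangulated_category.intro additive_opp)
qed

end

section \<open>Exactness in extriangulated categories\<close>

context extriangulated_category
begin

lemma s_triangleD:
  assumes "s_triangle X A B D x y \<delta>"
  shows "A \<in> Ob X" "B \<in> Ob X" "D \<in> Ob X" "x \<in> Ar X" "Dom X x = A" "Cod X x = B"
    "y \<in> Ar X" "Dom X y = B" "Cod X y = D" "\<delta> \<in> carrier (Ext X D A)" "(x, y) \<in> Real X D A \<delta>"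
    "x \<in> Mor X A B" "y \<in> Mor X B D"
  using assms unfolding s_triangle_def by (auto simp: Mor_def)

lemma push_closed [simp]:
  assumes "\<delta> \<in> carrier (Ext X D A)" "D \<in> Ob X" "a \<in> Mor X A A'"
  shows "push X D a \<delta> \<in> carrier (Ext X D A')"
  using Emap_hom[OF id_Mor[OF assms(2)] assms(3)] assms(1) by (auto simp: push_def hom_def)

lemma pull_closed [simp]:
  assumes "\<delta> \<in> carrier (Ext X D A)" "A \<in> Ob X" "d \<in> Mor X D' D"
  shows "pull X A d \<delta> \<in> carrier (Ext X D' A)"
  using Emap_hom[OF assms(3) id_Mor[OF assms(2)]] assms(1) by (auto simp: pull_def hom_def)

lemma Emap_closed [simp]:
  assumes "\<delta> \<in> carrier (Ext X D A)" "d \<in> Mor X D' D" "a \<in> Mor X A A'"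
  shows "Emap X d a \<delta> \<in> carrier (Ext X D' A')"
  using Emap_hom[OF assms(2,3)] assms(1) by (auto simp: hom_def)

lemma one_closed [simp]:
  assumes "D \<in> Ob X" "A \<in> Ob X" shows "\<one>\<^bsub>Ext X D A\<^esub> \<in> carrier (Ext X D A)"
  using Ext_group[OF assms] by (simp add: comm_group_def comm_monoid_def monoid.one_closed)

lemma push_push:
  assumes "\<delta> \<in> carrier (Ext X D A)" "D \<in> Ob X" "a \<in> Mor X A A'" "a' \<in> Mor X A' A''"
  shows "push X D a' (push X D a \<delta>) = push X D (a' \<cdot> a) \<delta>"
  using Emap_comp[of "Idn X D" D D "Idn X D" D a A A' a' A'' \<delta>] assms id_Mor by (simp add: push_def)

lemma pull_pull:
  assumes "\<delta> \<in> carrier (Ext X D A)" "A \<in> Ob X" "d \<in> Mor X D' D" "d' \<in> Mor X D'' D'"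
  shows "pull X A d' (pull X A d \<delta>) = pull X A (d \<cdot> d') \<delta>"
  using Emap_comp[of d D' D d' D'' "Idn X A" A A "Idn X A" A \<delta>] assms id_Mor by (simp add: pull_def)

lemma push_pull:
  assumes "\<delta> \<in> carrier (Ext X D A)" "d \<in> Mor X D' D" "a \<in> Mor X A A'"
  shows "push X D' a (pull X A d \<delta>) = Emap X d a \<delta>"
    "pull X A' d (push X D a \<delta>) = Emap X d a \<delta>"
proof -
  have O: "A \<in> Ob X" "A' \<in> Ob X" "D \<in> Ob X" "D' \<in> Ob X" using assms Mor_Ob by metis+
  have t: "d \<in> Ar X" "Dom X d = D'" "Cod X d = D" "a \<in> Ar X" "Dom X a = A" "Cod X a = A'"
    using assms by (auto simp: Mor_def)
  show "push X D' a (pull X A d \<delta>) = Emap X d a \<delta>"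
    using Emap_comp[of d D' D "Idn X D'" D' "Idn X A" A A a A' \<delta>] assms id_Mor O t
    by (simp add: push_def pull_def)
  show "pull X A' d (push X D a \<delta>) = Emap X d a \<delta>"
    using Emap_comp[of "Idn X D" D D d D' a A A' "Idn X A'" A' \<delta>] assms id_Mor O t
    by (simp add: push_def pull_def)
qed

lemma push_id [simp]:
  "\<delta> \<in> carrier (Ext X D A) \<Longrightarrow> D \<in> Ob X \<Longrightarrow> A \<in> Ob X \<Longrightarrow> push X D (Idn X A) \<delta> = \<delta>"
  by (simp add: push_def Emap_id)

lemma pull_id [simp]:
  "\<delta> \<in> carrier (Ext X D A) \<Longrightarrow> D \<in> Ob X \<Longrightarrow> A \<in> Ob X \<Longrightarrow> pull X A (Idn X D) \<delta> = \<delta>"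
  by (simp add: pull_def Emap_id)

lemma Emap_one:
  assumes "d \<in> Mor X D' D" "a \<in> Mor X A A'"
  shows "Emap X d a \<one>\<^bsub>Ext X D A\<^esub> = \<one>\<^bsub>Ext X D' A'\<^esub>"
proof -
  have O: "A \<in> Ob X" "A' \<in> Ob X" "D \<in> Ob X" "D' \<in> Ob X" using assms Mor_Ob by metis+
  show ?thesis
    using Emap_hom[OF assms] Ext_group[of D A] Ext_group[of D' A'] O
    by (intro group_hom.hom_one group_hom.intro group_hom_axioms.intro) (auto simp: comm_group_def)
qed

lemma push_one [simp]:
  "D \<in> Ob X \<Longrightarrow> a \<in> Mor X A A' \<Longrightarrow> push X D a \<one>\<^bsub>Ext X D A\<^esub> = \<one>\<^bsub>Ext X D A'\<^esub>"
  using Emap_one[of "Idn X D" D D a A A'] id_Mor by (simp add: push_def)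

lemma pull_one [simp]:
  "A \<in> Ob X \<Longrightarrow> d \<in> Mor X D' D \<Longrightarrow> pull X A d \<one>\<^bsub>Ext X D A\<^esub> = \<one>\<^bsub>Ext X D' A\<^esub>"
  using Emap_one[of d D' D "Idn X A" A A] id_Mor by (simp add: pull_def)

lemma tri_exists:
  assumes "\<delta> \<in> carrier (Ext X D A)" "D \<in> Ob X" "A \<in> Ob X"
  shows "\<exists>B x y. s_triangle X A B D x y \<delta>"
proof -
  obtain x y where xy: "(x, y) \<in> seqs X A D" "Real X D A \<delta> = seq_class X A D x y"
    using Real_class[OF assms(2,3,1)] by auto
  then obtain B where B: "x \<in> Mor X A B" "y \<in> Mor X B D" by (auto simp: seqs_def)
  show ?thesis using xy B assms seq_class_refl[OF xy(1)] Mor_Ob[OF B(1)]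
    by (auto simp: s_triangle_def)
qed

lemma tri_Real_class:
  assumes "s_triangle X A B D x y \<delta>"
  shows "Real X D A \<delta> = seq_class X A D x y"
proof -
  note t = s_triangleD[OF assms]
  obtain x0 y0 where xy: "(x0, y0) \<in> seqs X A D" "Real X D A \<delta> = seq_class X A D x0 y0"
    using Real_class t(1,3,10) by blast
  have 1: "(x, y) \<in> seq_class X A D x0 y0" using t xy by auto
  have "seq_class X A D u v \<subseteq> seq_class X A D u' v'"
    if *: "(u, v) \<in> seq_class X A D u' v'" and "(u', v') \<in> seqs X A D" for u v u' v'
  proof safe
    fix f g assume **: "(f, g) \<in> seq_class X A D u v"
    obtain b where b: "is_iso X b (Cod X u') (Cod X u)" "b \<cdot> u' = u" "v \<cdot> b = v'"
      using * by (auto simp: seq_class_def)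
    obtain c where c: "is_iso X c (Cod X u) (Cod X f)" "c \<cdot> u = f" "g \<cdot> c = v"
      using ** by (auto simp: seq_class_def)
    have t: "b \<in> Ar X" "Dom X b = Cod X u'" "Cod X b = Cod X u"
      "c \<in> Ar X" "Dom X c = Cod X u" "Cod X c = Cod X f"
      using b(1) c(1) by (auto simp: is_iso_def Mor_def)
    have s: "(f, g) \<in> seqs X A D" "(u, v) \<in> seqs X A D" using * ** by (auto simp: seq_class_def)
    have u: "u' \<in> Ar X" "g \<in> Ar X" "Dom X g = Cod X f"
      using s that(2) by (auto simp: seqs_def Mor_def)
    have "(c \<cdot> b) \<cdot> u' = c \<cdot> (b \<cdot> u')" by (rule assoc) (use t u in auto)
    moreover have "g \<cdot> (c \<cdot> b) = (g \<cdot> c) \<cdot> b" by (rule assoc[symmetric]) (use t u in auto)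
    ultimately have "(c \<cdot> b) \<cdot> u' = f" "g \<cdot> (c \<cdot> b) = v'"
      by (simp_all only: b c)
    then show "(f, g) \<in> seq_class X A D u' v'"
      using is_iso_comp[OF b(1) c(1)] s by (auto simp: seq_class_def)
  qed
  moreover have "(x, y) \<in> seqs X A D" using t by (auto simp: seqs_def)
  ultimately show ?thesis using xy 1 seq_class_sym[OF 1 xy(1)] by blast
qed

lemma tri_iso_middle:
  assumes "s_triangle X A B D x y \<delta>" "is_iso X b B B'" "b \<cdot> x = x'" "y' \<cdot> b = y" "y' \<in> Mor X B' D"
  shows "s_triangle X A B' D x' y' \<delta>"
proof -
  note t = s_triangleD[OF assms(1)]
  have b: "b \<in> Mor X B B'" using assms(2) by (simp add: is_iso_def)
  then have B': "B' \<in> Ob X" using Mor_Ob by metis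
  have x': "x' \<in> Mor X A B'" using assms(3) b t by (auto simp: Mor_def)
  then have "(x', y') \<in> seq_class X A D x y" using assms t by (auto simp: seq_class_def seqs_def Mor_def)
  then show ?thesis using tri_Real_class[OF assms(1)] t x' b B' assms(5) by (auto simp: s_triangle_def)
qed

lemma tri_id_left:
  assumes "A \<in> Ob X" "zero_object X Z"
  shows "s_triangle X A A Z (Idn X A) (Zero X A Z) \<one>\<^bsub>Ext X Z A\<^esub>"
  by (rule s_zero[OF biproduct_zero_right[OF assms]])

text \<open>ET3 compares the triangle with \<open>A \<rightarrow> A \<rightarrow> 0\<close>; the
  resulting map of cones makes \<open>y \<cdot> x\<close> factor through zero.\<close>

lemma tri_comp_zero:
  assumes "s_triangle X A B D x y \<delta>"
  shows "y \<cdot> x = Zero X A D"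
proof -
  note t = s_triangleD[OF assms]
  obtain Z where Z: "zero_object X Z" using zero_object_exists by auto
  obtain d where d: "d \<in> Mor X Z D" "d \<cdot> Zero X A Z = y \<cdot> x"
    using ET3[OF tri_id_left[OF t(1) Z] assms, of "Idn X A" x] t by (auto simp: Mor_def)
  then show ?thesis using t zero_object_id[OF Z] by (auto simp: Mor_def)
qed

text \<open>The dual of ET3, applied to a morphism from
  \<open>W \<rightarrow> W \<rightarrow> 0\<close>. The factor is unique only when \<open>x\<close>
  is monic.\<close>

lemma tri_factor_left:
  assumes "s_triangle X A B D x y \<delta>" "f \<in> Mor X W B" "y \<cdot> f = Zero X W D"
  shows "\<exists>g \<in> Mor X W A. x \<cdot> g = f"
proof -
  note t = s_triangleD[OF assms(1)]
  obtain Z where Z: "zero_object X Z" using zero_object_exists by auto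
  have O: "W \<in> Ob X" "Z \<in> Ob X" using Mor_Ob[OF assms(2)] zero_object_id[OF Z] by auto
  have "\<exists>a\<in>Mor X W A. f \<cdot> Idn X W = x \<cdot> a \<and>
      push X Z a \<one>\<^bsub>Ext X Z W\<^esub> = pull X A (Zero X Z D) \<delta>"
    by (rule ET3op[OF tri_id_left[OF O(1) Z] assms(1)]) (use assms O t in \<open>auto simp: Mor_def\<close>)
  then show ?thesis using assms(2) by (auto simp: Mor_def)
qed

lemma tri_factor_right:
  assumes "s_triangle X A B D x y \<delta>" "f \<in> Mor X B W" "f \<cdot> x = Zero X A W"
  shows "\<exists>g \<in> Mor X D W. g \<cdot> y = f"
proof -
  interpret O: extriangulated_category "opp X" by (rule opp)
  show ?thesis using O.tri_factor_left[of D B A y x \<delta> f W] assms by simp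
qed

text \<open>The map \<open>(1, y)\<close> from \<open>B\<close> to \<open>B \<oplus> D\<close>
  extends \<open>x\<close> to a morphism into the split triangle
  \<open>B \<rightarrow> B \<oplus> D \<rightarrow> D\<close>. ET3 then presents the pushed class as
  a pullback of the zero class.\<close>

lemma tri_push_infl:
  assumes "s_triangle X A B D x y \<delta>"
  shows "push X D x \<delta> = \<one>\<^bsub>Ext X D B\<^esub>"
proof -
  note t = s_triangleD[OF assms]
  obtain S i j p q where b: "biproduct X B D S i j p q" using biproduct_exists t by blast
  note bD = biproductD[OF b] biproduct_reassoc[OF b]
  have z: "y \<cdot> x = Zero X A D" by (rule tri_comp_zero[OF assms])
  have "\<exists>d\<in>Mor X D D. d \<cdot> y = q \<cdot> (i \<boxplus> (j \<cdot> y)) \<and> push X D x \<delta> = pull X B d \<one>\<^bsub>Ext X D B\<^esub>"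
    by (rule ET3[OF assms s_zero[OF b]]) (use t bD z in \<open>auto simp: Mor_def\<close>)
  then show ?thesis using t by auto
qed

lemma tri_pull_defl:
  assumes "s_triangle X A B D x y \<delta>"
  shows "pull X A y \<delta> = \<one>\<^bsub>Ext X B A\<^esub>"
proof -
  interpret O: extriangulated_category "opp X" by (rule opp)
  show ?thesis using O.tri_push_infl[of D B A y x \<delta>] assms by simp
qed

text \<open>If \<open>f\<close> pulls the class to zero, the split triangle
  \<open>A \<rightarrow> A \<oplus> W \<rightarrow> W\<close> maps to the given one over
  \<open>f\<close>; the lift is the restriction to \<open>W\<close>.\<close>

lemma tri_lift:
  assumes "s_triangle X A B D x y \<delta>" "f \<in> Mor X W D" "pull X A f \<delta> = \<one>\<^bsub>Ext X W A\<^esub>"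
  shows "\<exists>g \<in> Mor X W B. y \<cdot> g = f"
proof -
  note t = s_triangleD[OF assms(1)]
  have W: "W \<in> Ob X" using Mor_Ob[OF assms(2)] by auto
  obtain S i j p q where b: "biproduct X A W S i j p q" using biproduct_exists t W by blast
  note bD = biproductD[OF b] biproduct_reassoc[OF b]
  have "\<exists>h\<in>Mor X S B. h \<cdot> i = x \<cdot> Idn X A \<and> y \<cdot> h = f \<cdot> q"
    by (rule realization[OF s_zero[OF b] assms(1)]) (use assms t bD W in \<open>auto simp: Mor_def\<close>)
  then obtain h where h: "h \<in> Mor X S B" "y \<cdot> h = f \<cdot> q" by auto
  then have "y \<cdot> (h \<cdot> j) = f"
    using t bD assms(2) reassoc2[OF h(2), of j] by (auto simp: Mor_def)
  then show ?thesis using h bD by (intro bexI[of _ "h \<cdot> j"]) (auto simp: Mor_def)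
qed

text \<open>\<open>n\<close> factors as \<open>x \<cdot> g\<close> and kills \<open>x\<close>. This
  supplies the nilpotent differences for \<open>iso_of_unipotent\<close>.\<close>

lemma tri_endo_square_zero:
  assumes "s_triangle X A B D x y \<delta>" "n \<in> Mor X B B" "n \<cdot> x = Zero X A B" "y \<cdot> n = Zero X B D"
  shows "n \<cdot> n = Zero X B B"
proof -
  note t = s_triangleD[OF assms(1)]
  obtain g where g: "g \<in> Mor X B A" "x \<cdot> g = n" using tri_factor_left[OF assms(1,2,4)] by auto
  have "n \<cdot> n = (n \<cdot> x) \<cdot> g" using g assms(2) t by (auto simp: Mor_def)
  also have "\<dots> = Zero X B B" using assms(2,3) g t by (simp add: Mor_def)
  finally show ?thesis .
qed

text \<open>Realization gives a map back over the inverses of \<open>a\<close> and \<open>d\<close>.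
  Each composite differs from the identity by an endomorphism that kills the inflation and is killed
  by the deflation, hence has square zero.\<close>

lemma five_lemma:
  assumes T: "s_triangle X A B D x y \<delta>" "s_triangle X A' B' D' x' y' \<delta>'"
    and a: "is_iso X a A A'" and d: "is_iso X d D D'" and b: "b \<in> Mor X B B'"
    and e: "b \<cdot> x = x' \<cdot> a" "y' \<cdot> b = d \<cdot> y" "push X D a \<delta> = pull X A' d \<delta>'"
  shows "is_iso X b B B'"
proof -
  note t = s_triangleD[OF T(1)] s_triangleD[OF T(2)]
  obtain a' where a': "a \<in> Mor X A A'" "a' \<in> Mor X A' A" "a' \<cdot> a = Idn X A" "a \<cdot> a' = Idn X A'"
    using a by (rule is_isoE)
  obtain d' where d': "d \<in> Mor X D D'" "d' \<in> Mor X D' D" "d' \<cdot> d = Idn X D" "d \<cdot> d' = Idn X D'"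
    using d by (rule is_isoE)
  \<comment> \<open>The inverses of the ends must satisfy the mirrored compatibility of classes
    before realization applies to them.\<close>
  have "push X D' a' \<delta>' = push X D' a' (pull X A' d' (pull X A' d \<delta>'))"
    using t d' by (simp add: pull_pull)
  also have "\<dots> = push X D' a' (pull X A' d' (push X D a \<delta>))" by (simp add: e(3))
  also have "\<dots> = push X D' a' (push X D' a (pull X A d' \<delta>))"
    using t d' a' push_pull[of \<delta> D A d' D' a A'] by simp
  also have "\<dots> = pull X A d' \<delta>" using t d' a' by (subst push_push) auto
  finally have eq: "push X D' a' \<delta>' = pull X A d' \<delta>" .
  obtain b' where b': "b' \<in> Mor X B' B" "b' \<cdot> x' = x \<cdot> a'" "y \<cdot> b' = d' \<cdot> y'"
    using realization[OF T(2,1) a'(2) d'(2) eq] by auto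
  have ty: "b \<in> Ar X" "Dom X b = B" "Cod X b = B'" "b' \<in> Ar X" "Dom X b' = B'" "Cod X b' = B"
    "a \<in> Ar X" "Dom X a = A" "Cod X a = A'" "a' \<in> Ar X" "Dom X a' = A'" "Cod X a' = A"
    "d \<in> Ar X" "Dom X d = D" "Cod X d = D'" "d' \<in> Ar X" "Dom X d' = D'" "Cod X d' = D"
    using b b'(1) a'(1,2) d'(1,2) by (simp_all add: Mor_def)
  note T' = t(1-9) t(14-22)
  have 1: "(b' \<cdot> b) \<cdot> x = x"
  proof -
    have "(b' \<cdot> b) \<cdot> x = b' \<cdot> (b \<cdot> x)" using ty T' by simp
    also have "\<dots> = (b' \<cdot> x') \<cdot> a" unfolding e(1) using ty T' by simp
    also have "\<dots> = x \<cdot> (a' \<cdot> a)" unfolding b'(2) using ty T' by simp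
    also have "\<dots> = x" unfolding a'(3) using T' by simp
    finally show ?thesis .
  qed
  have 2: "y \<cdot> (b' \<cdot> b) = y"
  proof -
    have "y \<cdot> (b' \<cdot> b) = (y \<cdot> b') \<cdot> b" using ty T' by simp
    also have "\<dots> = d' \<cdot> (y' \<cdot> b)" unfolding b'(3) using ty T' by simp
    also have "\<dots> = (d' \<cdot> d) \<cdot> y" unfolding e(2) using ty T' by simp
    also have "\<dots> = y" unfolding d'(3) using T' by simp
    finally show ?thesis .
  qed
  have 3: "(b \<cdot> b') \<cdot> x' = x'"
  proof -
    have "(b \<cdot> b') \<cdot> x' = b \<cdot> (b' \<cdot> x')" using ty T' by simp
    also have "\<dots> = (b \<cdot> x) \<cdot> a'" unfolding b'(2) using ty T' by simp
    also have "\<dots> = x' \<cdot> (a \<cdot> a')" unfolding e(1) using ty T' by simp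
    also have "\<dots> = x'" unfolding a'(4) using T' by simp
    finally show ?thesis .
  qed
  have 4: "y' \<cdot> (b \<cdot> b') = y'"
  proof -
    have "y' \<cdot> (b \<cdot> b') = (y' \<cdot> b) \<cdot> b'" using ty T' by simp
    also have "\<dots> = d \<cdot> (y \<cdot> b')" unfolding e(2) using ty T' by simp
    also have "\<dots> = (d \<cdot> d') \<cdot> y'" unfolding b'(3) using ty T' by simp
    also have "\<dots> = y'" unfolding d'(4) using T' by simp
    finally show ?thesis .
  qed
  show ?thesis
  proof (rule iso_of_unipotent[OF b b'(1)])
    show "((b' \<cdot> b) \<boxplus> Neg X (Idn X B)) \<cdot> ((b' \<cdot> b) \<boxplus> Neg X (Idn X B)) = Zero X B B"
      by (rule tri_endo_square_zero[OF T(1)])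
        (use 1 2 ty T' in \<open>simp_all add: Mor_def\<close>)
    show "((b \<cdot> b') \<boxplus> Neg X (Idn X B')) \<cdot> ((b \<cdot> b') \<boxplus> Neg X (Idn X B')) = Zero X B' B'"
      by (rule tri_endo_square_zero[OF T(2)])
        (use 3 4 ty T' in \<open>simp_all add: Mor_def\<close>)
  qed
qed

lemma tri_unique:
  assumes T: "s_triangle X A B D x y \<delta>" "s_triangle X A B' D x' y' \<delta>"
  shows "\<exists>b. is_iso X b B B' \<and> b \<cdot> x = x' \<and> y' \<cdot> b = y"
proof -
  note t = s_triangleD[OF T(1)] s_triangleD[OF T(2)]
  have "\<exists>b\<in>Mor X B B'. b \<cdot> x = x' \<cdot> Idn X A \<and> y' \<cdot> b = Idn X D \<cdot> y"
    by (rule realization[OF T]) (use t in \<open>auto simp: Mor_def\<close>)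
  then obtain b where b: "b\<in>Mor X B B'" "b \<cdot> x = x' \<cdot> Idn X A" "y' \<cdot> b = Idn X D \<cdot> y" by auto
  have "is_iso X b B B'"
    by (rule five_lemma[OF T is_iso_id is_iso_id b]) (use t in auto)
  then show ?thesis using b t by auto
qed

text \<open>\<open>Real\<close> is closed under isomorphisms of middle terms that fix the ends. So
  \<open>\<delta>'\<close> is first realised separately, and its middle term is then carried to
  \<open>B'\<close> through \<open>B\<close>.\<close>

lemma tri_iso:
  assumes T: "s_triangle X A B D x y \<delta>"
    and i: "is_iso X a A A'" "is_iso X b B B'" "is_iso X d D D'"
    and m: "x' \<in> Mor X A' B'" "y' \<in> Mor X B' D'" "\<delta>' \<in> carrier (Ext X D' A')"
    and e: "b \<cdot> x = x' \<cdot> a" "d \<cdot> y = y' \<cdot> b" "push X D a \<delta> = pull X A' d \<delta>'"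
  shows "s_triangle X A' B' D' x' y' \<delta>'"
proof -
  have M: "a \<in> Mor X A A'" "b \<in> Mor X B B'" "d \<in> Mor X D D'" using i by (auto simp: is_iso_def)
  have O: "A' \<in> Ob X" "D' \<in> Ob X" "B' \<in> Ob X" using Mor_Ob M by metis+
  note t = s_triangleD[OF T]
  obtain B0 x0 y0 where T0: "s_triangle X A' B0 D' x0 y0 \<delta>'" using tri_exists[OF m(3) O(2,1)] by auto
  note t0 = s_triangleD[OF T0]
  obtain b0 where b0: "b0 \<in> Mor X B B0" "b0 \<cdot> x = x0 \<cdot> a" "y0 \<cdot> b0 = d \<cdot> y"
    using realization[OF T T0 M(1,3) e(3)] by auto
  have i0: "is_iso X b0 B B0" by (rule five_lemma[OF T T0 i(1,3) b0 e(3)])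
  obtain c where c: "c \<in> Mor X B0 B" "c \<cdot> b0 = Idn X B" "b0 \<cdot> c = Idn X B0" "is_iso X c B0 B"
    using i0 by (rule is_isoE)
  obtain a' where a': "a' \<in> Mor X A' A" "a' \<cdot> a = Idn X A" "a \<cdot> a' = Idn X A'"
    using i(1) by (rule is_isoE)
  have "c \<cdot> x0 = c \<cdot> (x0 \<cdot> a) \<cdot> a'" using c a' M t0 by (simp add: Mor_def)
  also have "\<dots> = c \<cdot> (b0 \<cdot> x) \<cdot> a'" by (simp add: b0)
  also have "\<dots> = x \<cdot> a'" using c b0(1) t a' reassoc[OF c(2), of "x \<cdot> a'"] by (simp add: Mor_def)
  finally have 1: "c \<cdot> x0 = x \<cdot> a'" .
  have "(b \<cdot> c) \<cdot> x0 = b \<cdot> x \<cdot> a'" using M c t0 1 by (simp add: Mor_def)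
  also have "\<dots> = (x' \<cdot> a) \<cdot> a'" using M t a' e(1)[symmetric] by (simp add: Mor_def)
  also have "\<dots> = x'" using M a' m by (simp add: Mor_def)
  finally have 2: "(b \<cdot> c) \<cdot> x0 = x'" .
  have "y' \<cdot> (b \<cdot> c) = (d \<cdot> y) \<cdot> c" unfolding e(2) using M m c by (simp add: Mor_def)
  also have "\<dots> = y0 \<cdot> (b0 \<cdot> c)" unfolding b0(3)[symmetric] using b0(1) t0 c(1) by (simp add: Mor_def)
  also have "\<dots> = y0" using c t0 by simp
  finally have 3: "y' \<cdot> (b \<cdot> c) = y0" .
  show ?thesis by (rule tri_iso_middle[OF T0 is_iso_comp[OF c(4) i(2)] 2 3 m(2)])
qed

text \<open>ET3 gives comparison maps in both directions that respect the deflations and the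
  classes. So \<open>c' c - 1\<close> kills \<open>y\<close> and pulls \<open>\<delta>\<close> to
  zero; by the second fact it factors as \<open>y \<cdot> g\<close>, and its square
  vanishes.\<close>

lemma cone_unique:
  assumes T: "s_triangle X A B D x y \<delta>" "s_triangle X A B D' x y' \<delta>'"
  shows "\<exists>c. is_iso X c D D' \<and> c \<cdot> y = y' \<and> \<delta> = pull X A c \<delta>'"
proof -
  have *: "\<exists>c\<in>Mor X D D'. c \<cdot> y = y' \<and> \<delta> = pull X A c \<delta>'"
    if T: "s_triangle X A B D x y \<delta>" "s_triangle X A B D' x y' \<delta>'" for y y' D D' \<delta> \<delta>'
  proof -
    note t = s_triangleD[OF T(1)] s_triangleD[OF T(2)]
    have "\<exists>c\<in>Mor X D D'. c \<cdot> y = y' \<cdot> Idn X B \<and> push X D (Idn X A) \<delta> = pull X A c \<delta>'"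
      by (rule ET3[OF T]) (use t in \<open>auto simp: Mor_def\<close>)
    then show ?thesis using t by auto
  qed
  have sq: "((c' \<cdot> c) \<boxplus> Neg X (Idn X D)) \<cdot> ((c' \<cdot> c) \<boxplus> Neg X (Idn X D)) = Zero X D D" (is "?n \<cdot> ?n = _")
    if T: "s_triangle X A B D x y \<delta>" "s_triangle X A B D' x y' \<delta>'"
    and c: "c \<in> Mor X D D'" "c \<cdot> y = y'" "\<delta> = pull X A c \<delta>'"
    and c': "c' \<in> Mor X D' D" "c' \<cdot> y' = y" "\<delta>' = pull X A c' \<delta>" for y y' D D' \<delta> \<delta>' c c'
  proof -
    note t = s_triangleD[OF T(1)] s_triangleD[OF T(2)]
    have ty: "c \<in> Ar X" "Dom X c = D" "Cod X c = D'" "c' \<in> Ar X" "Dom X c' = D'" "Cod X c' = D"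
      using c(1) c'(1) by (simp_all add: Mor_def)
    note T' = t(1-9) t(14-22)
    have "(c' \<cdot> c) \<cdot> y = c' \<cdot> (c \<cdot> y)" using ty T' by simp
    also have "\<dots> = y" by (simp only: c c')
    finally have cy: "(c' \<cdot> c) \<cdot> y = y" .
    have n: "?n \<in> Mor X D D" using ty T' by (simp add: Mor_def)
    have "?n \<cdot> y = ((c' \<cdot> c) \<cdot> y) \<boxplus> Neg X y" using ty T' by simp
    then have ny: "?n \<cdot> y = Zero X B D" unfolding cy using T' by simp
    have "pull X A (c' \<cdot> c) \<delta> = pull X A c (pull X A c' \<delta>)"
      using t c(1) c'(1) by (intro pull_pull[symmetric]) auto
    then have p: "pull X A (c' \<cdot> c) \<delta> = \<delta>" using c(3) c'(3) by metis
    have G: "comm_group (Ext X D A)" using Ext_group t by auto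
    interpret G: comm_group "Ext X D A" by (rule G)
    have idD: "Idn X D \<in> Mor X D D" "Neg X (Idn X D) \<in> Mor X D D" "Idn X A \<in> Mor X A A"
      "Zero X D D \<in> Mor X D D" "c' \<cdot> c \<in> Mor X D D"
      using ty T' by (simp_all add: Mor_def)
    have "pull X A (Zero X D D \<boxplus> Zero X D D) \<delta> = pull X A (Zero X D D) \<delta> \<otimes>\<^bsub>Ext X D A\<^esub> pull X A (Zero X D D) \<delta>"
      unfolding pull_def by (rule Emap_add_left[OF idD(4,4,3) t(10)])
    then have z: "pull X A (Zero X D D) \<delta> = \<one>\<^bsub>Ext X D A\<^esub>"
      using T' G.l_cancel_one pull_closed[OF t(10,1) idD(4)] by simp
    have "pull X A (Idn X D \<boxplus> Neg X (Idn X D)) \<delta> = \<delta> \<otimes>\<^bsub>Ext X D A\<^esub> pull X A (Neg X (Idn X D)) \<delta>"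
      unfolding pull_def Emap_add_left[OF idD(1,2,3) t(10)] using t by (simp add: Emap_id)
    also have "\<dots> = pull X A ?n \<delta>"
      unfolding pull_def Emap_add_left[OF idD(5,2,3) t(10)] using p by (simp add: pull_def)
    finally have "pull X A ?n \<delta> = \<one>\<^bsub>Ext X D A\<^esub>" using z T' by simp
    then obtain g where g: "g \<in> Mor X D B" "y \<cdot> g = ?n" using tri_lift[OF T(1) n] by auto
    have "?n \<cdot> ?n = ?n \<cdot> (y \<cdot> g)" by (simp only: g(2))
    also have "\<dots> = (?n \<cdot> y) \<cdot> g" by (rule assoc[symmetric]) (use n g t in \<open>auto simp: Mor_def\<close>)
    also have "\<dots> = Zero X D D" unfolding ny using g T' by (simp add: Mor_def)
    finally show ?thesis .
  qed
  obtain c where c: "c \<in> Mor X D D'" "c \<cdot> y = y'" "\<delta> = pull X A c \<delta>'" using *[OF T] by auto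
  obtain c' where c': "c' \<in> Mor X D' D" "c' \<cdot> y' = y" "\<delta>' = pull X A c' \<delta>" using *[OF T(2,1)] by auto
  have "is_iso X c D D'"
    by (rule iso_of_unipotent[OF c(1) c'(1) sq[OF T c c'] sq[OF T(2,1) c' c]])
  then show ?thesis using c by auto
qed

end

section \<open>Homotopy pushouts and pullbacks\<close>

context extriangulated_category
begin

text \<open>The inflation \<open>(x, -a)\<close> is the composite of the graph of \<open>-a\<close>, which is a split inflation
  \<open>A \<rightarrow> A \<oplus> A'\<close>, and of \<open>x \<oplus> 1\<close>; ET4 for this composite gives both triangles.\<close>

lemma homotopy_pushout:
  assumes T: "s_triangle X A B D x y \<delta>" and a: "a \<in> Mor X A A'"
    and T': "s_triangle X A' B' D x' y' (push X D a \<delta>)" and bB: "biproduct X B A' S j j' r r'"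
  shows "\<exists>b \<in> Mor X B B'. b \<cdot> x = x' \<cdot> a \<and> y' \<cdot> b = y \<and>
    s_triangle X A S B' ((j \<cdot> x) \<boxplus> Neg X (j' \<cdot> a)) ((b \<cdot> r) \<boxplus> (x' \<cdot> r')) (pull X A y' \<delta>)"
proof -
  note t = s_triangleD[OF T] and t' = s_triangleD[OF T']
  have ta: "a \<in> Ar X" "Dom X a = A" "Cod X a = A'" using a by (auto simp: Mor_def)
  note ty = t(1-9) t'(1-9) ta
  obtain SA i i' p p' where bA: "biproduct X A A' SA i i' p p'" using biproduct_exists ty by blast
  obtain Z where Z: "zero_object X Z" using zero_object_exists by auto
  have ZO: "Z \<in> Ob X" using zero_object_id[OF Z] by auto
  note BA = biproductD[OF bA] biproduct_reassoc[OF bA]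
  note BB = biproductD[OF bB] biproduct_reassoc[OF bB]
  note tyB = BA(1-15) BB(1-15)
  define f where "f = i \<boxplus> (i' \<cdot> Neg X a)"
  define f' where "f' = p' \<boxplus> Neg X (Neg X a \<cdot> p)"
  define g where "g = dsum X j j' p p' x (Idn X A')"
  have tf: "f \<in> Ar X" "Dom X f = A" "Cod X f = SA" "f' \<in> Ar X" "Dom X f' = SA" "Cod X f' = A'"
    "g \<in> Ar X" "Dom X g = SA" "Cod X g = S"
    using ty tyB by (simp_all add: f_def f'_def g_def dsum_def)
  have bf0: "biproduct X A A' SA f i' p f'"
    unfolding f_def f'_def by (rule biproduct_graph[OF bA]) (use ty in \<open>simp add: Mor_def\<close>)
  have F: "s_triangle X A SA A' f f' \<one>\<^bsub>Ext X A' A\<^esub>" by (rule s_zero[OF bf0])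
  note bf = biproductD(16,17)[OF bf0]
  \<comment> \<open>The direct sum of the given triangle with
    \<open>A' \<rightarrow> A' \<rightarrow> 0\<close>; its class \<open>\<delta> \<oplus> 0\<close>
    is \<open>\<delta>\<close> pushed along \<open>i\<close>.\<close>
  have "s_triangle X SA S D g (dsum X (Idn X D) (Zero X Z D) r r' y (Zero X A' Z))
      (Emap X (Idn X D) i \<delta> \<otimes>\<^bsub>Ext X D SA\<^esub> Emap X (Zero X D Z) i' \<one>\<^bsub>Ext X Z A'\<^esub>)"
    unfolding g_def
    by (rule s_additive[OF T tri_id_left[OF _ Z] bA bB biproduct_zero_right[OF _ Z]]) (use ty in auto)
  moreover have "dsum X (Idn X D) (Zero X Z D) r r' y (Zero X A' Z) = y \<cdot> r"
    using ty tyB ZO by (simp add: dsum_def)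
  moreover have "Emap X (Idn X D) i \<delta> \<otimes>\<^bsub>Ext X D SA\<^esub> Emap X (Zero X D Z) i' \<one>\<^bsub>Ext X Z A'\<^esub> = push X D i \<delta>"
  proof -
    have 1: "Emap X (Zero X D Z) i' \<one>\<^bsub>Ext X Z A'\<^esub> = \<one>\<^bsub>Ext X D SA\<^esub>"
      by (rule Emap_one) (use ty tyB ZO in \<open>auto simp: Mor_def\<close>)
    have G: "comm_group (Ext X D SA)" using Ext_group ty tyB by auto
    interpret G: comm_group "Ext X D SA" by (rule G)
    have "push X D i \<delta> \<in> carrier (Ext X D SA)" using t tyB by (intro push_closed) (auto simp: Mor_def)
    then show ?thesis unfolding 1 by (simp add: push_def)
  qed
  ultimately have G: "s_triangle X SA S D g (y \<cdot> r) (push X D i \<delta>)" by simp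
  obtain E h' d e \<delta>'' where E: "s_triangle X A S E (g \<cdot> f) h' \<delta>''"
      "s_triangle X A' E D d e (push X D f' (push X D i \<delta>))"
      "d \<cdot> f' = h' \<cdot> g" "e \<cdot> h' = y \<cdot> r" "pull X A d \<delta>'' = \<one>\<^bsub>Ext X A' A\<^esub>"
      "push X E f \<delta>'' = pull X SA e (push X D i \<delta>)"
    using ET4[OF F G] by auto
  note tE = s_triangleD[OF E(1)] s_triangleD[OF E(2)]
  note tyE = tE(1-9) tE(14-22)
  have fi: "f' \<cdot> i = a" unfolding f'_def using ty BA by simp
  have gf: "g \<cdot> f = (j \<cdot> x) \<boxplus> Neg X (j' \<cdot> a)"
    unfolding g_def f_def dsum_def using ty BA BB(1-15) by simp
  have gi: "g \<cdot> i' = j'" unfolding g_def dsum_def using ty BA BB(1-15) by simp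
  have "push X D f' (push X D i \<delta>) = push X D (f' \<cdot> i) \<delta>"
    by (rule push_push) (use t tyB tf in \<open>auto simp: Mor_def\<close>)
  then have pp: "push X D f' (push X D i \<delta>) = push X D a \<delta>" unfolding fi .
  have E2: "s_triangle X A' E D d e (push X D a \<delta>)" using E(2) unfolding pp .
  have d: "d = h' \<cdot> j'"
  proof -
    have "d = d \<cdot> (f' \<cdot> i')" using tyE bf by simp
    also have "\<dots> = (d \<cdot> f') \<cdot> i'" using tyE tf tyB by simp
    also have "\<dots> = h' \<cdot> (g \<cdot> i')" unfolding E(3) using tyE tf tyB by simp
    finally show ?thesis unfolding gi .
  qed
  \<comment> \<open>\<open>p\<close> is a retraction of \<open>f\<close>, so the class of the
    composite is recovered by pushing the last equation of ET4 along \<open>p\<close>.\<close>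
  have dd: "\<delta>'' = pull X A e \<delta>"
  proof -
    have pM: "p \<in> Mor X SA A" "f \<in> Mor X A SA" "i \<in> Mor X A SA" "e \<in> Mor X E D"
      using tyB tf tyE by (simp_all add: Mor_def)
    have "\<delta>'' = push X E (p \<cdot> f) \<delta>''" unfolding bf using tE by simp
    also have "\<dots> = push X E p (push X E f \<delta>'')" by (rule push_push[symmetric]) (use tE pM in auto)
    also have "\<dots> = push X E p (pull X SA e (push X D i \<delta>))" unfolding E(6) ..
    also have "\<dots> = pull X A e (push X D p (push X D i \<delta>))"
      using push_pull[of "push X D i \<delta>" D SA e E p A] pM t by simp
    also have "push X D p (push X D i \<delta>) = \<delta>"
      using push_push[OF t(10,3) pM(3,1)] BA(16) t by simp
    finally show ?thesis .
  qed
  \<comment> \<open>The second triangle of ET4 and the given one over \<open>A'\<close> realise the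
    same class, so their middle terms may be identified.\<close>
  obtain c where c: "is_iso X c E B'" "c \<cdot> d = x'" "y' \<cdot> c = e"
    using tri_unique[OF E2 T'] by auto
  have tc: "c \<in> Ar X" "Dom X c = E" "Cod X c = B'" "c \<in> Mor X E B'" using c(1) by (auto simp: is_iso_def Mor_def)
  define b where "b = c \<cdot> h' \<cdot> j"
  have tb: "b \<in> Ar X" "Dom X b = B" "Cod X b = B'" using tc tyE tyB by (simp_all add: b_def)
  have ch: "c \<cdot> h' = (b \<cdot> r) \<boxplus> (x' \<cdot> r')"
  proof (rule biproduct_ext_left[OF bB])
    show "(c \<cdot> h') \<cdot> j' = ((b \<cdot> r) \<boxplus> (x' \<cdot> r')) \<cdot> j'"
      unfolding b_def c(2)[symmetric] d using tc tyE ty BB by simp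
  qed (use tb tc tyE ty BB b_def in \<open>simp_all add: Mor_def\<close>)
  have z: "h' \<cdot> (g \<cdot> f) = Zero X A E" by (rule tri_comp_zero[OF E(1)])
  have bx: "b \<cdot> x = x' \<cdot> a"
  proof -
    have "h' \<cdot> j \<cdot> x \<boxplus> Neg X (h' \<cdot> j' \<cdot> a) = Zero X A E"
      using z unfolding gf using tyE tyB ty by simp
    then have 1: "h' \<cdot> j \<cdot> x = h' \<cdot> j' \<cdot> a"
      by (subst eq_iff_diff_zero[of _ A E]) (use tyE tyB ty in \<open>auto simp: Mor_def\<close>)
    have "b \<cdot> x = c \<cdot> (h' \<cdot> j \<cdot> x)" using tc tyE tyB ty by (simp add: b_def)
    also have "\<dots> = (c \<cdot> (h' \<cdot> j')) \<cdot> a" unfolding 1 using tc tyE tyB ty by simp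
    finally show ?thesis using c(2) d by simp
  qed
  have yb: "y' \<cdot> b = y"
  proof -
    have "y' \<cdot> b = (y' \<cdot> c) \<cdot> (h' \<cdot> j)" using tc tyE tyB ty by (simp add: b_def)
    also have "\<dots> = (e \<cdot> h') \<cdot> j" unfolding c(3) using tyE tyB by simp
    also have "\<dots> = y" unfolding E(4) using ty BB by simp
    finally show ?thesis .
  qed
  have "s_triangle X A S B' (g \<cdot> f) (c \<cdot> h') (pull X A y' \<delta>)"
  proof (rule tri_iso[OF E(1) is_iso_id is_iso_id c(1)])
    show "push X E (Idn X A) \<delta>'' = pull X A c (pull X A y' \<delta>)"
      using pull_pull[of \<delta> D A y' B' c E] t t' tc(4) c(3) dd tE by simp
  qed (use tc tyE ty tyB tf t t' in \<open>simp_all add: Mor_def\<close>)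
  then show ?thesis using bx yb tb unfolding gf ch by (auto simp: Mor_def)
qed

lemma homotopy_pullback:
  assumes T: "s_triangle X A B D x y \<delta>" and d: "d \<in> Mor X D' D"
    and T': "s_triangle X A B' D' x' y' (pull X A d \<delta>)" and bB: "biproduct X B D' S j j' r r'"
  shows "\<exists>b \<in> Mor X B' B. y \<cdot> b = d \<cdot> y' \<and> b \<cdot> x' = x \<and>
    s_triangle X B' S D ((j \<cdot> b) \<boxplus> (j' \<cdot> y')) ((y \<cdot> r) \<boxplus> Neg X (d \<cdot> r')) (push X D x' \<delta>)"
proof -
  interpret O: extriangulated_category "opp X" by (rule opp)
  show ?thesis
    using O.homotopy_pushout[of D B A y x \<delta> d D' B' y' x' S r r' j j'] assms by simp
qed

text \<open>The homotopy pullback triangle makes the square a weak pullback: a compatible pair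
  \<open>(u, v)\<close> is a map into \<open>B \<oplus> D'\<close> killed by \<open>(y, -d)\<close>.
  Uniqueness of \<open>w\<close> is not claimed and has to wait for monic inflations.\<close>

lemma pullback_ex:
  assumes T: "s_triangle X A B D x y \<delta>" and d: "d \<in> Mor X D' D"
  shows "\<exists>B' x' y' b. s_triangle X A B' D' x' y' (pull X A d \<delta>) \<and> b \<in> Mor X B' B \<and>
    y \<cdot> b = d \<cdot> y' \<and> b \<cdot> x' = x \<and>
    (\<forall>W. \<forall>u \<in> Mor X W B. \<forall>v \<in> Mor X W D'. y \<cdot> u = d \<cdot> v \<longrightarrow> (\<exists>w \<in> Mor X W B'. b \<cdot> w = u \<and> y' \<cdot> w = v))"
proof -
  note t = s_triangleD[OF T]
  have D': "D' \<in> Ob X" using Mor_Ob[OF d] by auto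
  obtain B' x' y' where T': "s_triangle X A B' D' x' y' (pull X A d \<delta>)"
    using tri_exists[OF pull_closed[OF t(10,1) d] D' t(1)] by auto
  obtain S j j' r r' where b: "biproduct X B D' S j j' r r'" using biproduct_exists t(2) D' by blast
  note bD = biproductD[OF b] biproduct_reassoc[OF b]
  obtain b where *: "b \<in> Mor X B' B" "y \<cdot> b = d \<cdot> y'" "b \<cdot> x' = x"
    and H: "s_triangle X B' S D ((j \<cdot> b) \<boxplus> (j' \<cdot> y')) ((y \<cdot> r) \<boxplus> Neg X (d \<cdot> r')) (push X D x' \<delta>)"
    using homotopy_pullback[OF T d T' b] by auto
  note t' = s_triangleD[OF T']
  have "\<exists>w \<in> Mor X W B'. b \<cdot> w = u \<and> y' \<cdot> w = v"
    if u: "u \<in> Mor X W B" "v \<in> Mor X W D'" "y \<cdot> u = d \<cdot> v" for W u v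
  proof -
    have ty: "u \<in> Ar X" "Dom X u = W" "Cod X u = B" "v \<in> Ar X" "Dom X v = W" "Cod X v = D'"
      "d \<in> Ar X" "Dom X d = D'" "Cod X d = D" "b \<in> Ar X" "Dom X b = B'" "Cod X b = B"
      using u d *(1) by (simp_all add: Mor_def)
    have "(y \<cdot> r \<boxplus> Neg X (d \<cdot> r')) \<cdot> (j \<cdot> u \<boxplus> j' \<cdot> v) = y \<cdot> u \<boxplus> Neg X (d \<cdot> v)"
      using ty bD t(1-9) Mor_Ob[OF u(1)] by simp
    also have "\<dots> = Zero X W D" unfolding u(3) using ty by simp
    finally obtain w where w: "w \<in> Mor X W B'" "((j \<cdot> b) \<boxplus> (j' \<cdot> y')) \<cdot> w = j \<cdot> u \<boxplus> j' \<cdot> v"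
      using tri_factor_left[OF H, of "j \<cdot> u \<boxplus> j' \<cdot> v" W] ty bD(1-15) by (auto simp: Mor_def)
    have tw: "w \<in> Ar X" "Dom X w = W" "Cod X w = B'" using w(1) by (simp_all add: Mor_def)
    have "r \<cdot> ((j \<cdot> b) \<boxplus> (j' \<cdot> y')) \<cdot> w = b \<cdot> w" "r' \<cdot> ((j \<cdot> b) \<boxplus> (j' \<cdot> y')) \<cdot> w = y' \<cdot> w"
      using tw ty t'(1-9) bD by simp_all
    moreover have "r \<cdot> (j \<cdot> u \<boxplus> j' \<cdot> v) = u" "r' \<cdot> (j \<cdot> u \<boxplus> j' \<cdot> v) = v"
      using tw ty t'(1-9) bD by simp_all
    ultimately show ?thesis using w by auto
  qed
  then show ?thesis using T' * by blast
qed

lemma pushout_ex: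
  assumes T: "s_triangle X A B D x y \<delta>" and a: "a \<in> Mor X A A'"
  shows "\<exists>B' x' y' b. s_triangle X A' B' D x' y' (push X D a \<delta>) \<and> b \<in> Mor X B B' \<and>
    b \<cdot> x = x' \<cdot> a \<and> y' \<cdot> b = y \<and>
    (\<forall>W. \<forall>u \<in> Mor X B W. \<forall>v \<in> Mor X A' W. u \<cdot> x = v \<cdot> a \<longrightarrow> (\<exists>w \<in> Mor X B' W. w \<cdot> b = u \<and> w \<cdot> x' = v))"
proof -
  interpret O: extriangulated_category "opp X" by (rule opp)
  obtain B' x' y' b where *: "s_triangle X A' B' D x' y' (push X D a \<delta>)" "b \<in> Mor X B B'"
    "b \<cdot> x = x' \<cdot> a" "y' \<cdot> b = y"
    "\<forall>W. \<forall>u \<in> Mor X B W. \<forall>v \<in> Mor X A' W. u \<cdot> x = v \<cdot> a \<longrightarrow> (\<exists>w \<in> Mor X B' W. w \<cdot> b = u \<and> w \<cdot> x' = v)"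
    using O.pullback_ex[of D B A y x \<delta> a A'] assms by auto
  show ?thesis by (rule exI[of _ B'], rule exI[of _ x'], rule exI[of _ y'], rule exI[of _ b])
      (use * in simp)
qed

text \<open>The homotopy pushouts of \<open>x1\<close> along \<open>x2\<close> and of \<open>x2\<close> along \<open>x1\<close> are cones of the same inflation
  up to sign, hence isomorphic.\<close>

lemma common_pushout:
  assumes T1: "s_triangle X A B1 D1 x1 y1 \<delta>1" and T2: "s_triangle X A B2 D2 x2 y2 \<delta>2"
  shows "\<exists>M m1 m2 e1 e2. s_triangle X B2 M D1 m2 e1 (push X D1 x2 \<delta>1) \<and>
    s_triangle X B1 M D2 m1 e2 (push X D2 x1 \<delta>2) \<and> m1 \<cdot> x1 = m2 \<cdot> x2 \<and> e1 \<cdot> m1 = y1 \<and> e2 \<cdot> m2 = y2"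
proof -
  note t1 = s_triangleD[OF T1] and t2 = s_triangleD[OF T2]
  obtain S j1 j2 r1 r2 where bS: "biproduct X B1 B2 S j1 j2 r1 r2" using biproduct_exists t1 t2 by blast
  note B = biproductD[OF bS] biproduct_reassoc[OF bS]
  obtain M m2 e1 where M: "s_triangle X B2 M D1 m2 e1 (push X D1 x2 \<delta>1)"
    using tri_exists[OF push_closed[OF t1(10,3) t2(12)] t1(3) t2(2)] by auto
  obtain M' m1' e2' where M': "s_triangle X B1 M' D2 m1' e2' (push X D2 x1 \<delta>2)"
    using tri_exists[OF push_closed[OF t2(10,3) t1(12)] t2(3) t1(2)] by auto
  note tM = s_triangleD[OF M] and tM' = s_triangleD[OF M']
  obtain b1 where b1: "b1 \<in> Mor X B1 M" "b1 \<cdot> x1 = m2 \<cdot> x2" "e1 \<cdot> b1 = y1"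
    "s_triangle X A S M ((j1 \<cdot> x1) \<boxplus> Neg X (j2 \<cdot> x2)) ((b1 \<cdot> r1) \<boxplus> (m2 \<cdot> r2)) (pull X A e1 \<delta>1)"
    using homotopy_pushout[OF T1 t2(12) M bS] by auto
  obtain b2 where b2: "b2 \<in> Mor X B2 M'" "b2 \<cdot> x2 = m1' \<cdot> x1" "e2' \<cdot> b2 = y2"
    "s_triangle X A S M' ((j2 \<cdot> x2) \<boxplus> Neg X (j1 \<cdot> x1)) ((b2 \<cdot> r2) \<boxplus> (m1' \<cdot> r1)) (pull X A e2' \<delta>2)"
    using homotopy_pushout[OF T2 t1(12) M' biproduct_swap[OF bS]] by auto
  have ty: "b1 \<in> Ar X" "Dom X b1 = B1" "Cod X b1 = M" "b2 \<in> Ar X" "Dom X b2 = B2" "Cod X b2 = M'"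
    using b1(1) b2(1) by (simp_all add: Mor_def)
  note ty = ty t1(1-9) t2(1-9) tM(1-9) tM'(1-9)
  let ?k = "(b2 \<cdot> r2) \<boxplus> (m1' \<cdot> r1)"
  \<comment> \<open>The second homotopy pushout starts with \<open>j2 x2 - j1 x1\<close>; the
    automorphism \<open>-1\<close> of \<open>S\<close> turns it into the inflation of the first, so
    that both cones can be compared.\<close>
  have "is_iso X (Neg X (Idn X S)) S S"
    by (rule is_isoI[of _ _ _ "Neg X (Idn X S)"]) (use B(3) in \<open>simp_all add: Mor_def\<close>)
  then have "s_triangle X A S M' ((j1 \<cdot> x1) \<boxplus> Neg X (j2 \<cdot> x2)) (Neg X ?k) (pull X A e2' \<delta>2)"
    by (rule tri_iso_middle[OF b2(4)]) (use ty B(1-15) in \<open>simp_all add: Mor_def neg_add add_comm\<close>)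
  from cone_unique[OF b1(4) this]
  obtain c where c: "is_iso X c M M'" "c \<cdot> ((b1 \<cdot> r1) \<boxplus> (m2 \<cdot> r2)) = Neg X ?k" by auto
  obtain c' where c': "c \<in> Mor X M M'" "c' \<in> Mor X M' M" "c' \<cdot> c = Idn X M" "c \<cdot> c' = Idn X M'"
    using c(1) by (rule is_isoE)
  have tc: "c \<in> Ar X" "Dom X c = M" "Cod X c = M'" "c' \<in> Ar X" "Dom X c' = M'" "Cod X c' = M"
    using c'(1,2) by (simp_all add: Mor_def)
  have "(c \<cdot> ((b1 \<cdot> r1) \<boxplus> (m2 \<cdot> r2))) \<cdot> j1 = c \<cdot> b1" using ty tc B by simp
  moreover have "(Neg X ?k) \<cdot> j1 = Neg X m1'" using ty B by simp
  ultimately have cb: "c \<cdot> b1 = Neg X m1'" using c(2) by simp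
  have "(c \<cdot> ((b1 \<cdot> r1) \<boxplus> (m2 \<cdot> r2))) \<cdot> j2 = c \<cdot> m2" using ty tc B by simp
  moreover have "(Neg X ?k) \<cdot> j2 = Neg X b2" using ty B by simp
  ultimately have cm: "c \<cdot> m2 = Neg X b2" using c(2) by simp
  \<comment> \<open>The sign reappears in the deflations, so the isomorphism that carries
    \<open>m1'\<close> to \<open>b1\<close> is \<open>-c'\<close>.\<close>
  have i: "is_iso X (Neg X c') M' M"
    by (rule is_isoI[of _ _ _ "Neg X c"]) (use tc c' tM(2) tM'(2) in \<open>simp_all add: Mor_def\<close>)
  have 1: "Neg X c' \<cdot> m1' = b1"
  proof -
    have "Neg X c' \<cdot> m1' = c' \<cdot> Neg X m1'" using tc ty by simp
    also have "\<dots> = (c' \<cdot> c) \<cdot> b1" unfolding cb[symmetric] using tc ty by simp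
    finally show ?thesis using c' ty by simp
  qed
  have 2: "(e2' \<cdot> Neg X c) \<cdot> Neg X c' = e2'" using tc ty c'(4) by simp
  have "s_triangle X B1 M D2 b1 (e2' \<cdot> Neg X c) (push X D2 x1 \<delta>2)"
    by (rule tri_iso_middle[OF M' i 1 2]) (use tc ty in \<open>simp_all add: Mor_def\<close>)
  moreover have "(e2' \<cdot> Neg X c) \<cdot> m2 = y2"
  proof -
    have "(e2' \<cdot> Neg X c) \<cdot> m2 = Neg X (e2' \<cdot> (c \<cdot> m2))" using tc ty by simp
    also have "\<dots> = y2" unfolding cm using ty b2(3) by simp
    finally show ?thesis .
  qed
  ultimately show ?thesis using M b1 by blast
qed

lemma common_pullback:
  assumes T1: "s_triangle X A1 B1 D x1 y1 \<delta>1" and T2: "s_triangle X A2 B2 D x2 y2 \<delta>2"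
  shows "\<exists>M m1 m2 e1 e2. s_triangle X A2 M B1 m2 e1 (pull X A2 y1 \<delta>2) \<and>
    s_triangle X A1 M B2 m1 e2 (pull X A1 y2 \<delta>1) \<and> y1 \<cdot> e1 = y2 \<cdot> e2 \<and> e1 \<cdot> m1 = x1 \<and> e2 \<cdot> m2 = x2"
proof -
  interpret O: extriangulated_category "opp X" by (rule opp)
  obtain M m1 m2 e1 e2 where
    *: "s_triangle X A1 M B2 m1 e2 (pull X A1 y2 \<delta>1)"
    "s_triangle X A2 M B1 m2 e1 (pull X A2 y1 \<delta>2)" "y1 \<cdot> e1 = y2 \<cdot> e2" "e1 \<cdot> m1 = x1" "e2 \<cdot> m2 = x2"
    using O.common_pushout[of D B1 A1 y1 x1 \<delta>1 B2 A2 y2 x2 \<delta>2] assms by auto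
  show ?thesis by (intro exI conjI) (fact *)+
qed

end

section \<open>The largest exact substructure\<close>

text \<open>One good representative is asked for; representatives of a class are isomorphic, so all
  of them are then good.\<close>

definition adm :: "('o, 'm, 'e, 'z) extri_scheme \<Rightarrow> 'o \<Rightarrow> 'o \<Rightarrow> 'e set" where
  "adm X D A = {\<delta> \<in> carrier (Ext X D A). \<exists>B x y. s_triangle X A B D x y \<delta> \<and> mono_arr X x \<and> epi_arr X y}"

text \<open>Only the carriers of the groups \<open>E(D,A)\<close> shrink. The types stay those of
  \<open>X\<close>, which lets the result serve as a test category in
  \<open>extri_localization\<close>.\<close>

definition adm_extri :: "('o, 'm, 'e) extri \<Rightarrow> ('o, 'm, 'e) extri" where
  "adm_extri X = X\<lparr>Ext := (\<lambda>D A. (Ext X D A)\<lparr>carrier := adm X D A\<rparr>)\<rparr>"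

lemma adm_opp [simp]: "adm (opp X) A D = adm X D A"
  unfolding adm_def by auto

context additive_category
begin

lemma mono_comp:
  assumes "mono_arr C x" "x \<in> Mor C A B" "mono_arr C y" "y \<in> Mor C B D"
  shows "mono_arr C (y \<cdot> x)"
proof (rule mono_arrI[of _ A D])
  show "y \<cdot> x \<in> Mor C A D" using comp_Mor assms by blast
  fix W f assume f: "f \<in> Mor C W A" "(y \<cdot> x) \<cdot> f = Zero C W D"
  have "y \<cdot> (x \<cdot> f) = Zero C W D" using f assms(2,4) by (simp add: Mor_def)
  then have "x \<cdot> f = Zero C W B"
    by (rule monoD[OF assms(3,4), rotated]) (use f assms(2) in \<open>auto simp: Mor_def\<close>)
  then show "f = Zero C W A" by (rule monoD[OF assms(1,2) f(1)])
qed

lemma mono_cancel: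
  assumes "x \<in> Mor C A B" "y \<in> Mor C B D" "mono_arr C (y \<cdot> x)"
  shows "mono_arr C x"
proof (rule mono_arrI[OF assms(1)])
  fix W f assume f: "f \<in> Mor C W A" "x \<cdot> f = Zero C W B"
  have "(y \<cdot> x) \<cdot> f = y \<cdot> (x \<cdot> f)" using f(1) assms(1,2) by (simp add: Mor_def)
  also have "\<dots> = Zero C W D" unfolding f(2) using Mor_Ob[OF f(1)] assms(2) by (simp add: Mor_def)
  finally show "f = Zero C W A"
    using monoD[OF assms(3) comp_Mor[OF assms(1,2)] f(1)] by simp
qed

end

context extriangulated_category
begin

lemma epi_comp:
  assumes "epi_arr X x" "x \<in> Mor X A B" "epi_arr X y" "y \<in> Mor X B D"
  shows "epi_arr X (y \<cdot> x)"
proof -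
  interpret O: extriangulated_category "opp X" by (rule opp)
  show ?thesis using O.mono_comp[of y D B x A] assms by simp
qed

lemma epi_cancel:
  assumes "x \<in> Mor X A B" "y \<in> Mor X B D" "epi_arr X (y \<cdot> x)"
  shows "epi_arr X y"
proof -
  interpret O: extriangulated_category "opp X" by (rule opp)
  show ?thesis using O.mono_cancel[of y D B x A] assms by simp
qed

lemma Real_tri:
  assumes "(x, y) \<in> Real X D A \<delta>" "\<delta> \<in> carrier (Ext X D A)" "D \<in> Ob X" "A \<in> Ob X"
  shows "\<exists>B. s_triangle X A B D x y \<delta>"
proof -
  obtain x0 y0 where "Real X D A \<delta> = seq_class X A D x0 y0"
    using Real_class[OF assms(3,4,2)] by auto
  then obtain B where B: "x \<in> Mor X A B" "y \<in> Mor X B D" using assms(1) by (auto simp: seq_class_def seqs_def)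
  then show ?thesis using assms Mor_Ob[OF B(1)] by (auto simp: s_triangle_def)
qed

section \<open>Closure properties of the admissible classes\<close>

lemma adm_mono:
  assumes "\<delta> \<in> adm X D A" "s_triangle X A B D x y \<delta>"
  shows "mono_arr X x"
proof -
  obtain B' x' y' where *: "s_triangle X A B' D x' y' \<delta>" "mono_arr X x'"
    using assms(1) by (auto simp: adm_def)
  obtain b where b: "is_iso X b B B'" "b \<cdot> x = x'" using tri_unique[OF assms(2) *(1)] by auto
  show ?thesis
    by (rule mono_cancel[of x A B b B']) (use b * s_triangleD[OF assms(2)] in \<open>auto simp: is_iso_def\<close>)
qed

lemma adm_epi:
  assumes "\<delta> \<in> adm X D A" "s_triangle X A B D x y \<delta>"
  shows "epi_arr X y"
proof -
  interpret O: extriangulated_category "opp X" by (rule opp)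
  show ?thesis using O.adm_mono[of \<delta> A D B y x] assms by simp
qed

text \<open>If \<open>x' \<cdot> f = 0\<close>, the map \<open>(0, f)\<close> into
  \<open>B \<oplus> A'\<close> is killed by the deflation of the homotopy pushout, so it comes from
  some \<open>w\<close> into \<open>A\<close> with \<open>x \<cdot> w = 0\<close>; thus
  \<open>w = 0\<close> and \<open>f = 0\<close>. The deflation \<open>y'\<close> is epic because
  \<open>y = y' \<cdot> b\<close> is.\<close>

lemma adm_push:
  assumes "\<delta> \<in> adm X D A" "D \<in> Ob X" "a \<in> Mor X A A'"
  shows "push X D a \<delta> \<in> adm X D A'"
proof -
  obtain B x y where T: "s_triangle X A B D x y \<delta>" and me: "mono_arr X x" "epi_arr X y"
    using assms(1) by (auto simp: adm_def)
  note t = s_triangleD[OF T]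
  have A': "A' \<in> Ob X" using Mor_Ob[OF assms(3)] by simp
  have cl: "push X D a \<delta> \<in> carrier (Ext X D A')" using push_closed t assms by blast
  obtain B' x' y' where T': "s_triangle X A' B' D x' y' (push X D a \<delta>)"
    using tri_exists[OF cl assms(2) A'] by auto
  note t' = s_triangleD[OF T']
  obtain S j j' r r' where bS: "biproduct X B A' S j j' r r'" using biproduct_exists t(2) A' by blast
  note bD = biproductD[OF bS] biproduct_reassoc[OF bS]
  obtain b where b: "b \<in> Mor X B B'" "b \<cdot> x = x' \<cdot> a" "y' \<cdot> b = y"
   and H: "s_triangle X A S B' ((j \<cdot> x) \<boxplus> Neg X (j' \<cdot> a)) ((b \<cdot> r) \<boxplus> (x' \<cdot> r')) (pull X A y' \<delta>)"
    using homotopy_pushout[OF T assms(3) T' bS] by auto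
  have ty: "a \<in> Ar X" "Dom X a = A" "Cod X a = A'" "b \<in> Ar X" "Dom X b = B" "Cod X b = B'"
    using assms(3) b(1) by (simp_all add: Mor_def)
  have "mono_arr X x'"
  proof (rule mono_arrI[OF t'(12)])
    fix W f assume f: "f \<in> Mor X W A'" "x' \<cdot> f = Zero X W B'"
    have tf: "f \<in> Ar X" "Dom X f = W" "Cod X f = A'" "W \<in> Ob X" using f(1) Mor_Ob[OF f(1)] by (simp_all add: Mor_def)
    have "((b \<cdot> r) \<boxplus> (x' \<cdot> r')) \<cdot> (j' \<cdot> f) = Zero X W B'"
      using tf ty t'(1-9) bD f(2) by simp
    then obtain w where w: "w \<in> Mor X W A" "((j \<cdot> x) \<boxplus> Neg X (j' \<cdot> a)) \<cdot> w = j' \<cdot> f"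
      using tri_factor_left[OF H, of "j' \<cdot> f" W] tf bD(1-15) by (auto simp: Mor_def)
    have tw: "w \<in> Ar X" "Dom X w = W" "Cod X w = A" using w(1) by (simp_all add: Mor_def)
    have "x \<cdot> w = r \<cdot> ((j \<cdot> x) \<boxplus> Neg X (j' \<cdot> a)) \<cdot> w" using tw tf(4) ty t(1-9) bD by simp
    also have "\<dots> = Zero X W B" unfolding w(2) using tf bD by simp
    finally have "w = Zero X W A" using monoD[OF me(1) t(12) w(1)] by simp
    then have "((j \<cdot> x) \<boxplus> Neg X (j' \<cdot> a)) \<cdot> w = Zero X W S" using tf ty t(1-9) bD by simp
    then have "r' \<cdot> (j' \<cdot> f) = Zero X W A'" using w(2) bD tf by simp
    then show "f = Zero X W A'" using bD tf by simp
  qed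
  moreover have "epi_arr X y'"
    by (rule epi_cancel[OF b(1) t'(13)]) (simp add: b me)
  ultimately show ?thesis using cl T' by (auto simp: adm_def)
qed

lemma adm_pull:
  assumes "\<delta> \<in> adm X D A" "A \<in> Ob X" "d \<in> Mor X D' D"
  shows "pull X A d \<delta> \<in> adm X D' A"
proof -
  interpret O: extriangulated_category "opp X" by (rule opp)
  show ?thesis using O.adm_push[of \<delta> A D d D'] assms by simp
qed

lemma adm_Emap:
  assumes "\<delta> \<in> adm X D A" "d \<in> Mor X D' D" "a \<in> Mor X A A'"
  shows "Emap X d a \<delta> \<in> adm X D' A'"
proof -
  have "\<delta> \<in> carrier (Ext X D A)" using assms(1) by (simp add: adm_def)
  from push_pull(1)[OF this assms(2,3)] show ?thesis
    using adm_push[OF adm_pull[OF assms(1) _ assms(2)] _ assms(3)] Mor_Ob[OF assms(2)] Mor_Ob[OF assms(3)]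
    by simp
qed

lemma dsum_mono:
  assumes "biproduct X A A' SA i i' p p'" "biproduct X B B' SB j j' r r'"
    and "x \<in> Mor X A B" "x' \<in> Mor X A' B'" "mono_arr X x" "mono_arr X x'"
  shows "mono_arr X (dsum X j j' p p' x x')"
proof (rule mono_arrI[of _ SA SB])
  note b1 = biproductD[OF assms(1)] and b2 = biproductD[OF assms(2)] biproduct_reassoc[OF assms(2)]
  have ty: "x \<in> Ar X" "Dom X x = A" "Cod X x = B" "x' \<in> Ar X" "Dom X x' = A'" "Cod X x' = B'"
    using assms by (auto simp: Mor_def)
  show "dsum X j j' p p' x x' \<in> Mor X SA SB" using ty b1(1-15) b2(1-15) by (simp add: dsum_def Mor_def)
  fix W f assume f: "f \<in> Mor X W SA" "dsum X j j' p p' x x' \<cdot> f = Zero X W SB"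
  have tf: "f \<in> Ar X" "Dom X f = W" "Cod X f = SA" "W \<in> Ob X" using f(1) Mor_Ob[OF f(1)] by (simp_all add: Mor_def)
  have "x \<cdot> (p \<cdot> f) = r \<cdot> (dsum X j j' p p' x x' \<cdot> f)"
    using tf ty b1(1-15) b2 by (simp add: dsum_def)
  also have "\<dots> = Zero X W B" unfolding f(2) using tf b2 by simp
  finally have 1: "p \<cdot> f = Zero X W A"
    by (rule monoD[OF assms(5,3), rotated]) (use tf b1 in \<open>simp add: Mor_def\<close>)
  have "x' \<cdot> (p' \<cdot> f) = r' \<cdot> (dsum X j j' p p' x x' \<cdot> f)"
    using tf ty b1(1-15) b2 by (simp add: dsum_def)
  also have "\<dots> = Zero X W B'" unfolding f(2) using tf b2 by simp
  finally have 2: "p' \<cdot> f = Zero X W A'"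
    by (rule monoD[OF assms(6,4), rotated]) (use tf b1 in \<open>simp add: Mor_def\<close>)
  show "f = Zero X W SA"
    by (rule biproduct_ext_right[OF assms(1)]) (use tf b1 1 2 in \<open>simp_all add: Mor_def\<close>)
qed

lemma dsum_opp:
  assumes "biproduct X A A' SA i i' p p'" "biproduct X B B' SB j j' r r'"
    and "x \<in> Mor X A B" "x' \<in> Mor X A' B'"
  shows "dsum (opp X) p p' j j' x x' = dsum X j j' p p' x x'"
  using biproductD(1-15)[OF assms(1)] biproductD(1-15)[OF assms(2)] assms(3,4)
  by (simp add: dsum_def Mor_def)

lemma dsum_epi:
  assumes "biproduct X A A' SA i i' p p'" "biproduct X B B' SB j j' r r'"
    and "x \<in> Mor X A B" "x' \<in> Mor X A' B'" "epi_arr X x" "epi_arr X x'"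
  shows "epi_arr X (dsum X j j' p p' x x')"
proof -
  interpret O: extriangulated_category "opp X" by (rule opp)
  show ?thesis using O.dsum_mono[of B B' SB r r' j j' A A' SA p p' i i' x x'] assms
     dsum_opp[OF assms(1-4)] by simp
qed

lemma Emap_mult:
  assumes "d \<in> Mor X D' D" "a \<in> Mor X A A'" "\<delta> \<in> carrier (Ext X D A)" "\<epsilon> \<in> carrier (Ext X D A)"
  shows "Emap X d a (\<delta> \<otimes>\<^bsub>Ext X D A\<^esub> \<epsilon>) = Emap X d a \<delta> \<otimes>\<^bsub>Ext X D' A'\<^esub> Emap X d a \<epsilon>"
  using Emap_hom[OF assms(1,2)] assms(3,4) by (auto simp: hom_def)

text \<open>The diagonal followed by a projection, and an injection followed by the codiagonal, are
  identities. So the group operation is the Baer sum, and closure under sums reduces to closure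
  under direct sums, pushing and pulling.\<close>

lemma codiagonal_sum:
  assumes bA: "biproduct X A A SA i i' p p'" and bD: "biproduct X D D SD k k' q q'"
    and d: "\<delta> \<in> carrier (Ext X D A)" "\<delta>' \<in> carrier (Ext X D A)"
  shows "Emap X (k \<boxplus> k') (p \<boxplus> p') (Emap X q i \<delta> \<otimes>\<^bsub>Ext X SD SA\<^esub> Emap X q' i' \<delta>')
    = \<delta> \<otimes>\<^bsub>Ext X D A\<^esub> \<delta>'"
proof -
  note A = biproductD[OF bA] and D = biproductD[OF bD]
  have M: "q \<in> Mor X SD D" "q' \<in> Mor X SD D" "i \<in> Mor X A SA" "i' \<in> Mor X A SA"
    "k \<boxplus> k' \<in> Mor X D SD" "p \<boxplus> p' \<in> Mor X SA A"
    using A(1-15) D(1-15) by (simp_all add: Mor_def)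
  have 1: "Emap X (k \<boxplus> k') (p \<boxplus> p') (Emap X q i \<delta>) = \<delta>"
    using Emap_comp[OF M(1,5,3,6) d(1)] A D d by (simp add: Emap_id)
  have 2: "Emap X (k \<boxplus> k') (p \<boxplus> p') (Emap X q' i' \<delta>') = \<delta>'"
    using Emap_comp[OF M(2,5,4,6) d(2)] A D d by (simp add: Emap_id)
  show ?thesis unfolding Emap_mult[OF M(5,6) Emap_closed[OF d(1) M(1,3)] Emap_closed[OF d(2) M(2,4)]] 1 2 ..
qed

lemma adm_dsum:
  assumes "\<delta> \<in> adm X D A" "\<delta>' \<in> adm X D' A'"
    "biproduct X A A' SA i i' p p'" "biproduct X D D' SD k k' q q'"
  shows "Emap X q i \<delta> \<otimes>\<^bsub>Ext X SD SA\<^esub> Emap X q' i' \<delta>' \<in> adm X SD SA"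
proof -
  obtain B x y where T: "s_triangle X A B D x y \<delta>" and me: "mono_arr X x" "epi_arr X y"
    using assms(1) by (auto simp: adm_def)
  obtain B' x' y' where T': "s_triangle X A' B' D' x' y' \<delta>'" and me': "mono_arr X x'" "epi_arr X y'"
    using assms(2) by (auto simp: adm_def)
  note t = s_triangleD[OF T] and t' = s_triangleD[OF T']
  obtain SB j j' r r' where b: "biproduct X B B' SB j j' r r'" using biproduct_exists t(2) t'(2) by blast
  have "s_triangle X SA SB SD (dsum X j j' p p' x x') (dsum X k k' r r' y y')
            (Emap X q i \<delta> \<otimes>\<^bsub>Ext X SD SA\<^esub> Emap X q' i' \<delta>')" (is "s_triangle X SA SB SD ?x ?y ?d")
    by (rule s_additive[OF T T' assms(3) b assms(4)])
  moreover have "mono_arr X ?x" by (rule dsum_mono[OF assms(3) b t(12) t'(12) me(1) me'(1)])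
  moreover have "epi_arr X ?y" by (rule dsum_epi[OF b assms(4) t(13) t'(13) me(2) me'(2)])
  ultimately show ?thesis unfolding adm_def s_triangle_def by auto
qed

lemma adm_one:
  assumes "D \<in> Ob X" "A \<in> Ob X" shows "\<one>\<^bsub>Ext X D A\<^esub> \<in> adm X D A"
proof -
  obtain S i j p q where b: "biproduct X A D S i j p q" using biproduct_exists assms(2,1) by blast
  note B = biproductD[OF b]
  have M: "i \<in> Mor X A S" "p \<in> Mor X S A" "q \<in> Mor X S D" "j \<in> Mor X D S" using B by (auto simp: Mor_def)
  have "mono_arr X i" by (rule mono_cancel[OF M(1,2)]) (use B in \<open>auto simp: mono_arr_def Mor_def\<close>)
  moreover have "epi_arr X q" by (rule epi_cancel[OF M(4,3)]) (use B in \<open>auto simp: epi_arr_def Mor_def\<close>)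
  ultimately show ?thesis using s_zero[OF b] assms by (auto simp: adm_def)
qed

text \<open>Inverses are obtained by pushing along \<open>-1\<close>, so a family of classes closed
  under pushing is closed under inverses.\<close>

lemma push_neg_id:
  assumes "D \<in> Ob X" "A \<in> Ob X" "\<delta> \<in> carrier (Ext X D A)"
  shows "push X D (Neg X (Idn X A)) \<delta> = inv\<^bsub>Ext X D A\<^esub> \<delta>"
proof -
  interpret G: comm_group "Ext X D A" by (rule Ext_group[OF assms(1,2)])
  have M: "Idn X D \<in> Mor X D D" "Idn X A \<in> Mor X A A" "Neg X (Idn X A) \<in> Mor X A A" "Zero X A A \<in> Mor X A A"
    using assms by (auto simp: Mor_def)
  have "push X D (Zero X A A \<boxplus> Zero X A A) \<delta> = push X D (Zero X A A) \<delta> \<otimes>\<^bsub>Ext X D A\<^esub> push X D (Zero X A A) \<delta>"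
    unfolding push_def by (rule Emap_add_right[OF M(1,4,4) assms(3)])
  then have z: "push X D (Zero X A A) \<delta> = \<one>\<^bsub>Ext X D A\<^esub>"
    using assms G.l_cancel_one push_closed[OF assms(3,1) M(4)] by simp
  have "push X D (Neg X (Idn X A) \<boxplus> Idn X A) \<delta> = push X D (Neg X (Idn X A)) \<delta> \<otimes>\<^bsub>Ext X D A\<^esub> \<delta>"
    unfolding push_def Emap_add_right[OF M(1,3,2) assms(3)] using assms by (simp add: Emap_id)
  then have "push X D (Neg X (Idn X A)) \<delta> \<otimes>\<^bsub>Ext X D A\<^esub> \<delta> = \<one>\<^bsub>Ext X D A\<^esub>" using z assms by simp
  then show ?thesis using G.inv_equality[of "push X D (Neg X (Idn X A)) \<delta>" \<delta>] assms M by simp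
qed

lemma adm_group:
  assumes "D \<in> Ob X" "A \<in> Ob X"
  shows "comm_group ((Ext X D A)\<lparr>carrier := adm X D A\<rparr>)"
proof -
  interpret G: comm_group "Ext X D A" by (rule Ext_group[OF assms])
  have sub: "adm X D A \<subseteq> carrier (Ext X D A)" by (auto simp: adm_def)
  have inv: "inv\<^bsub>Ext X D A\<^esub> \<delta> \<in> adm X D A" if "\<delta> \<in> adm X D A" for \<delta>
    using adm_push[OF that assms(1), of "Neg X (Idn X A)" A] that sub assms push_neg_id[OF assms, of \<delta>]
    by (auto simp: Mor_def)
  have mult: "\<delta> \<otimes>\<^bsub>Ext X D A\<^esub> \<epsilon> \<in> adm X D A" if "\<delta> \<in> adm X D A" "\<epsilon> \<in> adm X D A" for \<delta> \<epsilon>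
  proof -
    obtain SA i i' p p' where bA: "biproduct X A A SA i i' p p'" using biproduct_exists assms by blast
    obtain SD k k' q q' where bD: "biproduct X D D SD k k' q q'" using biproduct_exists assms by blast
    have "k \<boxplus> k' \<in> Mor X D SD" "p \<boxplus> p' \<in> Mor X SA A"
      using biproductD(1-15)[OF bA] biproductD(1-15)[OF bD] by (simp_all add: Mor_def)
    from adm_Emap[OF adm_dsum[OF that bA bD] this] show ?thesis
      unfolding codiagonal_sum[OF bA bD subsetD[OF sub that(1)] subsetD[OF sub that(2)]] .
  qed
  have "subgroup (adm X D A) (Ext X D A)"
    by (rule G.subgroupI[OF sub]) (use adm_one[OF assms] inv mult in auto)
  then have "group ((Ext X D A)\<lparr>carrier := adm X D A\<rparr>)" by (rule G.subgroup_imp_group)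
  then show ?thesis
    by (rule group.group_comm_groupI) (use G.m_comm sub in auto)
qed

end

lemma adm_extri_simps [simp]:
  "Ob (adm_extri X) = Ob X" "Ar (adm_extri X) = Ar X" "Dom (adm_extri X) = Dom X" "Cod (adm_extri X) = Cod X"
  "Idn (adm_extri X) = Idn X" "Comp (adm_extri X) = Comp X" "Add (adm_extri X) = Add X"
  "Zero (adm_extri X) = Zero X"
  "Ext (adm_extri X) D A = (Ext X D A)\<lparr>carrier := adm X D A\<rparr>" "Emap (adm_extri X) = Emap X"
  "Mor (adm_extri X) = Mor X" "Homg (adm_extri X) = Homg X"
  "Real (adm_extri X) = Real X"
  by (auto simp: adm_extri_def Mor_def Homg_def fun_eq_iff)

lemma adm_extri_derived [simp]:
  "s_triangle (adm_extri X) A B D x y \<delta> \<longleftrightarrow> s_triangle X A B D x y \<delta> \<and> \<delta> \<in> adm X D A"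
  "push (adm_extri X) = push X" "pull (adm_extri X) = pull X"
  "is_iso (adm_extri X) = is_iso X" "zero_object (adm_extri X) = zero_object X"
  "seqs (adm_extri X) = seqs X" "biproduct (adm_extri X) = biproduct X"
  "dsum (adm_extri X) = dsum X" "seq_class (adm_extri X) = seq_class X"
  by (auto simp: s_triangle_def push_def pull_def is_iso_def zero_object_def seqs_def
      biproduct_def dsum_def seq_class_def fun_eq_iff adm_def)

lemma additive_adm_extri:
  assumes "extriangulated_category X"
  shows "additive_category (adm_extri X)"
proof (rule additive_category.intro)
  interpret extriangulated_category X by fact
  show "category (adm_extri X)"
    by unfold_locales (auto simp: Mor_def)
  show "additive_category_axioms (adm_extri X)"
    by (rule additive_category_axioms.intro)
      (simp_all add: hom_group comp_add_left comp_add_right zero_object_exists biproduct_exists)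
qed

text \<open>The axioms are inherited once the classes they produce are seen to be admissible. The
  substance is ET4 and its dual, where the new arrow \<open>h'\<close> has to be shown epic,
  respectively monic.\<close>

theorem extriangulated_adm:
  assumes "extriangulated_category X"
  shows "extriangulated_category (adm_extri X)"
proof -
  interpret extriangulated_category X by fact
  have sub: "\<delta> \<in> adm X D A \<Longrightarrow> \<delta> \<in> carrier (Ext X D A)" for D A \<delta> by (auto simp: adm_def)
  have "extriangulated_category_axioms (adm_extri X)"
  proof (rule extriangulated_category_axioms.intro, goal_cases)
    case (1 D A) then show ?case by (simp add: adm_group)
  next
    case (2 d D' D a A A')
    then show ?case using adm_Emap[of _ D A d D' a A'] Emap_mult[of d D' D a A A'] sub[of _ D A]
      by (auto simp: hom_def)
  next
    case (3 D A \<delta>) then show ?case using sub by (auto simp: Emap_id)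
  next
    case (4 d D' D d' D'' a A A' a' A'' \<delta>)
    then have "\<delta> \<in> carrier (Ext X D A)" using sub by auto
    with 4 show ?case using Emap_comp by simp
  next
    case (5 d D' D d' a A A' \<delta>)
    then have "\<delta> \<in> carrier (Ext X D A)" using sub by auto
    with 5 show ?case using Emap_add_left by simp
  next
    case (6 d D' D a A A' a' \<delta>)
    then have "\<delta> \<in> carrier (Ext X D A)" using sub by auto
    with 6 show ?case using Emap_add_right by simp
  next
    case (7 D A \<delta>)
    then show ?case using Real_class[of D A \<delta>] sub by auto
  next
    case (8 A B D x y \<delta> A' B' D' x' y' \<delta>' a d)
    then show ?case using realization[of A B D x y \<delta> A' B' D' x' y' \<delta>' a d] by simp
  next
    case (9 A D S i j p q)
    then show ?case using s_zero[of A D S i j p q] adm_one biproductD(1,2)[of A D S i j p q] by simp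
  next
    case (10 A B D x y \<delta> A' B' D' x' y' \<delta>' SA i i' p p' SB j j' r r' SD k k' q q')
    then show ?case
      using s_additive[of A B D x y \<delta> A' B' D' x' y' \<delta>' SA i i' p p' SB j j' r r' SD k k' q q']
        adm_dsum[of \<delta> D A \<delta>' D' A' SA i i' p p' SD k k' q q']
      by simp
  next
    case (11 A B D x y \<delta> A' B' D' x' y' \<delta>' a b)
    then show ?case using ET3[of A B D x y \<delta> A' B' D' x' y' \<delta>' a b] by simp
  next
    case (12 A B D x y \<delta> A' B' D' x' y' \<delta>' b d)
    then show ?case using ET3op[of A B D x y \<delta> A' B' D' x' y' \<delta>' b d] by simp
  next
    case (13 A B D f f' \<delta> C F g g' \<delta>')
    then have T: "s_triangle X A B D f f' \<delta>" "s_triangle X B C F g g' \<delta>'"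
      and ad: "\<delta> \<in> adm X D A" "\<delta>' \<in> adm X F B" by auto
    obtain E h' d e \<delta>'' where E: "s_triangle X A C E (g \<cdot>\<^bsub>X\<^esub> f) h' \<delta>''"
      "s_triangle X D E F d e (push X F f' \<delta>')" "d \<cdot>\<^bsub>X\<^esub> f' = h' \<cdot>\<^bsub>X\<^esub> g" "e \<cdot>\<^bsub>X\<^esub> h' = g'"
      "pull X A d \<delta>'' = \<delta>" "push X E f \<delta>'' = pull X B e \<delta>'" using ET4[OF T] by auto
    note t = s_triangleD[OF T(1)] and t' = s_triangleD[OF T(2)] and e1 = s_triangleD[OF E(1)] and e2 = s_triangleD[OF E(2)]
    have m: "mono_arr X (g \<cdot>\<^bsub>X\<^esub> f)"
      by (rule mono_comp[OF adm_mono[OF ad(1) T(1)] t(12) adm_mono[OF ad(2) T(2)] t'(12)])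
    \<comment> \<open>A map \<open>u\<close> with \<open>u \<cdot> h' = 0\<close> satisfies
      \<open>u \<cdot> d = 0\<close> because \<open>f'\<close> is epic, so it factors through
      \<open>e\<close>; the factor vanishes because \<open>g'\<close> is epic.\<close>
    have "epi_arr X h'"
    proof (rule epi_arrI[OF e1(13)])
      fix W u assume u: "u \<in> Mor X E W" "u \<cdot>\<^bsub>X\<^esub> h' = Zero X C W"
      have tu: "u \<in> Ar X" "Dom X u = E" "Cod X u = W" "W \<in> Ob X" using u(1) Mor_Ob[OF u(1)] by (simp_all add: Mor_def)
      have "(u \<cdot>\<^bsub>X\<^esub> d) \<cdot>\<^bsub>X\<^esub> f' = u \<cdot>\<^bsub>X\<^esub> (d \<cdot>\<^bsub>X\<^esub> f')" using tu e2(1-9) t(1-9) by simp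
      also have "\<dots> = (u \<cdot>\<^bsub>X\<^esub> h') \<cdot>\<^bsub>X\<^esub> g" unfolding E(3) using tu e1(1-9) t'(1-9) by simp
      also have "\<dots> = Zero X B W" unfolding u(2) using tu t'(1-9) by simp
      finally have "u \<cdot>\<^bsub>X\<^esub> d = Zero X D W"
        by (rule epiD[OF adm_epi[OF ad(1) T(1)] t(13), rotated]) (use tu e2 in \<open>simp add: Mor_def\<close>)
      from tri_factor_right[OF E(2) u(1) this]
      obtain v where v: "v \<in> Mor X F W" "v \<cdot>\<^bsub>X\<^esub> e = u" by auto
      have "v \<cdot>\<^bsub>X\<^esub> g' = (v \<cdot>\<^bsub>X\<^esub> e) \<cdot>\<^bsub>X\<^esub> h'" unfolding E(4)[symmetric] using v(1) e1(1-9) e2(1-9) by (simp add: Mor_def)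
      then have "v \<cdot>\<^bsub>X\<^esub> g' = Zero X C W" using v(2) u(2) by simp
      then have "v = Zero X F W" by (rule epiD[OF adm_epi[OF ad(2) T(2)] t'(13) v(1)])
      then show "u = Zero X E W" using v(2) e2(1-9) tu by simp
    qed
    then have "\<delta>'' \<in> adm X E A" using m E(1) e1 by (auto simp: adm_def)
    moreover have "push X F f' \<delta>' \<in> adm X F D" by (rule adm_push[OF ad(2) t'(3) t(13)])
    ultimately show ?case using E
      by (intro exI[of _ E] exI[of _ h'] exI[of _ d] exI[of _ e] exI[of _ \<delta>'']) simp
  next
    case (14 D B A f' f \<delta> F C g' g \<delta>')
    then have T: "s_triangle X D B A f' f \<delta>" "s_triangle X F C B g' g \<delta>'"
      and ad: "\<delta> \<in> adm X A D" "\<delta>' \<in> adm X B F" by auto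
    obtain E h' d e \<delta>'' where E: "s_triangle X E C A h' (f \<cdot>\<^bsub>X\<^esub> g) \<delta>''"
      "s_triangle X F E D e d (pull X F f' \<delta>')" "f' \<cdot>\<^bsub>X\<^esub> d = g \<cdot>\<^bsub>X\<^esub> h'" "h' \<cdot>\<^bsub>X\<^esub> e = g'"
      "push X A d \<delta>'' = \<delta>" "pull X E f \<delta>'' = push X B e \<delta>'" using ET4op[OF T] by auto
    note t = s_triangleD[OF T(1)] and t' = s_triangleD[OF T(2)] and e1 = s_triangleD[OF E(1)] and e2 = s_triangleD[OF E(2)]
    have m: "epi_arr X (f \<cdot>\<^bsub>X\<^esub> g)"
      by (rule epi_comp[OF adm_epi[OF ad(2) T(2)] t'(13) adm_epi[OF ad(1) T(1)] t(13)])
    have "mono_arr X h'"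
    proof (rule mono_arrI[OF e1(12)])
      fix W u assume u: "u \<in> Mor X W E" "h' \<cdot>\<^bsub>X\<^esub> u = Zero X W C"
      have tu: "u \<in> Ar X" "Dom X u = W" "Cod X u = E" "W \<in> Ob X" using u(1) Mor_Ob[OF u(1)] by (simp_all add: Mor_def)
      have "f' \<cdot>\<^bsub>X\<^esub> (d \<cdot>\<^bsub>X\<^esub> u) = (f' \<cdot>\<^bsub>X\<^esub> d) \<cdot>\<^bsub>X\<^esub> u" using tu e2(1-9) t(1-9) by simp
      also have "\<dots> = g \<cdot>\<^bsub>X\<^esub> (h' \<cdot>\<^bsub>X\<^esub> u)" unfolding E(3) using tu e1(1-9) t'(1-9) by simp
      also have "\<dots> = Zero X W B" unfolding u(2) using tu t'(1-9) by simp
      finally have "d \<cdot>\<^bsub>X\<^esub> u = Zero X W D"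
        by (rule monoD[OF adm_mono[OF ad(1) T(1)] t(12), rotated]) (use tu e2 in \<open>simp add: Mor_def\<close>)
      from tri_factor_left[OF E(2) u(1) this]
      obtain v where v: "v \<in> Mor X W F" "e \<cdot>\<^bsub>X\<^esub> v = u" by auto
      have "g' \<cdot>\<^bsub>X\<^esub> v = h' \<cdot>\<^bsub>X\<^esub> (e \<cdot>\<^bsub>X\<^esub> v)" unfolding E(4)[symmetric] using v(1) e1(1-9) e2(1-9) by (simp add: Mor_def)
      then have "g' \<cdot>\<^bsub>X\<^esub> v = Zero X W C" using v(2) u(2) by simp
      then have "v = Zero X W F" by (rule monoD[OF adm_mono[OF ad(2) T(2)] t'(12) v(1)])
      then show "u = Zero X W E" using v(2) e2(1-9) tu by simp
    qed
    then have "\<delta>'' \<in> adm X A E" using m E(1) e1 by (auto simp: adm_def)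
    moreover have "pull X F f' \<delta>' \<in> adm X D F" by (rule adm_pull[OF ad(2) t'(1) t(12)])
    ultimately show ?case using E
      by (intro exI[of _ E] exI[of _ h'] exI[of _ d] exI[of _ e] exI[of _ \<delta>'']) simp
  qed
  then show ?thesis using additive_adm_extri[OF assms] by (intro extriangulated_category.intro) auto
qed

section \<open>Extriangulated categories with regular inflations and deflations\<close>

definition conflations :: "('o, 'm, 'e, 'z) extri_scheme \<Rightarrow> ('m \<times> 'm) set" where
  "conflations X = {(x, y). \<exists>A B D \<delta>. s_triangle X A B D x y \<delta>}"

lemma conflationsI: "s_triangle X A B D x y \<delta> \<Longrightarrow> (x, y) \<in> conflations X"
  by (auto simp: conflations_def)

text \<open>Factorizations through inflations and deflations always exist; monic inflations and epic
  deflations make them unique, so that conflations become kernel-cokernel pairs.\<close>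

locale exact_extriangulated = extriangulated_category X
  for X :: "('o, 'm, 'e, 'z) extri_scheme" (structure) +
  assumes infl_mono: "s_triangle X A B D x y \<delta> \<Longrightarrow> mono_arr X x"
    and defl_epi: "s_triangle X A B D x y \<delta> \<Longrightarrow> epi_arr X y"
begin

lemma exact_opp: "exact_extriangulated (opp X)"
proof -
  interpret O: extriangulated_category "opp X" by (rule opp)
  show ?thesis by unfold_locales (auto intro: infl_mono defl_epi)
qed

lemma kernel:
  assumes T: "s_triangle X A B D x y \<delta>"
  shows "is_kernel X x y"
proof -
  note t = s_triangleD[OF T]
  have "\<exists>!g. g \<in> Mor X W A \<and> x \<cdot> g = f" if "f \<in> Mor X W B" "y \<cdot> f = Zero X W D" for W f
  proof (rule ex_ex1I)
    show "\<exists>g. g \<in> Mor X W A \<and> x \<cdot> g = f" using tri_factor_left[OF T that] by auto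
    show "g = g'" if "g \<in> Mor X W A \<and> x \<cdot> g = f" "g' \<in> Mor X W A \<and> x \<cdot> g' = f" for g g'
      using infl_mono[OF T] that t unfolding mono_arr_def by auto
  qed
  then show ?thesis using t tri_comp_zero[OF T] unfolding is_kernel_def by blast
qed

lemma cokernel:
  assumes T: "s_triangle X A B D x y \<delta>"
  shows "is_cokernel X y x"
proof -
  interpret O: exact_extriangulated "opp X" by (rule exact_opp)
  have *: "is_kernel (opp X) y x" using O.kernel[of D B A y x \<delta>] T by simp
  then obtain A B D where "y \<in> Mor (opp X) D B" "x \<in> Mor (opp X) B A" 
    "x \<cdot>\<^bsub>opp X\<^esub> y = Zero (opp X) D A"
    "\<forall>T. \<forall>f \<in> Mor (opp X) T B. x \<cdot>\<^bsub>opp X\<^esub> f = Zero (opp X) T A \<longrightarrow>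
        (\<exists>!g. g \<in> Mor (opp X) T D \<and> y \<cdot>\<^bsub>opp X\<^esub> g = f)"
    unfolding is_kernel_def by blast
  then show ?thesis unfolding is_cokernel_def opp_simps by blast
qed

text \<open>Fillers exist by the weak pushout property. Two of them differ by a map that kills
  \<open>x'\<close>, hence equals some \<open>g \<cdot> y'\<close>; as it also kills
  \<open>b\<close>, \<open>g \<cdot> y = 0\<close>, and \<open>y\<close> is epic.\<close>

lemma pushout:
  assumes T: "s_triangle X A B D x y \<delta>" and a: "a \<in> Mor X A A'"
  shows "\<exists>x' a' y' B' \<delta>'. is_pushout X x a x' a' \<and> s_triangle X A' B' D x' y' \<delta>'"
proof -
  note t = s_triangleD[OF T]
  obtain B' x' y' b where T': "s_triangle X A' B' D x' y' (push X D a \<delta>)" and b: "b \<in> Mor X B B'"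
    "b \<cdot> x = x' \<cdot> a" "y' \<cdot> b = y"
    "\<forall>W. \<forall>u \<in> Mor X B W. \<forall>v \<in> Mor X A' W. u \<cdot> x = v \<cdot> a \<longrightarrow> (\<exists>w \<in> Mor X B' W. w \<cdot> b = u \<and> w \<cdot> x' = v)"
    using pushout_ex[OF T a] by blast
  note t' = s_triangleD[OF T']
  have uniq: "w = w'" if w: "w \<in> Mor X B' W" "w' \<in> Mor X B' W" "w \<cdot> b = w' \<cdot> b" "w \<cdot> x' = w' \<cdot> x'" for w w' W
  proof -
    have ty: "w \<in> Ar X" "Dom X w = B'" "Cod X w = W" "w' \<in> Ar X" "Dom X w' = B'" "Cod X w' = W"
      "b \<in> Ar X" "Dom X b = B" "Cod X b = B'" "W \<in> Ob X"
      using w(1,2) b(1) Mor_Ob[OF w(1)] by (simp_all add: Mor_def)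
    have n: "w \<boxplus> Neg X w' \<in> Mor X B' W" using ty by (simp add: Mor_def)
    have "(w \<boxplus> Neg X w') \<cdot> x' = Zero X A' W" using ty t'(1-9) w(4) by simp
    then obtain g where g: "g \<in> Mor X D W" "g \<cdot> y' = w \<boxplus> Neg X w'" using tri_factor_right[OF T' n] by auto
    have tg: "g \<in> Ar X" "Dom X g = D" "Cod X g = W" using g(1) by (simp_all add: Mor_def)
    have "g \<cdot> y = (g \<cdot> y') \<cdot> b" unfolding b(3)[symmetric] using tg ty t'(1-9) by simp
    also have "\<dots> = Zero X B W" unfolding g(2) using ty w(3) by simp
    finally have "g = Zero X D W" by (rule epiD[OF defl_epi[OF T] t(13) g(1)])
    then have "w \<boxplus> Neg X w' = Zero X B' W" using g(2) t'(1-9) ty by simp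
    then show ?thesis using eq_iff_diff_zero[OF w(1,2)] by simp
  qed
  have "is_pushout X x a x' b"
    unfolding is_pushout_def
  proof (intro exI conjI allI ballI impI)
    fix W u v assume "u \<in> Mor X B W" "v \<in> Mor X A' W" "u \<cdot> x = v \<cdot> a"
    then obtain w where "w \<in> Mor X B' W" "w \<cdot> b = u" "w \<cdot> x' = v" using b(4) by blast
    then show "\<exists>!w. w \<in> Mor X B' W \<and> w \<cdot> b = u \<and> w \<cdot> x' = v" using uniq by metis
  qed (use t t' a b in auto)
  then show ?thesis using T' by blast
qed

lemma pullback:
  assumes T: "s_triangle X A B D x y \<delta>" and d: "d \<in> Mor X D' D"
  shows "\<exists>y' d' x' B' \<delta>'. is_pullback X y d y' d' \<and> s_triangle X A B' D' x' y' \<delta>'"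
proof -
  interpret O: exact_extriangulated "opp X" by (rule exact_opp)
  obtain y' d' x' B' \<delta>' where *: "is_pushout (opp X) y d y' d'" "s_triangle X A B' D' x' y' \<delta>'"
    using O.pushout[of D B A y x \<delta> d D'] T d by auto
  then have "is_pullback X y d y' d'" unfolding is_pushout_def is_pullback_def opp_simps by blast
  then show ?thesis using * by blast
qed

lemma exact_structure: "exact_structure X (conflations X)"
proof (unfold_locales, goal_cases)
  case (1 i p) then show ?case using kernel cokernel by (auto simp: conflations_def)
next
  case (2 i p A B D i' A' B' p' D' a b d)
  then obtain \<delta> where T: "s_triangle X A B D i p \<delta>"
    by (auto simp: conflations_def s_triangle_def Mor_def)
  note t = s_triangleD[OF T]
  have M: "a \<in> Mor X A A'" "b \<in> Mor X B B'" "d \<in> Mor X D D'" using 2 by (auto simp: is_iso_def)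
  obtain d' where d': "d' \<in> Mor X D' D" "d' \<cdot> d = Idn X D" "d \<cdot> d' = Idn X D'" using 2(8) by (auto elim: is_isoE)
  \<comment> \<open>The class for the new ends: \<open>\<delta>\<close> transported along
    \<open>a\<close> and along the inverse of \<open>d\<close>.\<close>
  let ?\<delta> = "pull X A' d' (push X D a \<delta>)"
  have pc: "push X D a \<delta> \<in> carrier (Ext X D A')" by (rule push_closed[OF t(10,3) M(1)])
  have A': "A' \<in> Ob X" using Mor_Ob[OF M(1)] by simp
  have c: "?\<delta> \<in> carrier (Ext X D' A')" by (rule pull_closed[OF pc A' d'(1)])
  have "pull X A' d ?\<delta> = push X D a \<delta>" using pull_pull[OF pc A' d'(1) M(3)] d'(2) pc A' t(3) by simp
  then have "s_triangle X A' B' D' i' p' ?\<delta>" using tri_iso[OF T 2(6-8) 2(4,5) c 2(9,10)] by simp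
  then show ?case by (auto simp: conflations_def)
next
  case (3 A)
  obtain Z where "zero_object X Z" using zero_object_exists by auto
  from conflationsI[OF s_zero[OF biproduct_zero_right[OF 3 this]]] show ?case by blast
next
  case (4 A)
  obtain Z where "zero_object X Z" using zero_object_exists by auto
  from conflationsI[OF s_zero[OF biproduct_zero_left[OF 4 this]]] show ?case by blast
next
  case (5 i p i' p')
  then obtain A B D \<delta> B' C F \<delta>' where T: "s_triangle X A B D i p \<delta>" "s_triangle X B' C F i' p' \<delta>'"
    by (auto simp: conflations_def)
  have "B' = B" using 5(3) s_triangleD[OF T(1)] s_triangleD[OF T(2)] by simp
  then obtain E h' \<delta>'' where "s_triangle X A C E (i' \<cdot> i) h' \<delta>''"
    using ET4[OF T(1), of C F i' p' \<delta>'] T(2) by auto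
  from conflationsI[OF this] show ?case by blast
next
  case (6 i p i' p')
  then obtain F C B \<delta> D B' A \<delta>' where T: "s_triangle X F C B i p \<delta>" "s_triangle X D B' A i' p' \<delta>'"
    by (auto simp: conflations_def)
  have "B' = B" using 6(3) s_triangleD[OF T(1)] s_triangleD[OF T(2)] by simp
  then obtain E h' \<delta>'' where "s_triangle X E C A h' (p' \<cdot> p) \<delta>''"
    using ET4op[of D B A i' p' \<delta>' F C i p \<delta>] T by auto
  from conflationsI[OF this] show ?case by blast
next
  case (7 i p f)
  then obtain A B D \<delta> where T: "s_triangle X A B D i p \<delta>" by (auto simp: conflations_def)
  have "f \<in> Mor X A (Cod X f)" using 7 s_triangleD[OF T] by (auto simp: Mor_def)
  from pushout[OF T this] obtain x' a' y' B' \<delta>'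
    where "is_pushout X i f x' a'" "s_triangle X (Cod X f) B' D x' y' \<delta>'" by auto
  then show ?case using conflationsI[of X "Cod X f" B' D x' y' \<delta>'] by blast
next
  case (8 i p f)
  then obtain A B D \<delta> where T: "s_triangle X A B D i p \<delta>" by (auto simp: conflations_def)
  have "f \<in> Mor X (Dom X f) D" using 8 s_triangleD[OF T] by (auto simp: Mor_def)
  from pullback[OF T this] obtain y' d' x' B' \<delta>'
    where "is_pullback X p f y' d'" "s_triangle X A B' (Dom X f) x' y' \<delta>'" by auto
  then show ?case using conflationsI[of X A B' "Dom X f" x' y' \<delta>'] by blast
qed

text \<open>ET3 promises some third component; it equals \<open>d\<close> because the deflation
  \<open>y\<close> is epic. Hence a class is determined by its sequence, which underlies the
  comparison with Yoneda extensions.\<close>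

lemma tri_eq_of_morphism:
  assumes T: "s_triangle X A B D x y \<delta>" and T': "s_triangle X A' B' D' x' y' \<delta>'"
    and a: "a \<in> Mor X A A'" "d \<in> Mor X D D'" "b \<in> Mor X B B'" "b \<cdot> x = x' \<cdot> a" "y' \<cdot> b = d \<cdot> y"
  shows "push X D a \<delta> = pull X A' d \<delta>'"
proof -
  note t = s_triangleD[OF T]
  obtain d0 where d0: "d0 \<in> Mor X D D'" "d0 \<cdot> y = y' \<cdot> b" "push X D a \<delta> = pull X A' d0 \<delta>'"
    using ET3[OF T T' a(1,3,4)] by auto
  have "d0 \<cdot> y = d \<cdot> y" using d0 a by simp
  then have "d0 = d" using defl_epi[OF T] d0(1) a(2) t unfolding epi_arr_def by auto
  then show ?thesis using d0 by simp
qed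

lemma conflationE:
  assumes "(x, y) \<in> conflations X" "(x, y) \<in> seqs X A D"
  obtains B \<delta> where "s_triangle X A B D x y \<delta>"
proof -
  obtain A' B D' \<delta> where T: "s_triangle X A' B D' x y \<delta>" using assms by (auto simp: conflations_def)
  have "A' = A" "D' = D" using s_triangleD[OF T] assms(2) by (auto simp: seqs_def Mor_def)
  then show thesis using T that by auto
qed

lemma tri_conflation:
  assumes "s_triangle X A B D x y \<delta>"
  shows "(x, y) \<in> conflations X \<inter> seqs X A D"
  using assms s_triangleD[OF assms] by (auto simp: conflations_def seqs_def)

text \<open>By \<open>tri_eq_of_morphism\<close> the two morphisms of conflations force the class of
  every extension produced to be \<open>Emap X d a \<delta>\<close>. Stated for a nonempty subset of
  the class, because the Baer sum applies it to one direct-sum sequence.\<close>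

lemma yoneda_map_eq:
  assumes \<delta>: "\<delta> \<in> carrier (Ext X D A)" and d: "d \<in> Mor X D' D" and a: "a \<in> Mor X A A'"
    and \<xi>: "\<xi> \<subseteq> Real X D A \<delta>" "\<xi> \<noteq> {}"
  shows "yoneda_map X (conflations X) d a \<xi> = Real X D' A' (Emap X d a \<delta>)"
proof -
  have O: "A \<in> Ob X" "A' \<in> Ob X" "D \<in> Ob X" "D' \<in> Ob X" using Mor_Ob[OF d] Mor_Ob[OF a] by auto
  have ty: "d \<in> Ar X" "Dom X d = D'" "Cod X d = D" "a \<in> Ar X" "Dom X a = A" "Cod X a = A'"
    using d a by (auto simp: Mor_def)
  have pc: "push X D a \<delta> \<in> carrier (Ext X D A')" by (rule push_closed[OF \<delta> O(3) a])
  have ec: "Emap X d a \<delta> \<in> carrier (Ext X D' A')" by (rule Emap_closed[OF \<delta> d a])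
  have idm: "Idn X A' \<in> Mor X A' A'" "Idn X D \<in> Mor X D D" using O id_Mor by auto
  show ?thesis
  proof (rule subset_antisym; rule subrelI)
    fix x' y' assume "(x', y') \<in> yoneda_map X (conflations X) d a \<xi>"
    then obtain x y x'' y'' b b' where *: "(x', y') \<in> conflations X" "(x', y') \<in> seqs X A' D'"
      "(x, y) \<in> \<xi>" "(x'', y'') \<in> conflations X" "(x'', y'') \<in> seqs X A' D"
      "b \<in> Mor X (Cod X x) (Cod X x'')" "b \<cdot> x = x'' \<cdot> a" "y'' \<cdot> b = y"
      "b' \<in> Mor X (Cod X x') (Cod X x'')" "b' \<cdot> x' = x''" "y'' \<cdot> b' = d \<cdot> y'"
      unfolding yoneda_map_def ty by blast
    obtain B where T: "s_triangle X A B D x y \<delta>" using Real_tri[of x y D A \<delta>] *(3) \<xi> \<delta> O by auto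
    obtain B'' \<delta>'' where T'': "s_triangle X A' B'' D x'' y'' \<delta>''" by (rule conflationE[OF *(4,5)])
    obtain B' \<delta>' where T': "s_triangle X A' B' D' x' y' \<delta>'" by (rule conflationE[OF *(1,2)])
    note t = s_triangleD[OF T] s_triangleD[OF T'] s_triangleD[OF T'']
    have "push X D a \<delta> = pull X A' (Idn X D) \<delta>''"
      by (rule tri_eq_of_morphism[OF T T'' a idm(2), of b]) (use * t in simp_all)
    then have 1: "\<delta>'' = push X D a \<delta>" using t O by simp
    have "push X D' (Idn X A') \<delta>' = pull X A' d \<delta>''"
      by (rule tri_eq_of_morphism[OF T' T'' idm(1) d, of b']) (use * t in simp_all)
    then have "\<delta>' = Emap X d a \<delta>" unfolding 1 using t O push_pull(2)[OF \<delta> d a] by simp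
    then show "(x', y') \<in> Real X D' A' (Emap X d a \<delta>)" using t by simp
  next
    fix x' y' assume "(x', y') \<in> Real X D' A' (Emap X d a \<delta>)"
    then obtain B' where T': "s_triangle X A' B' D' x' y' (Emap X d a \<delta>)" using Real_tri ec O by blast
    obtain x y where xy: "(x, y) \<in> \<xi>" using \<xi>(2) by auto
    then obtain B where T: "s_triangle X A B D x y \<delta>" using Real_tri[of x y D A \<delta>] \<xi> \<delta> O by auto
    obtain B'' x'' y'' where T'': "s_triangle X A' B'' D x'' y'' (push X D a \<delta>)"
      using tri_exists[OF pc O(3,2)] by auto
    note t = s_triangleD[OF T] s_triangleD[OF T'] s_triangleD[OF T'']
    have "\<exists>b \<in> Mor X B B''. b \<cdot> x = x'' \<cdot> a \<and> y'' \<cdot> b = Idn X D \<cdot> y"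
      by (rule realization[OF T T'' a idm(2)]) (use pc O in simp)
    moreover have "\<exists>b \<in> Mor X B' B''. b \<cdot> x' = x'' \<cdot> Idn X A' \<and> y'' \<cdot> b = d \<cdot> y'"
      by (rule realization[OF T' T'' idm(1) d]) (use ec O push_pull(2)[OF \<delta> d a] in simp)
    ultimately show "(x', y') \<in> yoneda_map X (conflations X) d a \<xi>"
      unfolding yoneda_map_def ty
      using tri_conflation[OF T] tri_conflation[OF T'] tri_conflation[OF T''] xy t
      by (intro CollectI case_prodI conjI exI[of _ x] exI[of _ y] exI[of _ x''] exI[of _ y'']) simp_all
  qed
qed

text \<open>By \<open>codiagonal_sum\<close> every choice of representatives and biproducts gives
  the same set; one existing choice yields the converse inclusion.\<close>

lemma baer_sum_eq:
  assumes O: "D \<in> Ob X" "A \<in> Ob X" and \<delta>: "\<delta> \<in> carrier (Ext X D A)" "\<delta>' \<in> carrier (Ext X D A)"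
  shows "baer_sum X (conflations X) D A (Real X D A \<delta>) (Real X D A \<delta>') = Real X D A (\<delta> \<otimes>\<^bsub>Ext X D A\<^esub> \<delta>')"
proof -
  have *: "yoneda_map X (conflations X) (k \<boxplus> k') (p \<boxplus> p')
      {(dsum X j j' p p' x x', dsum X k k' r r' y y')} = Real X D A (\<delta> \<otimes>\<^bsub>Ext X D A\<^esub> \<delta>')"
    if xy: "(x, y) \<in> Real X D A \<delta>" "(x', y') \<in> Real X D A \<delta>'"
      and bA: "biproduct X A A SA i i' p p'" and bB: "biproduct X (Cod X x) (Cod X x') SB j j' r r'"
      and bD: "biproduct X D D SD k k' q q'" for x y x' y' SA i i' p p' SB j j' r r' SD k k' q q'
  proof -
    obtain B where T: "s_triangle X A B D x y \<delta>" using Real_tri[OF xy(1) \<delta>(1) O] by auto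
    obtain B' where T': "s_triangle X A B' D x' y' \<delta>'" using Real_tri[OF xy(2) \<delta>(2) O] by auto
    have C: "Cod X x = B" "Cod X x' = B'" using s_triangleD[OF T] s_triangleD[OF T'] by auto
    note S = s_additive[OF T T' bA bB[unfolded C] bD]
    have M: "k \<boxplus> k' \<in> Mor X D SD" "p \<boxplus> p' \<in> Mor X SA A"
      using biproductD(1-15)[OF bA] biproductD(1-15)[OF bD] by (simp_all add: Mor_def)
    show ?thesis unfolding codiagonal_sum[OF bA bD \<delta>, symmetric]
      by (rule yoneda_map_eq[OF s_triangleD(10)[OF S] M]) (use s_triangleD(11)[OF S] in auto)
  qed
  obtain B x y where T: "s_triangle X A B D x y \<delta>" using tri_exists \<delta> O by blast
  obtain B' x' y' where T': "s_triangle X A B' D x' y' \<delta>'" using tri_exists \<delta> O by blast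
  note t = s_triangleD[OF T] and t' = s_triangleD[OF T']
  obtain SA i i' p p' where bA: "biproduct X A A SA i i' p p'" using biproduct_exists O by blast
  obtain SD k k' q q' where bD: "biproduct X D D SD k k' q q'" using biproduct_exists O by blast
  obtain SB j j' r r' where bB: "biproduct X B B' SB j j' r r'" using biproduct_exists t(2) t'(2) by blast
  have bB': "biproduct X (Cod X x) (Cod X x') SB j j' r r'" using bB t t' by simp
  show ?thesis
  proof (rule subset_antisym; rule subsetI)
    fix s assume "s \<in> baer_sum X (conflations X) D A (Real X D A \<delta>) (Real X D A \<delta>')"
    then show "s \<in> Real X D A (\<delta> \<otimes>\<^bsub>Ext X D A\<^esub> \<delta>')" unfolding baer_sum_def using * by blast
  next
    fix s assume "s \<in> Real X D A (\<delta> \<otimes>\<^bsub>Ext X D A\<^esub> \<delta>')"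
    then have "s \<in> yoneda_map X (conflations X) (k \<boxplus> k') (p \<boxplus> p')
      {(dsum X j j' p p' x x', dsum X k k' r r' y y')}" using *[OF t(11) t'(11) bA bB' bD] by simp
    then show "s \<in> baer_sum X (conflations X) D A (Real X D A \<delta>) (Real X D A \<delta>')"
      unfolding baer_sum_def using t(11) t'(11) bA bB' bD by blast
  qed
qed

lemma Real_inj:
  assumes "D \<in> Ob X" "A \<in> Ob X" "\<delta> \<in> carrier (Ext X D A)" "\<delta>' \<in> carrier (Ext X D A)"
    "Real X D A \<delta> = Real X D A \<delta>'"
  shows "\<delta> = \<delta>'"
proof -
  obtain B x y where T: "s_triangle X A B D x y \<delta>" using tri_exists assms by blast
  then have T': "s_triangle X A B D x y \<delta>'" using assms by (simp add: s_triangle_def)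
  note t = s_triangleD[OF T]
  have "push X D (Idn X A) \<delta> = pull X A (Idn X D) \<delta>'"
    by (rule tri_eq_of_morphism[OF T T' id_Mor id_Mor id_Mor]) (use t in auto)
  then show ?thesis using assms by simp
qed

text \<open>The isomorphism with Yoneda extensions is \<open>Real\<close> itself, which sends a
  class to the set of its sequences.\<close>

theorem corresponds: "corresponds_to_exact X"
proof -
  let ?Y = "exact_extri X (conflations X)"
  have E: "Ext ?Y = yoneda_ext X (conflations X)" "Emap ?Y = yoneda_map X (conflations X)"
    "Real ?Y = (\<lambda>D A \<xi>. \<xi>)" by (simp_all add: exact_extri_def)
  have "Real X D A \<in> iso (Ext X D A) (yoneda_ext X (conflations X) D A)"
    if O: "D \<in> Ob X" "A \<in> Ob X" for D A
  proof -
    have cl: "Real X D A \<delta> \<in> carrier (yoneda_ext X (conflations X) D A)" if \<delta>: "\<delta> \<in> carrier (Ext X D A)" for \<delta>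
    proof -
      obtain B x y where T: "s_triangle X A B D x y \<delta>" using tri_exists \<delta> O by blast
      show ?thesis using tri_conflation[OF T] tri_Real_class[OF T] by (auto simp: yoneda_ext_def)
    qed
    interpret G: comm_group "Ext X D A" by (rule Ext_group[OF O])
    have "Real X D A \<in> hom (Ext X D A) (yoneda_ext X (conflations X) D A)"
    proof (rule homI)
      fix \<delta> \<delta>' assume "\<delta> \<in> carrier (Ext X D A)" "\<delta>' \<in> carrier (Ext X D A)"
      then show "Real X D A (\<delta> \<otimes>\<^bsub>Ext X D A\<^esub> \<delta>') =
          Real X D A \<delta> \<otimes>\<^bsub>yoneda_ext X (conflations X) D A\<^esub> Real X D A \<delta>'"
        using baer_sum_eq[OF O] by (simp add: yoneda_ext_def)
    qed (rule cl)
    moreover have "bij_betw (Real X D A) (carrier (Ext X D A)) (carrier (yoneda_ext X (conflations X) D A))"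
    proof (rule bij_betwI')
      fix \<xi> assume "\<xi> \<in> carrier (yoneda_ext X (conflations X) D A)"
      then obtain x y where xy: "(x, y) \<in> conflations X" "(x, y) \<in> seqs X A D" "\<xi> = seq_class X A D x y"
        by (auto simp: yoneda_ext_def)
      obtain B \<delta> where T: "s_triangle X A B D x y \<delta>" by (rule conflationE[OF xy(1,2)])
      then show "\<exists>\<delta> \<in> carrier (Ext X D A). \<xi> = Real X D A \<delta>"
        using tri_Real_class[OF T] xy(3) s_triangleD(10)[OF T] by auto
    qed (use Real_inj[OF O] cl in auto)
    ultimately show ?thesis by (simp add: iso_def)
  qed
  moreover have "Real X D' A' (Emap X d a \<delta>) = yoneda_map X (conflations X) d a (Real X D A \<delta>)"
    if "d \<in> Mor X D' D" "a \<in> Mor X A A'" "\<delta> \<in> carrier (Ext X D A)" for D D' A A' d a \<delta>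
  proof -
    have "Real X D A \<delta> \<noteq> {}" using tri_exists[OF that(3)] Mor_Ob[OF that(1)] Mor_Ob[OF that(2)]
      by (auto simp: s_triangle_def)
    then show ?thesis using yoneda_map_eq[OF that(3,1,2) order_refl] by simp
  qed
  ultimately show ?thesis unfolding corresponds_to_exact_def
    by (intro exI[of _ "conflations X"] exI[of _ "Real X"]) (simp add: exact_structure E)
qed

end

section \<open>Triangulated categories are extriangulated\<close>

lemma additive_functor_simps:
  assumes "additive_category C" "additive_category D" "additive_functor C D Fo Fa"
  shows "A \<in> Ob C \<Longrightarrow> Fo A \<in> Ob D"
    "f \<in> Ar C \<Longrightarrow> Fa f \<in> Ar D" "f \<in> Ar C \<Longrightarrow> Dom D (Fa f) = Fo (Dom C f)"
    "f \<in> Ar C \<Longrightarrow> Cod D (Fa f) = Fo (Cod C f)"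
    "A \<in> Ob C \<Longrightarrow> Fa (Idn C A) = Idn D (Fo A)"
    "f \<in> Ar C \<Longrightarrow> g \<in> Ar C \<Longrightarrow> Cod C f = Dom C g \<Longrightarrow> Fa (g \<cdot>\<^bsub>C\<^esub> f) = Fa g \<cdot>\<^bsub>D\<^esub> Fa f"
    "f \<in> Ar C \<Longrightarrow> g \<in> Ar C \<Longrightarrow> Dom C f = Dom C g \<Longrightarrow> Cod C f = Cod C g
      \<Longrightarrow> Fa (f \<boxplus>\<^bsub>C\<^esub> g) = Fa f \<boxplus>\<^bsub>D\<^esub> Fa g"
    "A \<in> Ob C \<Longrightarrow> B \<in> Ob C \<Longrightarrow> Fa (Zero C A B) = Zero D (Fo A) (Fo B)"
    "f \<in> Ar C \<Longrightarrow> Fa (Neg C f) = Neg D (Fa f)"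
proof -
  interpret C: additive_category C by fact
  interpret D: additive_category D by fact
  have F: "is_functor C D Fo Fa"
    and H: "A \<in> Ob C \<Longrightarrow> B \<in> Ob C \<Longrightarrow> Fa \<in> hom (Homg C A B) (Homg D (Fo A) (Fo B))" for A B
    using assms(3) by (auto simp: additive_functor_def)
  show Ob: "A \<in> Ob C \<Longrightarrow> Fo A \<in> Ob D" and "A \<in> Ob C \<Longrightarrow> Fa (Idn C A) = Idn D (Fo A)" for A
    using F by (auto simp: is_functor_def)
  have M: "f \<in> Mor C A B \<Longrightarrow> Fa f \<in> Mor D (Fo A) (Fo B)" for f A B
    using F by (auto simp: is_functor_def)
  show Ar: "f \<in> Ar C \<Longrightarrow> Fa f \<in> Ar D" "f \<in> Ar C \<Longrightarrow> Dom D (Fa f) = Fo (Dom C f)"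
    "f \<in> Ar C \<Longrightarrow> Cod D (Fa f) = Fo (Cod C f)" for f
    using M[of f "Dom C f" "Cod C f"] by (simp_all add: Mor_def)
  show "f \<in> Ar C \<Longrightarrow> g \<in> Ar C \<Longrightarrow> Cod C f = Dom C g \<Longrightarrow> Fa (g \<cdot>\<^bsub>C\<^esub> f) = Fa g \<cdot>\<^bsub>D\<^esub> Fa f"
    using F C.Mor_Ar[of f] C.Mor_Ar[of g] unfolding is_functor_def by metis
  show add: "f \<in> Ar C \<Longrightarrow> g \<in> Ar C \<Longrightarrow> Dom C f = Dom C g \<Longrightarrow> Cod C f = Cod C g
      \<Longrightarrow> Fa (f \<boxplus>\<^bsub>C\<^esub> g) = Fa f \<boxplus>\<^bsub>D\<^esub> Fa g" for f g
    using H[of "Dom C g" "Cod C g"] by (auto simp: hom_def Mor_def)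
  show zero: "A \<in> Ob C \<Longrightarrow> B \<in> Ob C \<Longrightarrow> Fa (Zero C A B) = Zero D (Fo A) (Fo B)" for A B
    using add[of "Zero C A B" "Zero C A B"] M[of "Zero C A B" A B]
    by (intro D.idem_zero) (simp_all add: Mor_def)
  show "f \<in> Ar C \<Longrightarrow> Fa (Neg C f) = Neg D (Fa f)"
    using add[of f "Neg C f"] zero[of "Dom C f" "Cod C f"] Ar[of f] Ar[of "Neg C f"]
    by (intro D.neg_unique[symmetric, of _ "Fo (Dom C f)" "Fo (Cod C f)"]) (auto simp: Mor_def)
qed

context triangulated_category
begin

lemmas shift_simps [simp] = additive_functor_simps[OF additive_category_axioms additive_category_axioms shift_functor]
lemmas unshift_simps [simp] = additive_functor_simps[OF additive_category_axioms additive_category_axioms unshift_functor]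

lemma unshift_shift [simp]:
  "A \<in> Ob T \<Longrightarrow> UnO T (ShO T A) = A" "A \<in> Ob T \<Longrightarrow> ShO T (UnO T A) = A"
  "f \<in> Ar T \<Longrightarrow> UnA T (ShA T f) = f" "f \<in> Ar T \<Longrightarrow> ShA T (UnA T f) = f"
  using shift_inverse_Ob shift_inverse_Ar by auto

lemma triangleD:
  assumes "triangle T A B D f g h"
  shows "f \<in> Ar T" "Dom T f = A" "Cod T f = B" "g \<in> Ar T" "Dom T g = B" "Cod T g = D"
    "h \<in> Ar T" "Dom T h = D" "Cod T h = ShO T A" "A \<in> Ob T" "B \<in> Ob T" "D \<in> Ob T"
    "f \<in> Mor T A B" "g \<in> Mor T B D" "h \<in> Mor T D (ShO T A)"
proof -
  show M: "f \<in> Mor T A B" "g \<in> Mor T B D" "h \<in> Mor T D (ShO T A)"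
    using assms by (auto simp: triangle_def)
  show "A \<in> Ob T" "B \<in> Ob T" "D \<in> Ob T" using Mor_Ob[OF M(1)] Mor_Ob[OF M(2)] by auto
  show "f \<in> Ar T" "Dom T f = A" "Cod T f = B" "g \<in> Ar T" "Dom T g = B" "Cod T g = D"
    "h \<in> Ar T" "Dom T h = D" "Cod T h = ShO T A" using M by (auto simp: Mor_def)
qed

lemma rotate:
  assumes "triangle T A B D f g h"
  shows "triangle T B D (ShO T A) g h (Neg T (ShA T f))"
  using TR2 triangleD(13-15)[OF assms] assms by blast

text \<open>TR3 fills the third map only. After two rotations the missing map is the third one,
  between the suspensions; it is desuspended, and the rotation signs cancel.\<close>

lemma fill_middle:
  assumes T1: "triangle T A B D f g h" and T2: "triangle T A' B' D' f' g' h'"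
    and a: "a \<in> Mor T A A'" and d: "d \<in> Mor T D D'" and e: "ShA T a \<cdot> h = h' \<cdot> d"
  shows "\<exists>b \<in> Mor T B B'. b \<cdot> f = f' \<cdot> a \<and> g' \<cdot> b = d \<cdot> g"
proof -
  note t1 = triangleD[OF T1] and t2 = triangleD[OF T2]
  have ty: "a \<in> Ar T" "Dom T a = A" "Cod T a = A'" "d \<in> Ar T" "Dom T d = D" "Cod T d = D'"
    using a d by (auto simp: Mor_def)
  have "\<exists>b \<in> Mor T (ShO T B) (ShO T B'). b \<cdot> Neg T (ShA T f) = Neg T (ShA T f') \<cdot> ShA T a \<and>
      ShA T d \<cdot> Neg T (ShA T g) = Neg T (ShA T g') \<cdot> b"
    by (rule TR3[OF rotate[OF rotate[OF T1]] rotate[OF rotate[OF T2]] d _ e]) (use ty in \<open>simp add: Mor_def\<close>)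
  then obtain b where b: "b \<in> Mor T (ShO T B) (ShO T B')"
    "b \<cdot> Neg T (ShA T f) = Neg T (ShA T f') \<cdot> ShA T a" "ShA T d \<cdot> Neg T (ShA T g) = Neg T (ShA T g') \<cdot> b"
    by auto
  have tb: "b \<in> Ar T" "Dom T b = ShO T B" "Cod T b = ShO T B'" using b by (auto simp: Mor_def)
  have "Neg T (b \<cdot> ShA T f) = Neg T (ShA T f' \<cdot> ShA T a)" using b(2) tb ty t1(1-9) t2(1-9) by simp
  then have "Neg T (Neg T (b \<cdot> ShA T f)) = Neg T (Neg T (ShA T f' \<cdot> ShA T a))" by simp
  then have "b \<cdot> ShA T f = ShA T f' \<cdot> ShA T a" using tb ty t1(1-9) t2(1-9) by simp
  then have "UnA T (b \<cdot> ShA T f) = UnA T (ShA T f' \<cdot> ShA T a)" by simp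
  then have 1: "UnA T b \<cdot> f = f' \<cdot> a" using tb ty t1(1-9) t2(1-9) by simp
  have "Neg T (ShA T d \<cdot> ShA T g) = Neg T (ShA T g' \<cdot> b)" using b(3) tb ty t1(1-9) t2(1-9) by simp
  then have "Neg T (Neg T (ShA T d \<cdot> ShA T g)) = Neg T (Neg T (ShA T g' \<cdot> b))" by simp
  then have "ShA T d \<cdot> ShA T g = ShA T g' \<cdot> b" using tb ty t1(1-9) t2(1-9) by simp
  then have "UnA T (ShA T d \<cdot> ShA T g) = UnA T (ShA T g' \<cdot> b)" by simp
  then have 2: "g' \<cdot> UnA T b = d \<cdot> g" using tb ty t1(1-9) t2(1-9) by simp
  show ?thesis using 1 2 tb t1 t2 by (intro bexI[of _ "UnA T b"]) (auto simp: Mor_def)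
qed

lemma triangle_comp:
  assumes "triangle T A B D f g h"
  shows "g \<cdot> f = Zero T A D"
proof -
  note t = triangleD[OF assms]
  obtain Z where Z: "zero_object T Z" using zero_object_exists by auto
  have "\<exists>d \<in> Mor T Z D. d \<cdot> Zero T A Z = g \<cdot> f \<and> ShA T (Idn T A) \<cdot> Zero T Z (ShO T A) = h \<cdot> d"
    by (rule TR3[OF TR1_id[OF t(10) Z] assms]) (use t in \<open>auto simp: Mor_def\<close>)
  then show ?thesis using t zero_object_id[OF Z] by (auto simp: Mor_def)
qed

text \<open>TR3 maps the triangle to \<open>0 \<rightarrow> W \<rightarrow> W\<close>, a rotation of
  the triangle on an identity.\<close>

lemma triangle_right:
  assumes tr: "triangle T A B D f g h" and u: "u \<in> Mor T B W" "u \<cdot> f = Zero T A W"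
  shows "\<exists>v \<in> Mor T D W. v \<cdot> g = u"
proof -
  note t = triangleD[OF tr]
  obtain Z where Z: "zero_object T Z" using zero_object_exists by auto
  have O: "W \<in> Ob T" "Z \<in> Ob T" using Mor_Ob[OF u(1)] zero_object_id[OF Z] by auto
  have "triangle T (UnO T Z) W W (Zero T (UnO T Z) W) (Idn T W) (Zero T W Z)"
    using TR2[of "Zero T (UnO T Z) W" "UnO T Z" W "Idn T W" W "Zero T W Z"] TR1_id[OF O(1) Z] O
    by (simp add: Mor_def)
  from TR3[OF tr this _ u(1), of "Zero T A (UnO T Z)"] show ?thesis
    using t O u by (auto simp: Mor_def)
qed

lemma triangle_left:
  assumes tr: "triangle T A B D f g h" and u: "u \<in> Mor T W B" "g \<cdot> u = Zero T W D"
  shows "\<exists>v \<in> Mor T W A. f \<cdot> v = u"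
proof -
  note t = triangleD[OF tr]
  obtain Z where Z: "zero_object T Z" using zero_object_exists by auto
  have O: "W \<in> Ob T" "Z \<in> Ob T" using Mor_Ob[OF u(1)] zero_object_id[OF Z] by auto
  have ty: "u \<in> Ar T" "Dom T u = W" "Cod T u = B" using u(1) by (auto simp: Mor_def)
  have "\<exists>b \<in> Mor T W A. b \<cdot> Idn T W = Idn T A \<cdot> b \<and> f \<cdot> b = u"
  proof -
    have "\<exists>d \<in> Mor T (ShO T W) (ShO T A). d \<cdot> Zero T Z (ShO T W) = h \<cdot> Zero T Z D \<and>
       ShA T u \<cdot> Neg T (ShA T (Idn T W)) = Neg T (ShA T f) \<cdot> d"
      by (rule TR3[OF rotate[OF TR1_id[OF O(1) Z]] rotate[OF tr] u(1)])
        (use t O ty u in \<open>auto simp: Mor_def\<close>)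
    then obtain d where d: "d \<in> Mor T (ShO T W) (ShO T A)"
      "ShA T u \<cdot> Neg T (ShA T (Idn T W)) = Neg T (ShA T f) \<cdot> d" by auto
    have td: "d \<in> Ar T" "Dom T d = ShO T W" "Cod T d = ShO T A" using d(1) by (auto simp: Mor_def)
    have "Neg T (ShA T u) = Neg T (ShA T f \<cdot> d)" using d(2) td ty t(1-12) O by simp
    then have "Neg T (Neg T (ShA T u)) = Neg T (Neg T (ShA T f \<cdot> d))" by simp
    then have "ShA T u = ShA T f \<cdot> d" using td ty t(1-12) O by simp
    then have "UnA T (ShA T u) = UnA T (ShA T f \<cdot> d)" by simp
    then have "u = f \<cdot> UnA T d" using td ty t(1-12) O by simp
    then show ?thesis using td O t by (intro bexI[of _ "UnA T d"]) (auto simp: Mor_def)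
  qed
  then show ?thesis by auto
qed

lemma triangle_endo:
  assumes tr: "triangle T A B D f g h" "n \<in> Mor T B B" "n \<cdot> f = Zero T A B" "g \<cdot> n = Zero T B D"
  shows "n \<cdot> n = Zero T B B"
proof -
  note t = triangleD[OF tr(1)]
  obtain v where v: "v \<in> Mor T B A" "f \<cdot> v = n" using triangle_left[OF tr(1,2,4)] by auto
  have "n \<cdot> n = (n \<cdot> f) \<cdot> v" using v(1) v(2)[symmetric] tr(2) t(1-12) by (simp add: Mor_def)
  also have "\<dots> = Zero T B B" unfolding tr(3) using v t by (simp add: Mor_def)
  finally show ?thesis .
qed

text \<open>The lower row enters only through \<open>E\<close>, so the lemma applies to split
  sequences and direct sums before they are known to be triangles.\<close>

lemma triangle_middle_iso:
  assumes T1: "triangle T A B D f g h" and b: "b \<in> Mor T B B'" "c \<in> Mor T B' B"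
    and e: "b \<cdot> f = f'" "g' \<cdot> b = g" "c \<cdot> f' = f" "g \<cdot> c = g'"
    and ty': "f' \<in> Mor T A B'" "g' \<in> Mor T B' D"
    and E: "\<And>n. n \<in> Mor T B' B' \<Longrightarrow> n \<cdot> f' = Zero T A B' \<Longrightarrow> g' \<cdot> n = Zero T B' D \<Longrightarrow> n \<cdot> n = Zero T B' B'"
  shows "is_iso T b B B'"
proof -
  note t = triangleD[OF T1]
  have ty: "b \<in> Ar T" "Dom T b = B" "Cod T b = B'" "c \<in> Ar T" "Dom T c = B'" "Cod T c = B"
    "f' \<in> Ar T" "Dom T f' = A" "Cod T f' = B'" "g' \<in> Ar T" "Dom T g' = B'" "Cod T g' = D" "B' \<in> Ob T"
    using b ty' Mor_Ob[OF b(1)] by (auto simp: Mor_def)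
  have "(c \<cdot> b) \<cdot> f = c \<cdot> (b \<cdot> f)" using ty t(1-12) by simp
  then have 1: "(c \<cdot> b) \<cdot> f = f" by (simp only: e)
  have "g \<cdot> (c \<cdot> b) = (g \<cdot> c) \<cdot> b" using ty t(1-12) by simp
  then have 2: "g \<cdot> (c \<cdot> b) = g" by (simp only: e)
  have "(b \<cdot> c) \<cdot> f' = b \<cdot> (c \<cdot> f')" using ty t(1-12) by simp
  then have 3: "(b \<cdot> c) \<cdot> f' = f'" by (simp only: e)
  have "g' \<cdot> (b \<cdot> c) = (g' \<cdot> b) \<cdot> c" using ty t(1-12) by simp
  then have 4: "g' \<cdot> (b \<cdot> c) = g'" by (simp only: e)
  show ?thesis
  proof (rule iso_of_unipotent[OF b])
    show "((c \<cdot> b) \<boxplus> Neg T (Idn T B)) \<cdot> ((c \<cdot> b) \<boxplus> Neg T (Idn T B)) = Zero T B B"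
      by (rule triangle_endo[OF T1]) (use 1 2 ty t(1-12) in \<open>simp_all add: Mor_def\<close>)
    show "((b \<cdot> c) \<boxplus> Neg T (Idn T B')) \<cdot> ((b \<cdot> c) \<boxplus> Neg T (Idn T B')) = Zero T B' B'"
      by (rule E) (use 3 4 ty t(1-12) in \<open>simp_all add: Mor_def\<close>)
  qed
qed

lemma triangle_unique:
  assumes T1: "triangle T A B D f g h" and T2: "triangle T A B' D f' g' h"
  shows "\<exists>b. is_iso T b B B' \<and> b \<cdot> f = f' \<and> g' \<cdot> b = g"
proof -
  note t1 = triangleD[OF T1] and t2 = triangleD[OF T2]
  have *: "\<exists>b \<in> Mor T B B'. b \<cdot> f = f' \<and> g' \<cdot> b = g"
    if T1: "triangle T A B D f g h" and T2: "triangle T A B' D f' g' h" for B B' f f' g g'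
  proof -
    note t1 = triangleD[OF T1] and t2 = triangleD[OF T2]
    have "\<exists>b \<in> Mor T B B'. b \<cdot> f = f' \<cdot> Idn T A \<and> g' \<cdot> b = Idn T D \<cdot> g"
      by (rule fill_middle[OF T1 T2 id_Mor id_Mor]) (use t1(1-12) t2(1-12) in simp_all)
    then show ?thesis using t1 t2 by simp
  qed
  obtain b where b: "b \<in> Mor T B B'" "b \<cdot> f = f'" "g' \<cdot> b = g" using *[OF T1 T2] by auto
  obtain c where c: "c \<in> Mor T B' B" "c \<cdot> f' = f" "g \<cdot> c = g'" using *[OF T2 T1] by auto
  have "is_iso T b B B'"
    by (rule triangle_middle_iso[OF T1 b(1) c(1) b(2,3) c(2,3) t2(13,14) triangle_endo[OF T2]])
  then show ?thesis using b by auto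
qed

text \<open>A cone of \<open>-h[-1]\<close>, rotated once; the sign of the rotation cancels the one
  put in.\<close>

lemma triangle_realize:
  assumes "h \<in> Mor T D (ShO T A)" "A \<in> Ob T"
  shows "\<exists>B f g. triangle T A B D f g h"
proof -
  have ty: "h \<in> Ar T" "Dom T h = D" "Cod T h = ShO T A" "D \<in> Ob T"
    using assms Mor_Ob[OF assms(1)] by (auto simp: Mor_def)
  have "UnA T (Neg T h) \<in> Mor T (UnO T D) A" using ty assms by (simp add: Mor_def)
  from TR1_cone[OF this] obtain B f g where
    tr: "triangle T (UnO T D) A B (UnA T (Neg T h)) f g" by auto
  have "triangle T A B (ShO T (UnO T D)) f g (Neg T (ShA T (UnA T (Neg T h))))" by (rule rotate[OF tr])
  then show ?thesis using ty by auto
qed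

text \<open>Some triangle has zero third map. That zero yields a section of \<open>y\<close> and a
  retraction of \<open>x\<close>, which provide comparison maps with the biproduct.\<close>

lemma triangle_split:
  assumes "biproduct T A D S i j p q"
  shows "triangle T A S D i q (Zero T D (ShO T A))"
proof -
  note b = biproductD[OF assms] biproduct_reassoc[OF assms]
  obtain Z where Z: "zero_object T Z" using zero_object_exists by auto
  have ZO: "Z \<in> Ob T" "Idn T Z = Zero T Z Z" using zero_object_id[OF Z] by auto
  obtain B x y where tr: "triangle T A B D x y (Zero T D (ShO T A))"
    using triangle_realize[of "Zero T D (ShO T A)" D A] b(1-2) by (auto simp: Mor_def)
  note t = triangleD[OF tr]
  obtain s where s: "s \<in> Mor T D B" "y \<cdot> s = Idn T D"
    using triangle_left[OF rotate[OF tr], of "Idn T D" D] b(1,2) by (auto simp: Mor_def)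
  have "\<exists>r \<in> Mor T B A. r \<cdot> x = Idn T A \<cdot> Idn T A \<and> Zero T A Z \<cdot> r = Zero T D Z \<cdot> y"
    by (rule fill_middle[OF tr TR1_id[OF b(1) Z]]) (use b(1,2) ZO in \<open>simp_all add: Mor_def\<close>)
  then obtain r where r: "r \<in> Mor T B A" "r \<cdot> x = Idn T A" using b(1) by auto
  have ty: "s \<in> Ar T" "Dom T s = D" "Cod T s = B" "r \<in> Ar T" "Dom T r = B" "Cod T r = A"
    using s r by (auto simp: Mor_def)
  have z: "y \<cdot> x = Zero T A D" by (rule triangle_comp[OF tr])
  have z': "y \<cdot> x \<cdot> v = Zero T (Dom T v) D" if "v \<in> Ar T" "Cod T v = A" for v
    using reassoc[OF z, of v] that t(1-12) by simp
  have sv: "y \<cdot> s \<cdot> v = v" if "v \<in> Ar T" "Cod T v = D" for v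
    using reassoc[OF s(2), of v] that t(1-12) ty by simp
  have rv: "r \<cdot> x \<cdot> v = v" if "v \<in> Ar T" "Cod T v = A" for v
    using reassoc[OF r(2), of v] that t(1-12) ty by simp
  let ?b = "(i \<cdot> r) \<boxplus> (j \<cdot> y)" and ?c = "(x \<cdot> p) \<boxplus> (s \<cdot> q)"
  have e: "?b \<cdot> x = i" "q \<cdot> ?b = y" "?c \<cdot> i = x" "y \<cdot> ?c = q"
    using ty t(1-12) b(1-19) b(21-) r(2) s(2) z z' sv by simp_all
  have iso: "is_iso T ?b B S"
  proof (rule triangle_middle_iso[OF tr _ _ e])
    fix n assume n: "n \<in> Mor T S S" "n \<cdot> i = Zero T A S" "q \<cdot> n = Zero T S D"
    have tn: "n \<in> Ar T" "Dom T n = S" "Cod T n = S" using n(1) by (auto simp: Mor_def)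
    have "n = n \<cdot> (i \<cdot> p \<boxplus> j \<cdot> q)" using tn b(20) by simp
    also have "\<dots> = (n \<cdot> i) \<cdot> p \<boxplus> (n \<cdot> j) \<cdot> q" using tn b(1-15) by simp
    also have "\<dots> = (n \<cdot> j) \<cdot> q" unfolding n(2) using tn b(1-15) by simp
    finally have 1: "n = (n \<cdot> j) \<cdot> q" .
    have "n \<cdot> n = ((n \<cdot> j) \<cdot> q) \<cdot> n" by (subst 1) (rule refl)
    also have "\<dots> = (n \<cdot> j) \<cdot> (q \<cdot> n)" by (rule assoc) (use tn b(1-15) in simp_all)
    also have "\<dots> = Zero T S S" unfolding n(3) using tn b(1-15) by simp
    finally show "n \<cdot> n = Zero T S S" .
  qed (use ty t b in \<open>simp_all add: Mor_def\<close>)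
  show ?thesis
    by (rule TR1_iso[OF tr is_iso_id iso is_iso_id]) (use e b t in \<open>simp_all add: Mor_def\<close>)
qed

text \<open>The direct sum of the classes is realised by some triangle, and its middle term is
  compared with \<open>SB\<close> by maps filled in from and to each of the given triangles.\<close>

lemma triangle_dsum:
  assumes T1: "triangle T A B D x y h" and T2: "triangle T A' B' D' x' y' h'"
    and bA: "biproduct T A A' SA i i' p p'" and bB: "biproduct T B B' SB j j' r r'"
    and bD: "biproduct T D D' SD k k' q q'"
  shows "triangle T SA SB SD (dsum T j j' p p' x x') (dsum T k k' r r' y y')
     ((ShA T i \<cdot> h \<cdot> q) \<boxplus> (ShA T i' \<cdot> h' \<cdot> q'))" (is "triangle T SA SB SD ?x ?y ?h")
proof -
  note t = triangleD[OF T1] triangleD[OF T2]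
  note t = t(1-12) t(16-27)
  note A = biproductD[OF bA] biproduct_reassoc[OF bA] and B = biproductD[OF bB] biproduct_reassoc[OF bB]
    and D = biproductD[OF bD] biproduct_reassoc[OF bD]
  have shb: "ShA T p \<cdot> ShA T i = Idn T (ShO T A)" "ShA T p' \<cdot> ShA T i' = Idn T (ShO T A')"
    "ShA T p' \<cdot> ShA T i = Zero T (ShO T A) (ShO T A')" "ShA T p \<cdot> ShA T i' = Zero T (ShO T A') (ShO T A)"
    using A(1-19) by (simp_all flip: shift_simps(6))
  have shr: "ShA T p \<cdot> ShA T i \<cdot> v = v" "ShA T p' \<cdot> ShA T i \<cdot> v = Zero T (Dom T v) (ShO T A')"
    if "v \<in> Ar T" "Cod T v = ShO T A" for v
    using reassoc[OF shb(1), of v] reassoc[OF shb(3), of v] that A(1-15) by auto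
  have shr': "ShA T p' \<cdot> ShA T i' \<cdot> v = v" "ShA T p \<cdot> ShA T i' \<cdot> v = Zero T (Dom T v) (ShO T A)"
    if "v \<in> Ar T" "Cod T v = ShO T A'" for v
    using reassoc[OF shb(2), of v] reassoc[OF shb(4), of v] that A(1-15) by auto
  have hM: "?h \<in> Mor T SD (ShO T SA)" using t A(1-15) D(1-15) by (simp add: Mor_def)
  obtain E X Y where tr: "triangle T SA E SD X Y ?h" using triangle_realize[OF hM A(3)] by auto
  note e = triangleD(1-12)[OF tr]
  have "\<exists>b \<in> Mor T B E. b \<cdot> x = X \<cdot> i \<and> Y \<cdot> b = k \<cdot> y"
    by (rule fill_middle[OF T1 tr]) (use t A(1-15) D in \<open>simp_all add: Mor_def\<close>)
  then obtain b where b: "b \<in> Mor T B E" "b \<cdot> x = X \<cdot> i" "Y \<cdot> b = k \<cdot> y" by auto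
  have "\<exists>b \<in> Mor T B' E. b \<cdot> x' = X \<cdot> i' \<and> Y \<cdot> b = k' \<cdot> y'"
    by (rule fill_middle[OF T2 tr]) (use t A(1-15) D in \<open>simp_all add: Mor_def\<close>)
  then obtain b' where b': "b' \<in> Mor T B' E" "b' \<cdot> x' = X \<cdot> i'" "Y \<cdot> b' = k' \<cdot> y'" by auto
  have "\<exists>b \<in> Mor T E B. b \<cdot> X = x \<cdot> p \<and> y \<cdot> b = q \<cdot> Y"
    by (rule fill_middle[OF tr T1]) (use t A(1-15) D(1-15) shr shr' in \<open>simp_all add: Mor_def\<close>)
  then obtain c where c: "c \<in> Mor T E B" "c \<cdot> X = x \<cdot> p" "y \<cdot> c = q \<cdot> Y" by auto
  have "\<exists>b \<in> Mor T E B'. b \<cdot> X = x' \<cdot> p' \<and> y' \<cdot> b = q' \<cdot> Y"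
    by (rule fill_middle[OF tr T2]) (use t A(1-15) D(1-15) shr shr' in \<open>simp_all add: Mor_def\<close>)
  then obtain c' where c': "c' \<in> Mor T E B'" "c' \<cdot> X = x' \<cdot> p'" "y' \<cdot> c' = q' \<cdot> Y" by auto
  have ty: "b \<in> Ar T" "Dom T b = B" "Cod T b = E" "b' \<in> Ar T" "Dom T b' = B'" "Cod T b' = E"
    "c \<in> Ar T" "Dom T c = E" "Cod T c = B" "c' \<in> Ar T" "Dom T c' = E" "Cod T c' = B'"
    using b(1) b'(1) c(1) c'(1) by (auto simp: Mor_def)
  let ?b = "(b \<cdot> r) \<boxplus> (b' \<cdot> r')" and ?c = "(j \<cdot> c) \<boxplus> (j' \<cdot> c')"
  note tt = ty t e A(1-15) B(1-15) D(1-15)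
  have xy: "?x \<in> Mor T SA SB" "?y \<in> Mor T SB SD" using tt by (simp_all add: dsum_def Mor_def)
  have cX: "?c \<cdot> X = ?x" using tt c(2) c'(2) by (simp add: dsum_def)
  have yc: "?y \<cdot> ?c = Y"
  proof -
    have "?y \<cdot> ?c = k \<cdot> (y \<cdot> c) \<boxplus> k' \<cdot> (y' \<cdot> c')" using tt B(21-) by (simp add: dsum_def)
    also have "\<dots> = (k \<cdot> q \<boxplus> k' \<cdot> q') \<cdot> Y" unfolding c(3) c'(3) using tt by simp
    also have "\<dots> = Y" unfolding D(20) using tt by simp
    finally show ?thesis .
  qed
  have bx: "?b \<cdot> ?x = X"
  proof -
    have "?b \<cdot> ?x = (b \<cdot> x) \<cdot> p \<boxplus> (b' \<cdot> x') \<cdot> p'" using tt B(21-) by (simp add: dsum_def)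
    also have "\<dots> = X \<cdot> (i \<cdot> p \<boxplus> i' \<cdot> p')" unfolding b(2) b'(2) using tt by simp
    also have "\<dots> = X" unfolding A(20) using tt by simp
    finally show ?thesis .
  qed
  have Yb: "Y \<cdot> ?b = ?y"
  proof -
    have "Y \<cdot> ?b = (Y \<cdot> b) \<cdot> r \<boxplus> (Y \<cdot> b') \<cdot> r'" using tt by simp
    also have "\<dots> = ?y" unfolding b(3) b'(3) using tt by (simp add: dsum_def)
    finally show ?thesis .
  qed
  have iso: "is_iso T ?c E SB"
  proof (rule triangle_middle_iso[OF tr _ _ cX yc bx Yb xy])
    fix n assume n: "n \<in> Mor T SB SB" "n \<cdot> ?x = Zero T SA SB" "?y \<cdot> n = Zero T SB SD"
    have tn: "n \<in> Ar T" "Dom T n = SB" "Cod T n = SB" using n(1) by (auto simp: Mor_def)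
    \<comment> \<open>On each summand \<open>n\<close> kills the first arrow, so \<open>n\<close>
      factors through \<open>?y\<close>, and \<open>?y\<close> annihilates \<open>n\<close>.\<close>
    have "(n \<cdot> j) \<cdot> x = (n \<cdot> ?x) \<cdot> i" using tt tn A(16-) by (simp add: dsum_def)
    also have "\<dots> = Zero T A SB" unfolding n(2) using tt by simp
    finally obtain u where u: "u \<in> Mor T D SB" "u \<cdot> y = n \<cdot> j"
      using triangle_right[OF T1, of "n \<cdot> j" SB] tt tn by (auto simp: Mor_def)
    have "(n \<cdot> j') \<cdot> x' = (n \<cdot> ?x) \<cdot> i'" using tt tn A(16-) by (simp add: dsum_def)
    also have "\<dots> = Zero T A' SB" unfolding n(2) using tt by simp
    finally obtain u' where u': "u' \<in> Mor T D' SB" "u' \<cdot> y' = n \<cdot> j'"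
      using triangle_right[OF T2, of "n \<cdot> j'" SB] tt tn by (auto simp: Mor_def)
    have tu: "u \<in> Ar T" "Dom T u = D" "Cod T u = SB" "u' \<in> Ar T" "Dom T u' = D'" "Cod T u' = SB"
      using u(1) u'(1) by (auto simp: Mor_def)
    have "(u \<cdot> q \<boxplus> u' \<cdot> q') \<cdot> ?y = (u \<cdot> y) \<cdot> r \<boxplus> (u' \<cdot> y') \<cdot> r'"
      using tt tu D(21-) by (simp add: dsum_def)
    also have "\<dots> = n \<cdot> (j \<cdot> r \<boxplus> j' \<cdot> r')" unfolding u(2) u'(2) using tt tn by simp
    also have "\<dots> = n" unfolding B(20) using tn by simp
    finally have 1: "(u \<cdot> q \<boxplus> u' \<cdot> q') \<cdot> ?y = n" .
    have "n \<cdot> n = ((u \<cdot> q \<boxplus> u' \<cdot> q') \<cdot> ?y) \<cdot> n" by (simp only: 1)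
    also have "\<dots> = (u \<cdot> q \<boxplus> u' \<cdot> q') \<cdot> (?y \<cdot> n)"
      by (rule assoc) (use tt tu tn xy in \<open>simp_all add: Mor_def\<close>)
    also have "\<dots> = Zero T SB SB" unfolding n(3) using tt tu by simp
    finally show "n \<cdot> n = Zero T SB SB" .
  qed (use tt in \<open>simp_all add: Mor_def\<close>)
  show ?thesis
    by (rule TR1_iso[OF tr is_iso_id iso is_iso_id]) (use cX yc xy hM tt in \<open>simp_all add: Mor_def\<close>)
qed

text \<open>The third rotation of \<open>(f, g, h)\<close> is its suspension with three minus signs;
  the automorphism \<open>-1\<close> of \<open>B[1]\<close> accounts for the first two.\<close>

lemma triangle_shift:
  assumes M: "f \<in> Mor T A B" "g \<in> Mor T B D" "h \<in> Mor T D (ShO T A)"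
  assumes tr: "triangle T (ShO T A) (ShO T B) (ShO T D) (ShA T f) (ShA T g) (Neg T (ShA T h))"
  shows "triangle T A B D f g h"
proof -
  have ty: "f \<in> Ar T" "Dom T f = A" "Cod T f = B" "g \<in> Ar T" "Dom T g = B" "Cod T g = D"
    "h \<in> Ar T" "Dom T h = D" "Cod T h = ShO T A" "A \<in> Ob T" "B \<in> Ob T" "D \<in> Ob T"
    using M Mor_Ob[OF M(1)] Mor_Ob[OF M(2)] by (auto simp: Mor_def)
  have i: "is_iso T (Neg T (Idn T (ShO T B))) (ShO T B) (ShO T B)"
    by (rule is_isoI[of _ _ _ "Neg T (Idn T (ShO T B))"]) (use ty in \<open>simp_all add: Mor_def\<close>)
  have "triangle T (ShO T A) (ShO T B) (ShO T D) (Neg T (ShA T f)) (Neg T (ShA T g)) (Neg T (ShA T h))"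
    by (rule TR1_iso[OF tr is_iso_id i is_iso_id]) (use ty in \<open>simp_all add: Mor_def\<close>)
  then have "triangle T D (ShO T A) (ShO T B) h (Neg T (ShA T f)) (Neg T (ShA T g))"
    using TR2[of h D "ShO T A" "Neg T (ShA T f)" "ShO T B" "Neg T (ShA T g)"] ty by (simp add: Mor_def)
  then have "triangle T B D (ShO T A) g h (Neg T (ShA T f))"
    using TR2[of g B D h "ShO T A" "Neg T (ShA T f)"] ty by (simp add: Mor_def)
  then show ?thesis using TR2[OF M] by simp
qed

end

lemma tri_extri_simps [simp]:
  "Ob (tri_extri T) = Ob T" "Ar (tri_extri T) = Ar T" "Dom (tri_extri T) = Dom T" "Cod (tri_extri T) = Cod T"
  "Idn (tri_extri T) = Idn T" "Comp (tri_extri T) = Comp T" "Add (tri_extri T) = Add T"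
  "Zero (tri_extri T) = Zero T" "Ext (tri_extri T) D A = Homg T D (ShO T A)"
  "Emap (tri_extri T) d a h = ShA T a \<cdot>\<^bsub>T\<^esub> h \<cdot>\<^bsub>T\<^esub> d"
  "(x, y) \<in> Real (tri_extri T) D A h \<longleftrightarrow> (\<exists>B. triangle T A B D x y h)"
  "Mor (tri_extri T) = Mor T" "Homg (tri_extri T) = Homg T"
  by (auto simp: tri_extri_def Mor_def Homg_def fun_eq_iff)

lemma tri_extri_derived [simp]:
  "is_iso (tri_extri T) = is_iso T" "zero_object (tri_extri T) = zero_object T"
  "seqs (tri_extri T) = seqs T" "biproduct (tri_extri T) = biproduct T"
  "dsum (tri_extri T) = dsum T" "seq_class (tri_extri T) = seq_class T"
  by (auto simp: is_iso_def zero_object_def seqs_def biproduct_def dsum_def seq_class_def fun_eq_iff)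

context triangulated_category
begin

lemma tri_extri_tri [simp]: "s_triangle (tri_extri T) A B D x y h \<longleftrightarrow> triangle T A B D x y h"
proof
  assume "s_triangle (tri_extri T) A B D x y h"
  then obtain B' where M: "x \<in> Mor T A B" and tr: "triangle T A B' D x y h" by (auto simp: s_triangle_def)
  then show "triangle T A B D x y h" using triangleD[OF tr] by (auto simp: Mor_def)
next
  assume tr: "triangle T A B D x y h"
  then show "s_triangle (tri_extri T) A B D x y h"
    using triangleD[OF tr] by (auto simp: s_triangle_def)
qed

lemma tri_extri_push [simp]: "h \<in> Ar T \<Longrightarrow> Dom T h = D \<Longrightarrow> push (tri_extri T) D a h = ShA T a \<cdot> h"
  by (simp add: push_def)

lemma tri_extri_pull [simp]:
  "A \<in> Ob T \<Longrightarrow> h \<in> Ar T \<Longrightarrow> Cod T h = ShO T A \<Longrightarrow> d \<in> Ar T \<Longrightarrow> Cod T d = Dom T h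
    \<Longrightarrow> pull (tri_extri T) A d h = h \<cdot> d"
  by (simp add: pull_def)

lemma triangle_Real_class:
  assumes tr: "triangle T A B D x y h"
  shows "Real (tri_extri T) D A h = seq_class T A D x y"
proof (rule subset_antisym; rule subrelI)
  note t = triangleD[OF tr]
  fix x' y' assume "(x', y') \<in> Real (tri_extri T) D A h"
  then obtain B' where tr': "triangle T A B' D x' y' h" by auto
  note t' = triangleD[OF tr']
  show "(x', y') \<in> seq_class T A D x y"
    using triangle_unique[OF tr tr'] t t' by (auto simp: seq_class_def seqs_def)
next
  note t = triangleD[OF tr]
  fix x' y' assume "(x', y') \<in> seq_class T A D x y"
  then obtain b B' where b: "is_iso T b B B'" "b \<cdot> x = x'" "y' \<cdot> b = y" "x' \<in> Mor T A B'" "y' \<in> Mor T B' D"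
    using t by (auto simp: seq_class_def seqs_def Mor_def)
  have "triangle T A B' D x' y' h"
    by (rule TR1_iso[OF tr is_iso_id b(1) is_iso_id]) (use b t in \<open>simp_all add: Mor_def\<close>)
  then show "(x', y') \<in> Real (tri_extri T) D A h" by auto
qed

text \<open>TR4 for the composite \<open>C \<rightarrow> B \<rightarrow> A\<close>, whose cones are
  the suspensions of \<open>F\<close>, \<open>D\<close> and \<open>E\<close>; desuspending gives the
  dual octahedron.\<close>

lemma octahedron_dual:
  assumes T1: "triangle T D B A f' f \<delta>" and T2: "triangle T F C B g' g \<delta>'"
  shows "\<exists>E h' d e \<delta>''. triangle T E C A h' (f \<cdot> g) \<delta>'' \<and> triangle T F E D e d (\<delta>' \<cdot> f') \<and>
            f' \<cdot> d = g \<cdot> h' \<and> h' \<cdot> e = g' \<and> ShA T d \<cdot> \<delta>'' = \<delta> \<and> \<delta>'' \<cdot> f = ShA T e \<cdot> \<delta>'"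
proof -
  note t1 = triangleD[OF T1] and t2 = triangleD[OF T2]
  have "f \<cdot> g \<in> Mor T C A" using t1 t2 by (simp add: Mor_def)
  from TR1_cone[OF this] obtain E1 u v where tr: "triangle T C A E1 (f \<cdot> g) u v" by auto
  note t = triangleD[OF tr]
  obtain d1 e1 where o: "triangle T (ShO T F) E1 (ShO T D) d1 e1 (ShA T \<delta>' \<cdot> Neg T (ShA T f'))"
    "d1 \<cdot> \<delta>' = u \<cdot> f" "e1 \<cdot> u = \<delta>" "v \<cdot> d1 = Neg T (ShA T g')"
    "Neg T (ShA T f') \<cdot> e1 = ShA T g \<cdot> v"
    using TR4[OF rotate[OF T2] rotate[OF T1] tr] by blast
  note to = triangleD[OF o(1)]
  note ty = t1(1-12) t2(1-12) t(1-12) to(1-12)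
  let ?E = "UnO T E1" and ?h = "UnA T (Neg T v)" and ?d = "UnA T e1" and ?e = "UnA T d1"
  have "triangle T ?E C A ?h (f \<cdot> g) u"
    using TR2[of ?h ?E C "f \<cdot> g" A u] tr ty by (simp add: Mor_def)
  moreover have "triangle T F ?E D ?e ?d (\<delta>' \<cdot> f')"
    by (rule triangle_shift) (use o(1) ty in \<open>simp_all add: Mor_def\<close>)
  moreover have "f' \<cdot> ?d = g \<cdot> ?h"
  proof -
    have "UnA T (Neg T (Neg T (ShA T f') \<cdot> e1)) = UnA T (Neg T (ShA T g \<cdot> v))" by (simp only: o(5))
    then show ?thesis using ty by simp
  qed
  moreover have "?h \<cdot> ?e = g'"
  proof -
    have "UnA T (Neg T (v \<cdot> d1)) = UnA T (Neg T (Neg T (ShA T g')))" by (simp only: o(4))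
    then show ?thesis using ty by simp
  qed
  moreover have "ShA T ?d \<cdot> u = \<delta>" "u \<cdot> f = ShA T ?e \<cdot> \<delta>'" using o ty by simp_all
  ultimately show ?thesis by blast
qed

lemma additive_tri_extri: "additive_category (tri_extri T)"
proof (rule additive_category.intro)
  show "category (tri_extri T)" by unfold_locales (auto simp: Mor_def)
  show "additive_category_axioms (tri_extri T)"
    by (rule additive_category_axioms.intro)
      (simp_all add: hom_group comp_add_left comp_add_right zero_object_exists biproduct_exists)
qed

theorem extriangulated: "extriangulated_category (tri_extri T)"
proof -
  have "extriangulated_category_axioms (tri_extri T)"
  proof (rule extriangulated_category_axioms.intro, goal_cases)
    case (1 D A) then show ?case by (simp add: hom_group)
  next
    case (2 d D' D a A A')
    then show ?case using Mor_Ob[of a A A'] by (auto simp: hom_def Mor_def)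
  next
    case (3 D A \<delta>) then show ?case by (simp add: Mor_def)
  next
    case (4 d D' D d' D'' a A A' a' A'' \<delta>) then show ?case by (simp add: Mor_def)
  next
    case (5 d D' D d' a A A' \<delta>) then show ?case by (simp add: Mor_def)
  next
    case (6 d D' D a A A' a' \<delta>) then show ?case by (simp add: Mor_def)
  next
    case (7 D A \<delta>)
    then obtain B x y where tr: "triangle T A B D x y \<delta>" using triangle_realize[of \<delta> D A] by auto
    show ?case using triangle_Real_class[OF tr] triangleD[OF tr]
      by (intro bexI[of _ "(x, y)"]) (auto simp: seqs_def)
  next
    case (8 A B D x y \<delta> A' B' D' x' y' \<delta>' a d)
    then have tr: "triangle T A B D x y \<delta>" "triangle T A' B' D' x' y' \<delta>'" by auto
    note t = triangleD[OF tr(1)] triangleD[OF tr(2)]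
    show ?case using fill_middle[OF tr, of a d] 8 t by (simp add: Mor_def)
  next
    case (9 A D S i j p q) then show ?case using triangle_split by simp
  next
    case (10 A B D x y \<delta> A' B' D' x' y' \<delta>' SA i i' p p' SB j j' r r' SD k k' q q')
    then show ?case
      using triangle_dsum[of A B D x y \<delta> A' B' D' x' y' \<delta>' SA i i' p p' SB j j' r r' SD k k' q q'] by simp
  next
    case (11 A B D x y \<delta> A' B' D' x' y' \<delta>' a b)
    then have tr: "triangle T A B D x y \<delta>" "triangle T A' B' D' x' y' \<delta>'" by auto
    note t = triangleD[OF tr(1)] triangleD[OF tr(2)]
    obtain d where "d \<in> Mor T D D'" "d \<cdot> y = y' \<cdot> b" "ShA T a \<cdot> \<delta> = \<delta>' \<cdot> d"
      using TR3[OF tr, of a b] 11 by auto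
    then show ?case using t by (intro bexI[of _ d]) (simp_all add: Mor_def)
  next
    case (12 A B D x y \<delta> A' B' D' x' y' \<delta>' b d)
    then have tr: "triangle T A B D x y \<delta>" "triangle T A' B' D' x' y' \<delta>'" by auto
    note t = triangleD[OF tr(1)] triangleD[OF tr(2)]
    note t = t(1-12) t(16-27)
    have M: "b \<in> Mor T B B'" "d \<in> Mor T D D'" "d \<cdot> y = y' \<cdot> b" using 12 by auto
    have ty: "b \<in> Ar T" "Dom T b = B" "Cod T b = B'" "d \<in> Ar T" "Dom T d = D" "Cod T d = D'"
      using M by (simp_all add: Mor_def)
    obtain c where c: "c \<in> Mor T (ShO T A) (ShO T A')" "c \<cdot> \<delta> = \<delta>' \<cdot> d"
      "ShA T b \<cdot> Neg T (ShA T x) = Neg T (ShA T x') \<cdot> c"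
      using TR3[OF rotate[OF tr(1)] rotate[OF tr(2)] M] by auto
    have tc: "c \<in> Ar T" "Dom T c = ShO T A" "Cod T c = ShO T A'" using c(1) by (simp_all add: Mor_def)
    have "UnA T (Neg T (ShA T b \<cdot> Neg T (ShA T x))) = UnA T (Neg T (Neg T (ShA T x') \<cdot> c))"
      by (simp only: c(3))
    then have "b \<cdot> x = x' \<cdot> UnA T c" using tc ty t by simp
    then show ?case using c(2) tc ty t by (intro bexI[of _ "UnA T c"]) (simp_all add: Mor_def)
  next
    case (13 A B D f f' \<delta> C F g g' \<delta>')
    then have tr: "triangle T A B D f f' \<delta>" "triangle T B C F g g' \<delta>'" by auto
    note t = triangleD[OF tr(1)] triangleD[OF tr(2)]
    have "g \<cdot> f \<in> Mor T A C" using t by (simp add: Mor_def)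
    from TR1_cone[OF this] obtain E h' h'' where E: "triangle T A C E (g \<cdot> f) h' h''" by auto
    obtain d e where o: "triangle T D E F d e (ShA T f' \<cdot> \<delta>')"
            "d \<cdot> f' = h' \<cdot> g" "e \<cdot> h' = g'" "h'' \<cdot> d = \<delta>" "\<delta>' \<cdot> e = ShA T f \<cdot> h''"
      using TR4[OF tr E] by (elim exE conjE) (rule that; assumption)
    note te = triangleD[OF E] triangleD[OF o(1)]
    show ?case
      by (intro exI[of _ E] exI[of _ h'] exI[of _ d] exI[of _ e] exI[of _ h'']) (simp add: E o t te)
  next
    case (14 D B A f' f \<delta> F C g' g \<delta>')
    then have tr: "triangle T D B A f' f \<delta>" "triangle T F C B g' g \<delta>'" by auto
    note t = triangleD[OF tr(1)] triangleD[OF tr(2)]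
    obtain E h' d e \<delta>'' where o: "triangle T E C A h' (f \<cdot> g) \<delta>''" "triangle T F E D e d (\<delta>' \<cdot> f')"
      "f' \<cdot> d = g \<cdot> h'" "h' \<cdot> e = g'" "ShA T d \<cdot> \<delta>'' = \<delta>" "\<delta>'' \<cdot> f = ShA T e \<cdot> \<delta>'"
      using octahedron_dual[OF tr] by blast
    note te = triangleD[OF o(1)] triangleD[OF o(2)]
    show ?case
      by (intro exI[of _ E] exI[of _ h'] exI[of _ d] exI[of _ e] exI[of _ \<delta>'']) (simp add: o t te)
  qed
  then show ?thesis by (intro extriangulated_category.intro additive_tri_extri)
qed

end

section \<open>Arrows factoring through an extension-closed subcategory\<close>

text \<open>The ideal that turns out to consist of the arrows sent to zero. One intermediate object
  is enough for a sum of such arrows as soon as \<open>N\<close> is closed under biproducts.\<close>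

definition null_arr :: "('o, 'm, 'z) cat_scheme \<Rightarrow> 'o set \<Rightarrow> 'm \<Rightarrow> bool" where
  "null_arr C N f \<longleftrightarrow> (\<exists>M \<in> N. factors_through C f M)"

text \<open>A map \<open>D \<rightarrow> A[1]\<close> factors through \<open>M[1]\<close> if and only if, as an element of \<open>E(D,A)\<close>, it is pushed
  out from \<open>E(D,M)\<close>. In this form the relative structure makes sense in any extriangulated category,
  and passing to the opposite category exchanges its two halves.\<close>

definition rel_left :: "('o, 'm, 'e, 'z) extri_scheme \<Rightarrow> 'o set \<Rightarrow> 'o \<Rightarrow> 'o \<Rightarrow> 'e set" where
  "rel_left X N D A = {h \<in> carrier (Ext X D A). \<forall>M \<in> N. \<forall>x \<in> Mor X M D.
     \<exists>M' \<in> N. \<exists>u \<in> carrier (Ext X M M'). \<exists>v \<in> Mor X M' A. pull X A x h = push X M v u}"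

definition rel_right :: "('o, 'm, 'e, 'z) extri_scheme \<Rightarrow> 'o set \<Rightarrow> 'o \<Rightarrow> 'o \<Rightarrow> 'e set" where
  "rel_right X N D A = {h \<in> carrier (Ext X D A). \<forall>M \<in> N. \<forall>y \<in> Mor X A M.
     \<exists>M' \<in> N. \<exists>u \<in> carrier (Ext X M' M). \<exists>v \<in> Mor X D M'. push X D y h = pull X M v u}"

definition rel_tri :: "('o, 'm, 'e, 'z) extri_scheme \<Rightarrow> 'o set \<Rightarrow> 'o \<Rightarrow> 'o \<Rightarrow> 'o \<Rightarrow> 'm \<Rightarrow> 'm \<Rightarrow> 'e \<Rightarrow> bool" where
  "rel_tri X N A B D x y h \<longleftrightarrow> s_triangle X A B D x y h \<and> h \<in> rel_left X N D A \<and> h \<in> rel_right X N D A"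

text \<open>The generation of \<open>loc_arrows\<close>, phrased with relative triangles of the
  ambient structure, so that inductions have the class at hand and \<open>opp\<close> preserves the
  set.\<close>

inductive_set qis :: "('o, 'm, 'e, 'z) extri_scheme \<Rightarrow> 'o set \<Rightarrow> 'm set"
  for X :: "('o, 'm, 'e, 'z) extri_scheme" and N :: "'o set" where
  qis_infl: "\<lbrakk>rel_tri X N A B D x y h; D \<in> N\<rbrakk> \<Longrightarrow> x \<in> qis X N"
| qis_defl: "\<lbrakk>rel_tri X N A B D x y h; A \<in> N\<rbrakk> \<Longrightarrow> y \<in> qis X N"
| qis_comp: "\<lbrakk>f \<in> qis X N; g \<in> qis X N; Cod X f = Dom X g\<rbrakk> \<Longrightarrow> g \<cdot>\<^bsub>X\<^esub> f \<in> qis X N"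

lemma rel_opp [simp]:
  "null_arr (opp X) N f \<longleftrightarrow> null_arr X N f"
  "rel_left (opp X) N A D = rel_right X N D A" "rel_right (opp X) N A D = rel_left X N D A"
  "rel_tri (opp X) N A B D x y h \<longleftrightarrow> rel_tri X N D B A y x h"
  by (auto simp: null_arr_def factors_through_def rel_left_def rel_right_def rel_tri_def)

lemma qis_opp [simp]: "qis (opp X) N = qis X N"
proof (rule subset_antisym; rule subsetI)
  fix s assume "s \<in> qis (opp X) N" then show "s \<in> qis X N"
    by induction (auto intro: qis.intros)
next
  fix s assume "s \<in> qis X N" then show "s \<in> qis (opp X) N"
  proof induction
    case (qis_comp f g) then show ?case using qis.qis_comp[of g "opp X" N f] by simp
  next
    case (qis_infl A B D x y h)
    then show ?case using qis.qis_defl[of "opp X" N D B A y x h] by simp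
  next
    case (qis_defl A B D x y h)
    then show ?case using qis.qis_infl[of "opp X" N D B A y x h] by simp
  qed
qed

locale ext_closed = extriangulated_category X
  for X :: "('o, 'm, 'e, 'z) extri_scheme" (structure) +
  fixes N :: "'o set"
  assumes N_Ob: "A \<in> N \<Longrightarrow> A \<in> Ob X"
    and N_sum: "\<lbrakk>A \<in> N; B \<in> N; biproduct X A B S i j p q\<rbrakk> \<Longrightarrow> S \<in> N"
    and N_summand: "\<lbrakk>S \<in> N; biproduct X A B S i j p q\<rbrakk> \<Longrightarrow> A \<in> N"
    and N_ext: "\<lbrakk>s_triangle X A B D x y h; A \<in> N; D \<in> N\<rbrakk> \<Longrightarrow> B \<in> N"
    and N_zero: "zero_object X Z \<Longrightarrow> Z \<in> N"
begin

lemma ext_closed_opp: "ext_closed (opp X) N"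
proof -
  interpret O: extriangulated_category "opp X" by (rule opp)
  show ?thesis
    by unfold_locales (auto intro: N_Ob N_sum N_summand N_ext N_zero simp: biproduct_opp)
qed

abbreviation "null \<equiv> null_arr X N"

section \<open>The ideal of arrows that factor through \<open>N\<close>\<close>

lemma nullI: "M \<in> N \<Longrightarrow> u \<in> Mor X A M \<Longrightarrow> v \<in> Mor X M B \<Longrightarrow> null (v \<cdot> u)"
  unfolding null_arr_def factors_through_def by (auto simp: Mor_def)

lemma nullE:
  assumes "null f" "f \<in> Mor X A B"
  obtains M u v where "M \<in> N" "u \<in> Mor X A M" "v \<in> Mor X M B" "f = v \<cdot> u"
  using assms unfolding null_arr_def factors_through_def by (auto simp: Mor_def)

lemma null_comp_left:
  assumes "null f" "f \<in> Mor X A B" "g \<in> Mor X B D" shows "null (g \<cdot> f)"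
proof -
  obtain M u v where *: "M \<in> N" "u \<in> Mor X A M" "v \<in> Mor X M B" "f = v \<cdot> u" by (rule nullE[OF assms(1,2)])
  have "g \<cdot> f = (g \<cdot> v) \<cdot> u" using * assms(3) by (simp add: Mor_def)
  then show ?thesis using nullI[OF *(1,2), of "g \<cdot> v" D] * assms(3) by (simp add: Mor_def)
qed

lemma null_comp_right:
  assumes "null f" "f \<in> Mor X A B" "g \<in> Mor X D A" shows "null (f \<cdot> g)"
proof -
  obtain M u v where *: "M \<in> N" "u \<in> Mor X A M" "v \<in> Mor X M B" "f = v \<cdot> u" by (rule nullE[OF assms(1,2)])
  have "f \<cdot> g = v \<cdot> (u \<cdot> g)" using * assms(3) by (simp add: Mor_def)
  then show ?thesis using nullI[OF *(1), of "u \<cdot> g" D v B] * assms(3) by (simp add: Mor_def)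
qed

lemma null_add:
  assumes "null f" "null g" "f \<in> Mor X A B" "g \<in> Mor X A B" shows "null (f \<boxplus> g)"
proof -
  obtain M u v where *: "M \<in> N" "u \<in> Mor X A M" "v \<in> Mor X M B" "f = v \<cdot> u" by (rule nullE[OF assms(1,3)])
  obtain M' u' v' where **: "M' \<in> N" "u' \<in> Mor X A M'" "v' \<in> Mor X M' B" "g = v' \<cdot> u'" by (rule nullE[OF assms(2,4)])
  obtain S i j p q where b: "biproduct X M M' S i j p q" using biproduct_exists N_Ob *(1) **(1) by blast
  note bD = biproductD[OF b] biproduct_reassoc[OF b]
  have "f \<boxplus> g = ((v \<cdot> p) \<boxplus> (v' \<cdot> q)) \<cdot> ((i \<cdot> u) \<boxplus> (j \<cdot> u'))"
    using * ** bD by (auto simp: Mor_def)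
  moreover have "(i \<cdot> u) \<boxplus> (j \<cdot> u') \<in> Mor X A S" "(v \<cdot> p) \<boxplus> (v' \<cdot> q) \<in> Mor X S B"
    using *(1-3) **(1-3) bD(1-15) by (simp_all add: Mor_def)
  ultimately show ?thesis using nullI[OF N_sum[OF *(1) **(1) b]] by simp
qed

lemma null_neg:
  assumes "null f" "f \<in> Mor X A B" shows "null (Neg X f)"
proof -
  have "Neg X (Idn X B) \<in> Mor X B B" using Mor_Ob[OF assms(2)] by (simp add: Mor_def)
  from null_comp_left[OF assms this] show ?thesis using assms(2) by (auto simp: Mor_def)
qed

lemma null_zero:
  assumes "A \<in> Ob X" "B \<in> Ob X" shows "null (Zero X A B)"
proof -
  obtain Z where Z: "zero_object X Z" using zero_object_exists by auto
  have ZO: "Z \<in> Ob X" using zero_object_id[OF Z] by auto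
  show ?thesis using nullI[OF N_zero[OF Z], of "Zero X A Z" A "Zero X Z B" B] assms ZO by (simp add: Mor_def)
qed

lemma null_diff_sym:
  assumes "null (f \<boxplus> Neg X g)" "f \<in> Mor X A B" "g \<in> Mor X A B" shows "null (g \<boxplus> Neg X f)"
proof -
  have "null (Neg X (f \<boxplus> Neg X g))" by (rule null_neg[OF assms(1)]) (use assms in \<open>auto simp: Mor_def\<close>)
  moreover have "Neg X (f \<boxplus> Neg X g) = g \<boxplus> Neg X f"
    using assms(2,3) by (auto simp: Mor_def neg_add add_comm)
  ultimately show ?thesis by simp
qed

lemma null_diff_trans:
  assumes "null (f \<boxplus> Neg X g)" "null (g \<boxplus> Neg X h)"
    "f \<in> Mor X A B" "g \<in> Mor X A B" "h \<in> Mor X A B"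
  shows "null (f \<boxplus> Neg X h)"
proof -
  have "null ((f \<boxplus> Neg X g) \<boxplus> (g \<boxplus> Neg X h))"
    by (rule null_add[OF assms(1,2)]) (use assms in \<open>auto simp: Mor_def\<close>)
  moreover have "(f \<boxplus> Neg X g) \<boxplus> (g \<boxplus> Neg X h) = f \<boxplus> Neg X h"
    using assms(3-5) by (auto simp: Mor_def add_assoc)
  ultimately show ?thesis by simp
qed

lemma null_diff_left:
  assumes "null (f \<boxplus> Neg X g)" "f \<in> Mor X A B" "g \<in> Mor X A B" "k \<in> Mor X B D"
  shows "null ((k \<cdot> f) \<boxplus> Neg X (k \<cdot> g))"
proof -
  have "null (k \<cdot> (f \<boxplus> Neg X g))"
    by (rule null_comp_left[OF assms(1) _ assms(4)]) (use assms in \<open>auto simp: Mor_def\<close>)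
  moreover have "k \<cdot> (f \<boxplus> Neg X g) = (k \<cdot> f) \<boxplus> Neg X (k \<cdot> g)" using assms(2-4) by (auto simp: Mor_def)
  ultimately show ?thesis by simp
qed

lemma null_diff_right:
  assumes "null (f \<boxplus> Neg X g)" "f \<in> Mor X A B" "g \<in> Mor X A B" "k \<in> Mor X D A"
  shows "null ((f \<cdot> k) \<boxplus> Neg X (g \<cdot> k))"
proof -
  have "null ((f \<boxplus> Neg X g) \<cdot> k)"
    by (rule null_comp_right[OF assms(1) _ assms(4)]) (use assms in \<open>auto simp: Mor_def\<close>)
  moreover have "(f \<boxplus> Neg X g) \<cdot> k = (f \<cdot> k) \<boxplus> Neg X (g \<cdot> k)" using assms(2-4) by (auto simp: Mor_def)
  ultimately show ?thesis by simp
qed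

text \<open>If \<open>y \<cdot> f\<close> passes through \<open>M\<close>, the pullback of the
  triangle along \<open>M \<rightarrow> D\<close> has a middle term which extends \<open>M\<close>
  by \<open>A\<close>, hence lies in \<open>N\<close>; \<open>f\<close> lifts to it by the weak
  pullback property.\<close>

lemma defl_reflects_null:
  assumes T: "s_triangle X A B D x y h" and A: "A \<in> N" and f: "f \<in> Mor X W B" "null (y \<cdot> f)"
  shows "null f"
proof -
  note t = s_triangleD[OF T]
  have yf: "y \<cdot> f \<in> Mor X W D" using f(1) t by (simp add: Mor_def)
  obtain M k l where M: "M \<in> N" "k \<in> Mor X W M" "l \<in> Mor X M D" "y \<cdot> f = l \<cdot> k"
    by (rule nullE[OF f(2) yf])
  obtain P x' y' b where P: "s_triangle X A P M x' y' (pull X A l h)" "b \<in> Mor X P B"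
    and w: "\<forall>W. \<forall>u \<in> Mor X W B. \<forall>v \<in> Mor X W M. y \<cdot> u = l \<cdot> v \<longrightarrow> (\<exists>w \<in> Mor X W P. b \<cdot> w = u \<and> y' \<cdot> w = v)"
    using pullback_ex[OF T M(3)] by blast
  obtain w where "w \<in> Mor X W P" "b \<cdot> w = f" using w f(1) M(2,4) by blast
  then show ?thesis using nullI[OF N_ext[OF P(1) A M(1)] _ P(2)] by auto
qed

text \<open>Realise \<open>u\<close> by \<open>M \<rightarrow> F \<rightarrow> D\<close>. The homotopy pushout turns \<open>x\<close>, modulo \<open>F \<in> N\<close>, into the deflation
  \<open>F \<oplus> A \<rightarrow> B\<close> with cocone \<open>M \<in> N\<close>.\<close>

lemma infl_reflects_null:
  assumes T: "s_triangle X A B D x y (push X D v u)" and D: "D \<in> N" "M \<in> N"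
    and u: "u \<in> carrier (Ext X D M)" "v \<in> Mor X M A"
    and f: "f \<in> Mor X W A" "null (x \<cdot> f)"
  shows "null f"
proof -
  note t = s_triangleD[OF T]
  obtain F m n where F: "s_triangle X M F D m n u" using tri_exists[OF u(1) t(3)] N_Ob D by auto
  note tF = s_triangleD[OF F]
  obtain S j j' r r' where bS: "biproduct X F A S j j' r r'" using biproduct_exists tF(2) t(1) by blast
  note b = biproductD[OF bS] biproduct_reassoc[OF bS]
  obtain c where c: "c \<in> Mor X F B"
    and H: "s_triangle X M S B ((j \<cdot> m) \<boxplus> Neg X (j' \<cdot> v)) ((c \<cdot> r) \<boxplus> (x \<cdot> r')) (pull X M y u)"
    using homotopy_pushout[OF F u(2) T bS] by auto
  have ty: "f \<in> Ar X" "Dom X f = W" "Cod X f = A" "c \<in> Ar X" "Dom X c = F" "Cod X c = B" "W \<in> Ob X"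
    using f(1) c Mor_Ob[OF f(1)] by (auto simp: Mor_def)
  have "((c \<cdot> r) \<boxplus> (x \<cdot> r')) \<cdot> (j' \<cdot> f) = x \<cdot> f" using ty b t(1-9) by simp
  then have "null (j' \<cdot> f)"
    using defl_reflects_null[OF H D(2), of "j' \<cdot> f" W] f(2) ty b(1-15) by (simp add: Mor_def)
  then have "null (r' \<cdot> j' \<cdot> f)"
    by (rule null_comp_left[of _ W S _ A]) (use ty b in \<open>auto simp: Mor_def\<close>)
  then show ?thesis using b ty by simp
qed

text \<open>Since \<open>D\<close> itself lies in \<open>N\<close>, the left condition may be tested
  at the identity of \<open>D\<close>.\<close>

lemma rel_tri_inflE:
  assumes "rel_tri X N A B D x y h" "D \<in> N"
  obtains M u v where "M \<in> N" "u \<in> carrier (Ext X D M)" "v \<in> Mor X M A" "h = push X D v u"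
proof -
  have h: "s_triangle X A B D x y h" "h \<in> rel_left X N D A" using assms by (auto simp: rel_tri_def)
  note t = s_triangleD[OF h(1)]
  have "\<exists>M \<in> N. \<exists>u \<in> carrier (Ext X D M). \<exists>v \<in> Mor X M A. pull X A (Idn X D) h = push X D v u"
    using h(2) id_Mor[OF t(3)] assms(2) unfolding rel_left_def by blast
  then show thesis using that t by auto
qed

lemma rel_tri_deflE:
  assumes "rel_tri X N A B D x y h" "A \<in> N"
  obtains M u d where "M \<in> N" "u \<in> carrier (Ext X M A)" "d \<in> Mor X D M" "h = pull X A d u"
proof -
  have h: "s_triangle X A B D x y h" "h \<in> rel_right X N D A" using assms by (auto simp: rel_tri_def)
  note t = s_triangleD[OF h(1)]
  have "\<exists>M \<in> N. \<exists>u \<in> carrier (Ext X M A). \<exists>d \<in> Mor X D M. push X D (Idn X A) h = pull X A d u"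
    using h(2) id_Mor[OF t(1)] assms(2) unfolding rel_right_def by blast
  then show thesis using that t by auto
qed

section \<open>Regularity and Ore conditions for \<open>qis\<close> modulo the ideal\<close>

lemma qis_Ar: "s \<in> qis X N \<Longrightarrow> s \<in> Ar X"
  by (induction rule: qis.induct) (auto simp: rel_tri_def dest: s_triangleD)

lemma qis_reflects_null_left:
  assumes "s \<in> qis X N" "f \<in> Mor X W (Dom X s)" "null (s \<cdot> f)"
  shows "null f"
  using assms
proof (induction arbitrary: f rule: qis.induct)
  case (qis_infl A B D x y h)
  obtain M u v where M: "M \<in> N" "u \<in> carrier (Ext X D M)" "v \<in> Mor X M A" "h = push X D v u"
    by (rule rel_tri_inflE[OF qis_infl(1,2)])
  have T: "s_triangle X A B D x y (push X D v u)" using qis_infl(1) M(4) by (simp add: rel_tri_def)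
  show ?case
    by (rule infl_reflects_null[OF T qis_infl(2) M(1-3)]) (use qis_infl s_triangleD[OF T] in auto)
next
  case (qis_defl A B D x y h)
  have T: "s_triangle X A B D x y h" using qis_defl(1) by (simp add: rel_tri_def)
  show ?case
    by (rule defl_reflects_null[OF T qis_defl(2)]) (use qis_defl s_triangleD[OF T] in auto)
next
  case (qis_comp f' g)
  have A: "f' \<in> Ar X" "g \<in> Ar X" using qis_Ar qis_comp by auto
  have f: "f \<in> Mor X W (Dom X f')" using qis_comp A by simp
  have "null (g \<cdot> (f' \<cdot> f))" using qis_comp(7) f A qis_comp(3) by (simp add: Mor_def)
  then have "null (f' \<cdot> f)"
    using qis_comp(5)[of "f' \<cdot> f"] f A qis_comp(3) by (simp add: Mor_def)
  then show ?case using qis_comp(4) f by blast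
qed

lemma qis_reflects_null_right:
  assumes "s \<in> qis X N" "f \<in> Mor X (Cod X s) W" "null (f \<cdot> s)"
  shows "null f"
proof -
  interpret O: ext_closed "opp X" N by (rule ext_closed_opp)
  show ?thesis using O.qis_reflects_null_left[of s f W] assms by simp
qed

text \<open>A class pulled back from \<open>E(M,A)\<close> with \<open>M\<close> and
  \<open>A\<close> in \<open>N\<close> meets the left condition through \<open>A\<close> itself and
  the right one through \<open>M\<close>, because pushing commutes with pulling. The denominators of
  the Ore squares are of this form.\<close>

lemma qis_deflI:
  assumes T: "s_triangle X A B D x y (pull X A d w)" and A: "A \<in> N" "M \<in> N"
    and w: "w \<in> carrier (Ext X M A)" "d \<in> Mor X D M"
  shows "y \<in> qis X N"
proof (rule qis.qis_defl[OF _ A(1)])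
  note t = s_triangleD[OF T]
  let ?h = "pull X A d w"
  have "?h \<in> rel_left X N D A"
    unfolding rel_left_def
  proof (intro CollectI conjI ballI)
    fix M1 x1 assume M1: "M1 \<in> N" "x1 \<in> Mor X M1 D"
    have c: "pull X A x1 ?h \<in> carrier (Ext X M1 A)" by (rule pull_closed[OF t(10,1) M1(2)])
    then show "\<exists>M'\<in>N. \<exists>u\<in>carrier (Ext X M1 M'). \<exists>v\<in>Mor X M' A. pull X A x1 ?h = push X M1 v u"
      using A(1) id_Mor[OF t(1)] N_Ob[OF M1(1)] t(1)
      by (intro bexI[of _ A] bexI[of _ "pull X A x1 ?h"] bexI[of _ "Idn X A"]) auto
  qed (rule t)
  moreover have "?h \<in> rel_right X N D A"
    unfolding rel_right_def
  proof (intro CollectI conjI ballI)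
    fix M1 y1 assume M1: "M1 \<in> N" "y1 \<in> Mor X A M1"
    have "push X D y1 ?h = pull X M1 d (push X M y1 w)"
      using push_pull[OF w M1(2)] by simp
    moreover have "push X M y1 w \<in> carrier (Ext X M M1)" by (rule push_closed[OF w(1) N_Ob[OF A(2)] M1(2)])
    ultimately show "\<exists>M'\<in>N. \<exists>u\<in>carrier (Ext X M' M1). \<exists>v\<in>Mor X D M'. push X D y1 ?h = pull X M1 v u"
      using A(2) w(2) by blast
  qed (rule t)
  ultimately show "rel_tri X N A B D x y ?h" using T by (simp add: rel_tri_def)
qed

text \<open>For an inflation the homotopy pushout gives a deflation
  \<open>F \<oplus> A \<rightarrow> B\<close> with cocone in \<open>N\<close>, and its pullback
  along \<open>a\<close> is the denominator. The component through \<open>F\<close> is null, which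
  is why the square commutes only modulo the ideal. A deflation is pulled back directly, and squares
  for composites are pasted.\<close>

lemma ore_right:
  assumes "s \<in> qis X N" "a \<in> Mor X U (Cod X s)"
  shows "\<exists>U' r b. r \<in> qis X N \<and> r \<in> Mor X U' U \<and> b \<in> Mor X U' (Dom X s) \<and> null ((s \<cdot> b) \<boxplus> Neg X (a \<cdot> r))"
  using assms
proof (induction arbitrary: U a rule: qis.induct)
  case (qis_infl A B D x y h)
  obtain M u v where M: "M \<in> N" "u \<in> carrier (Ext X D M)" "v \<in> Mor X M A" "h = push X D v u"
    by (rule rel_tri_inflE[OF qis_infl(1,2)])
  have T: "s_triangle X A B D x y (push X D v u)" using qis_infl(1) M(4) by (simp add: rel_tri_def)
  note t = s_triangleD[OF T]
  obtain F m n where F: "s_triangle X M F D m n u" using tri_exists[OF M(2) t(3)] N_Ob[OF M(1)] by auto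
  have FN: "F \<in> N" by (rule N_ext[OF F M(1) qis_infl(2)])
  obtain S j j' r r' where bS: "biproduct X F A S j j' r r'" using biproduct_exists s_triangleD(2)[OF F] t(1) by blast
  note b = biproductD[OF bS] biproduct_reassoc[OF bS]
  obtain c where c: "c \<in> Mor X F B"
    and H: "s_triangle X M S B ((j \<cdot> m) \<boxplus> Neg X (j' \<cdot> v)) ((c \<cdot> r) \<boxplus> (x \<cdot> r')) (pull X M y u)"
    using homotopy_pushout[OF F M(3) T bS] by auto
  have a: "a \<in> Mor X U B" using qis_infl t by simp
  obtain P k r1 b1 where P: "s_triangle X M P U k r1 (pull X M a (pull X M y u))" "b1 \<in> Mor X P S"
    "((c \<cdot> r) \<boxplus> (x \<cdot> r')) \<cdot> b1 = a \<cdot> r1"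
    using pullback_ex[OF H a] by blast
  note tP = s_triangleD[OF P(1)]
  have ya: "y \<cdot> a \<in> Mor X U D" using a t by (simp add: Mor_def)
  \<comment> \<open>The class of the new deflation is \<open>u\<close> pulled back along
    \<open>y \<cdot> a\<close>, and \<open>u\<close> lies in \<open>E(D,M)\<close> with
    \<open>D\<close> and \<open>M\<close> in \<open>N\<close>.\<close>
  have "pull X M a (pull X M y u) = pull X M (y \<cdot> a) u"
    by (rule pull_pull[OF M(2) N_Ob[OF M(1)] t(13) a])
  then have r1: "r1 \<in> qis X N"
    using qis_deflI[of M P U k r1 "y \<cdot> a" u D] P(1) M(1,2) qis_infl(2) ya by simp
  have ty: "a \<in> Ar X" "Dom X a = U" "Cod X a = B" "b1 \<in> Ar X" "Dom X b1 = P" "Cod X b1 = S"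
    "c \<in> Ar X" "Dom X c = F" "Cod X c = B" using a P(2) c by (auto simp: Mor_def)
  have "c \<cdot> (r \<cdot> b1) \<boxplus> x \<cdot> (r' \<cdot> b1) = a \<cdot> r1" using P(3) ty b(1-15) t(1-9) by simp
  moreover have "Neg X (c \<cdot> (r \<cdot> b1) \<boxplus> x \<cdot> (r' \<cdot> b1)) = Neg X (c \<cdot> (r \<cdot> b1)) \<boxplus> Neg X (x \<cdot> (r' \<cdot> b1))"
    using ty b(1-15) t(1-9) by (simp add: neg_add)
  moreover have "x \<cdot> (r' \<cdot> b1) \<boxplus> (Neg X (c \<cdot> (r \<cdot> b1)) \<boxplus> Neg X (x \<cdot> (r' \<cdot> b1))) = Neg X (c \<cdot> (r \<cdot> b1))"
    by (subst add_left_comm) (use ty b(1-15) t(1-9) in simp_all)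
  ultimately have eq: "x \<cdot> (r' \<cdot> b1) \<boxplus> Neg X (a \<cdot> r1) = Neg X (c \<cdot> (r \<cdot> b1))" by simp
  have "null (c \<cdot> (r \<cdot> b1))" by (rule nullI[OF FN, of _ P _ B]) (use ty b(1-15) in \<open>simp_all add: Mor_def\<close>)
  then have "null (x \<cdot> (r' \<cdot> b1) \<boxplus> Neg X (a \<cdot> r1))"
    unfolding eq by (rule null_neg[of _ P B]) (use ty b(1-15) in \<open>simp add: Mor_def\<close>)
  moreover have "r' \<cdot> b1 \<in> Mor X P (Dom X x)" using ty b(1-15) t(1-9) by (simp add: Mor_def)
  ultimately show ?case using r1 tP(13) by blast
next
  case (qis_defl A B D x y h)
  obtain M w d where M: "M \<in> N" "w \<in> carrier (Ext X M A)" "d \<in> Mor X D M" "h = pull X A d w"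
    by (rule rel_tri_deflE[OF qis_defl(1,2)])
  have T: "s_triangle X A B D x y h" using qis_defl(1) by (simp add: rel_tri_def)
  note t = s_triangleD[OF T]
  have a: "a \<in> Mor X U D" using qis_defl t by simp
  obtain P k r1 b1 where P: "s_triangle X A P U k r1 (pull X A a h)" "b1 \<in> Mor X P B" "y \<cdot> b1 = a \<cdot> r1"
    using pullback_ex[OF T a] by blast
  note tP = s_triangleD[OF P(1)]
  have "pull X A a h = pull X A (d \<cdot> a) w" unfolding M(4) by (rule pull_pull[OF M(2) t(1) M(3) a])
  moreover have "d \<cdot> a \<in> Mor X U M" by (rule comp_Mor[OF a M(3)])
  ultimately have r1: "r1 \<in> qis X N" using qis_deflI[of A P U k r1 "d \<cdot> a" w M] P(1) qis_defl(2) M(1,2) by simp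
  have "y \<cdot> b1 \<boxplus> Neg X (a \<cdot> r1) = Zero X P D"
    unfolding P(3) using a tP by (simp add: Mor_def)
  then have "null (y \<cdot> b1 \<boxplus> Neg X (a \<cdot> r1))" using null_zero[OF tP(2) t(3)] by simp
  moreover have "b1 \<in> Mor X P (Dom X y)" using P(2) t by simp
  ultimately show ?case using r1 tP(13) by blast
next
  case (qis_comp f g)
  have A: "f \<in> Ar X" "g \<in> Ar X" using qis_Ar qis_comp by auto
  have a: "a \<in> Mor X U (Cod X g)" using qis_comp A by simp
  obtain U1 r1 b1 where 1: "r1 \<in> qis X N" "r1 \<in> Mor X U1 U" "b1 \<in> Mor X U1 (Dom X g)"
    "null ((g \<cdot> b1) \<boxplus> Neg X (a \<cdot> r1))" using qis_comp(5)[OF a] by blast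
  have "b1 \<in> Mor X U1 (Cod X f)" using 1(3) qis_comp(3) by simp
  from qis_comp(4)[OF this] obtain U2 r2 b2 where 2: "r2 \<in> qis X N" "r2 \<in> Mor X U2 U1" "b2 \<in> Mor X U2 (Dom X f)"
    "null ((f \<cdot> b2) \<boxplus> Neg X (b1 \<cdot> r2))" by blast
  have ty: "r1 \<in> Ar X" "Dom X r1 = U1" "Cod X r1 = U" "r2 \<in> Ar X" "Dom X r2 = U2" "Cod X r2 = U1"
    "b1 \<in> Ar X" "Dom X b1 = U1" "Cod X b1 = Dom X g" "b2 \<in> Ar X" "Dom X b2 = U2" "Cod X b2 = Dom X f"
    "a \<in> Ar X" "Dom X a = U" "Cod X a = Cod X g"
    using 1(2,3) 2(2,3) a by (simp_all add: Mor_def)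
  have n1: "null ((g \<cdot> (f \<cdot> b2)) \<boxplus> Neg X (g \<cdot> (b1 \<cdot> r2)))"
    by (rule null_diff_left[OF 2(4), of U2 "Dom X g" _ "Cod X g"]) (use ty A qis_comp(3) in \<open>simp_all add: Mor_def\<close>)
  have n2: "null (((g \<cdot> b1) \<cdot> r2) \<boxplus> Neg X ((a \<cdot> r1) \<cdot> r2))"
    by (rule null_diff_right[OF 1(4), of U1 "Cod X g" _ U2]) (use ty A qis_comp(3) in \<open>simp_all add: Mor_def\<close>)
  have "null ((g \<cdot> (f \<cdot> b2)) \<boxplus> Neg X ((a \<cdot> r1) \<cdot> r2))"
    by (rule null_diff_trans[OF n1, of _ U2 "Cod X g"]) (use n2 ty A qis_comp(3) in \<open>simp_all add: Mor_def\<close>)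
  then have "null (((g \<cdot> f) \<cdot> b2) \<boxplus> Neg X (a \<cdot> (r1 \<cdot> r2)))"
    using ty A qis_comp(3) by simp
  moreover have "r1 \<cdot> r2 \<in> qis X N" using qis.qis_comp[OF 2(1) 1(1)] ty by simp
  moreover have "r1 \<cdot> r2 \<in> Mor X U2 U" "b2 \<in> Mor X U2 (Dom X (g \<cdot> f))" using ty A qis_comp(3) by (simp_all add: Mor_def)
  ultimately show ?case by blast
qed

lemma ore_left:
  assumes "s \<in> qis X N" "a \<in> Mor X (Dom X s) U"
  shows "\<exists>U' l b. l \<in> qis X N \<and> l \<in> Mor X U U' \<and> b \<in> Mor X (Cod X s) U' \<and> null ((b \<cdot> s) \<boxplus> Neg X (l \<cdot> a))"
proof -
  interpret O: ext_closed "opp X" N by (rule ext_closed_opp)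
  show ?thesis using O.ore_right[of s a U] assms by simp
qed

lemma rel_left_reflects_null:
  assumes gen: "\<exists>N1 N0 n p \<delta>. N1 \<in> N \<and> N0 \<in> N \<and> s_triangle X N1 N0 D n p \<delta>"
    and T: "s_triangle X A B D x y h" "h \<in> rel_left X N D A"
    and f: "f \<in> Mor X W A" "null (x \<cdot> f)"
  shows "null f"
proof -
  obtain N1 N0 n p \<delta> where G: "N1 \<in> N" "N0 \<in> N" "s_triangle X N1 N0 D n p \<delta>" using gen by auto
  note t = s_triangleD[OF T(1)] and tG = s_triangleD[OF G(3)]
  obtain P m1 m2 e1 e2 where P: "s_triangle X N1 P B m2 e1 (pull X N1 y \<delta>)"
    "s_triangle X A P N0 m1 e2 (pull X A p h)" "e1 \<cdot> m1 = x"
    using common_pullback[OF T(1) G(3)] by blast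
  note tP = s_triangleD[OF P(1)] and tP' = s_triangleD[OF P(2)]
  \<comment> \<open>The left condition is tested at \<open>p : N0 \<rightarrow> D\<close>; it shows
    that the class of \<open>m1 : A \<rightarrow> P\<close> is pushed out from
    \<open>E(N0,M)\<close>.\<close>
  obtain M u v where M: "M \<in> N" "u \<in> carrier (Ext X N0 M)" "v \<in> Mor X M A" "pull X A p h = push X N0 v u"
    using T(2) G(2) tG(13) unfolding rel_left_def by blast
  have ty: "f \<in> Ar X" "Dom X f = W" "Cod X f = A" using f(1) by (auto simp: Mor_def)
  have "null (e1 \<cdot> (m1 \<cdot> f))" using f(2) unfolding P(3)[symmetric] using ty tP tP' by simp
  then have "null (m1 \<cdot> f)"
    by (rule defl_reflects_null[OF P(1) G(1), rotated]) (use ty tP' in \<open>simp add: Mor_def\<close>)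
  then show ?thesis using infl_reflects_null[OF P(2)[unfolded M(4)] G(2) M(1-3) f(1)] by simp
qed

lemma rel_left_N:
  assumes gen: "\<exists>N1 N0 n p \<delta>. N1 \<in> N \<and> N0 \<in> N \<and> s_triangle X N1 N0 D n p \<delta>"
    and T: "s_triangle X A B D x y h" "h \<in> rel_left X N D A" and B: "B \<in> N"
  shows "A \<in> N"
proof -
  obtain N1 N0 n p \<delta> where G: "N1 \<in> N" "N0 \<in> N" "s_triangle X N1 N0 D n p \<delta>" using gen by auto
  note t = s_triangleD[OF T(1)] and tG = s_triangleD[OF G(3)]
  obtain P m1 m2 e1 e2 where P: "s_triangle X N1 P B m2 e1 (pull X N1 y \<delta>)"
    "s_triangle X A P N0 m1 e2 (pull X A p h)"
    using common_pullback[OF T(1) G(3)] by blast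
  obtain M u v where M: "M \<in> N" "u \<in> carrier (Ext X N0 M)" "v \<in> Mor X M A" "pull X A p h = push X N0 v u"
    using T(2) G(2) tG(13) unfolding rel_left_def by blast
  obtain F m n' where F: "s_triangle X M F N0 m n' u" using tri_exists[OF M(2)] N_Ob[OF M(1)] N_Ob[OF G(2)] by auto
  obtain S j j' r r' where bS: "biproduct X F A S j j' r r'" using biproduct_exists s_triangleD(2)[OF F] t(1) by blast
  obtain c where "s_triangle X M S P ((j \<cdot> m) \<boxplus> Neg X (j' \<cdot> v)) ((c \<cdot> r) \<boxplus> (m1 \<cdot> r')) (pull X M e2 u)"
    using homotopy_pushout[OF F M(3) P(2)[unfolded M(4)] bS] by auto
  \<comment> \<open>\<open>P\<close> extends \<open>B\<close> by \<open>N1\<close>, and the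
    biproduct \<open>S\<close> of \<open>F\<close> and \<open>A\<close> extends \<open>P\<close> by
    \<open>M\<close>.\<close>
  then have "S \<in> N" using N_ext M(1) N_ext[OF P(1) G(1) B] by blast
  then show ?thesis using N_summand biproduct_swap[OF bS] by blast
qed

lemma rel_right_reflects_null:
  assumes gen: "\<exists>N1 N0 n p \<delta>. N1 \<in> N \<and> N0 \<in> N \<and> s_triangle X A N0 N1 p n \<delta>"
    and T: "s_triangle X A B D x y h" "h \<in> rel_right X N D A"
    and f: "f \<in> Mor X D W" "null (f \<cdot> y)"
  shows "null f"
proof -
  interpret O: ext_closed "opp X" N by (rule ext_closed_opp)
  show ?thesis using O.rel_left_reflects_null[of A D B y x h f W] assms by auto
qed

lemma rel_right_N:
  assumes gen: "\<exists>N1 N0 n p \<delta>. N1 \<in> N \<and> N0 \<in> N \<and> s_triangle X A N0 N1 p n \<delta>"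
    and T: "s_triangle X A B D x y h" "h \<in> rel_right X N D A" and B: "B \<in> N"
  shows "D \<in> N"
proof -
  interpret O: ext_closed "opp X" N by (rule ext_closed_opp)
  show ?thesis using O.rel_left_N[of A D B y x h] assms by auto
qed

text \<open>A zero class is pushed out from, and pulled back from, the zero object, which belongs to
  \<open>N\<close>. So vanishing under all test arrows is a sufficient criterion.\<close>

lemma one_rel:
  assumes "D \<in> Ob X" "A \<in> Ob X"
    and "h \<in> carrier (Ext X D A)"
  shows "(\<And>M x. M \<in> N \<Longrightarrow> x \<in> Mor X M D \<Longrightarrow> pull X A x h = \<one>\<^bsub>Ext X M A\<^esub>) \<Longrightarrow> h \<in> rel_left X N D A"
    "(\<And>M y. M \<in> N \<Longrightarrow> y \<in> Mor X A M \<Longrightarrow> push X D y h = \<one>\<^bsub>Ext X D M\<^esub>) \<Longrightarrow> h \<in> rel_right X N D A"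
proof -
  obtain Z where Z: "zero_object X Z" using zero_object_exists by auto
  have ZO: "Z \<in> Ob X" "Z \<in> N" using zero_object_id[OF Z] N_zero[OF Z] by auto
  have z: "Zero X Z A \<in> Mor X Z A" "Zero X D Z \<in> Mor X D Z" using ZO assms by (auto simp: Mor_def)
  have L: "\<exists>M'\<in>N. \<exists>u\<in>carrier (Ext X M M'). \<exists>v\<in>Mor X M' A. \<one>\<^bsub>Ext X M A\<^esub> = push X M v u"
    if "M \<in> N" for M
    by (intro bexI[of _ Z] bexI[of _ "\<one>\<^bsub>Ext X M Z\<^esub>"] bexI[of _ "Zero X Z A"])
      (use ZO z N_Ob[OF that] in simp_all)
  have R: "\<exists>M'\<in>N. \<exists>u\<in>carrier (Ext X M' M). \<exists>v\<in>Mor X D M'. \<one>\<^bsub>Ext X D M\<^esub> = pull X M v u"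
    if "M \<in> N" for M
    by (intro bexI[of _ Z] bexI[of _ "\<one>\<^bsub>Ext X Z M\<^esub>"] bexI[of _ "Zero X D Z"])
      (use ZO z N_Ob[OF that] in simp_all)
  show "h \<in> rel_left X N D A" if "\<And>M x. M \<in> N \<Longrightarrow> x \<in> Mor X M D \<Longrightarrow> pull X A x h = \<one>\<^bsub>Ext X M A\<^esub>"
    unfolding rel_left_def using assms(3) that L by simp
  show "h \<in> rel_right X N D A" if "\<And>M y. M \<in> N \<Longrightarrow> y \<in> Mor X A M \<Longrightarrow> push X D y h = \<one>\<^bsub>Ext X D M\<^esub>"
    unfolding rel_right_def using assms(3) that R by simp
qed

text \<open>The class is \<open>h\<close> pulled back along \<open>e\<close>. For the left
  condition, \<open>e \<cdot> g\<close> lifts through \<open>p\<close>, and \<open>p\<close> pulls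
  \<open>h\<close> to zero. For the right one, a map from \<open>K\<close> to an object of
  \<open>N\<close> extends along \<open>q\<close>, hence along the inflation into \<open>S\<close>,
  and an inflation pushes its own class to zero.\<close>

lemma approximation_rel_tri:
  assumes T: "s_triangle X K M0 D k p h" and M0: "M0 \<in> N"
    and p: "\<And>M g. M \<in> N \<Longrightarrow> g \<in> Mor X M D \<Longrightarrow> \<exists>t \<in> Mor X M M0. p \<cdot> t = g"
    and M1: "M1 \<in> N" "q \<in> Mor X K M1"
    and q: "\<And>M g. M \<in> N \<Longrightarrow> g \<in> Mor X K M \<Longrightarrow> \<exists>t \<in> Mor X M1 M. t \<cdot> q = g"
  shows "\<exists>S E x y h'. rel_tri X N K S E x y h' \<and> S \<in> N"
proof -
  note t = s_triangleD[OF T]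
  obtain E x' e where T': "s_triangle X M1 E D x' e (push X D q h)"
    using tri_exists[OF push_closed[OF t(10,3) M1(2)] t(3) N_Ob[OF M1(1)]] by auto
  note t' = s_triangleD[OF T']
  obtain S j j' r r' where bS: "biproduct X M0 M1 S j j' r r'" using biproduct_exists t(2) t'(1) by blast
  note b = biproductD[OF bS] biproduct_reassoc[OF bS]
  obtain c where H: "s_triangle X K S E ((j \<cdot> k) \<boxplus> Neg X (j' \<cdot> q)) ((c \<cdot> r) \<boxplus> (x' \<cdot> r')) (pull X K e h)"
      (is "s_triangle X K S E ?x ?y ?h")
    using homotopy_pushout[OF T M1(2) T' bS] by auto
  note tH = s_triangleD[OF H]
  have qq: "q \<in> Ar X" "Dom X q = K" "Cod X q = M1" using M1(2) by (auto simp: Mor_def)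
  have "?h \<in> rel_left X N E K"
  proof (rule one_rel(1)[OF tH(3,1,10)])
    fix M g assume M: "M \<in> N" "g \<in> Mor X M E"
    have eg: "e \<cdot> g \<in> Mor X M D" using M(2) t' by (simp add: Mor_def)
    obtain s where s: "s \<in> Mor X M M0" "p \<cdot> s = e \<cdot> g" using p[OF M(1) eg] by auto
    have "pull X K g ?h = pull X K (p \<cdot> s) h" unfolding s(2) by (rule pull_pull[OF t(10,1) t'(13) M(2)])
    also have "\<dots> = pull X K s (pull X K p h)" by (rule pull_pull[OF t(10,1) t(13) s(1), symmetric])
    also have "\<dots> = \<one>\<^bsub>Ext X M K\<^esub>" unfolding tri_pull_defl[OF T] using t s(1) by simp
    finally show "pull X K g ?h = \<one>\<^bsub>Ext X M K\<^esub>" .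
  qed
  moreover have "?h \<in> rel_right X N E K"
  proof (rule one_rel(2)[OF tH(3,1,10)])
    fix M g assume M: "M \<in> N" "g \<in> Mor X K M"
    obtain s where s: "s \<in> Mor X M1 M" "s \<cdot> q = g" using q[OF M] by auto
    have ts: "s \<in> Ar X" "Dom X s = M1" "Cod X s = M" using s(1) by (auto simp: Mor_def)
    have "Neg X (s \<cdot> r') \<cdot> ?x = s \<cdot> q" using ts qq t(1-9) b N_Ob[OF M(1)] by simp
    then have g: "g = Neg X (s \<cdot> r') \<cdot> ?x" using s(2) by simp
    have sr: "Neg X (s \<cdot> r') \<in> Mor X S M" using ts b(1-15) by (simp add: Mor_def)
    have "push X E g ?h = push X E (Neg X (s \<cdot> r')) (push X E ?x ?h)"
      unfolding g by (rule push_push[OF tH(10,3,12) sr, symmetric])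
    also have "\<dots> = \<one>\<^bsub>Ext X E M\<^esub>" unfolding tri_push_infl[OF H] using tH sr by simp
    finally show "push X E g ?h = \<one>\<^bsub>Ext X E M\<^esub>" .
  qed
  ultimately have "rel_tri X N K S E ?x ?y ?h" using H by (simp add: rel_tri_def)
  then show ?thesis using N_sum[OF M0 M1(1) bS] by blast
qed

end

section \<open>Gabriel--Zisman localization and fractions\<close>

lemma zz_path_append: "zz_path C S A p B \<Longrightarrow> zz_path C S B q D \<Longrightarrow> zz_path C S A (p @ q) D"
  by (induction rule: zz_path.induct) (auto intro: zz_path.intros)

context category
begin

lemma zz_path_fwd: "f \<in> Mor C A B \<Longrightarrow> zz_path C S A [Inl f] B"
  using Mor_Ob[of f A B] by (auto intro: zz_path.intros)

lemma zz_path_bwd: "s \<in> S \<Longrightarrow> s \<in> Mor C B A \<Longrightarrow> zz_path C S A [Inr s] B"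
  using Mor_Ob[of s B A] by (auto intro: zz_path.intros)

lemma zz_eq_path: "zz_eq C S A B p q \<Longrightarrow> zz_path C S A p B \<and> zz_path C S A q B"
proof (induction rule: zz_eq.induct)
  case (zz_comp f A B g D)
  then show ?case using zz_path_append[OF zz_path_fwd[OF zz_comp(1)] zz_path_fwd[OF zz_comp(2)]]
      zz_path_fwd[OF comp_Mor[OF zz_comp(1,2)]] by simp
next
  case (zz_inv_left s A B)
  then show ?case using zz_path_append[OF zz_path_fwd[OF zz_inv_left(2)] zz_path_bwd[OF zz_inv_left]]
      Mor_Ob[of s A B] by (auto intro: zz_path.intros)
next
  case (zz_inv_right s A B)
  then show ?case using zz_path_append[OF zz_path_bwd[OF zz_inv_right] zz_path_fwd[OF zz_inv_right(2)]]
      Mor_Ob[of s A B] by (auto intro: zz_path.intros)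
qed (auto intro: zz_path.intros zz_path_append zz_path_fwd id_Mor)

lemma gz_class_eq_iff:
  assumes "zz_path C S A p B"
  shows "gz_class C S A B p = gz_class C S A B q \<longleftrightarrow> zz_eq C S A B p q"
proof
  assume "gz_class C S A B p = gz_class C S A B q"
  then have "{r. zz_eq C S A B p r} = {r. zz_eq C S A B q r}" by (simp add: gz_class_def)
  then have "zz_eq C S A B q p" using zz_refl[OF assms] by auto
  then show "zz_eq C S A B p q" by (rule zz_sym)
next
  assume "zz_eq C S A B p q"
  then show "gz_class C S A B p = gz_class C S A B q"
    unfolding gz_class_def by (auto intro: zz_trans zz_sym)
qed

text \<open>Zigzags are listed in the order of traversal, so the factors of a composite are
  concatenated in reverse.\<close>

lemma gz_comp:
  assumes "zz_path C S A p B" "zz_path C S B q D"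
  shows "Comp (gz_localization C S) (gz_class C S B D q) (gz_class C S A B p) = gz_class C S A D (p @ q)"
proof -
  have "(\<exists>p'. zz_eq C S A B p p' \<and> (\<exists>q'. zz_eq C S B D q q' \<and> zz_eq C S A D (p' @ q') r))
      \<longleftrightarrow> zz_eq C S A D (p @ q) r" for r
    using assms by (meson zz_refl zz_trans zz_cong)
  then show ?thesis by (auto simp: gz_localization_def gz_class_def)
qed

end

text \<open>\<open>eqv\<close> is a congruence modulo which the arrows of \<open>S\<close> are regular and satisfy the Ore conditions.
  A zigzag then acts on the arrows into its source as a partial function modulo \<open>eqv\<close>, which is
  defined after precomposition with an arrow of \<open>S\<close>; this action is invariant under \<open>zz_eq\<close>.\<close>

locale gz_calculus = category C
  for C :: "('o, 'm, 'z) cat_scheme" (structure) +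
  fixes S :: "'m set" and eqv :: "'m \<Rightarrow> 'm \<Rightarrow> bool"
  assumes S_id: "A \<in> Ob C \<Longrightarrow> Idn C A \<in> S"
    and S_comp: "\<lbrakk>f \<in> S; g \<in> S; f \<in> Mor C A B; g \<in> Mor C B D\<rbrakk> \<Longrightarrow> g \<cdot> f \<in> S"
    and eqv_refl: "f \<in> Mor C A B \<Longrightarrow> eqv f f"
    and eqv_sym: "\<lbrakk>f \<in> Mor C A B; g \<in> Mor C A B; eqv f g\<rbrakk> \<Longrightarrow> eqv g f"
    and eqv_trans: "\<lbrakk>f \<in> Mor C A B; g \<in> Mor C A B; h \<in> Mor C A B; eqv f g; eqv g h\<rbrakk> \<Longrightarrow> eqv f h"
    and eqv_left: "\<lbrakk>f \<in> Mor C A B; g \<in> Mor C A B; k \<in> Mor C B D; eqv f g\<rbrakk> \<Longrightarrow> eqv (k \<cdot> f) (k \<cdot> g)"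
    and eqv_right: "\<lbrakk>f \<in> Mor C A B; g \<in> Mor C A B; k \<in> Mor C D A; eqv f g\<rbrakk> \<Longrightarrow> eqv (f \<cdot> k) (g \<cdot> k)"
    and eqv_mono: "\<lbrakk>s \<in> S; s \<in> Mor C A B; f \<in> Mor C W A; g \<in> Mor C W A; eqv (s \<cdot> f) (s \<cdot> g)\<rbrakk> \<Longrightarrow> eqv f g"
    and eqv_epi: "\<lbrakk>s \<in> S; s \<in> Mor C A B; f \<in> Mor C B W; g \<in> Mor C B W; eqv (f \<cdot> s) (g \<cdot> s)\<rbrakk> \<Longrightarrow> eqv f g"
    and ore_r: "\<lbrakk>s \<in> S; s \<in> Mor C A B; a \<in> Mor C U B\<rbrakk>
      \<Longrightarrow> \<exists>U' r b. r \<in> S \<and> r \<in> Mor C U' U \<and> b \<in> Mor C U' A \<and> eqv (s \<cdot> b) (a \<cdot> r)"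
    and ore_l: "\<lbrakk>s \<in> S; s \<in> Mor C A B; a \<in> Mor C A U\<rbrakk>
      \<Longrightarrow> \<exists>U' l b. l \<in> S \<and> l \<in> Mor C U U' \<and> b \<in> Mor C B U' \<and> eqv (b \<cdot> s) (l \<cdot> a)"
begin

primrec act :: "'m zigzag \<Rightarrow> 'm \<Rightarrow> 'm \<Rightarrow> bool" where
  "act [] a b \<longleftrightarrow> eqv a b"
| "act (z # p) a b \<longleftrightarrow> (case z of Inl f \<Rightarrow> act p (f \<cdot> a) b
     | Inr s \<Rightarrow> \<exists>c \<in> Mor C (Dom C a) (Dom C s). eqv (s \<cdot> c) a \<and> act p c b)"

lemma act_cong:
  assumes "zz_path C S A p B" "a \<in> Mor C U A" "a' \<in> Mor C U A" "b \<in> Mor C U B" "eqv a a'" "act p a b"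
  shows "act p a' b"
  using assms
proof (induction arbitrary: a a' rule: zz_path.induct)
  case (zz_nil A)
  then have "eqv a' a" using eqv_sym[of a U A a'] by simp
  then show ?case using eqv_trans[of a' U A a b] zz_nil by simp
next
  case (zz_fwd f A B' p D)
  have "eqv (f \<cdot> a) (f \<cdot> a')" by (rule eqv_left[OF zz_fwd(4,5,1,7)])
  then show ?case
    using zz_fwd(3)[OF comp_Mor[OF zz_fwd(4,1)] comp_Mor[OF zz_fwd(5,1)] zz_fwd(6)] zz_fwd(8) by simp
next
  case (zz_bwd s B' A p D)
  have D: "Dom C a = U" "Dom C a' = U" "Dom C s = B'" using zz_bwd by (auto simp: Mor_def)
  obtain c where c: "c \<in> Mor C U B'" "eqv (s \<cdot> c) a" "act p c b" using zz_bwd(9) D by auto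
  have "eqv (s \<cdot> c) a'"
    by (rule eqv_trans[OF comp_Mor[OF c(1) zz_bwd(2)] zz_bwd(5,6) c(2) zz_bwd(8)])
  then show ?case using c D by auto
qed

text \<open>At a formal inverse of \<open>s\<close>, two solutions \<open>c\<close> of
  \<open>s \<cdot> c = a\<close> modulo \<open>eqv\<close> agree modulo \<open>eqv\<close> by
  \<open>eqv_mono\<close>.\<close>

lemma act_fun:
  assumes "zz_path C S A p B" "a \<in> Mor C U A" "b \<in> Mor C U B" "b' \<in> Mor C U B" "act p a b" "act p a b'"
  shows "eqv b b'"
  using assms
proof (induction arbitrary: a rule: zz_path.induct)
  case (zz_nil A)
  then have "eqv b a" using eqv_sym[of a U A b] by simp
  then show ?case using eqv_trans[of b U A a b'] zz_nil by simp
next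
  case (zz_fwd f A B' p D)
  show ?case using zz_fwd(3)[OF comp_Mor[OF zz_fwd(4,1)] zz_fwd(5,6)] zz_fwd(7,8) by simp
next
  case (zz_bwd s B' A p D)
  have D: "Dom C a = U" "Dom C s = B'" using zz_bwd by (auto simp: Mor_def)
  obtain c where c: "c \<in> Mor C U B'" "eqv (s \<cdot> c) a" "act p c b" using zz_bwd(8) D by auto
  obtain c' where c': "c' \<in> Mor C U B'" "eqv (s \<cdot> c') a" "act p c' b'" using zz_bwd(9) D by auto
  have sc: "s \<cdot> c \<in> Mor C U A" "s \<cdot> c' \<in> Mor C U A" using comp_Mor zz_bwd(2) c(1) c'(1) by blast+
  have "eqv (s \<cdot> c') (s \<cdot> c)"
    by (rule eqv_trans[OF sc(2) zz_bwd(5) sc(1) c'(2) eqv_sym[OF sc(1) zz_bwd(5) c(2)]])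
  then have "eqv c' c" by (rule eqv_mono[OF zz_bwd(1,2) c'(1) c(1)])
  then have "act p c b'" by (rule act_cong[OF zz_bwd(3) c'(1) c(1) zz_bwd(7) _ c'(3)])
  then show ?case by (rule zz_bwd(4)[OF c(1) zz_bwd(6,7) c(3)])
qed

lemma act_append:
  assumes "zz_path C S A p B" "zz_path C S B q D" "a \<in> Mor C U A" "d \<in> Mor C U D" "act (p @ q) a d"
  shows "\<exists>c \<in> Mor C U B. act p a c \<and> act q c d"
  using assms
proof (induction arbitrary: a rule: zz_path.induct)
  case (zz_nil A) then show ?case using eqv_refl by auto
next
  case (zz_fwd f A B' p D')
  show ?case using zz_fwd(3)[OF zz_fwd(4) comp_Mor[OF zz_fwd(5,1)] zz_fwd(6)] zz_fwd(7) by simp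
next
  case (zz_bwd s B' A p D')
  have D: "Dom C a = U" "Dom C s = B'" using zz_bwd by (auto simp: Mor_def)
  obtain c where c: "c \<in> Mor C U B'" "eqv (s \<cdot> c) a" "act (p @ q) c d" using zz_bwd(8) D by auto
  obtain e where "e \<in> Mor C U D'" "act p c e" "act q e d" using zz_bwd(4)[OF zz_bwd(5) c(1) zz_bwd(7) c(3)] by auto
  then show ?case using c D by auto
qed

lemma act_pre:
  assumes "zz_path C S A p B" "a \<in> Mor C U A" "b \<in> Mor C U B" "act p a b" "r \<in> Mor C V U"
  shows "act p (a \<cdot> r) (b \<cdot> r)"
  using assms
proof (induction arbitrary: a rule: zz_path.induct)
  case (zz_nil A) then show ?case using eqv_right by auto
next
  case (zz_fwd f A B' p D')
  have "f \<cdot> (a \<cdot> r) = (f \<cdot> a) \<cdot> r" using zz_fwd(1,4,7) by (simp add: Mor_def)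
  then show ?case using zz_fwd(3)[OF comp_Mor[OF zz_fwd(4,1)] zz_fwd(5) _ zz_fwd(7)] zz_fwd(6) by simp
next
  case (zz_bwd s B' A p D')
  have D: "Dom C a = U" "Dom C s = B'" "Dom C (a \<cdot> r) = V" using zz_bwd(2,5,8) by (auto simp: Mor_def)
  obtain c where c: "c \<in> Mor C U B'" "eqv (s \<cdot> c) a" "act p c b" using zz_bwd(7) D by auto
  have "act p (c \<cdot> r) (b \<cdot> r)" by (rule zz_bwd(4)[OF c(1) zz_bwd(6) c(3) zz_bwd(8)])
  moreover have "eqv ((s \<cdot> c) \<cdot> r) (a \<cdot> r)"
    by (rule eqv_right[OF comp_Mor[OF c(1) zz_bwd(2)] zz_bwd(5,8) c(2)])
  then have "eqv (s \<cdot> (c \<cdot> r)) (a \<cdot> r)" using c(1) zz_bwd(2,8) by (simp add: Mor_def)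
  ultimately show ?case using D comp_Mor[OF zz_bwd(8) c(1)] by auto
qed

text \<open>An Ore square makes each formal inverse solvable; the denominators accumulate in
  \<open>r\<close>.\<close>

lemma act_dense:
  assumes "zz_path C S A p B" "a \<in> Mor C U A"
  shows "\<exists>V r b. r \<in> S \<and> r \<in> Mor C V U \<and> b \<in> Mor C V B \<and> act p (a \<cdot> r) b"
  using assms
proof (induction arbitrary: a U rule: zz_path.induct)
  case (zz_nil A)
  have U: "U \<in> Ob C" using Mor_Ob[OF zz_nil(2)] by simp
  have a: "a \<cdot> Idn C U \<in> Mor C U A" using comp_Mor[OF id_Mor[OF U] zz_nil(2)] .
  show ?case
    by (rule exI[of _ U], rule exI[of _ "Idn C U"], rule exI[of _ "a \<cdot> Idn C U"])
      (use S_id[OF U] id_Mor[OF U] a eqv_refl[OF a] in simp)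
next
  case (zz_fwd f A B' p D)
  obtain V r b where r: "r \<in> S" "r \<in> Mor C V U" "b \<in> Mor C V D" "act p ((f \<cdot> a) \<cdot> r) b"
    using zz_fwd(3)[OF comp_Mor[OF zz_fwd(4,1)]] by blast
  have "(f \<cdot> a) \<cdot> r = f \<cdot> (a \<cdot> r)" using zz_fwd(1,4) r(2) by (simp add: Mor_def)
  then show ?case using r by auto
next
  case (zz_bwd s B' A p D)
  obtain V r b where r: "r \<in> S" "r \<in> Mor C V U" "b \<in> Mor C V B'" "eqv (s \<cdot> b) (a \<cdot> r)"
    using ore_r[OF zz_bwd(1,2,5)] by blast
  obtain V' r' d where r': "r' \<in> S" "r' \<in> Mor C V' V" "d \<in> Mor C V' D" "act p (b \<cdot> r') d"
    using zz_bwd(4)[OF r(3)] by blast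
  have "eqv ((s \<cdot> b) \<cdot> r') ((a \<cdot> r) \<cdot> r')"
    by (rule eqv_right[OF comp_Mor[OF r(3) zz_bwd(2)] comp_Mor[OF r(2) zz_bwd(5)] r'(2) r(4)])
  then have e: "eqv (s \<cdot> (b \<cdot> r')) (a \<cdot> (r \<cdot> r'))" using r(2,3) r'(2) zz_bwd(2,5) by (simp add: Mor_def)
  have D: "Dom C (a \<cdot> (r \<cdot> r')) = V'" "Dom C s = B'" using r(2,3) r'(2) zz_bwd(2,5) by (simp_all add: Mor_def)
  have "act (Inr s # p) (a \<cdot> (r \<cdot> r')) d"
    using e r'(4) comp_Mor[OF r'(2) r(3)] D by auto
  then show ?case using S_comp[OF r'(1) r(1) r'(2) r(2)] comp_Mor[OF r'(2) r(2)] r'(3) by blast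
qed

lemma act_invariant:
  assumes "zz_eq C S A B p q" "a \<in> Mor C U A" "b \<in> Mor C U B" "c \<in> Mor C U B" "act p a b" "act q a c"
  shows "eqv b c"
  using assms
proof (induction arbitrary: U a b c rule: zz_eq.induct)
  case (zz_refl A p B) then show ?case using act_fun by blast
next
  case (zz_sym A B p q)
  have "eqv c b" by (rule zz_sym(2)[OF zz_sym(3,5,4,7,6)])
  then show ?case by (rule eqv_sym[OF zz_sym(5,4)])
next
  case (zz_trans A B p q t)
  have P: "zz_path C S A p B" "zz_path C S A q B" "zz_path C S A t B"
    using zz_eq_path[OF zz_trans(1)] zz_eq_path[OF zz_trans(2)] by auto
  \<comment> \<open>The intermediate zigzag \<open>q\<close> may fail to act on \<open>a\<close>. It
    acts after precomposition with some \<open>r\<close> in \<open>S\<close>, and \<open>r\<close>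
    is cancelled at the end by \<open>eqv_epi\<close>.\<close>
  obtain V r d where r: "r \<in> S" "r \<in> Mor C V U" "d \<in> Mor C V B" "act q (a \<cdot> r) d"
    using act_dense[OF P(2) zz_trans(5)] by blast
  have M: "a \<cdot> r \<in> Mor C V A" "b \<cdot> r \<in> Mor C V B" "c \<cdot> r \<in> Mor C V B"
    using comp_Mor r(2) zz_trans(5-7) by blast+
  have "eqv (b \<cdot> r) d"
    by (rule zz_trans(3)[OF M(1,2) r(3) act_pre[OF P(1) zz_trans(5,6,8) r(2)] r(4)])
  moreover have "eqv d (c \<cdot> r)"
    by (rule zz_trans(4)[OF M(1) r(3) M(3) r(4) act_pre[OF P(3) zz_trans(5,7,9) r(2)]])
  ultimately have "eqv (b \<cdot> r) (c \<cdot> r)" by (rule eqv_trans[OF M(2) r(3) M(3)])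
  then show ?case by (rule eqv_epi[OF r(1,2) zz_trans(6,7)])
next
  case (zz_cong A B p p' D q q')
  have P: "zz_path C S A p B" "zz_path C S A p' B" "zz_path C S B q D" "zz_path C S B q' D"
    using zz_eq_path[OF zz_cong(1)] zz_eq_path[OF zz_cong(2)] by auto
  obtain u where u: "u \<in> Mor C U B" "act p a u" "act q u b"
    using act_append[OF P(1,3) zz_cong(5,6,8)] by blast
  obtain v where v: "v \<in> Mor C U B" "act p' a v" "act q' v c"
    using act_append[OF P(2,4) zz_cong(5,7,9)] by blast
  have "eqv u v" by (rule zz_cong(3)[OF zz_cong(5) u(1) v(1) u(2) v(2)])
  then have "eqv v u" by (rule eqv_sym[OF u(1) v(1)])
  then have "act q' u c" by (rule act_cong[OF P(4) v(1) u(1) zz_cong(7) _ v(3)])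
  then show ?case by (rule zz_cong(4)[OF u(1) zz_cong(6,7) u(3)])
next
  case (zz_id A)
  have "Idn C A \<cdot> a = a" using zz_id(2) by (simp add: Mor_def)
  then have "eqv b a" "eqv a c" using zz_id eqv_sym[of a U A b] by simp_all
  then show ?case by (rule eqv_trans[OF zz_id(3,2,4)])
next
  case (zz_comp f A B g D)
  have e: "(g \<cdot> f) \<cdot> a = g \<cdot> (f \<cdot> a)" using zz_comp(1-3) by (simp add: Mor_def)
  have M: "g \<cdot> (f \<cdot> a) \<in> Mor C U D" using comp_Mor zz_comp(1-3) by blast
  have "eqv (g \<cdot> (f \<cdot> a)) b" "eqv (g \<cdot> (f \<cdot> a)) c" using zz_comp(6,7) e by simp_all
  then show ?case using eqv_trans[OF zz_comp(4) M zz_comp(5) eqv_sym[OF M zz_comp(4)]] by blast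
next
  case (zz_inv_left s A B)
  have D: "Dom C (s \<cdot> a) = U" "Dom C s = A" using zz_inv_left(2,3) by (auto simp: Mor_def)
  obtain u where u: "u \<in> Mor C U A" "eqv (s \<cdot> u) (s \<cdot> a)" "eqv u b" using zz_inv_left(6) D by auto
  have "eqv u a" by (rule eqv_mono[OF zz_inv_left(1,2) u(1) zz_inv_left(3) u(2)])
  then have "eqv u c" using zz_inv_left(7) eqv_trans[OF u(1) zz_inv_left(3,5)] by simp
  then show ?case by (rule eqv_trans[OF zz_inv_left(4) u(1) zz_inv_left(5) eqv_sym[OF u(1) zz_inv_left(4) u(3)]])
next
  case (zz_inv_right s A B)
  have D: "Dom C a = U" "Dom C s = A" using zz_inv_right(2,3) by (auto simp: Mor_def)
  obtain u where u: "u \<in> Mor C U A" "eqv (s \<cdot> u) a" "eqv (s \<cdot> u) b" using zz_inv_right(6) D by auto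
  have M: "s \<cdot> u \<in> Mor C U B" by (rule comp_Mor[OF u(1) zz_inv_right(2)])
  have "eqv (s \<cdot> u) c" using zz_inv_right(7) eqv_trans[OF M zz_inv_right(3,5) u(2)] by simp
  then show ?case by (rule eqv_trans[OF zz_inv_right(4) M zz_inv_right(5) eqv_sym[OF M zz_inv_right(4) u(3)]])
qed

text \<open>Both one-step zigzags act on the identity of \<open>A\<close>, with values
  \<open>f\<close> and \<open>g\<close>.\<close>

lemma gz_faithful:
  assumes "f \<in> Mor C A B" "g \<in> Mor C A B" "zz_eq C S A B [Inl f] [Inl g]"
  shows "eqv f g"
proof -
  have A: "A \<in> Ob C" using Mor_Ob[OF assms(1)] by simp
  have "f \<cdot> Idn C A = f" "g \<cdot> Idn C A = g" using assms by (auto simp: Mor_def)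
  then show ?thesis
    using act_invariant[OF assms(3) id_Mor[OF A] assms(1,2)] eqv_refl[OF assms(1)] eqv_refl[OF assms(2)]
    by simp
qed

lemma zz_cong_right:
  "zz_eq C S A B p q \<Longrightarrow> zz_path C S B r D \<Longrightarrow> zz_eq C S A D (p @ r) (q @ r)"
  by (rule zz_cong[OF _ zz_refl])

lemma zz_cong_left:
  "zz_path C S A r B \<Longrightarrow> zz_eq C S B D p q \<Longrightarrow> zz_eq C S A D (r @ p) (r @ q)"
  by (rule zz_cong[OF zz_refl])

context
  assumes eqv_zz: "\<And>f g A B. f \<in> Mor C A B \<Longrightarrow> g \<in> Mor C A B \<Longrightarrow> eqv f g \<Longrightarrow> zz_eq C S A B [Inl f] [Inl g]"
begin

text \<open>By \<open>eqv_zz\<close> an Ore square, which commutes only modulo \<open>eqv\<close>,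
  becomes an equation of zigzags. A forward step moves the denominator across by such a square; a
  formal inverse of \<open>s\<close> merely enlarges it to \<open>s \<cdot> r\<close>.\<close>

lemma right_fraction:
  assumes "zz_path C S A p B"
  shows "\<exists>U r f. r \<in> S \<and> r \<in> Mor C U A \<and> f \<in> Mor C U B \<and> zz_eq C S U B (Inl r # p) [Inl f]"
  using assms
proof (induction rule: zz_path.induct)
  case (zz_nil A)
  then show ?case using S_id[OF zz_nil] id_Mor[OF zz_nil] zz_refl[OF zz_path_fwd[OF id_Mor[OF zz_nil]]] by blast
next
  case (zz_fwd f A B p D)
  obtain U r k where r: "r \<in> S" "r \<in> Mor C U B" "k \<in> Mor C U D" "zz_eq C S U D (Inl r # p) [Inl k]"
    using zz_fwd(3) by blast
  obtain V r' b where r': "r' \<in> S" "r' \<in> Mor C V A" "b \<in> Mor C V U" "eqv (r \<cdot> b) (f \<cdot> r')"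
    using ore_r[OF r(1,2) zz_fwd(1)] by blast
  have M: "r \<cdot> b \<in> Mor C V B" "f \<cdot> r' \<in> Mor C V B" using comp_Mor r r' zz_fwd(1) by blast+
  have "zz_eq C S V B [Inl r', Inl f] [Inl (f \<cdot> r')]" by (rule zz_comp[OF r'(2) zz_fwd(1)])
  moreover have "zz_eq C S V B [Inl (f \<cdot> r')] [Inl (r \<cdot> b)]" by (rule zz_sym[OF eqv_zz[OF M r'(4)]])
  moreover have "zz_eq C S V B [Inl (r \<cdot> b)] [Inl b, Inl r]" by (rule zz_sym[OF zz_comp[OF r'(3) r(2)]])
  ultimately have "zz_eq C S V B [Inl r', Inl f] [Inl b, Inl r]" by (meson zz_trans)
  from zz_cong_right[OF this zz_fwd(2)] have 1: "zz_eq C S V D (Inl r' # Inl f # p) ([Inl b] @ Inl r # p)" by simp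
  have 2: "zz_eq C S V D ([Inl b] @ Inl r # p) ([Inl b] @ [Inl k])"
    by (rule zz_cong_left[OF zz_path_fwd[OF r'(3)] r(4)])
  have 3: "zz_eq C S V D ([Inl b] @ [Inl k]) [Inl (k \<cdot> b)]" using zz_comp[OF r'(3) r(3)] by simp
  show ?case using zz_trans[OF 1 zz_trans[OF 2 3]] r' comp_Mor[OF r'(3) r(3)] by blast
next
  case (zz_bwd s B A p D)
  obtain U r k where r: "r \<in> S" "r \<in> Mor C U B" "k \<in> Mor C U D" "zz_eq C S U D (Inl r # p) [Inl k]"
    using zz_bwd(4) by blast
  have M: "s \<cdot> r \<in> Mor C U A" by (rule comp_Mor[OF r(2) zz_bwd(2)])
  have "zz_eq C S U A [Inl (s \<cdot> r)] [Inl r, Inl s]" by (rule zz_sym[OF zz_comp[OF r(2) zz_bwd(2)]])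
  from zz_cong_right[OF this zz_path_bwd[OF zz_bwd(1,2)]]
  have "zz_eq C S U B [Inl (s \<cdot> r), Inr s] ([Inl r] @ [Inl s, Inr s])" by simp
  moreover have "zz_eq C S U B ([Inl r] @ [Inl s, Inr s]) ([Inl r] @ [])"
    by (rule zz_cong_left[OF zz_path_fwd[OF r(2)] zz_inv_left[OF zz_bwd(1,2)]])
  ultimately have "zz_eq C S U B [Inl (s \<cdot> r), Inr s] [Inl r]" by (metis zz_trans append_Nil2)
  from zz_cong_right[OF this zz_bwd(3)] have "zz_eq C S U D (Inl (s \<cdot> r) # Inr s # p) (Inl r # p)" by simp
  from zz_trans[OF this r(4)] show ?case using S_comp[OF r(1) zz_bwd(1) r(2) zz_bwd(2)] M r(3) by blast
qed

text \<open>The induction still runs from the head of the zigzag, so the roles change: a forward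
  step is absorbed by the numerator, and a formal inverse needs the Ore square.\<close>

lemma left_fraction:
  assumes "zz_path C S A p B"
  shows "\<exists>W l g. l \<in> S \<and> l \<in> Mor C B W \<and> g \<in> Mor C A W \<and> zz_eq C S A W (p @ [Inl l]) [Inl g]"
  using assms
proof (induction rule: zz_path.induct)
  case (zz_nil A)
  then show ?case using S_id[OF zz_nil] id_Mor[OF zz_nil] zz_refl[OF zz_path_fwd[OF id_Mor[OF zz_nil]]]
    by (metis append_Nil)
next
  case (zz_fwd f A B p D)
  obtain W l g where l: "l \<in> S" "l \<in> Mor C D W" "g \<in> Mor C B W" "zz_eq C S B W (p @ [Inl l]) [Inl g]"
    using zz_fwd(3) by blast
  have "zz_eq C S A W ([Inl f] @ (p @ [Inl l])) ([Inl f] @ [Inl g])"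
    by (rule zz_cong_left[OF zz_path_fwd[OF zz_fwd(1)] l(4)])
  moreover have "zz_eq C S A W ([Inl f] @ [Inl g]) [Inl (g \<cdot> f)]" using zz_comp[OF zz_fwd(1) l(3)] by simp
  ultimately have "zz_eq C S A W ((Inl f # p) @ [Inl l]) [Inl (g \<cdot> f)]" using zz_trans by fastforce
  then show ?case using l comp_Mor[OF zz_fwd(1) l(3)] by blast
next
  case (zz_bwd s B A p D)
  obtain W l g where l: "l \<in> S" "l \<in> Mor C D W" "g \<in> Mor C B W" "zz_eq C S B W (p @ [Inl l]) [Inl g]"
    using zz_bwd(4) by blast
  obtain V l' b where l': "l' \<in> S" "l' \<in> Mor C W V" "b \<in> Mor C A V" "eqv (b \<cdot> s) (l' \<cdot> g)"
    using ore_l[OF zz_bwd(1,2) l(3)] by blast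
  have M: "b \<cdot> s \<in> Mor C B V" "l' \<cdot> g \<in> Mor C B V" using comp_Mor l l' zz_bwd(2) by blast+
  have "zz_eq C S D V [Inl (l' \<cdot> l)] [Inl l, Inl l']" by (rule zz_sym[OF zz_comp[OF l(2) l'(2)]])
  from zz_cong_left[OF zz_bwd(3) this]
  have 1: "zz_eq C S B V (p @ [Inl (l' \<cdot> l)]) (p @ [Inl l, Inl l'])" .
  have 2: "zz_eq C S B V (p @ [Inl l, Inl l']) [Inl g, Inl l']"
    using zz_cong_right[OF l(4) zz_path_fwd[OF l'(2)]] by simp
  have 3: "zz_eq C S B V [Inl g, Inl l'] [Inl (l' \<cdot> g)]" by (rule zz_comp[OF l(3) l'(2)])
  have 4: "zz_eq C S B V [Inl (l' \<cdot> g)] [Inl (b \<cdot> s)]" by (rule zz_sym[OF eqv_zz[OF M l'(4)]])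
  have 5: "zz_eq C S B V [Inl (b \<cdot> s)] [Inl s, Inl b]" by (rule zz_sym[OF zz_comp[OF zz_bwd(2) l'(3)]])
  have "zz_eq C S B V (p @ [Inl (l' \<cdot> l)]) [Inl s, Inl b]"
    by (rule zz_trans[OF 1 zz_trans[OF 2 zz_trans[OF 3 zz_trans[OF 4 5]]]])
  from zz_cong_left[OF zz_path_bwd[OF zz_bwd(1,2)] this]
  have 6: "zz_eq C S A V ((Inr s # p) @ [Inl (l' \<cdot> l)]) ([Inr s, Inl s] @ [Inl b])" by simp
  have 7: "zz_eq C S A V ([Inr s, Inl s] @ [Inl b]) [Inl b]"
    using zz_cong_right[OF zz_inv_right[OF zz_bwd(1,2)] zz_path_fwd[OF l'(3)]] by simp
  show ?case using zz_trans[OF 6 7] S_comp[OF l(1) l'(1) l(2) l'(2)] comp_Mor[OF l(2) l'(2)] l'(3) by blast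
qed

end

end

section \<open>The localization of a triangulated category\<close>

lemma rel_extri_simps [simp]:
  "Ob (rel_extri T N) = Ob T" "Ar (rel_extri T N) = Ar T" "Dom (rel_extri T N) = Dom T"
  "Cod (rel_extri T N) = Cod T" "Idn (rel_extri T N) = Idn T" "Comp (rel_extri T N) = Comp T"
  "Add (rel_extri T N) = Add T" "Zero (rel_extri T N) = Zero T"
  "Ext (rel_extri T N) D A = (Homg T D (ShO T A))\<lparr>carrier := E_left T N D A \<inter> E_right T N D A\<rparr>"
  "Real (rel_extri T N) = Real (tri_extri T)" "Emap (rel_extri T N) = Emap (tri_extri T)"
  "Mor (rel_extri T N) = Mor T" "Homg (rel_extri T N) = Homg T"
  by (auto simp: rel_extri_def tri_extri_def Mor_def Homg_def fun_eq_iff)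

lemma rel_extri_derived [simp]:
  "is_iso (rel_extri T N) = is_iso T" "zero_object (rel_extri T N) = zero_object T"
  "biproduct (rel_extri T N) = biproduct T" "Neg (tri_extri T) = Neg T"
  by (auto simp: is_iso_def zero_object_def biproduct_def Neg_def fun_eq_iff)

lemma truncate_simps:
  "Ob (cat.truncate Y) = Ob Y" "Ar (cat.truncate Y) = Ar Y" "Dom (cat.truncate Y) = Dom Y"
  "Cod (cat.truncate Y) = Cod Y" "Idn (cat.truncate Y) = Idn Y" "Comp (cat.truncate Y) = Comp Y"
  by (simp_all add: cat.truncate_def)

context triangulated_category
begin

lemma additive_rel_extri: "additive_category (rel_extri T N)"
proof (rule additive_category.intro)
  show "category (rel_extri T N)" by unfold_locales (auto simp: Mor_def)
  show "additive_category_axioms (rel_extri T N)"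
    by (rule additive_category_axioms.intro)
      (simp_all add: hom_group comp_add_left comp_add_right zero_object_exists biproduct_exists)
qed

text \<open>Summands are defined by biproducts, whereas a null identity exhibits only a retract. In
  the triangle on the split monomorphism \<open>u\<close> the third map is annihilated by
  \<open>u[1]\<close>, again split monic, so it is zero and \<open>M\<close> is isomorphic to the
  biproduct of \<open>A\<close> and the cone.\<close>

lemma retract_closed:
  assumes N: "additive_subcategory T N" "summand_closed T N"
    and M: "M \<in> N" "u \<in> Mor T A M" "v \<in> Mor T M A" "v \<cdot> u = Idn T A"
  shows "A \<in> N"
proof -
  obtain D g h where tr: "triangle T A M D u g h" using TR1_cone[OF M(2)] by auto
  note t = triangleD[OF tr]
  have tv: "v \<in> Ar T" "Dom T v = M" "Cod T v = A" using M(3) by (auto simp: Mor_def)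
  have "Neg T (ShA T u) \<cdot> h = Zero T D (ShO T M)"
    using triangle_comp[OF rotate[OF rotate[OF tr]]] .
  then have "Neg T (Neg T (ShA T u \<cdot> h)) = Neg T (Zero T D (ShO T M))" using t(1-12) by simp
  then have z: "ShA T u \<cdot> h = Zero T D (ShO T M)" using t(1-12) by simp
  have "h = ShA T (v \<cdot> u) \<cdot> h" unfolding M(4) using t(1-12) by simp
  also have "\<dots> = ShA T v \<cdot> (ShA T u \<cdot> h)" using t(1-12) tv by simp
  also have "\<dots> = Zero T D (ShO T A)" unfolding z using t(1-12) tv by simp
  finally have h: "h = Zero T D (ShO T A)" .
  obtain S i j p q where b: "biproduct T A D S i j p q" using biproduct_exists t(10,12) by blast
  obtain c where "is_iso T c M S" using triangle_unique[OF tr[unfolded h] triangle_split[OF b]] by auto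
  then have "S \<in> N" using N(1) M(1) unfolding additive_subcategory_def by blast
  then show ?thesis using N(2) b unfolding summand_closed_def by blast
qed

section \<open>The two descriptions of the relative structure and of the inverted arrows
  agree\<close>

lemma E_left_eq:
  assumes "N \<subseteq> Ob T" "D \<in> Ob T" "A \<in> Ob T"
  shows "E_left T N D A = rel_left (tri_extri T) N D A"
proof -
  have "(\<exists>M' \<in> N. factors_through T (h \<cdot> x) (ShO T M')) \<longleftrightarrow>
      (\<exists>M' \<in> N. \<exists>u \<in> Mor T M (ShO T M'). \<exists>v \<in> Mor T M' A. pull (tri_extri T) A x h = push (tri_extri T) M v u)"
    if h: "h \<in> Mor T D (ShO T A)" and x: "M \<in> N" "x \<in> Mor T M D" for h x M
  proof -
    have ty: "h \<in> Ar T" "Dom T h = D" "Cod T h = ShO T A" "x \<in> Ar T" "Dom T x = M" "Cod T x = D"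
      using h x by (auto simp: Mor_def)
    have eq: "pull (tri_extri T) A x h = h \<cdot> x" using ty assms by simp
    show ?thesis
    proof
      assume "\<exists>M' \<in> N. factors_through T (h \<cdot> x) (ShO T M')"
      then obtain M' u v where *: "M' \<in> N" "u \<in> Mor T M (ShO T M')" "v \<in> Mor T (ShO T M') (ShO T A)" "v \<cdot> u = h \<cdot> x"
        using ty by (auto simp: factors_through_def)
      have tv: "v \<in> Ar T" "Dom T v = ShO T M'" "Cod T v = ShO T A" "M' \<in> Ob T" "u \<in> Ar T" "Dom T u = M"
        using * assms by (auto simp: Mor_def)
      have "UnA T v \<in> Mor T M' A" using tv assms by (simp add: Mor_def)
      moreover have "push (tri_extri T) M (UnA T v) u = h \<cdot> x" using tv *(4) by simp
      ultimately show "\<exists>M' \<in> N. \<exists>u \<in> Mor T M (ShO T M'). \<exists>v \<in> Mor T M' A.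
          pull (tri_extri T) A x h = push (tri_extri T) M v u"
        using *(1,2) eq by metis
    next
      assume "\<exists>M' \<in> N. \<exists>u \<in> Mor T M (ShO T M'). \<exists>v \<in> Mor T M' A.
          pull (tri_extri T) A x h = push (tri_extri T) M v u"
      then obtain M' u v where *: "M' \<in> N" "u \<in> Mor T M (ShO T M')" "v \<in> Mor T M' A"
        "h \<cdot> x = push (tri_extri T) M v u" unfolding eq by blast
      have tv: "v \<in> Ar T" "Dom T v = M'" "Cod T v = A" "u \<in> Ar T" "Dom T u = M"
        using * by (auto simp: Mor_def)
      have "ShA T v \<in> Mor T (ShO T M') (Cod T (h \<cdot> x))" "u \<in> Mor T (Dom T (h \<cdot> x)) (ShO T M')"
        using tv ty *(2) by (simp_all add: Mor_def)
      moreover have "ShA T v \<cdot> u = h \<cdot> x" using *(4) tv by simp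
      ultimately show "\<exists>M' \<in> N. factors_through T (h \<cdot> x) (ShO T M')"
        using *(1) unfolding factors_through_def by blast
    qed
  qed
  then show ?thesis unfolding E_left_def rel_left_def by auto
qed

text \<open>The definition speaks of \<open>h[-1]\<close>, so the whole factorization is suspended;
  its first arrow becomes the map \<open>D \<rightarrow> M'\<close> along which a class of
  \<open>E(M',M)\<close> is pulled back.\<close>

lemma E_right_eq:
  assumes "N \<subseteq> Ob T" "D \<in> Ob T" "A \<in> Ob T"
  shows "E_right T N D A = rel_right (tri_extri T) N D A"
proof -
  have "(\<exists>M' \<in> N. factors_through T (y \<cdot> UnA T h) (UnO T M')) \<longleftrightarrow>
      (\<exists>M' \<in> N. \<exists>u \<in> Mor T M' (ShO T M). \<exists>v \<in> Mor T D M'. push (tri_extri T) D y h = pull (tri_extri T) M v u)"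
    if h: "h \<in> Mor T D (ShO T A)" and y: "M \<in> N" "y \<in> Mor T A M" for h y M
  proof -
    have ty: "h \<in> Ar T" "Dom T h = D" "Cod T h = ShO T A" "y \<in> Ar T" "Dom T y = A" "Cod T y = M" "M \<in> Ob T"
      using h y assms by (auto simp: Mor_def)
    have eq: "push (tri_extri T) D y h = ShA T y \<cdot> h" using ty assms by simp
    show ?thesis
    proof
      assume "\<exists>M' \<in> N. factors_through T (y \<cdot> UnA T h) (UnO T M')"
      then obtain M' u v where *: "M' \<in> N" "u \<in> Mor T (UnO T D) (UnO T M')" "v \<in> Mor T (UnO T M') M"
        "v \<cdot> u = y \<cdot> UnA T h"
        using ty assms by (auto simp: factors_through_def)
      have tv: "v \<in> Ar T" "Dom T v = UnO T M'" "Cod T v = M" "M' \<in> Ob T" "u \<in> Ar T" "Dom T u = UnO T D"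
        "Cod T u = UnO T M'"
        using * assms by (auto simp: Mor_def)
      have M: "ShA T v \<in> Mor T M' (ShO T M)" "ShA T u \<in> Mor T D M'" using tv assms by (simp_all add: Mor_def)
      have "ShA T v \<cdot> ShA T u = ShA T (v \<cdot> u)" using tv by simp
      also have "\<dots> = ShA T y \<cdot> h" unfolding *(4) using ty assms by simp
      finally have "pull (tri_extri T) M (ShA T u) (ShA T v) = ShA T y \<cdot> h" using M ty tv assms(2) by simp
      then show "\<exists>M' \<in> N. \<exists>u \<in> Mor T M' (ShO T M). \<exists>v \<in> Mor T D M'.
          push (tri_extri T) D y h = pull (tri_extri T) M v u"
        using *(1) M eq by metis
    next
      assume "\<exists>M' \<in> N. \<exists>u \<in> Mor T M' (ShO T M). \<exists>v \<in> Mor T D M'.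
          push (tri_extri T) D y h = pull (tri_extri T) M v u"
      then obtain M' u v where *: "M' \<in> N" "u \<in> Mor T M' (ShO T M)" "v \<in> Mor T D M'"
        "ShA T y \<cdot> h = pull (tri_extri T) M v u" unfolding eq by blast
      have tv: "v \<in> Ar T" "Dom T v = D" "Cod T v = M'" "u \<in> Ar T" "Dom T u = M'" "Cod T u = ShO T M"
        using * by (auto simp: Mor_def)
      have "UnA T u \<cdot> UnA T v = UnA T (u \<cdot> v)" using tv by simp
      also have "u \<cdot> v = ShA T y \<cdot> h" using *(4) tv ty by simp
      also have "UnA T (ShA T y \<cdot> h) = y \<cdot> UnA T h" using ty assms by simp
      finally have "UnA T u \<cdot> UnA T v = y \<cdot> UnA T h" .
      moreover have "UnA T u \<in> Mor T (UnO T M') (Cod T (y \<cdot> UnA T h))"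
        "UnA T v \<in> Mor T (Dom T (y \<cdot> UnA T h)) (UnO T M')" using tv ty assms by (simp_all add: Mor_def)
      ultimately show "\<exists>M' \<in> N. factors_through T (y \<cdot> UnA T h) (UnO T M')"
        using *(1) unfolding factors_through_def by blast
    qed
  qed
  then show ?thesis unfolding E_right_def rel_right_def by auto
qed

lemma rel_extri_tri:
  assumes "N \<subseteq> Ob T"
  shows "s_triangle (rel_extri T N) A B D x y h \<longleftrightarrow> rel_tri (tri_extri T) N A B D x y h"
proof -
  have "s_triangle (rel_extri T N) A B D x y h \<longleftrightarrow>
     s_triangle (tri_extri T) A B D x y h \<and> h \<in> E_left T N D A \<inter> E_right T N D A"
    unfolding s_triangle_def by (auto simp: E_left_def)
  also have "\<dots> \<longleftrightarrow> rel_tri (tri_extri T) N A B D x y h"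
    using E_left_eq[OF assms, of D A] E_right_eq[OF assms, of D A]
    by (auto simp: rel_tri_def s_triangle_def)
  finally show ?thesis .
qed

lemma loc_arrows_eq:
  assumes "N \<subseteq> Ob T"
  shows "loc_arrows (rel_extri T N) N = qis (tri_extri T) N"
proof (rule subset_antisym; rule subsetI)
  fix s assume "s \<in> loc_arrows (rel_extri T N) N"
  then show "s \<in> qis (tri_extri T) N"
  proof induction
    case (comp f g)
    then show ?case using qis_comp[of f "tri_extri T" N g] by simp
  qed (auto simp: conflation_def rel_extri_tri[OF assms] intro: qis.intros)
next
  fix s assume "s \<in> qis (tri_extri T) N"
  then show "s \<in> loc_arrows (rel_extri T N) N"
  proof induction
    case (qis_comp f g)
    then show ?case using loc_arrows.comp[of f "rel_extri T N" N g] by simp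
  next
    case (qis_infl A B D x y h)
    then show ?case using loc_arrows.infl[of "rel_extri T N" A B D x y N]
      by (auto simp: conflation_def rel_extri_tri[OF assms])
  next
    case (qis_defl A B D x y h)
    then show ?case using loc_arrows.defl[of "rel_extri T N" A B D x y N]
      by (auto simp: conflation_def rel_extri_tri[OF assms])
  qed
qed

end

locale localization_setup = triangulated_category T
  for T :: "('o, 'm) tricat" (structure) +
  fixes N :: "'o set" and Y :: "('o, ('o, 'm) gzarrow, 'f) extri"
    and Q :: "('o, 'm, 'm, 'o, ('o, 'm) gzarrow, 'f) exfun"
  assumes N_add: "additive_subcategory T N"
    and N_summands: "summand_closed T N"
    and N_extensions: "tri_extension_closed T N"
    and localization: "extri_localization (rel_extri T N) (loc_arrows (rel_extri T N) N) Y Q"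
begin

abbreviation "X \<equiv> tri_extri T"
abbreviation "R \<equiv> rel_extri T N"
abbreviation "S \<equiv> loc_arrows R N"

lemma N_sub: "N \<subseteq> Ob T" using N_add by (simp add: additive_subcategory_def)

sublocale E: ext_closed X N
proof (rule ext_closed.intro[OF extriangulated], unfold_locales)
  show "A \<in> Ob X" if "A \<in> N" for A using that N_sub by auto
  show "S \<in> N" if "A \<in> N" "B \<in> N" "biproduct X A B S i j p q" for A B S i j p q
    using that N_add unfolding additive_subcategory_def tri_extri_derived by meson
  show "A \<in> N" if "S \<in> N" "biproduct X A B S i j p q" for A B S i j p q
    using that N_summands unfolding summand_closed_def tri_extri_derived by meson
  show "B \<in> N" if "s_triangle X A B D x y h" "A \<in> N" "D \<in> N" for A B D x y h
    using that N_extensions unfolding tri_extension_closed_def tri_extri_tri by meson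
  show "Z \<in> N" if "zero_object X Z" for Z
    using that N_add unfolding additive_subcategory_def tri_extri_derived by meson
qed

sublocale Y: extriangulated_category Y
  using localization by (simp add: extri_localization_def)

lemma R_tri: "s_triangle R A B D x y h \<longleftrightarrow> rel_tri X N A B D x y h"
  by (rule rel_extri_tri[OF N_sub])

lemma S_eq: "S = qis X N"
  by (rule loc_arrows_eq[OF N_sub])

lemma rel_one:
  assumes "D \<in> Ob T" "A \<in> Ob T"
  shows "\<one>\<^bsub>Ext X D A\<^esub> \<in> rel_left X N D A" "\<one>\<^bsub>Ext X D A\<^esub> \<in> rel_right X N D A"
proof -
  have O: "D \<in> Ob X" "A \<in> Ob X" using assms by auto
  note c = E.one_closed[OF O]
  show "\<one>\<^bsub>Ext X D A\<^esub> \<in> rel_left X N D A"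
    by (rule E.one_rel(1)[OF O c]) (rule E.pull_one[OF O(2)])
  show "\<one>\<^bsub>Ext X D A\<^esub> \<in> rel_right X N D A"
    by (rule E.one_rel(2)[OF O c]) (rule E.push_one[OF O(1)])
qed

text \<open>The split triangle \<open>0 \<rightarrow> M \<rightarrow> M\<close> has its cone in
  \<open>N\<close>. Inverting this arrow makes \<open>M\<close> a zero object of the
  localization.\<close>

lemma S_zero_infl:
  assumes "M \<in> N" "zero_object T Z"
  shows "Zero T Z M \<in> S"
proof -
  have O: "M \<in> Ob T" "Z \<in> Ob T" using assms N_sub by (auto simp: zero_object_def)
  have b: "biproduct X Z M M (Zero T Z M) (Idn T M) (Zero T M Z) (Idn T M)"
    using biproduct_zero_left[OF O(1) assms(2)] by simp
  have "rel_tri X N Z M M (Zero T Z M) (Idn T M) \<one>\<^bsub>Ext X M Z\<^esub>"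
    unfolding rel_tri_def by (intro conjI E.s_zero[OF b] rel_one O)
  then show ?thesis unfolding S_eq using assms(1) by (rule qis_infl)
qed

lemma S_ident: "A \<in> Ob T \<Longrightarrow> Idn T A \<in> S"
proof -
  assume A: "A \<in> Ob T"
  obtain Z where Z: "zero_object T Z" using zero_object_exists by auto
  have O: "Z \<in> Ob T" using Z by (auto simp: zero_object_def)
  have b: "biproduct X A Z A (Idn T A) (Zero T Z A) (Idn T A) (Zero T A Z)"
    using biproduct_zero_right[OF A Z] by simp
  have "rel_tri X N A A Z (Idn T A) (Zero T A Z) \<one>\<^bsub>Ext X Z A\<^esub>"
    unfolding rel_tri_def by (intro conjI E.s_zero[OF b] rel_one O A)
  moreover have "Z \<in> N" using E.N_zero Z by simp
  ultimately show ?thesis unfolding S_eq by (rule qis_infl)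
qed

abbreviation "eqv f g \<equiv> E.null (f \<boxplus> Neg T g)"

sublocale G: gz_calculus R S eqv
proof (rule gz_calculus.intro)
  show "category R" using additive_rel_extri by (rule additive_category.axioms)
  show "gz_calculus_axioms R S eqv"
  proof (rule gz_calculus_axioms.intro, goal_cases)
    case (1 A) then show ?case using S_ident by simp
  next
    case (2 f g A B D) then show ?case unfolding S_eq using qis_comp[of f X N g] by (simp add: Mor_def)
  next
    case (3 f A B)
    then show ?case using E.null_zero[of A B] Mor_Ob[of f A B] by (auto simp: Mor_def)
  next
    case (4 f A B g) then show ?case using E.null_diff_sym[of f g A B] by simp
  next
    case (5 f A B g h) then show ?case using E.null_diff_trans[of f g h A B] by simp
  next
    case (6 f A B g k D) then show ?case using E.null_diff_left[of f g A B k D] by simp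
  next
    case (7 f A B g k D) then show ?case using E.null_diff_right[of f g A B k D] by simp
  next
    case (8 s A B f W g)
    then have "s \<cdot> (f \<boxplus> Neg T g) = (s \<cdot> f) \<boxplus> Neg T (s \<cdot> g)" by (auto simp: Mor_def)
    then show ?case using 8 E.qis_reflects_null_left[of s "f \<boxplus> Neg T g" W] unfolding S_eq
      by (simp add: Mor_def)
  next
    case (9 s A B f W g)
    then have "(f \<boxplus> Neg T g) \<cdot> s = (f \<cdot> s) \<boxplus> Neg T (g \<cdot> s)" by (auto simp: Mor_def)
    then show ?case using 9 E.qis_reflects_null_right[of s "f \<boxplus> Neg T g" W] unfolding S_eq
      by (simp add: Mor_def)
  next
    case (10 s A B a U) then show ?case using E.ore_right[of s a U] unfolding S_eq by (simp add: Mor_def)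
  next
    case (11 s A B a U) then show ?case using E.ore_left[of s a U] unfolding S_eq by (simp add: Mor_def)
  qed
qed

section \<open>Arrows of the localization: vanishing and fractions\<close>

lemma Y_cat:
  "Ob Y = Ob T" "Ar Y = {gz_class R S A B p | A B p. zz_path R S A p B}"
  "Dom Y (A, B, P) = A" "Cod Y (A, B, P) = B" "Idn Y A = gz_class R S A A []"
  "Comp Y = Comp (gz_localization R S)"
proof -
  have "cat.truncate Y = gz_localization R S" using localization by (simp add: extri_localization_def)
  note e = truncate_simps[of Y, symmetric, unfolded this]
  show "Ob Y = Ob T" "Ar Y = {gz_class R S A B p | A B p. zz_path R S A p B}"
    "Dom Y (A, B, P) = A" "Cod Y (A, B, P) = B" "Idn Y A = gz_class R S A A []"
    "Comp Y = Comp (gz_localization R S)"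
    by (simp_all add: e, simp_all add: gz_localization_def)
qed

lemma gz_Mor: "zz_path R S A p B \<Longrightarrow> gz_class R S A B p \<in> Mor Y A B"
  unfolding Mor_def Y_cat(2) by (auto simp: gz_class_def Y_cat(3,4))

lemma Mor_Y: "t \<in> Mor Y A B \<Longrightarrow> \<exists>p. zz_path R S A p B \<and> t = gz_class R S A B p"
  unfolding Mor_def Y_cat(2) by (auto simp: gz_class_def Y_cat(3,4))

lemma Q_exact: "exact_functor R Y Q" using localization by (simp add: extri_localization_def)

lemma FOb_Q [simp]: "A \<in> Ob T \<Longrightarrow> FOb Q A = A" using localization by (simp add: extri_localization_def)

lemma FAr_Q: "f \<in> Mor T A B \<Longrightarrow> FAr Q f = gz_class R S A B [Inl f]"
  using localization by (simp add: extri_localization_def gz_functor_def Mor_def)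

lemma Q_additive: "additive_functor R Y (FOb Q) (FAr Q)" using Q_exact by (simp add: exact_functor_def)

lemmas Q_simps = additive_functor_simps[OF additive_rel_extri Y.additive_category_axioms Q_additive,
    unfolded rel_extri_simps]

lemma Q_Mor: "f \<in> Mor T A B \<Longrightarrow> FAr Q f \<in> Mor Y A B"
  using Q_simps(2-4)[of f] Mor_Ob[of f A B] by (auto simp: Mor_def)

lemma Q_comp: "f \<in> Mor T A B \<Longrightarrow> g \<in> Mor T B D \<Longrightarrow> FAr Q (g \<cdot> f) = FAr Q g \<cdot>\<^bsub>Y\<^esub> FAr Q f"
  using Q_simps(6)[of f g] by (auto simp: Mor_def)

lemma Q_zero: "A \<in> Ob T \<Longrightarrow> B \<in> Ob T \<Longrightarrow> FAr Q (Zero T A B) = Zero Y A B"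
  using Q_simps(8)[of A B] by simp

lemma Q_iso:
  assumes "s \<in> S" "s \<in> Mor T A B"
  shows "is_iso Y (FAr Q s) A B"
proof (rule Y.is_isoI[of _ _ _ "gz_class R S B A [Inr s]"])
  have s: "s \<in> Mor R A B" using assms(2) by simp
  note P = G.zz_path_fwd[OF s, of S] G.zz_path_bwd[OF assms(1) s]
  show "FAr Q s \<in> Mor Y A B" by (rule Q_Mor[OF assms(2)])
  show "gz_class R S B A [Inr s] \<in> Mor Y B A" by (rule gz_Mor[OF P(2)])
  show "gz_class R S B A [Inr s] \<cdot>\<^bsub>Y\<^esub> FAr Q s = Idn Y A"
    unfolding FAr_Q[OF assms(2)] Y_cat(5,6) G.gz_comp[OF P]
    using G.gz_class_eq_iff[OF zz_path_append[OF P]] zz_inv_left[OF assms(1) s] by simp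
  show "FAr Q s \<cdot>\<^bsub>Y\<^esub> gz_class R S B A [Inr s] = Idn Y B"
    unfolding FAr_Q[OF assms(2)] Y_cat(5,6) G.gz_comp[OF P(2,1)]
    using G.gz_class_eq_iff[OF zz_path_append[OF P(2,1)]] zz_inv_right[OF assms(1) s] by simp
qed

lemma Q_faithful:
  assumes "f \<in> Mor T A B" "g \<in> Mor T A B" "FAr Q f = FAr Q g"
  shows "eqv f g"
proof -
  have M: "f \<in> Mor R A B" "g \<in> Mor R A B" using assms by auto
  have "zz_eq R S A B [Inl f] [Inl g]"
    using G.gz_class_eq_iff[OF G.zz_path_fwd[OF M(1), of S]] assms by (simp add: FAr_Q)
  then show ?thesis by (rule G.gz_faithful[OF M])
qed

lemma Q_zero_null:
  assumes "f \<in> Mor T A B" "FAr Q f = Zero Y A B"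
  shows "E.null f"
proof -
  have O: "A \<in> Ob T" "B \<in> Ob T" using Mor_Ob[OF assms(1)] by auto
  then have "eqv f (Zero T A B)" using assms Q_zero[OF O] by (intro Q_faithful[of f A B]) (auto simp: Mor_def)
  then show ?thesis using assms(1) O by (simp add: Mor_def)
qed

text \<open>For \<open>M\<close> in \<open>N\<close> the isomorphism from \<open>0\<close> to
  \<open>M\<close> in \<open>Y\<close> is a zero arrow, so the identity of \<open>M\<close> vanishes
  there, and with it everything that factors through \<open>M\<close>.\<close>

lemma Q_null_zero:
  assumes "f \<in> Mor T A B" "E.null f"
  shows "FAr Q f = Zero Y A B"
proof -
  have f: "f \<in> Mor X A B" using assms(1) by simp
  obtain M u v where M: "M \<in> N" "u \<in> Mor X A M" "v \<in> Mor X M B" "f = v \<cdot>\<^bsub>X\<^esub> u"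
    by (rule E.nullE[OF assms(2) f])
  then have M': "u \<in> Mor T A M" "v \<in> Mor T M B" "f = v \<cdot> u" by auto
  have O: "A \<in> Ob T" "B \<in> Ob T" "M \<in> Ob T" using Mor_Ob[OF M'(1)] Mor_Ob[OF M'(2)] by auto
  obtain Z where Z: "zero_object T Z" using zero_object_exists by auto
  have ZO: "Z \<in> Ob T" using Z by (auto simp: zero_object_def)
  have "is_iso Y (FAr Q (Zero T Z M)) Z M"
    by (rule Q_iso[OF S_zero_infl[OF M(1) Z]]) (use O ZO in \<open>simp add: Mor_def\<close>)
  then have "is_iso Y (Zero Y Z M) Z M" using Q_zero[OF ZO O(3)] by simp
  then obtain g where g: "g \<in> Mor Y M Z" "Zero Y Z M \<cdot>\<^bsub>Y\<^esub> g = Idn Y M" by (auto elim: Y.is_isoE)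
  have OY: "A \<in> Ob Y" "B \<in> Ob Y" "M \<in> Ob Y" "Z \<in> Ob Y" using O ZO by (auto simp: Y_cat)
  have idz: "Idn Y M = Zero Y M M" using g OY by (auto simp: Mor_def)
  have u: "FAr Q u \<in> Mor Y A M" and v: "FAr Q v \<in> Mor Y M B" using Q_Mor M' by auto
  have "FAr Q u = Idn Y M \<cdot>\<^bsub>Y\<^esub> FAr Q u" using u by (simp add: Mor_def)
  also have "\<dots> = Zero Y A M" unfolding idz using u OY by (simp add: Mor_def)
  finally have "FAr Q u = Zero Y A M" .
  then show ?thesis unfolding M'(3) Q_comp[OF M'(1,2)] using v OY by (simp add: Mor_def)
qed

text \<open>Discharges the assumption of the fraction lemmas. It rests on the additive structure of
  \<open>Y\<close>, in which \<open>Q f - Q g\<close> is the image of a null arrow.\<close>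

lemma eqv_zz:
  assumes "f \<in> Mor R A B" "g \<in> Mor R A B" "eqv f g"
  shows "zz_eq R S A B [Inl f] [Inl g]"
proof -
  have M: "f \<in> Mor T A B" "g \<in> Mor T A B" using assms by auto
  have d: "f \<boxplus> Neg T g \<in> Mor T A B" using M by (auto simp: Mor_def)
  have "FAr Q (f \<boxplus> Neg T g) = FAr Q f \<boxplus>\<^bsub>Y\<^esub> Neg Y (FAr Q g)"
  proof -
    have "FAr Q (f \<boxplus> Neg T g) = FAr Q f \<boxplus>\<^bsub>Y\<^esub> FAr Q (Neg T g)"
      using Q_simps(7)[of f "Neg T g"] M by (simp add: Mor_def)
    moreover have "Neg R g = Neg T g" by (simp add: Neg_def)
    ultimately show ?thesis using Q_simps(9)[of g] M by (simp add: Mor_def)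
  qed
  then have "FAr Q f \<boxplus>\<^bsub>Y\<^esub> Neg Y (FAr Q g) = Zero Y A B" using Q_null_zero[OF d assms(3)] by simp
  then have "FAr Q f = FAr Q g" using Y.eq_iff_diff_zero[OF Q_Mor[OF M(1)] Q_Mor[OF M(2)]] by simp
  then show ?thesis using G.gz_class_eq_iff[OF G.zz_path_fwd[OF assms(1), of S]] M by (simp add: FAr_Q)
qed

lemma Y_right_fraction:
  assumes "t \<in> Mor Y A B"
  shows "\<exists>U r f. r \<in> S \<and> r \<in> Mor T U A \<and> f \<in> Mor T U B \<and> t \<cdot>\<^bsub>Y\<^esub> FAr Q r = FAr Q f"
proof -
  obtain p where p: "zz_path R S A p B" "t = gz_class R S A B p" using Mor_Y[OF assms] by auto
  obtain U r f where r: "r \<in> S" "r \<in> Mor R U A" "f \<in> Mor R U B" "zz_eq R S U B (Inl r # p) [Inl f]"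
    using G.right_fraction[OF eqv_zz p(1)] by blast
  note P = G.zz_path_fwd[OF r(2), of S]
  have "t \<cdot>\<^bsub>Y\<^esub> FAr Q r = gz_class R S U B ([Inl r] @ p)"
    unfolding p(2) Y_cat(6) using r(2) G.gz_comp[OF P p(1)] by (simp add: FAr_Q)
  also have "\<dots> = FAr Q f"
    using G.gz_class_eq_iff[OF zz_path_append[OF P p(1)]] r(3,4) by (simp add: FAr_Q)
  finally show ?thesis using r by auto
qed

lemma Y_left_fraction:
  assumes "t \<in> Mor Y A B"
  shows "\<exists>W l g. l \<in> S \<and> l \<in> Mor T B W \<and> g \<in> Mor T A W \<and> FAr Q l \<cdot>\<^bsub>Y\<^esub> t = FAr Q g"
proof -
  obtain p where p: "zz_path R S A p B" "t = gz_class R S A B p" using Mor_Y[OF assms] by auto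
  obtain W l g where r: "l \<in> S" "l \<in> Mor R B W" "g \<in> Mor R A W" "zz_eq R S A W (p @ [Inl l]) [Inl g]"
    using G.left_fraction[OF eqv_zz p(1)] by blast
  note P = G.zz_path_fwd[OF r(2), of S]
  have "FAr Q l \<cdot>\<^bsub>Y\<^esub> t = gz_class R S A W (p @ [Inl l])"
    unfolding p(2) Y_cat(6) using r(2) G.gz_comp[OF p(1) P] by (simp add: FAr_Q)
  also have "\<dots> = FAr Q g"
    using G.gz_class_eq_iff[OF zz_path_append[OF p(1) P]] r(3,4) by (simp add: FAr_Q)
  finally show ?thesis using r by auto
qed

lemma Y_iso_epi:
  assumes "is_iso Y r A B" "t \<in> Mor Y B D" "t \<cdot>\<^bsub>Y\<^esub> r = Zero Y A D"
  shows "t = Zero Y B D"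
proof -
  obtain r' where r: "r \<in> Mor Y A B" "r' \<in> Mor Y B A" "r \<cdot>\<^bsub>Y\<^esub> r' = Idn Y B"
    using assms(1) by (auto elim: Y.is_isoE)
  have "t = (t \<cdot>\<^bsub>Y\<^esub> r) \<cdot>\<^bsub>Y\<^esub> r'" using r assms(2) by (simp add: Mor_def)
  then show ?thesis unfolding assms(3) using r Y.Mor_Ob[OF assms(2)] by (simp add: Mor_def)
qed

lemma Y_iso_mono:
  assumes "is_iso Y r A B" "t \<in> Mor Y D A" "r \<cdot>\<^bsub>Y\<^esub> t = Zero Y D B"
  shows "t = Zero Y D A"
proof -
  obtain r' where r: "r \<in> Mor Y A B" "r' \<in> Mor Y B A" "r' \<cdot>\<^bsub>Y\<^esub> r = Idn Y A"
    using assms(1) by (auto elim: Y.is_isoE)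
  have "t = (r' \<cdot>\<^bsub>Y\<^esub> r) \<cdot>\<^bsub>Y\<^esub> t" using r assms(2) by (simp add: Mor_def)
  also have "\<dots> = r' \<cdot>\<^bsub>Y\<^esub> (r \<cdot>\<^bsub>Y\<^esub> t)" using r(1,2) assms(2) by (simp add: Mor_def)
  also have "\<dots> = Zero Y D A" unfolding assms(3) using r Y.Mor_Ob[OF assms(2)] by (simp add: Mor_def)
  finally show ?thesis .
qed

text \<open>A test arrow \<open>t\<close> becomes some \<open>Q f\<close> after composition with an
  isomorphism \<open>Q r\<close>. Then \<open>Q (x \<cdot> f) = 0\<close>, so
  \<open>x \<cdot> f\<close> is null, and \<open>refl\<close> passes this on to
  \<open>f\<close>.\<close>

lemma Q_mono:
  assumes x: "x \<in> Mor T A B" and refl: "\<And>W f. f \<in> Mor T W A \<Longrightarrow> E.null (x \<cdot> f) \<Longrightarrow> E.null f"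
  shows "mono_arr Y (FAr Q x)"
proof (rule Y.mono_arrI[OF Q_Mor[OF x]])
  fix W t assume t: "t \<in> Mor Y W A" "FAr Q x \<cdot>\<^bsub>Y\<^esub> t = Zero Y W B"
  obtain U r f where r: "r \<in> S" "r \<in> Mor T U W" "f \<in> Mor T U A" "t \<cdot>\<^bsub>Y\<^esub> FAr Q r = FAr Q f"
    using Y_right_fraction[OF t(1)] by auto
  have O: "U \<in> Ob Y" "A \<in> Ob Y" "B \<in> Ob Y" using Mor_Ob[OF r(3)] Mor_Ob[OF x] by (auto simp: Y_cat)
  note M = Q_Mor[OF r(2)] Q_Mor[OF r(3)] Q_Mor[OF x]
  have "FAr Q (x \<cdot> f) = FAr Q x \<cdot>\<^bsub>Y\<^esub> (t \<cdot>\<^bsub>Y\<^esub> FAr Q r)" using Q_comp[OF r(3) x] r(4) by simp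
  also have "\<dots> = (FAr Q x \<cdot>\<^bsub>Y\<^esub> t) \<cdot>\<^bsub>Y\<^esub> FAr Q r"
    by (rule Y.assoc[symmetric]) (use M t(1) in \<open>auto simp: Mor_def\<close>)
  also have "\<dots> = Zero Y U B" unfolding t(2) using M O by (simp add: Mor_def)
  finally have "E.null (x \<cdot> f)" by (rule Q_zero_null[OF comp_Mor[OF r(3) x]])
  then have "FAr Q f = Zero Y U A" by (rule Q_null_zero[OF r(3) refl[OF r(3)]])
  then show "t = Zero Y W A" using Y_iso_epi[OF Q_iso[OF r(1,2)] t(1)] r(4) by simp
qed

lemma Q_epi:
  assumes y: "y \<in> Mor T B D" and refl: "\<And>W f. f \<in> Mor T D W \<Longrightarrow> E.null (f \<cdot> y) \<Longrightarrow> E.null f"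
  shows "epi_arr Y (FAr Q y)"
proof (rule Y.epi_arrI[OF Q_Mor[OF y]])
  fix W t assume t: "t \<in> Mor Y D W" "t \<cdot>\<^bsub>Y\<^esub> FAr Q y = Zero Y B W"
  obtain U l g where r: "l \<in> S" "l \<in> Mor T W U" "g \<in> Mor T D U" "FAr Q l \<cdot>\<^bsub>Y\<^esub> t = FAr Q g"
    using Y_left_fraction[OF t(1)] by auto
  have O: "U \<in> Ob Y" "B \<in> Ob Y" "D \<in> Ob Y" using Mor_Ob[OF r(3)] Mor_Ob[OF y] by (auto simp: Y_cat)
  note M = Q_Mor[OF r(2)] Q_Mor[OF r(3)] Q_Mor[OF y]
  have "FAr Q (g \<cdot> y) = (FAr Q l \<cdot>\<^bsub>Y\<^esub> t) \<cdot>\<^bsub>Y\<^esub> FAr Q y" using Q_comp[OF y r(3)] r(4) by simp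
  also have "\<dots> = FAr Q l \<cdot>\<^bsub>Y\<^esub> (t \<cdot>\<^bsub>Y\<^esub> FAr Q y)"
    by (rule Y.assoc) (use M t(1) in \<open>auto simp: Mor_def\<close>)
  also have "\<dots> = Zero Y B U" unfolding t(2) using M O by (simp add: Mor_def)
  finally have "E.null (g \<cdot> y)" by (rule Q_zero_null[OF comp_Mor[OF y r(3)]])
  then have "FAr Q g = Zero Y D U" by (rule Q_null_zero[OF r(3) refl[OF r(3)]])
  then show "t = Zero Y D W" using Y_iso_mono[OF Q_iso[OF r(1,2)] t(1)] r(4) by simp
qed

end

context localization_setup
begin

section \<open>The implications between the three conditions\<close>

lemma R_conflation: "conflation R A B D x y \<longleftrightarrow> (\<exists>h. rel_tri X N A B D x y h)"
  unfolding conflation_def R_tri ..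

lemma cone_resolution:
  assumes "Cone T N N = Ob T" "D \<in> Ob T"
  shows "\<exists>N1 N0 n p \<delta>. N1 \<in> N \<and> N0 \<in> N \<and> s_triangle X N1 N0 D n p \<delta>"
  using assms unfolding Cone_def tri_extri_tri by blast

lemma cone_coresolution:
  assumes "Cone T N N = Ob T" "A \<in> Ob T"
  shows "\<exists>N1 N0 n p \<delta>. N1 \<in> N \<and> N0 \<in> N \<and> s_triangle X A N0 N1 p n \<delta>"
proof -
  have "ShO T A \<in> Cone T N N" using assms by simp
  then obtain N1 N0 f g h where tr: "N1 \<in> N" "N0 \<in> N" "triangle T N1 N0 (ShO T A) f g h"
    by (auto simp: Cone_def)
  note t = triangleD[OF tr(3)]
  have "triangle T A N1 N0 (UnA T (Neg T h)) f g"
    using TR2[of "UnA T (Neg T h)" A N1 f N0 g] tr(3) t(1-12) assms(2) by (simp add: Mor_def)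
  then show ?thesis using tr(1,2) unfolding tri_extri_tri by blast
qed

lemma cone_serre:
  assumes C: "Cone T N N = Ob T"
  shows "serre_subcategory R N"
proof -
  have *: "A \<in> N \<and> D \<in> N" if c: "conflation R A B D x y" "B \<in> N" for A B D x y
  proof -
    obtain h where h: "s_triangle X A B D x y h" "h \<in> rel_left X N D A" "h \<in> rel_right X N D A"
      using c(1) unfolding R_conflation rel_tri_def by blast
    have O: "A \<in> Ob T" "D \<in> Ob T" using E.s_triangleD(1,3)[OF h(1)] by simp_all
    show ?thesis
      using E.rel_left_N[OF cone_resolution[OF C O(2)] h(1,2) c(2)]
        E.rel_right_N[OF cone_coresolution[OF C O(1)] h(1,3) c(2)] by simp
  qed
  moreover have "B \<in> N" if "conflation R A B D x y" "A \<in> N" "D \<in> N" for A B D x y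
    using that E.N_ext unfolding R_conflation rel_tri_def by blast
  moreover have "additive_subcategory R N"
    using N_add unfolding additive_subcategory_def rel_extri_derived rel_extri_simps .
  moreover have "summand_closed R N"
    using N_summands unfolding summand_closed_def rel_extri_derived .
  ultimately show ?thesis unfolding serre_subcategory_def thick_subcategory_def by blast
qed

text \<open>Under this hypothesis \<open>Q\<close> is also an exact functor to the largest exact substructure \<open>Z\<close> of \<open>Y\<close>. The
  functor \<open>Y \<rightarrow> Z\<close> that the universal property yields is the identity by uniqueness, hence \<open>Z = Y\<close>;
  no description of the inflations of \<open>Y\<close> is needed.\<close>

lemma corresponds_if_regular:
  assumes reg: "\<And>A B D x y h. rel_tri X N A B D x y h \<Longrightarrow> mono_arr Y (FAr Q x) \<and> epi_arr Y (FAr Q y)"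
  shows "corresponds_to_exact Y"
proof -
  let ?Z = "adm_extri Y"
  have Z: "extriangulated_category ?Z" by (rule extriangulated_adm) (rule Y.extriangulated_category_axioms)
  have tri: "s_triangle Y (FOb Q A) (FOb Q B) (FOb Q D) (FAr Q x) (FAr Q y) (FExt Q D A h)"
    and ad: "FExt Q D A h \<in> adm Y (FOb Q D) (FOb Q A)" if "rel_tri X N A B D x y h" for A B D x y h
  proof -
    show T: "s_triangle Y (FOb Q A) (FOb Q B) (FOb Q D) (FAr Q x) (FAr Q y) (FExt Q D A h)"
      using Q_exact that unfolding exact_functor_def R_tri by blast
    show "FExt Q D A h \<in> adm Y (FOb Q D) (FOb Q A)"
      using T Y.s_triangleD(10)[OF T] reg[OF that] unfolding adm_def by blast
  qed
  \<comment> \<open>Every relative class is realised by a relative triangle, so \<open>reg\<close>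
    makes its image admissible.\<close>
  have ext: "FExt Q D A h \<in> adm Y (FOb Q D) (FOb Q A)"
    if O: "D \<in> Ob T" "A \<in> Ob T" "h \<in> carrier (Ext R D A)" for D A h
  proof -
    have h: "h \<in> rel_left X N D A" "h \<in> rel_right X N D A"
      using O E_left_eq[OF N_sub O(1,2)] E_right_eq[OF N_sub O(1,2)] by auto
    then have "h \<in> carrier (Ext X D A)" by (auto simp: rel_left_def)
    then obtain B x y where "s_triangle X A B D x y h" using E.tri_exists[of h D A] O(1,2) by auto
    then have "rel_tri X N A B D x y h" using h by (simp add: rel_tri_def)
    then show ?thesis by (rule ad)
  qed
  have QZ: "exact_functor R ?Z Q"
    unfolding exact_functor_def
  proof (intro conjI ballI allI impI)
    show "additive_functor R ?Z (FOb Q) (FAr Q)"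
      using Q_additive by (simp add: additive_functor_def is_functor_def)
    fix D A assume DA: "D \<in> Ob R" "A \<in> Ob R"
    then have "FExt Q D A \<in> hom (Ext R D A) (Ext Y (FOb Q D) (FOb Q A))"
      using Q_exact by (auto simp: exact_functor_def)
    then show "FExt Q D A \<in> hom (Ext R D A) (Ext ?Z (FOb Q D) (FOb Q A))"
      using ext[of D A] DA by (auto simp: hom_def)
  next
    fix D D' A A' d a \<delta> assume "d \<in> Mor R D' D" "a \<in> Mor R A A'" "\<delta> \<in> carrier (Ext R D A)"
    then show "FExt Q D' A' (Emap R d a \<delta>) = Emap ?Z (FAr Q d) (FAr Q a) (FExt Q D A \<delta>)"
      using Q_exact unfolding exact_functor_def adm_extri_simps by blast
  next
    fix A B D x y \<delta> assume "s_triangle R A B D x y \<delta>"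
    then have "rel_tri X N A B D x y \<delta>" unfolding R_tri .
    then show "s_triangle ?Z (FOb Q A) (FOb Q B) (FOb Q D) (FAr Q x) (FAr Q y) (FExt Q D A \<delta>)"
      unfolding adm_extri_derived using tri ad by blast
  qed
  have iY: "inverts Y Q S"
    unfolding inverts_def
  proof
    fix s assume s: "s \<in> S"
    then have "s \<in> Ar T" using E.qis_Ar[of s] unfolding S_eq by simp
    then have M: "s \<in> Mor T (Dom T s) (Cod T s)" by (rule Mor_Ar)
    show "is_iso Y (FAr Q s) (Dom Y (FAr Q s)) (Cod Y (FAr Q s))"
      using Q_iso[OF s M] Q_Mor[OF M] by (simp add: Mor_def)
  qed
  then have iZ: "inverts ?Z Q S" by (simp add: inverts_def)
  have univ: "\<exists>F'. exact_functor Y W F' \<and> exfun_eq R (exfun_comp F' Q) Q \<and>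
      (\<forall>G. exact_functor Y W G \<and> exfun_eq R (exfun_comp G Q) Q \<longrightarrow> exfun_eq Y G F')"
    if "extriangulated_category W" "exact_functor R W Q" "inverts W Q S" for W :: "('o, ('o, 'm) gzarrow, 'f) extri"
    using localization that unfolding extri_localization_def by blast
  obtain F where F: "exact_functor Y ?Z F" "exfun_eq R (exfun_comp F Q) Q"
    using univ[OF Z QZ iZ] by blast
  obtain F0 where F0: "\<And>G. exact_functor Y Y G \<Longrightarrow> exfun_eq R (exfun_comp G Q) Q \<Longrightarrow> exfun_eq Y G F0"
    using univ[OF Y.extriangulated_category_axioms Q_exact iY] by blast
  let ?I = "\<lparr>FOb = (\<lambda>A. A), FAr = (\<lambda>f. f), FExt = (\<lambda>D A \<delta>. \<delta>)\<rparr> :: ('o, ('o, 'm) gzarrow, 'f, 'o, ('o, 'm) gzarrow, 'f) exfun"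
  have "exact_functor Y Y ?I"
    by (simp add: exact_functor_def additive_functor_def is_functor_def hom_def)
  then have I: "exfun_eq Y ?I F0"
    by (rule F0) (simp add: exfun_eq_def exfun_comp_def)
  \<comment> \<open>\<open>F\<close> followed by the inclusion of the substructure is an endofunctor
    of \<open>Y\<close> over \<open>Q\<close>, just like \<open>?I\<close>; uniqueness identifies
    the two.\<close>
  have "exact_functor Y Y F"
    unfolding exact_functor_def
  proof (intro conjI ballI allI impI)
    show "additive_functor Y Y (FOb F) (FAr F)"
      using F(1) by (simp add: exact_functor_def additive_functor_def is_functor_def)
    fix D A assume "D \<in> Ob Y" "A \<in> Ob Y"
    then have "FExt F D A \<in> hom (Ext Y D A) (Ext ?Z (FOb F D) (FOb F A))"
      using F(1) by (simp add: exact_functor_def)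
    then show "FExt F D A \<in> hom (Ext Y D A) (Ext Y (FOb F D) (FOb F A))"
      by (auto simp: hom_def adm_def)
  next
    fix D D' A A' d a \<delta> assume "d \<in> Mor Y D' D" "a \<in> Mor Y A A'" "\<delta> \<in> carrier (Ext Y D A)"
    then show "FExt F D' A' (Emap Y d a \<delta>) = Emap Y (FAr F d) (FAr F a) (FExt F D A \<delta>)"
      using F(1) unfolding exact_functor_def adm_extri_simps by blast
  next
    fix A B D x y \<delta> assume "s_triangle Y A B D x y \<delta>"
    then show "s_triangle Y (FOb F A) (FOb F B) (FOb F D) (FAr F x) (FAr F y) (FExt F D A \<delta>)"
      using F(1) unfolding exact_functor_def adm_extri_derived by blast
  qed
  from F0[OF this F(2)] I have Fid: "A \<in> Ob Y \<Longrightarrow> FOb F A = A"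
    "D \<in> Ob Y \<Longrightarrow> A \<in> Ob Y \<Longrightarrow> \<delta> \<in> carrier (Ext Y D A) \<Longrightarrow> FExt F D A \<delta> = \<delta>" for D A \<delta>
    by (simp_all add: exfun_eq_def)
  \<comment> \<open>\<open>F\<close> acts as the identity on classes, yet its values are
    admissible.\<close>
  have all: "\<delta> \<in> adm Y D A" if "D \<in> Ob Y" "A \<in> Ob Y" "\<delta> \<in> carrier (Ext Y D A)" for D A \<delta>
  proof -
    have "FExt F D A \<in> hom (Ext Y D A) (Ext ?Z (FOb F D) (FOb F A))"
      using F(1) that by (simp add: exact_functor_def)
    then have "FExt F D A \<delta> \<in> adm Y (FOb F D) (FOb F A)" using that(3) by (auto simp: hom_def)
    then show ?thesis using Fid(1)[OF that(1)] Fid(1)[OF that(2)] Fid(2)[OF that] by simp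
  qed
  have "exact_extriangulated Y"
  proof (unfold_locales)
    fix A B D x y \<delta> assume T: "s_triangle Y A B D x y \<delta>"
    note t = Y.s_triangleD[OF T]
    show "mono_arr Y x" "epi_arr Y y"
      using Y.adm_mono[OF all T] Y.adm_epi[OF all T] t by auto
  qed
  then show ?thesis by (rule exact_extriangulated.corresponds)
qed

lemma cone_exact:
  assumes C: "Cone T N N = Ob T"
  shows "corresponds_to_exact Y"
proof (rule corresponds_if_regular)
  fix A B D x y h assume "rel_tri X N A B D x y h"
  then have h: "s_triangle X A B D x y h" "h \<in> rel_left X N D A" "h \<in> rel_right X N D A"
    by (auto simp: rel_tri_def)
  note t = E.s_triangleD[OF h(1)]
  have O: "A \<in> Ob T" "D \<in> Ob T" and M: "x \<in> Mor T A B" "y \<in> Mor T B D" using t by simp_all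
  have "mono_arr Y (FAr Q x)"
    by (rule Q_mono[OF M(1)]) (use E.rel_left_reflects_null[OF cone_resolution[OF C O(2)] h(1,2)] in simp)
  moreover have "epi_arr Y (FAr Q y)"
    by (rule Q_epi[OF M(2)]) (use E.rel_right_reflects_null[OF cone_coresolution[OF C O(1)] h(1,3)] in simp)
  ultimately show "mono_arr Y (FAr Q x) \<and> epi_arr Y (FAr Q y)" ..
qed

text \<open>Through the isomorphism with Yoneda extensions, \<open>x\<close> is up to an isomorphism
  of middle terms the first arrow of a kernel-cokernel pair, and kernels are monic.\<close>

lemma exact_infl_mono:
  assumes "corresponds_to_exact Y" "s_triangle Y A B D x y \<delta>"
  shows "mono_arr Y x"
proof -
  note t = Y.s_triangleD[OF assms(2)]
  obtain EE \<theta> where EE: "exact_structure Y EE"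
    and iso: "\<forall>D \<in> Ob Y. \<forall>A \<in> Ob Y. \<theta> D A \<in> iso (Ext Y D A) (Ext (exact_extri Y EE) D A)"
    and real: "\<forall>D \<in> Ob Y. \<forall>A \<in> Ob Y. \<forall>\<delta> \<in> carrier (Ext Y D A). Real Y D A \<delta> = Real (exact_extri Y EE) D A (\<theta> D A \<delta>)"
    using assms(1) unfolding corresponds_to_exact_def Let_def by blast
  have "\<theta> D A \<delta> \<in> carrier (Ext (exact_extri Y EE) D A)"
    using iso t(1,3,10) unfolding iso_def hom_def by blast
  then obtain x0 y0 where 0: "(x0, y0) \<in> EE" "(x0, y0) \<in> seqs Y A D" "\<theta> D A \<delta> = seq_class Y A D x0 y0"
    by (auto simp: exact_extri_def yoneda_ext_def)
  have "Real Y D A \<delta> = seq_class Y A D x0 y0" using real t(1,3,10) 0(3) by (simp add: exact_extri_def)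
  then have "(x, y) \<in> seq_class Y A D x0 y0" using t(11) by simp
  from Y.seq_class_sym[OF this 0(2)] obtain b where b: "is_iso Y b (Cod Y x) (Cod Y x0)" "b \<cdot>\<^bsub>Y\<^esub> x = x0"
    by (auto simp: seq_class_def)
  have bM: "b \<in> Mor Y B (Cod Y x0)" using b(1) t by (simp add: is_iso_def)
  have "is_kernel Y x0 y0" using exact_structure.kernel_cokernel[OF EE 0(1)] by simp
  then obtain A' B' D' where k: "x0 \<in> Mor Y A' B'" "y0 \<in> Mor Y B' D'" "y0 \<cdot>\<^bsub>Y\<^esub> x0 = Zero Y A' D'"
     "\<forall>W. \<forall>f \<in> Mor Y W B'. y0 \<cdot>\<^bsub>Y\<^esub> f = Zero Y W D' \<longrightarrow> (\<exists>!g. g \<in> Mor Y W A' \<and> x0 \<cdot>\<^bsub>Y\<^esub> g = f)"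
    unfolding is_kernel_def by blast
  have "mono_arr Y x0"
  proof (rule Y.mono_arrI[OF k(1)])
    fix W f assume f: "f \<in> Mor Y W A'" "x0 \<cdot>\<^bsub>Y\<^esub> f = Zero Y W B'"
    have O: "W \<in> Ob Y" "A' \<in> Ob Y" "B' \<in> Ob Y" "D' \<in> Ob Y"
      using Y.Mor_Ob[OF f(1)] Y.Mor_Ob[OF k(2)] by auto
    have z: "Zero Y W A' \<in> Mor Y W A'" "x0 \<cdot>\<^bsub>Y\<^esub> Zero Y W A' = Zero Y W B'" "Zero Y W B' \<in> Mor Y W B'"
      "y0 \<cdot>\<^bsub>Y\<^esub> Zero Y W B' = Zero Y W D'"
      using O k(1,2) by (simp_all add: Mor_def)
    show "f = Zero Y W A'" using k(4) f z by blast
  qed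
  then show ?thesis using Y.mono_cancel[OF t(12) bM] b(2) by simp
qed

text \<open>For a right approximation \<open>p : M0 \<rightarrow> D\<close> with cocone \<open>K\<close> and a left approximation \<open>K \<rightarrow> M1\<close>, the inflation
  \<open>K \<rightarrow> M0 \<oplus> M1\<close> belongs to the relative structure.\<close>

lemma finite_cone:
  assumes ff: "functorially_finite T N"
    and key: "\<And>K S E x y h. rel_tri X N K S E x y h \<Longrightarrow> S \<in> N \<Longrightarrow> K \<in> N"
  shows "Cone T N N = Ob T"
proof
  show "Cone T N N \<subseteq> Ob T" using triangleD(12) unfolding Cone_def by blast
  show "Ob T \<subseteq> Cone T N N"
  proof
    fix D assume D: "D \<in> Ob T"
    obtain M0 p where p: "M0 \<in> N" "p \<in> Mor T M0 D"
      "\<forall>M' \<in> N. \<forall>g \<in> Mor T M' D. \<exists>h \<in> Mor T M' M0. p \<cdot> h = g"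
      using ff D unfolding functorially_finite_def contravariantly_finite_def by blast
    obtain K1 g h where tr: "triangle T M0 D K1 p g h" using TR1_cone[OF p(2)] by auto
    note t = triangleD(1-12)[OF tr]
    \<comment> \<open>The cocone of \<open>p\<close> is its desuspended cone; the sign undoes the
      one that rotation introduces.\<close>
    let ?K = "UnO T K1" and ?k = "UnA T (Neg T h)"
    have K: "triangle T ?K M0 D ?k p g"
      using TR2[of ?k ?K M0 p D g] tr t by (simp add: Mor_def)
    have "?K \<in> Ob T" using t by simp
    then obtain M1 q where q: "M1 \<in> N" "q \<in> Mor T ?K M1"
      "\<forall>M' \<in> N. \<forall>g \<in> Mor T ?K M'. \<exists>h \<in> Mor T M1 M'. h \<cdot> q = g"
      using ff unfolding functorially_finite_def covariantly_finite_def by blast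
    have "\<exists>S E x y h'. rel_tri X N ?K S E x y h' \<and> S \<in> N"
      by (rule E.approximation_rel_tri[of ?K M0 D ?k p g M1 q]) (use K p q in simp_all)
    then have "?K \<in> N" using key by blast
    then show "D \<in> Cone T N N" using K p(1) unfolding Cone_def by blast
  qed
qed

lemma serre_cone:
  assumes "functorially_finite T N" "serre_subcategory R N"
  shows "Cone T N N = Ob T"
proof (rule finite_cone[OF assms(1)])
  fix K S' E x y h assume "rel_tri X N K S' E x y h" "S' \<in> N"
  then have "conflation R K S' E x y" "S' \<in> N" unfolding R_conflation by blast+
  then show "K \<in> N" using assms(2) unfolding serre_subcategory_def by blast
qed

text \<open>An inflation into an object of \<open>N\<close> is null, so \<open>Q\<close> sends it to
  zero; being also monic in \<open>Y\<close>, it forces \<open>K\<close> to vanish there. The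
  identity of \<open>K\<close> is then null, so \<open>K\<close> is a retract of an object of
  \<open>N\<close>.\<close>

lemma exact_cone:
  assumes "functorially_finite T N" "corresponds_to_exact Y"
  shows "Cone T N N = Ob T"
proof (rule finite_cone[OF assms(1)])
  fix K S' E x y h assume r: "rel_tri X N K S' E x y h" "S' \<in> N"
  then have h: "s_triangle X K S' E x y h" by (simp add: rel_tri_def)
  have x: "x \<in> Mor T K S'" using E.s_triangleD(12)[OF h] by simp
  have O: "K \<in> Ob T" "S' \<in> Ob T" using Mor_Ob[OF x] by auto
  then have OY: "K \<in> Ob Y" "S' \<in> Ob Y" by (simp_all add: Y_cat)
  have "s_triangle Y (FOb Q K) (FOb Q S') (FOb Q E) (FAr Q x) (FAr Q y) (FExt Q E K h)"
    using Q_exact r(1) unfolding exact_functor_def R_tri by blast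
  then have m: "mono_arr Y (FAr Q x)" by (rule exact_infl_mono[OF assms(2)])
  have "E.null (Idn T S' \<cdot> x)" using E.nullI[OF r(2), of x K "Idn T S'" S'] x id_Mor[OF O(2)] by simp
  then have "E.null x" using x by (simp add: Mor_def)
  then have z: "FAr Q x = Zero Y K S'" by (rule Q_null_zero[OF x])
  have i: "Idn Y K \<in> Mor Y K K" by (rule Y.id_Mor[OF OY(1)])
  have "FAr Q x \<cdot>\<^bsub>Y\<^esub> Idn Y K = Zero Y K S'" unfolding z using OY by simp
  then have "Idn Y K = Zero Y K K" by (rule Y.monoD[OF m Q_Mor[OF x] i])
  then have "FAr Q (Idn T K) = Zero Y K K" using Q_simps(5)[OF O(1)] O by simp
  then have "E.null (Idn T K)" by (rule Q_zero_null[OF id_Mor[OF O(1)]])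
  moreover have "Idn T K \<in> Mor X K K" using id_Mor[OF O(1)] by simp
  ultimately obtain M u v where M: "M \<in> N" "u \<in> Mor X K M" "v \<in> Mor X M K" "Idn T K = v \<cdot>\<^bsub>X\<^esub> u"
    by (rule E.nullE)
  show "K \<in> N" by (rule retract_closed[OF N_add N_summands M(1), of u K v]) (use M in simp_all)
qed

end

theorem theorem4p2:
  fixes T :: "('o, 'm) tricat"
    and N :: "'o set"
    and Y :: "('o, ('o, 'm) gzarrow, 'f) extri"
    and Q :: "('o, 'm, 'm, 'o, ('o, 'm) gzarrow, 'f) exfun"
  assumes "triangulated_category T"
    and "additive_subcategory T N"
    and "summand_closed T N"
    and "tri_extension_closed T N"
    and "extri_localization (rel_extri T N) (loc_arrows (rel_extri T N) N) Y Q"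
  shows "(Cone T N N = Ob T \<longrightarrow>
            corresponds_to_exact Y \<and> serre_subcategory (rel_extri T N) N) \<and>
         (functorially_finite T N \<longrightarrow>
            (corresponds_to_exact Y \<longleftrightarrow> Cone T N N = Ob T) \<and>
            (Cone T N N = Ob T \<longleftrightarrow> serre_subcategory (rel_extri T N) N))"
proof -
  interpret localization_setup T N Y Q
    using assms by (intro localization_setup.intro localization_setup_axioms.intro)
  show ?thesis using cone_exact cone_serre serre_cone exact_cone by blast
qed

end
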